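(* For the following elementary abelian $p$-subgroups $A$, with Weyl groups $W(A)$ as listed in the context, the ring of invariants $(H^*BA)^{W(A)}$ of the mod-$p$ cohomology $H^*BA=\mathbb{F}_p[t_1,\dots,t_n]\otimes\Lambda(dt_1,\dots,dt_n)$ is as follows. (1) For $p=5$, $A=E_{E_8}^3$ ($n=3$): $(H^*BA)^{W(A)}=\mathbb{F}_5[x_{62},x_{200},x_{240}]\otimes\mathbb{F}_5\{1,Q_Iu_3\}$, where $x_{62}=e_3(t_1,t_2,t_3)$, $x_{200}=c_{3,2}(t_1,t_2,t_3)$, $x_{240}=c_{3,1}(t_1,t_2,t_3)$, $u_3=dt_1dt_2dt_3$, and $I$ ranges over $A'_3$. (2) For $p=3$, $A=E_{F_4}^3$ ($n=3$): $(H^*BA)^{W(A)}=\mathbb{F}_3[x_{26},x_{36},x_{48}]\otimes\mathbb{F}_3\{1,Q_Iu_3\}$, where $x_{26}=e_3(t_1,t_2,t_3)$, $x_{36}=c_{3,2}(t_1,t_2,t_3)$, $x_{48}=c_{3,1}(t_1,t_2,t_3)$, $u_3=dt_1dt_2dt_3$, and $I$ ranges over $A'_3$. (3) For $p=3$, $A=E_{3E_6}^4$ ($n=4$): $(H^*BA)^{W(A)}=\mathbb{F}_3[x_{26},x_{36},x_{48},x_{54}]\otimes\mathbb{F}_3\{1,Q_Iu_3,Q_Ju_4\}$, where $x_{26}=e_3(t_2,t_3,t_4)$, $x_{36}=c_{3,2}(t_2,t_3,t_4)$, $x_{48}=c_{3,1}(t_2,t_3,t_4)$, $x_{54}=\prod_{t\in\mathbb{F}_3\{t_2,t_3,t_4\}}(t_1+t)$,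 $u_3=dt_2dt_3dt_4$, $u_4=dt_1dt_2dt_3dt_4$, $I$ ranges over $A'_3$ and $J$ ranges over $A_3$. (4) For $p=3$, $A=E_{2E_7}^4$ ($n=4$): $(H^*BA)^{W(A)}=\mathbb{F}_3[x_{26},x_{36},x_{48},x_{108}]\otimes\mathbb{F}_3\{1,Q_Iu_3,x_{54}Q_Ju_4\}$, where $x_{26}=e_3(t_2,t_3,t_4)$, $x_{36}=c_{3,2}(t_2,t_3,t_4)$, $x_{48}=c_{3,1}(t_2,t_3,t_4)$, $x_{54}=\prod_{t\in\mathbb{F}_3\{t_2,t_3,t_4\}}(t_1+t)$, $x_{108}=x_{54}^2$, $u_3=dt_2dt_3dt_4$, $u_4=dt_1dt_2dt_3dt_4$, $I$ ranges over $A'_3$ and $J$ ranges over $A_3$. (5) For $p=3$, $A=E_{E_8}^{5a}$ ($n=5$): $(H^*BA)^{W(A)}=\mathbb{F}_3[x_4,x_{26},x_{36},x_{48},x_{324}]\otimes\mathbb{F}_3\{1,Q_Iu_3,x_2u_1,(Q_Iu_3)x_2u_1,x_2x_{162}Q_Ju_5\}$, where $x_2=t_5$, $x_4=x_2^2$, $x_{26}=e_3(t_2,t_3,t_4)$, $x_{36}=c_{3,2}(t_2,t_3,t_4)$, $x_{48}=c_{3,1}(t_2,t_3,t_4)$, $x_{162}=\prod_{t\in\mathbb{F}_3\{t_2,t_3,t_4,t_5\}}(t_1+t)$, $x_{324}=x_{162}^2$, $u_1=dt_5$, $u_3=dt_2dt_3dt_4$, $u_5=dt_1dt_2dt_3dt_4dt_5$,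 $I$ ranges over $A'_3$ and $J$ ranges over $A_4$.
   Context: Subgroups: $E_{E_8}^3$ ($p=5$, Lie group $E_8$) and, for $p=3$, $E_{F_4}^3$, $E_{3E_6}^4$, $E_{2E_7}^4$, $E_{E_8}^{5a}$ (Lie groups $F_4,E_6,E_7,E_8$) are maximal non-toral elementary abelian $p$-subgroups of simply connected exceptional Lie groups (notation of Andersen–Grodal–Møller–Viruel); the superscript number is the rank $n$. After choosing a basis of $A\cong\mathbb{F}_p^n$, the Weyl group $W(A)\subset GL_n(\mathbb{F}_p)$ is: (1),(2) $W(A)=SL_3(\mathbb{F}_p)$. (3) $W(A)$ is the group of all $\begin{pmatrix}1&m\\0&g_1\end{pmatrix}$ with $m\in M_{1,3}(\mathbb{F}_3)$, $g_1\in SL_3(\mathbb{F}_3)$. (4) $W(A)$ is the group of all $\begin{pmatrix}\varepsilon_1&m\\0&g_1\end{pmatrix}$ with $\varepsilon_1\in\mathbb{F}_3^\times$, $m\in M_{1,3}(\mathbb{F}_3)$, $g_1\in SL_3(\mathbb{F}_3)$. (5) $W(A)$ is the group of all $\begin{pmatrix}\varepsilon_1&m_0&m_1\\0&g_1&0\\0&0&\varepsilon_2\end{pmatrix}$ with $\varepsilon_1,\varepsilon_2\in\mathbb{F}_3^\times$, $m_0\in M_{1,3}(\mathbb{F}_3)$, $m_1\in M_{1,1}(\mathbb{F}_3)$, $g_1\in SL_3(\mathbb{F}_3)$. Here $M_{k,l}$ denotes $k\times l$ matrices. $H^*BA=\mathbb{F}_p[t_1,\dots,t_n]\otimes\Lambda(dt_1,\dots,dt_n)$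 with $\deg t_i=2$, $\deg dt_i=1$, where $dt_1,\dots,dt_n$ is the basis of $H^1BA$ dual to the chosen basis of $A$ and $t_i$ is the Bockstein of $dt_i$. $W(A)$ acts by algebra automorphisms with $g t_i=\sum_j a_{i,j}(g^{-1})t_j$, $g\,dt_i=\sum_j a_{i,j}(g^{-1})dt_j$, $a_{i,j}(g^{-1})$ being the $(i,j)$ entry of $g^{-1}$. Milnor operations: $Q_j$ ($j\ge0$) is the $\mathbb{F}_p[t_1,\dots,t_n]$-linear map with $Q_j(xy)=(Q_jx)y+(-1)^{\deg x}x(Q_jy)$, $Q_j\,dt_i=t_i^{p^j}$, $Q_jt_i=0$. For $I=\{i_1<\dots<i_r\}$, $Q_I=Q_{i_1}\cdots Q_{i_r}$, $Q_\emptyset=1$. $A_k$ is the set of all subsets of $\{0,1,\dots,k-1\}$ and $A'_k$ the set of proper subsets (including $\emptyset$). Dickson invariants: for indeterminates $y_1,\dots,y_k$, $e_k(y_1,\dots,y_k)=Q_0\cdots Q_{k-1}dy_1\cdots dy_k$ (equivalently $\pm\det(y_j^{p^{i-1}})$ with the sign fixed by this formula), and $c_{k,i}(y_1,\dots,y_k)$ is defined by $\prod_{y\in\mathbb{F}_p\{y_1,\dots,y_k\}}(X+y)=\sum_{i=0}^k(-1)^{k-i}c_{k,i}(y_1,\dots,y_k)X^{p^i}$. $\mathbb{F}_p\{z_1,z_2,\dots\}$ denotes the $\mathbb{F}_p$-vector space spanned by the listed elements. $R\otimes\mathbb{F}_p\{b_1,b_2,\dots\}$, with $R$ a polynomial subalgebra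 on the listed generators and $b_i\in H^*BA$, means the free $R$-submodule of $H^*BA$ with basis $\{b_i\}$. Subscripts of $u$ and $x$ indicate cohomological degrees. *)

theory Defs
  imports
    "HOL-Library.Poly_Mapping"
    "HOL-Library.Cardinality"
    "HOL-Computational_Algebra.Polynomial"
    "Jordan_Normal_Form.Determinant"
    "Jordan_Normal_Form.Gauss_Jordan_Elimination"
begin

section \<open>Exterior algebras\<close>

text \<open>
  The exterior algebra over a commutative ring on generators \<open>e\<^sub>0, e\<^sub>1, \<dots>\<close>. An element is
  the family of its coefficients with respect to the basis \<open>e\<^sub>S = e\<^sub>i\<^sub>1 \<cdots> e\<^sub>i\<^sub>r\<close>, where
  \<open>S = {i\<^sub>1 < \<dots> < i\<^sub>r}\<close> runs over the finite sets of indices.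
\<close>

typedef (overloaded) 'r exterior =
  "{f :: nat set \<Rightarrow> 'r::zero. finite {S. f S \<noteq> 0} \<and> (\<forall>S. f S \<noteq> 0 \<longrightarrow> finite S)}"
  morphisms ext_coeff Abs_exterior
  by (rule exI[of _ "\<lambda>_. 0"]) simp

setup_lifting type_definition_exterior

lemma finite_ext_support [simp]: "finite {S. ext_coeff x S \<noteq> 0}"
  and ext_coeff_infinite: "infinite S \<Longrightarrow> ext_coeff x S = 0"
  using ext_coeff[of x] by auto

lemma exterior_eqI: "(\<And>S. finite S \<Longrightarrow> ext_coeff x S = ext_coeff y S) \<Longrightarrow> x = y"
  by (metis ext_coeff_infinite ext_coeff_inject ext)

text \<open>
  \<open>ext_sign A B\<close> is the sign of the shuffle sorting \<open>A\<close> followed by \<open>B\<close>, so that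
  \<open>e\<^sub>A e\<^sub>B = ext_sign A B \<cdot> e\<^sub>A\<^sub>\<union>\<^sub>B\<close> for disjoint \<open>A\<close> and \<open>B\<close>.
\<close>

definition ext_sign :: "nat set \<Rightarrow> nat set \<Rightarrow> 'r::comm_ring_1" where
  "ext_sign A B = (-1) ^ card {(a, b). a \<in> A \<and> b \<in> B \<and> b < a}"

lemma finite_inversions:
  "finite A \<Longrightarrow> finite B \<Longrightarrow> finite {(a, b). a \<in> A \<and> b \<in> B \<and> b < (a::nat)}"
  by (rule finite_subset[of _ "A \<times> B"]) auto

lemma ext_sign_Un_left:
  assumes "finite A" "finite B" "finite C" "A \<inter> B = {}"
  shows "ext_sign (A \<union> B) C = ext_sign A C * ext_sign B C"
proof -
  have "{(a, b). a \<in> A \<union> B \<and> b \<in> C \<and> b < a} =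
      {(a, b). a \<in> A \<and> b \<in> C \<and> b < a} \<union> {(a, b). a \<in> B \<and> b \<in> C \<and> b < a}" by auto
  moreover have "card \<dots> = card {(a, b). a \<in> A \<and> b \<in> C \<and> b < a}
      + card {(a, b). a \<in> B \<and> b \<in> C \<and> b < a}"
    by (rule card_Un_disjoint) (use assms in \<open>auto intro!: finite_inversions\<close>)
  ultimately show ?thesis by (simp add: ext_sign_def power_add)
qed

lemma ext_sign_Un_right:
  assumes "finite A" "finite B" "finite C" "B \<inter> C = {}"
  shows "ext_sign A (B \<union> C) = ext_sign A B * ext_sign A C"
proof -
  have "{(a, b). a \<in> A \<and> b \<in> B \<union> C \<and> b < a} =
      {(a, b). a \<in> A \<and> b \<in> B \<and> b < a} \<union> {(a, b). a \<in> A \<and> b \<in> C \<and> b < a}" by auto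
  moreover have "card \<dots> = card {(a, b). a \<in> A \<and> b \<in> B \<and> b < a}
      + card {(a, b). a \<in> A \<and> b \<in> C \<and> b < a}"
    by (rule card_Un_disjoint) (use assms in \<open>auto intro!: finite_inversions\<close>)
  ultimately show ?thesis by (simp add: ext_sign_def power_add)
qed

lemma ext_sign_empty [simp]: "ext_sign {} A = 1" "ext_sign A {} = 1"
  by (simp_all add: ext_sign_def)

instantiation exterior :: (comm_ring_1) ring_1
begin

lift_definition zero_exterior :: "'a exterior" is "\<lambda>_. 0" by simp

lift_definition one_exterior :: "'a exterior" is "\<lambda>S. if S = {} then 1 else 0" by simp

lift_definition plus_exterior :: "'a exterior \<Rightarrow> 'a exterior \<Rightarrow> 'a exterior"
  is "\<lambda>f g S. f S + g S"
proof -
  fix f g :: "nat set \<Rightarrow> 'a"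
  assume f: "finite {S. f S \<noteq> 0} \<and> (\<forall>S. f S \<noteq> 0 \<longrightarrow> finite S)"
    and g: "finite {S. g S \<noteq> 0} \<and> (\<forall>S. g S \<noteq> 0 \<longrightarrow> finite S)"
  have "{S. f S + g S \<noteq> 0} \<subseteq> {S. f S \<noteq> 0} \<union> {S. g S \<noteq> 0}" by auto
  then have "finite {S. f S + g S \<noteq> 0}"
    by (rule finite_subset) (use f g in simp)
  moreover have "\<forall>S. f S + g S \<noteq> 0 \<longrightarrow> finite S"
    using conjunct2[OF f] conjunct2[OF g] by (metis add_0)
  ultimately show "finite {S. f S + g S \<noteq> 0} \<and> (\<forall>S. f S + g S \<noteq> 0 \<longrightarrow> finite S)" by blast
qed

lift_definition uminus_exterior :: "'a exterior \<Rightarrow> 'a exterior" is "\<lambda>f S. - f S" by simp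

definition minus_exterior :: "'a exterior \<Rightarrow> 'a exterior \<Rightarrow> 'a exterior" where
  "x - y = x + - y" for x y :: "'a exterior"

lift_definition times_exterior :: "'a exterior \<Rightarrow> 'a exterior \<Rightarrow> 'a exterior"
  is "\<lambda>f g S. \<Sum>A\<in>Pow S. ext_sign A (S - A) * f A * g (S - A)"
proof -
  fix f g :: "nat set \<Rightarrow> 'a"
  assume f: "finite {S. f S \<noteq> 0} \<and> (\<forall>S. f S \<noteq> 0 \<longrightarrow> finite S)"
    and g: "finite {S. g S \<noteq> 0} \<and> (\<forall>S. g S \<noteq> 0 \<longrightarrow> finite S)"
  let ?h = "\<lambda>S. \<Sum>A\<in>Pow S. ext_sign A (S - A) * f A * g (S - A)"
  have *: "\<exists>A B. f A \<noteq> 0 \<and> g B \<noteq> 0 \<and> S = A \<union> B" if "?h S \<noteq> 0" for S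
  proof -
    from that obtain A where "A \<in> Pow S" "ext_sign A (S - A) * f A * g (S - A) \<noteq> 0"
      by (meson sum.not_neutral_contains_not_neutral)
    then show ?thesis by (intro exI[of _ A] exI[of _ "S - A"]) auto
  qed
  have "{S. ?h S \<noteq> 0} \<subseteq> (\<lambda>(A, B). A \<union> B) ` ({S. f S \<noteq> 0} \<times> {S. g S \<noteq> 0})"
    using * by fastforce
  then have "finite {S. ?h S \<noteq> 0}"
    by (rule finite_subset) (use f g in simp)
  moreover have "finite S" if "?h S \<noteq> 0" for S
    using *[OF that] conjunct2[OF f] conjunct2[OF g] by auto
  ultimately show "finite {S. ?h S \<noteq> 0} \<and> (\<forall>S. ?h S \<noteq> 0 \<longrightarrow> finite S)" by blast
qed

lemma times_exterior_assoc: "(x * y) * z = x * (y * z)" for x y z :: "'a exterior"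
proof (rule exterior_eqI)
  fix W :: "nat set"
  assume W: "finite W"
  note fin = finite_subset[OF _ W]
  let ?l = "\<lambda>(A, B). ext_sign A (W - A) *
      (ext_sign B (A - B) * ext_coeff x B * ext_coeff y (A - B)) * ext_coeff z (W - A)"
  let ?r = "\<lambda>(B, C). ext_sign B (W - B) * ext_coeff x B *
      (ext_sign C (W - B - C) * ext_coeff y C * ext_coeff z (W - B - C))"
  have eq: "?l (A, B) = ?r (B, A - B)" if "B \<subseteq> A" "A \<subseteq> W" for A B
  proof -
    have fs: "finite B" "finite (A - B)" "finite (W - A)"
      by (rule fin; use that in blast)+
    have un: "W - B - (A - B) = W - A" "B \<union> (A - B) = A" "(A - B) \<union> (W - A) = W - B"
      using that by auto
    have "ext_sign A (W - A) = (ext_sign B (W - A) * ext_sign (A - B) (W - A) :: 'a)"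
      using ext_sign_Un_left[of B "A - B" "W - A"] fs un(2) by auto
    moreover have "ext_sign B (W - B) = (ext_sign B (A - B) * ext_sign B (W - A) :: 'a)"
      using ext_sign_Un_right[of B "A - B" "W - A"] fs un(3) by auto
    ultimately show ?thesis by (simp add: un(1) mult_ac)
  qed
  have "ext_coeff (x * y * z) W = (\<Sum>A\<in>Pow W. \<Sum>B\<in>Pow A. ?l (A, B))"
    by (simp add: times_exterior.rep_eq sum_distrib_left sum_distrib_right)
  also have "\<dots> = sum ?l (Sigma (Pow W) Pow)"
    by (subst sum.Sigma) (use fin in \<open>auto simp: case_prod_beta\<close>)
  also have "\<dots> = sum ?r (Sigma (Pow W) (\<lambda>B. Pow (W - B)))"
  proof (rule sum.reindex_bij_witness[where i = "\<lambda>(B, C). (B \<union> C, B)"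
        and j = "\<lambda>(A, B). (B, A - B)"])
    fix a assume "a \<in> Sigma (Pow W) Pow"
    then show "?r (case a of (A, B) \<Rightarrow> (B, A - B)) = ?l a"
      using eq by (cases a) auto
  qed auto
  also have "\<dots> = (\<Sum>B\<in>Pow W. \<Sum>C\<in>Pow (W - B). ?r (B, C))"
    by (subst sum.Sigma) (use W in \<open>auto simp: case_prod_beta\<close>)
  also have "\<dots> = ext_coeff (x * (y * z)) W"
    by (simp add: times_exterior.rep_eq sum_distrib_left)
  finally show "ext_coeff (x * y * z) W = ext_coeff (x * (y * z)) W" .
qed

instance
proof
  fix a b c :: "'a exterior"
  show "a * b * c = a * (b * c)" by (rule times_exterior_assoc)
  show "1 * a = a"
  proof (rule exterior_eqI)
    fix S :: "nat set"
    assume "finite S"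
    have "ext_coeff (1 * a) S = (\<Sum>A\<in>Pow S. if A = {} then ext_coeff a S else 0)"
      by (auto simp: times_exterior.rep_eq one_exterior.rep_eq intro!: sum.cong)
    then show "ext_coeff (1 * a) S = ext_coeff a S" using \<open>finite S\<close> by (simp add: sum.delta)
  qed
  show "a * 1 = a"
  proof (rule exterior_eqI)
    fix S :: "nat set"
    assume "finite S"
    have "ext_coeff (a * 1) S = (\<Sum>A\<in>Pow S. if A = S then ext_coeff a S else 0)"
      by (auto simp: times_exterior.rep_eq one_exterior.rep_eq intro!: sum.cong)
    then show "ext_coeff (a * 1) S = ext_coeff a S" using \<open>finite S\<close> by (simp add: sum.delta)
  qed
  show "(0 :: 'a exterior) \<noteq> 1"
    by (metis one_exterior.rep_eq zero_exterior.rep_eq zero_neq_one)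
qed (rule exterior_eqI; simp add: plus_exterior.rep_eq zero_exterior.rep_eq uminus_exterior.rep_eq
    minus_exterior_def times_exterior.rep_eq algebra_simps sum.distrib)+

end

lemma ext_coeff_simps [simp]:
  "ext_coeff 0 S = 0" "ext_coeff (x + y) S = ext_coeff x S + ext_coeff y S"
  "ext_coeff (- x) S = - ext_coeff x S" "ext_coeff (x - y) S = ext_coeff x S - ext_coeff y S"
  unfolding minus_exterior_def
  by (simp_all only: zero_exterior.rep_eq plus_exterior.rep_eq uminus_exterior.rep_eq
      diff_conv_add_uminus)

lemma ext_coeff_sum [simp]: "ext_coeff (sum f I) S = (\<Sum>i\<in>I. ext_coeff (f i) S)"
  by (induction I rule: infinite_finite_induct) simp_all

lift_definition ext_scalar :: "'r::comm_ring_1 \<Rightarrow> 'r exterior" is "\<lambda>c S. if S = {} then c else 0"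
  by simp

definition ext_basis :: "nat set \<Rightarrow> 'r::comm_ring_1 exterior" where
  "ext_basis S = Abs_exterior (\<lambda>T. if finite S \<and> T = S then 1 else 0)"

lemma ext_coeff_basis: "ext_coeff (ext_basis S) T = (if finite S \<and> T = S then 1 else 0)"
  unfolding ext_basis_def by (subst Abs_exterior_inverse) auto

lemma ext_coeff_scalar_mult [simp]: "ext_coeff (ext_scalar c * x) S = c * ext_coeff x S"
proof (cases "finite S")
  case True
  have "ext_coeff (ext_scalar c * x) S = (\<Sum>A\<in>Pow S. if A = {} then c * ext_coeff x S else 0)"
    by (auto simp: times_exterior.rep_eq ext_scalar.rep_eq intro!: sum.cong)
  with True show ?thesis by (simp add: sum.delta)
qed (simp add: ext_coeff_infinite)

lemma ext_coeff_mult_scalar [simp]: "ext_coeff (x * ext_scalar c) S = c * ext_coeff x S"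
proof (cases "finite S")
  case True
  have "ext_coeff (x * ext_scalar c) S = (\<Sum>A\<in>Pow S. if A = S then c * ext_coeff x S else 0)"
    by (auto simp: times_exterior.rep_eq ext_scalar.rep_eq intro!: sum.cong)
  with True show ?thesis by (simp add: sum.delta)
qed (simp add: ext_coeff_infinite)

lemma ext_scalar_commute: "x * ext_scalar c = ext_scalar c * x"
  by (rule exterior_eqI) simp

lemma ext_scalar_hom [simp]:
  "ext_scalar 0 = 0" "ext_scalar 1 = 1" "ext_scalar (a + b) = ext_scalar a + ext_scalar b"
  "ext_scalar (- a) = - ext_scalar a" "ext_scalar (a * b) = ext_scalar a * ext_scalar b"
  by (rule exterior_eqI; simp add: ext_scalar.rep_eq one_exterior.rep_eq)+

lemma ext_basis_empty [simp]: "ext_basis {} = 1"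
  by (rule exterior_eqI) (simp add: ext_coeff_basis one_exterior.rep_eq)

lemma ext_expansion:
  "x = (\<Sum>S | ext_coeff x S \<noteq> 0. ext_scalar (ext_coeff x S) * ext_basis S)"
proof (rule exterior_eqI)
  fix T :: "nat set"
  assume "finite T"
  then have "(\<Sum>S | ext_coeff x S \<noteq> 0. ext_coeff x S * ext_coeff (ext_basis S) T) =
      (\<Sum>S | ext_coeff x S \<noteq> 0. if S = T then ext_coeff x T else 0)"
    by (intro sum.cong) (auto simp: ext_coeff_basis)
  also have "\<dots> = ext_coeff x T" by (subst sum.delta) auto
  finally show "ext_coeff x T = ext_coeff
      (\<Sum>S | ext_coeff x S \<noteq> 0. ext_scalar (ext_coeff x S) * ext_basis S) T" by simp
qed

lemma ext_basis_mult:
  assumes "finite A" "finite B"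
  shows "ext_basis A * ext_basis B =
    (if A \<inter> B = {} then ext_scalar (ext_sign A B) * ext_basis (A \<union> B) else 0)"
proof (rule exterior_eqI)
  fix S :: "nat set"
  assume S: "finite S"
  have "ext_coeff (ext_basis A * ext_basis B :: 'a exterior) S =
      (\<Sum>C\<in>Pow S. if C = A then (if S - A = B then ext_sign A B else 0) else 0)"
    unfolding times_exterior.rep_eq
    by (rule sum.cong) (use assms in \<open>auto simp: ext_coeff_basis\<close>)
  also have "\<dots> = (if A \<subseteq> S \<and> S - A = B then ext_sign A B else 0)"
    using S by (simp add: sum.delta)
  also have "(A \<subseteq> S \<and> S - A = B) \<longleftrightarrow> (A \<inter> B = {} \<and> S = A \<union> B)"
    by auto
  also have "(if A \<inter> B = {} \<and> S = A \<union> B then ext_sign A B else 0) =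
      ext_coeff (if A \<inter> B = {} then ext_scalar (ext_sign A B) * ext_basis (A \<union> B)
        else 0 :: 'a exterior) S"
    using assms by (simp add: ext_coeff_basis)
  finally show "ext_coeff (ext_basis A * ext_basis B :: 'a exterior) S =
      ext_coeff (if A \<inter> B = {} then ext_scalar (ext_sign A B) * ext_basis (A \<union> B)
        else 0 :: 'a exterior) S" .
qed

lemma ext_sum_superset:
  assumes "finite F" "{S. ext_coeff x S \<noteq> 0} \<subseteq> F" "\<And>S. f S 0 = 0"
  shows "(\<Sum>S | ext_coeff x S \<noteq> 0. f S (ext_coeff x S)) = (\<Sum>S\<in>F. f S (ext_coeff x S))"
  by (rule sum.mono_neutral_left) (use assms in auto)

lemma ext_sum_add:
  assumes "\<And>S. f S 0 = 0" "\<And>S a b. f S (a + b) = f S a + f S b"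
  shows "(\<Sum>S | ext_coeff (x + y) S \<noteq> 0. f S (ext_coeff (x + y) S)) =
    (\<Sum>S | ext_coeff x S \<noteq> 0. f S (ext_coeff x S)) + (\<Sum>S | ext_coeff y S \<noteq> 0. f S (ext_coeff y S))"
proof -
  let ?F = "{S. ext_coeff x S \<noteq> 0} \<union> {S. ext_coeff y S \<noteq> 0}"
  have "{S. ext_coeff (x + y) S \<noteq> 0} \<subseteq> ?F" by auto
  then have "(\<Sum>S | ext_coeff (x + y) S \<noteq> 0. f S (ext_coeff (x + y) S)) =
      (\<Sum>S\<in>?F. f S (ext_coeff (x + y) S))"
    by (intro ext_sum_superset) (use assms in auto)
  moreover have "(\<Sum>S | ext_coeff x S \<noteq> 0. f S (ext_coeff x S)) = (\<Sum>S\<in>?F. f S (ext_coeff x S))"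
    by (intro ext_sum_superset) (use assms in auto)
  moreover have "(\<Sum>S | ext_coeff y S \<noteq> 0. f S (ext_coeff y S)) = (\<Sum>S\<in>?F. f S (ext_coeff y S))"
    by (intro ext_sum_superset) (use assms in auto)
  ultimately show ?thesis by (simp add: assms sum.distrib)
qed

lemma ext_sum_scalar_mult:
  assumes "\<And>S. f S 0 = 0" "\<And>S a. f S (c * a) = d * f S a"
  shows "(\<Sum>S | ext_coeff (ext_scalar c * x) S \<noteq> 0. f S (ext_coeff (ext_scalar c * x) S)) =
    d * (\<Sum>S | ext_coeff x S \<noteq> 0. f S (ext_coeff x S) :: 'b::semiring_0)"
proof -
  have "{S. ext_coeff (ext_scalar c * x) S \<noteq> 0} \<subseteq> {S. ext_coeff x S \<noteq> 0}" by auto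
  then have "(\<Sum>S | ext_coeff (ext_scalar c * x) S \<noteq> 0. f S (ext_coeff (ext_scalar c * x) S)) =
      (\<Sum>S\<in>{S. ext_coeff x S \<noteq> 0}. f S (ext_coeff (ext_scalar c * x) S))"
    by (intro ext_sum_superset) (use assms in auto)
  then show ?thesis by (simp add: assms sum_distrib_left)
qed

lemma ext_sum_basis:
  fixes f :: "nat set \<Rightarrow> 'r::comm_ring_1 \<Rightarrow> 'b::comm_monoid_add"
  assumes "finite S" "\<And>T. f T 0 = 0"
  shows "(\<Sum>T | ext_coeff (ext_basis S :: 'r exterior) T \<noteq> 0. f T (ext_coeff (ext_basis S) T)) = f S 1"
proof -
  have "(\<Sum>T | ext_coeff (ext_basis S :: 'r exterior) T \<noteq> 0. f T (ext_coeff (ext_basis S) T)) =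
      (\<Sum>T\<in>{S}. f T (ext_coeff (ext_basis S) T))"
    by (rule ext_sum_superset) (use assms in \<open>auto simp: ext_coeff_basis\<close>)
  then show ?thesis using assms by (simp add: ext_coeff_basis)
qed

lemma ext_sign_singleton: "ext_sign {i} B = (-1) ^ card {b \<in> B. b < i}"
proof -
  have "{(a, b). a \<in> {i} \<and> b \<in> B \<and> b < a} = Pair i ` {b \<in> B. b < i}" by auto
  then show ?thesis by (simp add: ext_sign_def card_image inj_on_def)
qed

text \<open>Evaluation of \<open>e\<^sub>i \<mapsto> \<psi>\<^sub>i\<close> for anticommuting \<open>\<psi>\<^sub>i\<close> of square zero.\<close>

lemma sorted_list_of_set_insert_min:
  assumes "finite B" "\<And>b. b \<in> B \<Longrightarrow> (a::nat) < b"
  shows "sorted_list_of_set (insert a B) = a # sorted_list_of_set B"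
proof -
  have "a \<notin> B" using assms by auto
  moreover have "Min (insert a B) = a"
    by (rule Min_eqI) (use assms in \<open>auto intro: less_imp_le\<close>)
  ultimately show ?thesis
    using sorted_list_of_set_nonempty[of "insert a B"] assms by simp
qed

lemma anticomm_prod_insert:
  fixes \<psi> :: "nat \<Rightarrow> 'r::comm_ring_1 exterior"
  assumes anti: "\<And>i j. \<psi> i * \<psi> j = - (\<psi> j * \<psi> i)" and sq: "\<And>i. \<psi> i * \<psi> i = 0"
    and "finite B"
  shows "\<psi> i * (\<Prod>k\<leftarrow>sorted_list_of_set B. \<psi> k) =
    (if i \<in> B then 0 else ext_scalar (ext_sign {i} B) * (\<Prod>k\<leftarrow>sorted_list_of_set (insert i B). \<psi> k))"
  using \<open>finite B\<close>
proof (induction B rule: finite_linorder_min_induct)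
  case empty
  then show ?case by simp
next
  case (insert b B)
  let ?P = "\<lambda>B. \<Prod>k\<leftarrow>sorted_list_of_set B. \<psi> k"
  have P: "?P (insert b B) = \<psi> b * ?P B"
    using sorted_list_of_set_insert_min[of B b] insert.hyps by simp
  consider "i < b" | "i = b" | "b < i" by linarith
  then show ?case
  proof cases
    case 1
    then have "i \<notin> insert b B" using insert.hyps by auto
    moreover have "?P (insert i (insert b B)) = \<psi> i * ?P (insert b B)"
      using sorted_list_of_set_insert_min[of "insert b B" i] insert.hyps 1 by fastforce
    moreover have "{k \<in> insert b B. k < i} = {}" using 1 insert.hyps by auto
    ultimately show ?thesis by (simp only: ext_sign_singleton) simp
  next
    case 2
    then show ?thesis using P by (simp add: sq mult.assoc[symmetric])
  next
    case 3
    have *: "\<psi> i * ?P (insert b B) = - (\<psi> b * (\<psi> i * ?P B))"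
      unfolding P by (simp add: mult.assoc[symmetric] anti[of i b])
    show ?thesis
    proof (cases "i \<in> B")
      case True
      then show ?thesis using * insert.IH by simp
    next
      case False
      have Pi: "?P (insert i (insert b B)) = \<psi> b * ?P (insert i B)"
        using sorted_list_of_set_insert_min[of "insert i B" b] insert.hyps 3
        by (fastforce simp: insert_commute)
      have "{k \<in> insert b B. k < i} = insert b {k \<in> B. k < i}" using 3 by auto
      moreover have "b \<notin> B" using insert.hyps by auto
      ultimately have sgn: "ext_sign {i} (insert b B) = - (ext_sign {i} B :: 'r)"
        using insert.hyps by (simp only: ext_sign_singleton) simp
      have "\<psi> i * ?P (insert b B) =
          - (\<psi> b * (ext_scalar (ext_sign {i} B) * ?P (insert i B)))"
        using * insert.IH False by simp
      also have "\<dots> = ext_scalar (ext_sign {i} (insert b B)) * ?P (insert i (insert b B))"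
        by (simp only: Pi sgn mult.assoc[symmetric] ext_scalar_commute) simp
      finally show ?thesis using False 3 by simp
    qed
  qed
qed

lemma anticomm_prod_mult:
  fixes \<psi> :: "nat \<Rightarrow> 'r::comm_ring_1 exterior"
  assumes anti: "\<And>i j. \<psi> i * \<psi> j = - (\<psi> j * \<psi> i)" and sq: "\<And>i. \<psi> i * \<psi> i = 0"
    and "finite A" and B: "finite B"
  shows "(\<Prod>k\<leftarrow>sorted_list_of_set A. \<psi> k) * (\<Prod>k\<leftarrow>sorted_list_of_set B. \<psi> k) =
    (if A \<inter> B = {} then ext_scalar (ext_sign A B) * (\<Prod>k\<leftarrow>sorted_list_of_set (A \<union> B). \<psi> k) else 0)"
  using \<open>finite A\<close>
proof (induction A rule: finite_linorder_min_induct)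
  case empty
  then show ?case by simp
next
  case (insert a A)
  let ?P = "\<lambda>B. \<Prod>k\<leftarrow>sorted_list_of_set B. \<psi> k"
  have P: "?P (insert a A) = \<psi> a * ?P A"
    using sorted_list_of_set_insert_min[of A a] insert.hyps by simp
  have a: "a \<notin> A" using insert.hyps by auto
  show ?case
  proof (cases "A \<inter> B = {}")
    case False
    then have "?P A * ?P B = 0" using insert.IH by simp
    then show ?thesis using P False by (auto simp: mult.assoc)
  next
    case True
    have "?P (insert a A) * ?P B = \<psi> a * (ext_scalar (ext_sign A B) * ?P (A \<union> B))"
      using insert.IH True P by (simp add: mult.assoc)
    also have "\<dots> = ext_scalar (ext_sign A B) * (\<psi> a * ?P (A \<union> B))"
      by (simp only: mult.assoc[symmetric] ext_scalar_commute)
    also have "\<dots> = ext_scalar (ext_sign A B) * (if a \<in> A \<union> B then 0 else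
        ext_scalar (ext_sign {a} (A \<union> B)) * ?P (insert a (A \<union> B)))"
      by (subst anticomm_prod_insert[OF anti sq]) (use insert.hyps B in simp_all)
    finally have eq: "?P (insert a A) * ?P B = \<dots>" .
    show ?thesis
    proof (cases "a \<in> B")
      case True
      then show ?thesis using eq by simp
    next
      case aB: False
      have "{k \<in> A. k < a} = {}" using insert.hyps by auto
      then have "ext_sign {a} A = (1 :: 'r)" by (simp only: ext_sign_singleton) simp
      then have "ext_sign {a} (A \<union> B) = (ext_sign {a} B :: 'r)"
        using ext_sign_Un_right[where 'a = 'r, of "{a}" A B] True insert.hyps B by simp
      moreover have "ext_sign (insert a A) B = (ext_sign {a} B * ext_sign A B :: 'r)"
        using ext_sign_Un_left[where 'a = 'r, of "{a}" A B] insert.hyps B a by simp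
      ultimately show ?thesis using eq aB a True
        by (simp add: mult.assoc[symmetric]) (simp only: ext_scalar_hom(5)[symmetric] mult.commute)
    qed
  qed
qed

lemma ext_basis_anticomm:
  "ext_basis {i} * ext_basis {j} = - (ext_basis {j} * ext_basis {i} :: 'r::comm_ring_1 exterior)"
proof -
  consider "i < j" | "i = j" | "j < i" by linarith
  then show ?thesis
  proof cases
    case 1
    then have "{b \<in> {j}. b < i} = {}" "{b \<in> {i}. b < j} = {i}" by auto
    then have "ext_sign {i} {j} = (1 :: 'r)" "ext_sign {j} {i} = (- 1 :: 'r)"
      by (simp_all only: ext_sign_singleton) simp_all
    with 1 show ?thesis by (simp add: ext_basis_mult insert_commute)
  next
    case 3
    then have "{b \<in> {j}. b < i} = {j}" "{b \<in> {i}. b < j} = {}" by auto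
    then have "ext_sign {i} {j} = (- 1 :: 'r)" "ext_sign {j} {i} = (1 :: 'r)"
      by (simp_all only: ext_sign_singleton) simp_all
    with 3 show ?thesis by (simp add: ext_basis_mult insert_commute)
  qed (simp add: ext_basis_mult)
qed

lemma ext_basis_eq_prod: "finite S \<Longrightarrow> ext_basis S = (\<Prod>i\<leftarrow>sorted_list_of_set S. ext_basis {i})"
proof (induction S rule: finite_linorder_min_induct)
  case (insert b B)
  then have "{k \<in> B. k < b} = {}" by auto
  then have "ext_sign {b} B = (1 :: 'a)" by (simp only: ext_sign_singleton) simp
  then have "ext_basis (insert b B) = ext_basis {b} * (ext_basis B :: 'a exterior)"
    using insert.hyps by (subst ext_basis_mult) auto
  with insert show ?case using sorted_list_of_set_insert_min[of B b] by simp
qed simp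


section \<open>Polynomials in the indeterminates \<open>t\<^sub>0, t\<^sub>1, \<dots>\<close>\<close>

type_synonym 'a mpoly = "(nat \<Rightarrow>\<^sub>0 nat) \<Rightarrow>\<^sub>0 'a"

definition mconst :: "'a::comm_ring_1 \<Rightarrow> 'a mpoly" where
  "mconst c = Poly_Mapping.single 0 c"

definition mvar :: "nat \<Rightarrow> 'a::comm_ring_1 mpoly" where
  "mvar i = Poly_Mapping.single (Poly_Mapping.single i 1) 1"

definition mpolys_in :: "nat set \<Rightarrow> 'a::comm_ring_1 mpoly set" where
  "mpolys_in V = {P. \<forall>m\<in>Poly_Mapping.keys P. Poly_Mapping.keys m \<subseteq> V}"

definition msubst :: "(nat \<Rightarrow> 'a::comm_ring_1 mpoly) \<Rightarrow> 'a mpoly \<Rightarrow> 'a mpoly" where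
  "msubst f P = (\<Sum>m\<in>Poly_Mapping.keys P. mconst (Poly_Mapping.lookup P m) *
     (\<Prod>i\<in>Poly_Mapping.keys m. f i ^ Poly_Mapping.lookup m i))"

lemma mconst_hom [simp]:
  "mconst 0 = 0" "mconst 1 = 1" "mconst (a + b) = mconst a + mconst b"
  "mconst (a * b) = mconst a * mconst b"
  by (simp_all add: mconst_def single_add mult_single)

lemma msubst_superset:
  assumes "finite F" "Poly_Mapping.keys P \<subseteq> F"
  shows "msubst f P = (\<Sum>m\<in>F. mconst (Poly_Mapping.lookup P m) *
    (\<Prod>i\<in>Poly_Mapping.keys m. f i ^ Poly_Mapping.lookup m i))"
  unfolding msubst_def by (rule sum.mono_neutral_left) (use assms in \<open>auto simp: in_keys_iff\<close>)

lemma msubst_0 [simp]: "msubst f 0 = 0"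
  by (simp add: msubst_def)

lemma msubst_add: "msubst f (P + Q) = msubst f P + msubst f Q"
  using msubst_superset[of "Poly_Mapping.keys P \<union> Poly_Mapping.keys Q" P f]
    msubst_superset[of "Poly_Mapping.keys P \<union> Poly_Mapping.keys Q" Q f]
    msubst_superset[of "Poly_Mapping.keys P \<union> Poly_Mapping.keys Q" "P + Q" f]
    Poly_Mapping.keys_add[of P Q]
  by (simp add: lookup_add algebra_simps sum.distrib)

lemma msubst_sum: "msubst f (sum g I) = (\<Sum>i\<in>I. msubst f (g i))"
  by (induction I rule: infinite_finite_induct) (simp_all add: msubst_add)

lemma msubst_single: "msubst f (Poly_Mapping.single m c) =
    mconst c * (\<Prod>i\<in>Poly_Mapping.keys m. f i ^ Poly_Mapping.lookup m i)"
  by (subst msubst_superset[of "{m}"]) auto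

lemma msubst_mconst [simp]: "msubst f (mconst c) = mconst c"
  by (simp add: mconst_def[of c] msubst_single)

lemma msubst_1 [simp]: "msubst f 1 = 1"
  using msubst_mconst[of f 1] by simp

lemma msubst_sign: "msubst f ((-1) ^ k) = (-1) ^ k"
proof -
  have "mconst (- 1) = - (1 :: 'a mpoly)"
    by (simp add: mconst_def single_uminus)
  moreover have "mconst (a ^ k) = mconst a ^ k" for a :: 'a
    by (induction k) simp_all
  ultimately show ?thesis by (metis msubst_mconst)
qed

lemma msubst_mvar [simp]: "msubst f (mvar i) = f i"
  by (simp add: mvar_def msubst_single)

lemma sum_monomials:
  "P = (\<Sum>m\<in>Poly_Mapping.keys P. Poly_Mapping.single m (Poly_Mapping.lookup P m))"
proof (rule poly_mapping_eqI)
  fix k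
  show "Poly_Mapping.lookup P k = Poly_Mapping.lookup
      (\<Sum>m\<in>Poly_Mapping.keys P. Poly_Mapping.single m (Poly_Mapping.lookup P m)) k"
    by (simp add: lookup_sum lookup_single when_def sum.delta in_keys_iff)
qed

lemma msubst_mult: "msubst f (P * Q) = msubst f P * msubst f Q"
proof -
  have prod: "(\<Prod>i\<in>Poly_Mapping.keys m. f i ^ Poly_Mapping.lookup m i) =
      (\<Prod>i\<in>K. f i ^ Poly_Mapping.lookup m i)"
    if "finite K" "Poly_Mapping.keys m \<subseteq> K" for m K
    by (rule prod.mono_neutral_left) (use that in \<open>auto simp: in_keys_iff\<close>)
  have *: "msubst f (Poly_Mapping.single m a * Poly_Mapping.single k b) =
      msubst f (Poly_Mapping.single m a) * msubst f (Poly_Mapping.single k b)" for m k a b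
    using prod[of "Poly_Mapping.keys m \<union> Poly_Mapping.keys k" m]
      prod[of "Poly_Mapping.keys m \<union> Poly_Mapping.keys k" k]
      prod[of "Poly_Mapping.keys m \<union> Poly_Mapping.keys k" "m + k"]
      Poly_Mapping.keys_add[of m k]
    by (simp add: mult_single msubst_single lookup_add power_add prod.distrib)
  have "msubst f (P * Q) = msubst f
      ((\<Sum>m\<in>Poly_Mapping.keys P. Poly_Mapping.single m (Poly_Mapping.lookup P m)) *
       (\<Sum>k\<in>Poly_Mapping.keys Q. Poly_Mapping.single k (Poly_Mapping.lookup Q k)))"
    using sum_monomials[of P] sum_monomials[of Q] by simp
  also have "\<dots> =
      (\<Sum>m\<in>Poly_Mapping.keys P. msubst f (Poly_Mapping.single m (Poly_Mapping.lookup P m))) *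
      (\<Sum>k\<in>Poly_Mapping.keys Q. msubst f (Poly_Mapping.single k (Poly_Mapping.lookup Q k)))"
    by (simp add: sum_product msubst_sum *)
  also have "\<dots> = msubst f P * msubst f Q"
    using sum_monomials[of P] sum_monomials[of Q] by (simp flip: msubst_sum)
  finally show ?thesis .
qed


section \<open>The cohomology ring\<close>

text \<open>
  The ground field \<open>\<F>\<^sub>p\<close> is rendered by a finite field type \<open>'a\<close> such that \<open>CARD('a) = p\<close>.
  The type \<open>'a coh\<close> is the algebra on countably many pairs of generators \<open>t\<^sub>i\<close>, \<open>dt\<^sub>i\<close>;
  \<open>HBA n\<close> is its subalgebra on \<open>t\<^sub>1, \<dots>, t\<^sub>n, dt\<^sub>1, \<dots>, dt\<^sub>n\<close>.
\<close>

type_synonym 'a coh = "'a mpoly exterior"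

definition gen_t :: "nat \<Rightarrow> 'a::comm_ring_1 coh" where
  "gen_t i = ext_scalar (mvar i)"

definition gen_dt :: "nat \<Rightarrow> 'a::comm_ring_1 coh" where
  "gen_dt i = ext_basis {i}"

definition HBA :: "nat \<Rightarrow> 'a::comm_ring_1 coh set" where
  "HBA n = {x. \<forall>S. ext_coeff x S \<noteq> 0 \<longrightarrow> S \<subseteq> {1..n} \<and> ext_coeff x S \<in> mpolys_in {1..n}}"


subsection \<open>The action of matrices\<close>

text \<open>
  \<open>lin_subst n h\<close> is the algebra endomorphism with \<open>t\<^sub>i \<mapsto> \<Sum>\<^sub>j h\<^sub>i\<^sub>j t\<^sub>j\<close> and
  \<open>dt\<^sub>i \<mapsto> \<Sum>\<^sub>j h\<^sub>i\<^sub>j dt\<^sub>j\<close>; rows and columns of matrices are numbered from 0 in the library.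
\<close>

definition lin_t :: "nat \<Rightarrow> 'a::comm_ring_1 mat \<Rightarrow> nat \<Rightarrow> 'a mpoly" where
  "lin_t n h i = (\<Sum>j=1..n. mconst (h $$ (i - 1, j - 1)) * mvar j)"

definition lin_dt :: "nat \<Rightarrow> 'a::comm_ring_1 mat \<Rightarrow> nat \<Rightarrow> 'a coh" where
  "lin_dt n h i = (\<Sum>j=1..n. ext_scalar (mconst (h $$ (i - 1, j - 1))) * gen_dt j)"

definition lin_subst :: "nat \<Rightarrow> 'a::comm_ring_1 mat \<Rightarrow> 'a coh \<Rightarrow> 'a coh" where
  "lin_subst n h x = (\<Sum>S | ext_coeff x S \<noteq> 0.
     ext_scalar (msubst (lin_t n h) (ext_coeff x S)) * (\<Prod>i\<leftarrow>sorted_list_of_set S. lin_dt n h i))"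

definition act :: "nat \<Rightarrow> 'a::field mat \<Rightarrow> 'a coh \<Rightarrow> 'a coh" where
  "act n g = lin_subst n (the (mat_inverse g))"

lemma mat_inverse_nonsingular:
  fixes g :: "'a::field mat"
  assumes g: "g \<in> carrier_mat n n" and "det g \<noteq> 0"
  shows "the (mat_inverse g) \<in> carrier_mat n n"
    "g * the (mat_inverse g) = 1\<^sub>m n" "the (mat_inverse g) * g = 1\<^sub>m n"
proof -
  obtain h where "mat_inverse g = Some h"
    using mat_inverse(1)[OF g, of undefined] det_non_zero_imp_unit[OF assms, of undefined]
    by (cases "mat_inverse g") auto
  with mat_inverse(2)[OF g this] show "the (mat_inverse g) \<in> carrier_mat n n"
    "g * the (mat_inverse g) = 1\<^sub>m n" "the (mat_inverse g) * g = 1\<^sub>m n" by simp_all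
qed

definition invariants :: "nat \<Rightarrow> 'a::field mat set \<Rightarrow> 'a coh set" where
  "invariants n W = {x \<in> HBA n. \<forall>g\<in>W. act n g x = x}"

lemma lin_subst_add: "lin_subst n h (x + y) = lin_subst n h x + lin_subst n h y"
  unfolding lin_subst_def
  by (rule ext_sum_add[where f = "\<lambda>S c. ext_scalar (msubst (lin_t n h) c) *
      (\<Prod>i\<leftarrow>sorted_list_of_set S. lin_dt n h i)"]) (simp_all add: msubst_add distrib_right)

lemma lin_subst_0 [simp]: "lin_subst n h 0 = 0"
  by (simp add: lin_subst_def)

lemma lin_subst_sum: "lin_subst n h (sum f I) = (\<Sum>i\<in>I. lin_subst n h (f i))"
  by (induction I rule: infinite_finite_induct) (simp_all add: lin_subst_add)

lemma lin_subst_scalar_mult: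
  "lin_subst n h (ext_scalar c * x) = ext_scalar (msubst (lin_t n h) c) * lin_subst n h x"
  unfolding lin_subst_def
  by (rule ext_sum_scalar_mult[where f = "\<lambda>S c. ext_scalar (msubst (lin_t n h) c) *
      (\<Prod>i\<leftarrow>sorted_list_of_set S. lin_dt n h i)"]) (simp_all add: msubst_mult mult.assoc)

lemma lin_subst_basis:
  "finite S \<Longrightarrow> lin_subst n h (ext_basis S) = (\<Prod>i\<leftarrow>sorted_list_of_set S. lin_dt n h i)"
  unfolding lin_subst_def
  using ext_sum_basis[where f = "\<lambda>S c. ext_scalar (msubst (lin_t n h) c) *
      (\<Prod>i\<leftarrow>sorted_list_of_set S. lin_dt n h i)", of S] by simp

lemma lin_subst_1 [simp]: "lin_subst n h 1 = 1"
  using lin_subst_basis[of "{}" n h] by simp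

lemma lin_subst_const [simp]: "lin_subst n h (ext_scalar (mconst c)) = ext_scalar (mconst c)"
  using lin_subst_scalar_mult[of n h "mconst c" 1] by simp

lemma lin_subst_gen_t:
  "lin_subst n h (gen_t i) = (\<Sum>j=1..n. ext_scalar (mconst (h $$ (i - 1, j - 1))) * gen_t j)"
proof -
  have "ext_scalar (\<Sum>j\<in>J. f j) = (\<Sum>j\<in>J. ext_scalar (f j :: 'a mpoly))" for J :: "nat set" and f
    by (induction J rule: infinite_finite_induct) simp_all
  then show ?thesis
    using lin_subst_scalar_mult[of n h "mvar i" 1] by (simp add: gen_t_def lin_t_def)
qed

lemma lin_subst_gen_dt:
  "lin_subst n h (gen_dt i) = (\<Sum>j=1..n. ext_scalar (mconst (h $$ (i - 1, j - 1))) * gen_dt j)"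
  using lin_subst_basis[of "{i}" n h] by (simp add: gen_dt_def lin_dt_def)

lemma mult_scalar_left_commute: "x * (ext_scalar c * y) = ext_scalar c * (x * y)"
  by (simp only: mult.assoc[symmetric] ext_scalar_commute[of x])

lemma scalar_mult_swap:
  "(ext_scalar a * x) * (ext_scalar b * y) = ext_scalar (a * b) * (x * y)"
  by (simp add: mult.assoc mult_scalar_left_commute[of x])

lemma linear_form_anticomm:
  fixes a b :: "nat \<Rightarrow> 'r::comm_ring_1"
  shows "(\<Sum>j\<in>J. ext_scalar (a j) * ext_basis {j}) * (\<Sum>k\<in>J. ext_scalar (b k) * ext_basis {k}) =
    - ((\<Sum>k\<in>J. ext_scalar (b k) * ext_basis {k}) * (\<Sum>j\<in>J. ext_scalar (a j) * ext_basis {j}))"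
proof -
  have *: "ext_scalar (a j * b k) * (ext_basis {j} * ext_basis {k}) =
      - (ext_scalar (b k * a j) * (ext_basis {k} * ext_basis {j}))" for j k
    by (subst ext_basis_anticomm[of j k]) (simp add: mult.commute)
  have "(\<Sum>j\<in>J. \<Sum>k\<in>J. ext_scalar (a j * b k) * (ext_basis {j} * ext_basis {k})) =
      (\<Sum>j\<in>J. \<Sum>k\<in>J. - (ext_scalar (b k * a j) * (ext_basis {k} * ext_basis {j})))"
    by (intro sum.cong refl) (use * in simp)
  also have "\<dots> = - (\<Sum>k\<in>J. \<Sum>j\<in>J. ext_scalar (b k * a j) * (ext_basis {k} * ext_basis {j}))"
    by (subst sum.swap) (simp add: sum_negf)
  finally show ?thesis by (simp only: sum_product scalar_mult_swap)
qed

lemma linear_form_square: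
  fixes a :: "nat \<Rightarrow> 'r::comm_ring_1"
  assumes "finite J"
  shows "(\<Sum>j\<in>J. ext_scalar (a j) * ext_basis {j}) * (\<Sum>k\<in>J. ext_scalar (a k) * ext_basis {k}) = 0"
  using assms
proof (induction J)
  case (insert i J)
  let ?v = "ext_scalar (a i) * ext_basis {i}" and ?w = "\<Sum>j\<in>J. ext_scalar (a j) * ext_basis {j}"
  have "?v * ?w = - (?w * ?v)"
  proof -
    have "?v * (ext_scalar (a j) * ext_basis {j}) = - ((ext_scalar (a j) * ext_basis {j}) * ?v)" for j
      unfolding scalar_mult_swap by (subst ext_basis_anticomm) (simp add: mult.commute)
    then show ?thesis by (simp add: sum_distrib_left sum_distrib_right sum_negf)
  qed
  moreover have "?v * ?v = 0" unfolding scalar_mult_swap by (simp add: ext_basis_mult)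
  ultimately show ?case using insert by (simp add: distrib_left distrib_right)
qed simp

lemma lin_subst_mult: "lin_subst n h (x * y) = lin_subst n h x * lin_subst n h y"
proof -
  let ?\<psi> = "lin_dt n h"
  let ?L = "lin_subst n h"
  let ?m = "msubst (lin_t n h)"
  have anti: "?\<psi> i * ?\<psi> j = - (?\<psi> j * ?\<psi> i)" for i j
    unfolding gen_dt_def lin_dt_def by (rule linear_form_anticomm)
  have sq: "?\<psi> i * ?\<psi> i = 0" for i
    unfolding gen_dt_def lin_dt_def by (rule linear_form_square) simp
  have basis: "?L (ext_basis A * ext_basis B) = ?L (ext_basis A) * ?L (ext_basis B)"
    if "finite A" "finite B" for A B
    using anticomm_prod_mult[of ?\<psi>, OF anti sq that] that
    by (simp add: ext_basis_mult lin_subst_basis lin_subst_scalar_mult msubst_sign ext_sign_def)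
  have "x * y = (\<Sum>A | ext_coeff x A \<noteq> 0. \<Sum>B | ext_coeff y B \<noteq> 0.
      ext_scalar (ext_coeff x A * ext_coeff y B) * (ext_basis A * ext_basis B))"
    by (subst (1) ext_expansion[of x], subst (1) ext_expansion[of y])
      (simp only: sum_product scalar_mult_swap)
  then have "?L (x * y) = (\<Sum>A | ext_coeff x A \<noteq> 0. \<Sum>B | ext_coeff y B \<noteq> 0.
      ext_scalar (?m (ext_coeff x A) * ?m (ext_coeff y B)) * ?L (ext_basis A * ext_basis B))"
    by (simp only: lin_subst_sum lin_subst_scalar_mult msubst_mult)
  also have "\<dots> = (\<Sum>A | ext_coeff x A \<noteq> 0. \<Sum>B | ext_coeff y B \<noteq> 0.
      ext_scalar (?m (ext_coeff x A) * ?m (ext_coeff y B)) * (?L (ext_basis A) * ?L (ext_basis B)))"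
  proof (intro sum.cong refl)
    fix A B
    assume "A \<in> {A. ext_coeff x A \<noteq> 0}" "B \<in> {B. ext_coeff y B \<noteq> 0}"
    then have "finite A" "finite B" using ext_coeff_infinite by blast+
    then show "ext_scalar (?m (ext_coeff x A) * ?m (ext_coeff y B)) * ?L (ext_basis A * ext_basis B) =
        ext_scalar (?m (ext_coeff x A) * ?m (ext_coeff y B)) * (?L (ext_basis A) * ?L (ext_basis B))"
      by (simp only: basis)
  qed
  also have "\<dots> = (\<Sum>A | ext_coeff x A \<noteq> 0. ext_scalar (?m (ext_coeff x A)) * ?L (ext_basis A)) *
      (\<Sum>B | ext_coeff y B \<noteq> 0. ext_scalar (?m (ext_coeff y B)) * ?L (ext_basis B))"
    by (simp only: sum_product scalar_mult_swap)
  also have "\<dots> = ?L (\<Sum>A | ext_coeff x A \<noteq> 0. ext_scalar (ext_coeff x A) * ext_basis A) *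
      ?L (\<Sum>B | ext_coeff y B \<noteq> 0. ext_scalar (ext_coeff y B) * ext_basis B)"
    by (simp only: lin_subst_sum lin_subst_scalar_mult)
  finally show ?thesis by (simp only: flip: ext_expansion)
qed


subsection \<open>Milnor operations\<close>

text \<open>
  The operation \<open>Q\<^sub>j\<close> is written out on the basis \<open>e\<^sub>S\<close>. The lemmas below show that it is the
  polynomial-linear derivation with \<open>Q\<^sub>j dt\<^sub>i = t\<^sub>i ^ (p ^ j)\<close>; since polynomials have even degree,
  the parity of the cohomological degree is that of the number of factors \<open>dt\<^sub>i\<close>.
\<close>

definition milnor_Q_on_basis :: "nat \<Rightarrow> nat set \<Rightarrow> 'a::{finite,field} coh" where
  "milnor_Q_on_basis j S = (\<Sum>i\<in>S. ext_scalar ((-1) ^ card {k \<in> S. k < i} *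
     mvar i ^ (CARD('a) ^ j)) * ext_basis (S - {i}))"

definition milnor_Q :: "nat \<Rightarrow> 'a::{finite,field} coh \<Rightarrow> 'a coh" where
  "milnor_Q j x =
     (\<Sum>S | ext_coeff x S \<noteq> 0. ext_scalar (ext_coeff x S) * milnor_Q_on_basis j S)"

definition milnor_Qs :: "nat set \<Rightarrow> 'a::{finite,field} coh \<Rightarrow> 'a coh" where
  "milnor_Qs I = foldr milnor_Q (sorted_list_of_set I)"

lemma milnor_Q_add: "milnor_Q j (x + y) = milnor_Q j x + milnor_Q j y"
  unfolding milnor_Q_def
  by (rule ext_sum_add[where f = "\<lambda>S c. ext_scalar c * milnor_Q_on_basis j S"])
    (simp_all add: distrib_right)

lemma milnor_Q_0 [simp]: "milnor_Q j 0 = 0"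
  by (simp add: milnor_Q_def)

lemma milnor_Q_sum: "milnor_Q j (sum f I) = (\<Sum>i\<in>I. milnor_Q j (f i))"
  by (induction I rule: infinite_finite_induct) (simp_all add: milnor_Q_add)

lemma milnor_Q_scalar_mult: "milnor_Q j (ext_scalar c * x) = ext_scalar c * milnor_Q j x"
  unfolding milnor_Q_def
  by (rule ext_sum_scalar_mult[where f = "\<lambda>S c. ext_scalar c * milnor_Q_on_basis j S"])
    (simp_all add: mult.assoc)

lemma milnor_Q_basis: "finite S \<Longrightarrow> milnor_Q j (ext_basis S) = milnor_Q_on_basis j S"
  unfolding milnor_Q_def
  using ext_sum_basis[where f = "\<lambda>S c. ext_scalar c * milnor_Q_on_basis j S", of S] by simp

lemma milnor_Q_1 [simp]: "milnor_Q j 1 = 0"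
  using milnor_Q_basis[of "{}" j] by (simp add: milnor_Q_on_basis_def)

lemma milnor_Q_scalar [simp]: "milnor_Q j (ext_scalar c) = 0"
  using milnor_Q_scalar_mult[of j c 1] by simp

lemma milnor_Q_gen_t: "milnor_Q j (gen_t i) = 0"
  by (simp add: gen_t_def)

lemma milnor_Q_gen_dt: "milnor_Q j (gen_dt i :: 'a::{finite,field} coh) = gen_t i ^ (CARD('a) ^ j)"
proof -
  have "ext_scalar (c ^ n) = (ext_scalar c :: 'a coh) ^ n" for c n
    by (induction n) simp_all
  moreover have empty: "{k. k = i \<and> k < i} = {}" by auto
  ultimately show ?thesis
    by (simp add: gen_dt_def gen_t_def milnor_Q_basis milnor_Q_on_basis_def empty)
qed

lemma milnor_Q_basis_cons:
  assumes "finite B"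
  shows "milnor_Q j (ext_basis {a} * ext_basis B :: 'a::{finite,field} coh) =
    ext_scalar (mvar a ^ (CARD('a) ^ j)) * ext_basis B - ext_basis {a} * milnor_Q j (ext_basis B)"
proof -
  let ?\<theta> = "\<lambda>i::nat. mvar i ^ (CARD('a) ^ j) :: 'a mpoly"
  let ?s = "\<lambda>(B::nat set) i. (-1) ^ card {k \<in> B. k < i} :: 'a mpoly"
  have sq: "?s B i * ?s B i = 1" for B i
    by (simp flip: power_add mult_2)
  have right: "ext_basis {a} * milnor_Q j (ext_basis B :: 'a coh) =
      (\<Sum>i\<in>B. ext_scalar (?s B i * ?\<theta> i) * (ext_basis {a} * ext_basis (B - {i})))"
    unfolding milnor_Q_basis[OF assms] milnor_Q_on_basis_def sum_distrib_left
    by (rule sum.cong[OF refl], rule mult_scalar_left_commute)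
  show ?thesis
  proof (cases "a \<in> B")
    case True
    have "ext_scalar (?s B i * ?\<theta> i) * (ext_basis {a} * ext_basis (B - {i})) =
        (if i = a then ext_scalar (?\<theta> a) * ext_basis B else 0)" if "i \<in> B" for i
    proof (cases "i = a")
      case False
      then show ?thesis using True assms by (simp add: ext_basis_mult)
    next
      case i: True
      have "{k \<in> B - {a}. k < a} = {k \<in> B. k < a}" by auto
      then have "ext_sign {a} (B - {a}) = ?s B a" by (simp only: ext_sign_singleton)
      moreover have "insert a B = B" using True by auto
      ultimately have "ext_basis {a} * ext_basis (B - {a}) = ext_scalar (?s B a) * ext_basis B"
        using assms by (simp add: ext_basis_mult)
      then have "ext_scalar (?s B a * ?\<theta> a) * (ext_basis {a} * ext_basis (B - {a})) =
          ext_scalar (?s B a * ?\<theta> a * ?s B a) * ext_basis B"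
        by (simp only: ext_scalar_hom(5) mult.assoc)
      also have "?s B a * ?\<theta> a * ?s B a = (?s B a * ?s B a) * ?\<theta> a"
        by (simp only: mult_ac)
      finally show ?thesis using i by (simp only: sq) simp
    qed
    then have "ext_basis {a} * milnor_Q j (ext_basis B :: 'a coh) = ext_scalar (?\<theta> a) * ext_basis B"
      unfolding right using assms True by (simp add: sum.delta)
    moreover have "ext_basis {a} * ext_basis B = (0 :: 'a coh)"
      using True assms by (simp add: ext_basis_mult)
    ultimately show ?thesis by simp
  next
    case False
    let ?s' = "ext_sign {a} B :: 'a mpoly"
    have s': "?s' = ?s B a" by (rule ext_sign_singleton)
    have summand: "ext_scalar (?s' * (?s (insert a B) i * ?\<theta> i)) * ext_basis (insert a B - {i}) =
        - (ext_scalar (?s B i * ?\<theta> i) * (ext_basis {a} * ext_basis (B - {i})))" if i: "i \<in> B" for i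
    proof -
      have "?s B a * ?s (insert a B) i = - (?s B i * ?s (B - {i}) a)"
      proof (cases "a < i")
        case True
        have "{k \<in> insert a B. k < i} = insert a {k \<in> B. k < i}" using True by auto
        moreover have "{k \<in> B - {i}. k < a} = {k \<in> B. k < a}" using True by auto
        ultimately show ?thesis using \<open>a \<notin> B\<close> assms by (simp only:) simp
      next
        case False
        then have "i < a" using i \<open>a \<notin> B\<close> by (metis linorder_neqE_nat)
        then have "{k \<in> insert a B. k < i} = {k \<in> B. k < i}"
          "{k \<in> B. k < a} = insert i {k \<in> B - {i}. k < a}" using i by auto
        moreover have "finite {k \<in> B - {i}. k < a}" using assms by simp
        ultimately show ?thesis by (simp only: card_insert_if) simp
      qed
      moreover have "ext_sign {a} (B - {i}) = ?s (B - {i}) a" by (rule ext_sign_singleton)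
      moreover have "insert a B - {i} = insert a (B - {i})" using i \<open>a \<notin> B\<close> by auto
      moreover have "ext_basis {a} * ext_basis (B - {i}) =
          ext_scalar (ext_sign {a} (B - {i})) * (ext_basis (insert a (B - {i})) :: 'a coh)"
        using assms \<open>a \<notin> B\<close> by (simp add: ext_basis_mult)
      ultimately have "?s' * (?s (insert a B) i * ?\<theta> i) = - (?s B i * ?\<theta> i * ext_sign {a} (B - {i}))"
        "ext_basis (insert a B - {i}) = (ext_basis (insert a (B - {i})) :: 'a coh)"
        "ext_basis {a} * ext_basis (B - {i}) =
          ext_scalar (ext_sign {a} (B - {i})) * (ext_basis (insert a (B - {i})) :: 'a coh)"
        unfolding s' by (simp_all only: mult.assoc[symmetric]) (simp only: mult_minus_left mult_minus_right mult_ac)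
      then show ?thesis
        by (simp only: ext_scalar_hom(4) mult_minus_left) (simp only: ext_scalar_hom(5) mult.assoc)
    qed
    have "{k \<in> insert a B. k < a} = {k \<in> B. k < a}" by auto
    then have head: "?s' * (?s (insert a B) a * ?\<theta> a) = ?\<theta> a"
      unfolding s' by (simp only: mult.assoc[symmetric] sq) simp
    have "milnor_Q j (ext_basis {a} * ext_basis B :: 'a coh) =
        ext_scalar ?s' * milnor_Q j (ext_basis (insert a B))"
      using assms False by (simp add: ext_basis_mult milnor_Q_scalar_mult)
    also have "\<dots> = (\<Sum>i\<in>insert a B.
        ext_scalar (?s' * (?s (insert a B) i * ?\<theta> i)) * ext_basis (insert a B - {i}))"
      unfolding milnor_Q_basis[OF finite.insertI[OF assms]] milnor_Q_on_basis_def sum_distrib_left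
      by (rule sum.cong) (simp_all only: ext_scalar_hom(5) mult.assoc)
    also have "\<dots> = ext_scalar (?\<theta> a) * ext_basis B +
        (\<Sum>i\<in>B. ext_scalar (?s' * (?s (insert a B) i * ?\<theta> i)) * ext_basis (insert a B - {i}))"
      using False assms by (subst sum.insert) (simp_all only: head, simp_all)
    also have "(\<Sum>i\<in>B. ext_scalar (?s' * (?s (insert a B) i * ?\<theta> i)) * ext_basis (insert a B - {i})) =
        - (ext_basis {a} * milnor_Q j (ext_basis B :: 'a coh))"
      unfolding right sum_negf[symmetric] by (rule sum.cong[OF refl summand])
    finally show ?thesis by simp
  qed
qed

lemma milnor_Q_mult:
  fixes x y :: "'a::{finite,field} coh"
  assumes parity: "\<And>S. ext_coeff x S \<noteq> 0 \<Longrightarrow> even (card S) \<longleftrightarrow> even d"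
  shows "milnor_Q j (x * y) = milnor_Q j x * y + (-1) ^ d * x * milnor_Q j y"
proof -
  have gen: "milnor_Q j (ext_basis {a} * z) =
      ext_scalar (mvar a ^ (CARD('a) ^ j)) * z - ext_basis {a} * milnor_Q j z" for a and z :: "'a coh"
  proof -
    have z: "z = (\<Sum>B | ext_coeff z B \<noteq> 0. ext_scalar (ext_coeff z B) * ext_basis B)"
      by (rule ext_expansion)
    have mono: "milnor_Q j (ext_basis {a} * (ext_scalar c * ext_basis B)) =
        ext_scalar (mvar a ^ (CARD('a) ^ j)) * (ext_scalar c * ext_basis B) -
        ext_basis {a} * milnor_Q j (ext_scalar c * ext_basis B)" if "finite B" for c :: "'a mpoly" and B
      unfolding mult_scalar_left_commute[of _ c "ext_basis B"] milnor_Q_scalar_mult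
        milnor_Q_basis_cons[OF that] mult_scalar_left_commute[of "ext_basis {a}" c]
      by (simp only: right_diff_distrib)
    have fin: "finite B" if "B \<in> {B. ext_coeff z B \<noteq> 0}" for B
      using that ext_coeff_infinite by blast
    have "(\<Sum>B | ext_coeff z B \<noteq> 0.
          milnor_Q j (ext_basis {a} * (ext_scalar (ext_coeff z B) * ext_basis B))) =
        (\<Sum>B | ext_coeff z B \<noteq> 0.
          ext_scalar (mvar a ^ (CARD('a) ^ j)) * (ext_scalar (ext_coeff z B) * ext_basis B) -
          ext_basis {a} * milnor_Q j (ext_scalar (ext_coeff z B) * ext_basis B))"
      by (rule sum.cong[OF refl], rule mono, rule fin)
    then show ?thesis
      by (simp only: sum_distrib_left[symmetric] milnor_Q_sum[symmetric] sum_subtractf z[symmetric])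
  qed
  have basis: "milnor_Q j (ext_basis A * y) =
      milnor_Q j (ext_basis A) * y + (-1) ^ card A * ext_basis A * milnor_Q j y" if "finite A" for A
    using that
  proof (induction A rule: finite_linorder_min_induct)
    case empty
    then show ?case using milnor_Q_scalar[of j 1] by simp
  next
    case (insert b B)
    have b: "b \<notin> B" using insert.hyps by auto
    have "{k \<in> B. k < b} = {}" using insert.hyps by auto
    then have "ext_sign {b} B = (1 :: 'a mpoly)" by (simp only: ext_sign_singleton) simp
    then have bB: "ext_basis (insert b B) = ext_basis {b} * (ext_basis B :: 'a coh)"
      using insert.hyps b by (subst ext_basis_mult) auto
    have "ext_basis {b} * ((-1) ^ n * z) = (-1) ^ n * (ext_basis {b} * z)" for n and z :: "'a coh"
      by (induction n arbitrary: z) simp_all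
    then show ?case
      unfolding bB using insert.hyps b
      by (simp add: mult.assoc gen insert.IH algebra_simps)
  qed
  have "(-1 :: 'a coh) ^ card A = (-1) ^ d" if "ext_coeff x A \<noteq> 0" for A
    using parity[OF that] by (cases "even d") simp_all
  moreover have "finite A" if "ext_coeff x A \<noteq> 0" for A
    using that ext_coeff_infinite by blast
  ultimately have basis': "milnor_Q j (ext_basis A * y) =
      milnor_Q j (ext_basis A) * y + (-1) ^ d * ext_basis A * milnor_Q j y"
    if "ext_coeff x A \<noteq> 0" for A
    using basis that by metis
  have sgn: "(-1) ^ d * (ext_scalar c * z) = ext_scalar c * ((-1) ^ d * z)" for c and z :: "'a coh"
    by (rule mult_scalar_left_commute)
  have x: "x = (\<Sum>A | ext_coeff x A \<noteq> 0. ext_scalar (ext_coeff x A) * ext_basis A)"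
    by (rule ext_expansion)
  have "milnor_Q j (x * y) =
      (\<Sum>A | ext_coeff x A \<noteq> 0. ext_scalar (ext_coeff x A) * milnor_Q j (ext_basis A * y))"
    by (subst x) (simp only: sum_distrib_right milnor_Q_sum mult.assoc milnor_Q_scalar_mult)
  also have "\<dots> = (\<Sum>A | ext_coeff x A \<noteq> 0. ext_scalar (ext_coeff x A) *
      (milnor_Q j (ext_basis A) * y + (-1) ^ d * ext_basis A * milnor_Q j y))"
    by (intro sum.cong refl) (simp only: basis' mem_Collect_eq not_False_eq_True)
  also have "\<dots> = milnor_Q j (\<Sum>A | ext_coeff x A \<noteq> 0. ext_scalar (ext_coeff x A) * ext_basis A) * y +
      (-1) ^ d * (\<Sum>A | ext_coeff x A \<noteq> 0. ext_scalar (ext_coeff x A) * ext_basis A) * milnor_Q j y"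
    by (simp only: milnor_Q_sum milnor_Q_scalar_mult sum_distrib_right sum_distrib_left sgn
        mult.assoc distrib_left sum.distrib)
  finally show ?thesis by (simp only: flip: x)
qed


subsection \<open>Dickson invariants\<close>

text \<open>
  The indeterminates \<open>y\<^sub>1, \<dots>, y\<^sub>k\<close> are taken among the \<open>t\<^sub>i\<close> and are given by the list
  of their (distinct) indices.
\<close>

definition dickson_e :: "nat list \<Rightarrow> 'a::{finite,field} coh" where
  "dickson_e ys = milnor_Qs {..<length ys} (\<Prod>i\<leftarrow>ys. gen_dt i)"

text \<open>\<open>\<F>\<^sub>p{y\<^sub>1, \<dots>, y\<^sub>k}\<close>, as a finite set of polynomials\<close>

definition lin_forms :: "nat list \<Rightarrow> 'a::comm_ring_1 mpoly set" where
  "lin_forms ys = {\<Sum>i\<in>set ys. mconst (a i) * mvar i | a. True}"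

text \<open>
  The coefficient of \<open>X ^ (p ^ i)\<close> in the product of all \<open>X + y\<close> is \<open>(-1) ^ (k - i) * c\<^sub>k\<^sub>,\<^sub>i\<close>.
\<close>

definition dickson_c :: "nat list \<Rightarrow> nat \<Rightarrow> 'a::{finite,field} coh" where
  "dickson_c ys i = ext_scalar ((-1) ^ (length ys - i) *
     poly.coeff (\<Prod>y\<in>lin_forms ys. [:y, 1:]) (CARD('a) ^ i))"

definition shifted_product :: "nat \<Rightarrow> nat list \<Rightarrow> 'a::{finite,field} coh" where
  "shifted_product i ys = ext_scalar (\<Prod>y\<in>lin_forms ys. mvar i + y)"


subsection \<open>Free modules over polynomial subalgebras\<close>

text \<open>
  The substitution of \<open>xs ! 0, xs ! 1, \<dots>\<close> for the variables of a polynomial; it will be used for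
  lists of pairwise commuting elements only.
\<close>

definition coh_value :: "'a::comm_ring_1 coh list \<Rightarrow> 'a mpoly \<Rightarrow> 'a coh" where
  "coh_value xs P = (\<Sum>m\<in>Poly_Mapping.keys P. ext_scalar (mconst (Poly_Mapping.lookup P m)) *
     (\<Prod>i\<leftarrow>[0..<length xs]. (xs ! i) ^ Poly_Mapping.lookup m i))"

definition generated_subalgebra :: "'a::comm_ring_1 coh list \<Rightarrow> 'a coh set" where
  "generated_subalgebra xs = coh_value xs ` mpolys_in {..<length xs}"

definition alg_independent :: "'a::comm_ring_1 coh list \<Rightarrow> bool" where
  "alg_independent xs \<longleftrightarrow> inj_on (coh_value xs) (mpolys_in {..<length xs})"

definition is_free_module :: "'r::ring_1 set \<Rightarrow> 'r list \<Rightarrow> 'r set \<Rightarrow> bool" where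
  "is_free_module R bs M \<longleftrightarrow>
     M = {\<Sum>i<length bs. c i * bs ! i | c. \<forall>i<length bs. c i \<in> R} \<and>
     (\<forall>c. (\<forall>i<length bs. c i \<in> R) \<and> (\<Sum>i<length bs. c i * bs ! i) = 0 \<longrightarrow>
       (\<forall>i<length bs. c i = 0))"

text \<open>
  \<open>M = \<F>\<^sub>p[xs] \<otimes> \<F>\<^sub>p{bs}\<close>. The basis is a list, hence a family: repetitions are excluded by
  linear independence.
\<close>

definition is_polynomial_tensor :: "'a::comm_ring_1 coh set \<Rightarrow> 'a coh list \<Rightarrow> 'a coh list \<Rightarrow> bool" where
  "is_polynomial_tensor M xs bs \<longleftrightarrow>
     alg_independent xs \<and> is_free_module (generated_subalgebra xs) bs M"

text \<open>All subsets, and all proper subsets, of \<open>{0, \<dots>, k - 1}\<close>, each listed once.\<close>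

definition subsets :: "nat \<Rightarrow> nat set list" where
  "subsets k = map set (subseqs [0..<k])"

definition proper_subsets :: "nat \<Rightarrow> nat set list" where
  "proper_subsets k = filter (\<lambda>I. I \<noteq> {..<k}) (subsets k)"

lemma subsets: "set (subsets k) = Pow {..<k}" "distinct (subsets k)"
  by (simp_all add: subsets_def subseqs_powset distinct_set_subseqs lessThan_atLeast0)


section \<open>The Weyl groups\<close>

definition SL :: "nat \<Rightarrow> 'a::comm_ring_1 mat set" where
  "SL n = {g \<in> carrier_mat n n. det g = 1}"

definition scalar_mat :: "'a::comm_ring_1 \<Rightarrow> 'a mat" where
  "scalar_mat c = c \<cdot>\<^sub>m 1\<^sub>m 1"

definition weyl_3E6 :: "'a::comm_ring_1 mat set" where
  "weyl_3E6 = {four_block_mat (1\<^sub>m 1) m (0\<^sub>m 3 1) g\<^sub>1 | m g\<^sub>1. m \<in> carrier_mat 1 3 \<and> g\<^sub>1 \<in> SL 3}"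

definition weyl_2E7 :: "'a::comm_ring_1 mat set" where
  "weyl_2E7 = {four_block_mat (scalar_mat \<epsilon>\<^sub>1) m (0\<^sub>m 3 1) g\<^sub>1 | \<epsilon>\<^sub>1 m g\<^sub>1.
     \<epsilon>\<^sub>1 \<noteq> 0 \<and> m \<in> carrier_mat 1 3 \<and> g\<^sub>1 \<in> SL 3}"

text \<open>
  With diagonal blocks of sizes 1, 3, 1: the last column, without its last entry \<open>\<epsilon>\<^sub>2\<close>, is
  \<open>m\<^sub>1\<close> on top of a zero block.
\<close>

definition weyl_E8 :: "'a::comm_ring_1 mat set" where
  "weyl_E8 = {four_block_mat
       (four_block_mat (scalar_mat \<epsilon>\<^sub>1) m\<^sub>0 (0\<^sub>m 3 1) g\<^sub>1) (m\<^sub>1 @\<^sub>r 0\<^sub>m 3 1)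
       (0\<^sub>m 1 4) (scalar_mat \<epsilon>\<^sub>2) | \<epsilon>\<^sub>1 \<epsilon>\<^sub>2 m\<^sub>0 m\<^sub>1 g\<^sub>1.
     \<epsilon>\<^sub>1 \<noteq> 0 \<and> \<epsilon>\<^sub>2 \<noteq> 0 \<and> m\<^sub>0 \<in> carrier_mat 1 3 \<and> m\<^sub>1 \<in> carrier_mat 1 1 \<and> g\<^sub>1 \<in> SL 3}"

end

theory Submission
  imports Defs
begin

text \<open>
  Let \<open>q\<close> be the order of the field, a prime. A Weyl group contains \<open>SL\<^sub>3\<close> acting on a block of three of the
  variables, in some cases all translations of \<open>t\<^sub>1\<close> by linear forms in the other variables, and diagonal
  matrices. Invariants are determined in two steps: first those of the polynomial ring, then the ways in
  which an invariant can involve the exterior generators.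

  For the polynomials, the substitution of the claimed generators for the variables is shown to be a
  bijection from a polynomial ring onto the ring of invariants. For the special linear group this is
  Dickson's theorem (\<open>dickson_theorem\<close>). Its proof sets one variable \<open>t\<^sub>a\<close> to zero: invariance under the
  transvections \<open>t\<^sub>i \<mapsto> t\<^sub>i + t\<^sub>a\<close> makes the derivatives of the restricted polynomial with respect
  to the \<open>t\<^sub>i\<close> vanish, so that it is a polynomial in their \<open>q\<close>-th powers and induction applies; an
  invariant that restricts to zero is divisible by \<open>t\<^sub>a\<close>, hence by all linear forms, hence by the
  determinant \<open>e\<close>, which up to sign is the product of one linear form from each line. Translations of \<open>t\<^sub>1\<close>
  contribute the norm of \<open>t\<^sub>1\<close> as a further generator (\<open>adjoin_norm\<close>), and sign changes replace a generator
  by its square (\<open>bij_betw_msubst_square\<close>).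

  For the exterior part, let \<open>u\<close> be the product of the \<open>dt\<^sub>y\<close> over a list of variables \<open>y\<close>. The scalar
  part of \<open>Q\<^sub>J Q\<^sub>I u\<close> is \<open>e\<close> up to sign if \<open>J\<close> is the complement of \<open>I\<close>, and zero otherwise
  (\<open>milnor_pairing\<close>); and an element \<open>z\<close> is determined by the scalar parts of all \<open>Q\<^sub>J z\<close>
  (\<open>milnor_nondegenerate\<close>). By Cramer's rule, \<open>z\<close> is a combination of the \<open>Q\<^sub>I u\<close> with polynomial
  coefficients if \<open>e\<close> divides the scalar parts of all \<open>Q\<^sub>J z\<close> (\<open>milnor_Qs_expansion\<close>). The divisibility is
  tested on one linear form \<open>l\<close> at a time and comes from invariance: if \<open>x = dt\<^sub>i \<alpha> + \<beta>\<close> is fixed by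
  \<open>t\<^sub>i \<mapsto> t\<^sub>i + l\<close>, then \<open>dl \<alpha>\<close> is a multiple of \<open>l\<close> (\<open>transvection_congruence\<close>), and applying Milnor
  operations to this congruence shows that \<open>l\<close> divides the scalar parts of the \<open>Q\<^sub>J \<alpha>\<close>
  (\<open>lin_form_dvd_milnor_Qs\<close>). With transvections inside the block this gives Mui's description of the
  invariants of \<open>SL\<^sub>3\<close> (\<open>mui_expansion\<close>). With the translations of \<open>t\<^sub>1\<close> it shows that the part of an
  invariant that involves \<open>dt\<^sub>1\<close> is a combination of the \<open>Q\<^sub>J\<close> of the full product
  (\<open>translation_expansion\<close>), and the rest is again invariant under \<open>SL\<^sub>3\<close>.

  So the invariants lie in a free module over the whole polynomial ring, on basis elements that the Weyl
  group multiplies by characters. The coefficients of an invariant are semi-invariant for the inverse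
  characters. These semi-invariants are the multiples of one polynomial, a product of some of \<open>t\<^sub>5\<close> and
  the norm of \<open>t\<^sub>1\<close>, according to the variables in which they are odd. Multiplied by these polynomials,
  the basis elements become a basis over the invariant polynomials (\<open>invariants_tensor\<close>).
\<close>

section \<open>Polynomials in several variables\<close>

lemma mconst_uminus: "mconst (- a) = - mconst (a :: 'a::comm_ring_1)"
  by (simp add: mconst_def single_uminus)

lemma mconst_power: "mconst (a ^ k) = mconst (a :: 'a::comm_ring_1) ^ k"
  by (induction k) simp_all

lemma mconst_eq_0_iff [simp]: "mconst a = 0 \<longleftrightarrow> a = (0 :: 'a::comm_ring_1)"
  by (metis mconst_def mconst_hom(1) lookup_single_eq)

lemma mconst_eq_iff [simp]: "mconst a = mconst b \<longleftrightarrow> a = (b :: 'a::comm_ring_1)"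
  by (metis mconst_def lookup_single_eq)

lemma of_nat_mpoly: "of_nat n = mconst (of_nat n :: 'a::comm_ring_1)"
  by (simp add: mconst_def)

lemma CHAR_mpoly: "CHAR('a::comm_ring_1 mpoly) = CHAR('a)"
proof (rule CHAR_eqI)
  have *: "of_nat n = (0 :: 'a mpoly) \<longleftrightarrow> of_nat n = (0::'a)" for n
    by (subst of_nat_mpoly) (rule mconst_eq_0_iff)
  show "of_nat CHAR('a) = (0 :: 'a mpoly)" unfolding * by (rule of_nat_CHAR)
  show "\<And>n. of_nat n = (0 :: 'a mpoly) \<Longrightarrow> CHAR('a) dvd n" unfolding * of_nat_eq_0_iff_char_dvd .
qed

lemma mvar_power: "mvar i ^ k = (Poly_Mapping.single (Poly_Mapping.single i k) 1 :: 'a::comm_ring_1 mpoly)"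
proof (induction k)
  case (Suc k)
  then show ?case by (simp add: mvar_def mult_single single_add[symmetric])
qed simp

lemma mvar_neq_0 [simp]: "mvar i \<noteq> (0 :: 'a::comm_ring_1 mpoly)"
  unfolding mvar_def by (metis keys_single keys_zero insert_not_empty zero_neq_one)

lemma mvar_inj [simp]: "mvar i = (mvar j :: 'a::comm_ring_1 mpoly) \<longleftrightarrow> i = j"
proof
  assume eq: "mvar i = (mvar j :: 'a mpoly)"
  have "Poly_Mapping.single i (1::nat) = Poly_Mapping.single j 1"
    using arg_cong[OF eq, of Poly_Mapping.keys] unfolding mvar_def
    by (metis keys_single singleton_inject zero_neq_one)
  from arg_cong[OF this, of Poly_Mapping.keys] show "i = j"
    by (metis keys_single singleton_inject zero_neq_one)
qed simp

lemma infinite_mpoly: "infinite (UNIV :: 'a::comm_ring_1 mpoly set)"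
proof -
  have "inj (mvar :: nat \<Rightarrow> 'a mpoly)" by (simp add: inj_def)
  from range_inj_infinite[OF this] show ?thesis by (rule infinite_super[rotated]) simp
qed

lemma single_eq_mconst_prod:
  "Poly_Mapping.single m c = mconst c * (\<Prod>i\<in>Poly_Mapping.keys m. mvar i ^ Poly_Mapping.lookup m i)"
proof -
  have prod: "(\<Prod>i\<in>K. mvar i ^ g i) =
      (Poly_Mapping.single (\<Sum>i\<in>K. Poly_Mapping.single i (g i)) 1 :: 'a mpoly)" for K and g :: "nat \<Rightarrow> nat"
    by (induction K rule: infinite_finite_induct) (simp_all add: mvar_power mult_single)
  have m: "(\<Sum>i\<in>Poly_Mapping.keys m. Poly_Mapping.single i (Poly_Mapping.lookup m i)) = m"
    by (rule poly_mapping_eqI) (simp add: lookup_sum lookup_single when_def sum.delta in_keys_iff)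
  show ?thesis by (simp add: prod m mconst_def mult_single)
qed

lemma mpoly_induct [consumes 1, case_names const add var]:
  assumes "f \<in> mpolys_in V"
    and "\<And>c. P (mconst c)" "\<And>f g. P f \<Longrightarrow> P g \<Longrightarrow> P (f + g)"
    and "\<And>f i. i \<in> V \<Longrightarrow> P f \<Longrightarrow> P (f * mvar i)"
  shows "P f"
proof -
  have pow: "P (g * mvar i ^ k)" if "i \<in> V" "P g" for g i k
    by (induction k) (use that assms(4) in \<open>simp_all add: power_Suc2 mult.assoc[symmetric] del: power_Suc\<close>)
  have mono: "P (mconst c * (\<Prod>i\<in>K. mvar i ^ g i))" if "finite K" "K \<subseteq> V" for c K and g :: "nat \<Rightarrow> nat"
    using that
  proof (induction K)
    case (insert j K)
    then show ?case using pow[of j "mconst c * (\<Prod>i\<in>K. mvar i ^ g i)" "g j"]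
      by (simp add: mult_ac)
  qed (use assms(2) in simp)
  have "P (Poly_Mapping.single m (Poly_Mapping.lookup f m))" if "m \<in> Poly_Mapping.keys f" for m
    unfolding single_eq_mconst_prod by (rule mono) (use that assms(1) in \<open>auto simp: mpolys_in_def\<close>)
  moreover have "P (\<Sum>m\<in>M. Poly_Mapping.single m (Poly_Mapping.lookup f m))"
    if "\<And>m. m \<in> M \<Longrightarrow> P (Poly_Mapping.single m (Poly_Mapping.lookup f m))" for M
    using that
  proof (induction M rule: infinite_finite_induct)
    case (insert x F)
    then show ?case using assms(3) by simp
  qed (use assms(2)[of 0] in simp_all)
  ultimately show ?thesis using sum_monomials[of f] by metis
qed

lemma mpolys_in_UNIV [simp]: "f \<in> mpolys_in UNIV"
  by (simp add: mpolys_in_def)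

lemmas mpoly_induct_UNIV = mpoly_induct[OF mpolys_in_UNIV, consumes 0, case_names const add var]

lemma mpolys_in_mono: "f \<in> mpolys_in V \<Longrightarrow> V \<subseteq> W \<Longrightarrow> f \<in> mpolys_in W"
  by (auto simp: mpolys_in_def)

lemma mpolys_in_const [simp]: "mconst c \<in> mpolys_in V"
  by (simp add: mpolys_in_def mconst_def)

lemma mpolys_in_0 [simp]: "0 \<in> mpolys_in V"
  by (simp add: mpolys_in_def)

lemma mpolys_in_1 [simp]: "1 \<in> mpolys_in V"
  using mpolys_in_const[of 1] by simp

lemma mpolys_in_var [simp]: "mvar i \<in> (mpolys_in V :: 'a::comm_ring_1 mpoly set) \<longleftrightarrow> i \<in> V"
  by (simp add: mpolys_in_def mvar_def)

lemma mpolys_in_add: "f \<in> mpolys_in V \<Longrightarrow> g \<in> mpolys_in V \<Longrightarrow> f + g \<in> mpolys_in V"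
  using Poly_Mapping.keys_add[of f g] by (auto simp: mpolys_in_def)

lemma mpolys_in_mult:
  assumes "f \<in> mpolys_in V" "g \<in> mpolys_in V"
  shows "f * g \<in> mpolys_in V"
  unfolding mpolys_in_def
proof (intro CollectI ballI)
  fix m assume "m \<in> Poly_Mapping.keys (f * g)"
  then obtain a b where "a \<in> Poly_Mapping.keys f" "b \<in> Poly_Mapping.keys g" "m = a + b"
    using keys_mult[of f g] by blast
  moreover from this have "Poly_Mapping.keys a \<subseteq> V" "Poly_Mapping.keys b \<subseteq> V"
    using assms by (simp_all add: mpolys_in_def)
  ultimately show "Poly_Mapping.keys m \<subseteq> V"
    using Poly_Mapping.keys_add[of a b] by blast
qed

lemma mpolys_in_uminus: "f \<in> mpolys_in V \<Longrightarrow> - f \<in> mpolys_in V"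
  using mpolys_in_mult[OF mpolys_in_const, of f V "- 1"] by (simp add: mconst_uminus)

lemma mpolys_in_diff: "f \<in> mpolys_in V \<Longrightarrow> g \<in> mpolys_in V \<Longrightarrow> f - g \<in> mpolys_in V"
  using mpolys_in_add[of f V "- g"] mpolys_in_uminus by auto

lemma mpolys_in_sum: "(\<And>i. i \<in> I \<Longrightarrow> f i \<in> mpolys_in V) \<Longrightarrow> sum f I \<in> mpolys_in V"
  by (induction I rule: infinite_finite_induct) (auto intro: mpolys_in_add)

lemma mpolys_in_prod: "(\<And>i. i \<in> I \<Longrightarrow> f i \<in> mpolys_in V) \<Longrightarrow> prod f I \<in> mpolys_in V"
  by (induction I rule: infinite_finite_induct) (auto intro: mpolys_in_mult)

lemma mpolys_in_power: "f \<in> mpolys_in V \<Longrightarrow> f ^ k \<in> mpolys_in V"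
  by (induction k) (auto intro: mpolys_in_mult)

lemmas mpolys_in_intros = mpolys_in_add mpolys_in_mult mpolys_in_uminus mpolys_in_diff mpolys_in_sum
  mpolys_in_prod mpolys_in_power

lemma msubst_cong:
  "P \<in> mpolys_in V \<Longrightarrow> (\<And>i. i \<in> V \<Longrightarrow> f i = g i) \<Longrightarrow> msubst f P = msubst g P"
  unfolding msubst_def mpolys_in_def
  by (intro sum.cong arg_cong2[where f = "(*)"] prod.cong refl arg_cong2[where f = "(^)"]) blast

lemma msubst_uminus: "msubst f (- P) = - msubst f P"
  by (metis add.right_inverse eq_neg_iff_add_eq_0 msubst_0 msubst_add neg_equal_iff_equal add.commute)

lemma msubst_diff: "msubst f (P - Q) = msubst f P - msubst f Q"
  using msubst_add[of f P "- Q"] by (simp add: msubst_uminus)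

lemma msubst_power: "msubst f (P ^ k) = msubst f P ^ k"
  by (induction k) (simp_all add: msubst_mult)

lemma msubst_prod: "msubst f (prod g I) = (\<Prod>i\<in>I. msubst f (g i))"
  by (induction I rule: infinite_finite_induct) (simp_all add: msubst_mult)

lemmas msubst_hom = msubst_add msubst_mult msubst_uminus msubst_diff msubst_power msubst_sum msubst_prod

lemma msubst_in:
  assumes "P \<in> mpolys_in V" "\<And>i. i \<in> V \<Longrightarrow> f i \<in> mpolys_in W"
  shows "msubst f P \<in> mpolys_in W"
  using assms(1) by (induction rule: mpoly_induct) (auto simp: msubst_hom assms(2) intro!: mpolys_in_intros)

lemma msubst_msubst: "msubst f (msubst g P) = msubst (\<lambda>i. msubst f (g i)) P"
  by (induction P rule: mpoly_induct_UNIV) (simp_all add: msubst_hom)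

lemma msubst_id [simp]: "msubst mvar P = P"
  by (induction P rule: mpoly_induct_UNIV) (simp_all add: msubst_hom)

lemma msubst_id_on: "P \<in> mpolys_in V \<Longrightarrow> (\<And>i. i \<in> V \<Longrightarrow> f i = mvar i) \<Longrightarrow> msubst f P = P"
  using msubst_cong[of P V f mvar] by simp

subsection \<open>Polynomials in one variable over the others\<close>

text \<open>
  \<open>P\<close> read as a polynomial in \<open>t\<^sub>c\<close>. This turns divisibility by \<open>t\<^sub>c - s\<close> and degrees in \<open>t\<^sub>c\<close> into
  statements on roots and degrees of polynomials in one variable.
\<close>

definition to_uni :: "nat \<Rightarrow> 'a::comm_ring_1 mpoly \<Rightarrow> 'a mpoly poly" where
  "to_uni c P = (\<Sum>m\<in>Poly_Mapping.keys P. [:mconst (Poly_Mapping.lookup P m):] *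
     (\<Prod>i\<in>Poly_Mapping.keys m. (if i = c then [:0, 1:] else [:mvar i:]) ^ Poly_Mapping.lookup m i))"

lemma to_uni_superset:
  assumes "finite F" "Poly_Mapping.keys P \<subseteq> F"
  shows "to_uni c P = (\<Sum>m\<in>F. [:mconst (Poly_Mapping.lookup P m):] *
     (\<Prod>i\<in>Poly_Mapping.keys m. (if i = c then [:0, 1:] else [:mvar i:]) ^ Poly_Mapping.lookup m i))"
  unfolding to_uni_def by (rule sum.mono_neutral_left) (use assms in \<open>auto simp: in_keys_iff\<close>)

lemma to_uni_add: "to_uni c (P + Q) = to_uni c P + to_uni c Q"
  using to_uni_superset[of "Poly_Mapping.keys P \<union> Poly_Mapping.keys Q" P c]
    to_uni_superset[of "Poly_Mapping.keys P \<union> Poly_Mapping.keys Q" Q c]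
    to_uni_superset[of "Poly_Mapping.keys P \<union> Poly_Mapping.keys Q" "P + Q" c]
    Poly_Mapping.keys_add[of P Q]
  by (simp add: lookup_add sum.distrib smult_add_left)

lemma to_uni_0 [simp]: "to_uni c 0 = 0"
  by (simp add: to_uni_def)

lemma to_uni_sum: "to_uni c (sum g I) = (\<Sum>i\<in>I. to_uni c (g i))"
  by (induction I rule: infinite_finite_induct) (simp_all add: to_uni_add)

lemma to_uni_single: "to_uni c (Poly_Mapping.single m a) = [:mconst a:] *
    (\<Prod>i\<in>Poly_Mapping.keys m. (if i = c then [:0, 1:] else [:mvar i:]) ^ Poly_Mapping.lookup m i)"
  by (subst to_uni_superset[of "{m}"]) auto

lemma to_uni_const [simp]: "to_uni c (mconst a) = [:mconst a:]"
  by (simp add: mconst_def to_uni_single)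

lemma to_uni_mult: "to_uni c (P * Q) = to_uni c P * to_uni c Q"
proof -
  let ?f = "\<lambda>i. if i = c then [:0, 1:] else [:mvar i:] :: 'a mpoly poly"
  have prod: "(\<Prod>i\<in>Poly_Mapping.keys m. ?f i ^ Poly_Mapping.lookup m i) =
      (\<Prod>i\<in>K. ?f i ^ Poly_Mapping.lookup m i)"
    if "finite K" "Poly_Mapping.keys m \<subseteq> K" for m K
    by (rule prod.mono_neutral_left) (use that in \<open>auto simp: in_keys_iff\<close>)
  have *: "to_uni c (Poly_Mapping.single m a * Poly_Mapping.single k b) =
      to_uni c (Poly_Mapping.single m a) * to_uni c (Poly_Mapping.single k b)" for m k and a b :: 'a
  proof -
    let ?K = "Poly_Mapping.keys m \<union> Poly_Mapping.keys k"
    have 1: "(\<Prod>i\<in>Poly_Mapping.keys (m + k). ?f i ^ Poly_Mapping.lookup (m + k) i) =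
        (\<Prod>i\<in>?K. ?f i ^ Poly_Mapping.lookup m i) * (\<Prod>i\<in>?K. ?f i ^ Poly_Mapping.lookup k i)"
      unfolding prod[OF finite_UnI[OF finite_keys finite_keys] Poly_Mapping.keys_add[of m k]]
      by (simp only: lookup_add power_add prod.distrib)
    have 2: "(\<Prod>i\<in>Poly_Mapping.keys m. ?f i ^ Poly_Mapping.lookup m i) = (\<Prod>i\<in>?K. ?f i ^ Poly_Mapping.lookup m i)"
      "(\<Prod>i\<in>Poly_Mapping.keys k. ?f i ^ Poly_Mapping.lookup k i) = (\<Prod>i\<in>?K. ?f i ^ Poly_Mapping.lookup k i)"
      by (rule prod; simp)+
    have 3: "[:mconst (a * b):] = [:mconst a:] * [:mconst b:]" by simp
    show ?thesis
      unfolding mult_single to_uni_single 1 2 3 by (simp only: mult_ac)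
  qed
  have "to_uni c (P * Q) = to_uni c
      ((\<Sum>m\<in>Poly_Mapping.keys P. Poly_Mapping.single m (Poly_Mapping.lookup P m)) *
       (\<Sum>k\<in>Poly_Mapping.keys Q. Poly_Mapping.single k (Poly_Mapping.lookup Q k)))"
    using sum_monomials[of P] sum_monomials[of Q] by simp
  also have "\<dots> =
      (\<Sum>m\<in>Poly_Mapping.keys P. to_uni c (Poly_Mapping.single m (Poly_Mapping.lookup P m))) *
      (\<Sum>k\<in>Poly_Mapping.keys Q. to_uni c (Poly_Mapping.single k (Poly_Mapping.lookup Q k)))"
    by (simp add: sum_product to_uni_sum *)
  also have "\<dots> = to_uni c P * to_uni c Q"
    using sum_monomials[of P] sum_monomials[of Q] by (simp flip: to_uni_sum)
  finally show ?thesis .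
qed

lemma to_uni_var: "to_uni c (mvar i) = (if i = c then [:0, 1:] else [:mvar i:])"
  by (simp add: mvar_def to_uni_single)

lemma to_uni_1 [simp]: "to_uni c 1 = 1"
  using to_uni_const[of c 1] by (simp add: one_pCons)

lemma to_uni_power: "to_uni c (P ^ k) = to_uni c P ^ k"
  by (induction k) (simp_all add: to_uni_mult)

lemma to_uni_uminus: "to_uni c (- P) = - to_uni c P"
  by (metis add.right_inverse eq_neg_iff_add_eq_0 to_uni_0 to_uni_add neg_equal_iff_equal add.commute)

lemma to_uni_diff: "to_uni c (P - Q) = to_uni c P - to_uni c Q"
  using to_uni_add[of c P "- Q"] by (simp add: to_uni_uminus)

lemmas to_uni_hom = to_uni_add to_uni_mult to_uni_uminus to_uni_diff to_uni_power to_uni_sum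

lemma poly_to_uni: "poly (to_uni c P) s = msubst (mvar(c := s)) P"
  by (induction P rule: mpoly_induct_UNIV) (simp_all add: to_uni_hom msubst_hom to_uni_var)

lemma poly_to_uni_var [simp]: "poly (to_uni c P) (mvar c) = P"
proof -
  have "mvar(c := mvar c) = (mvar :: nat \<Rightarrow> 'a mpoly)" by auto
  then show ?thesis by (simp add: poly_to_uni)
qed

lemma to_uni_eq_0_iff [simp]: "to_uni c P = 0 \<longleftrightarrow> P = 0"
  by (metis poly_0 poly_to_uni_var to_uni_0)

lemma to_uni_free: "P \<in> mpolys_in V \<Longrightarrow> c \<notin> V \<Longrightarrow> to_uni c P = [:P:]"
  by (induction P rule: mpoly_induct) (auto simp: to_uni_hom to_uni_var)

lemma coeff_to_uni_in: "P \<in> mpolys_in V \<Longrightarrow> coeff (to_uni c P) k \<in> mpolys_in (V - {c})"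
proof (induction arbitrary: k rule: mpoly_induct)
  case (const a)
  then show ?case by (cases k) simp_all
next
  case (add f g)
  then show ?case by (simp add: to_uni_hom mpolys_in_add)
next
  case (var f i)
  then show ?case
    by (cases k) (auto simp: to_uni_hom to_uni_var coeff_pCons intro!: mpolys_in_mult)
qed

lemma to_uni_poly:
  assumes "\<And>k. coeff p k \<in> mpolys_in (- {c})"
  shows "to_uni c (poly p (mvar c)) = p"
proof -
  have "to_uni c (poly p (mvar c)) = (\<Sum>i\<le>degree p. [:coeff p i:] * [:0, 1:] ^ i)"
    unfolding poly_altdef
    by (simp add: to_uni_hom to_uni_var to_uni_free[OF assms])
  also have "\<dots> = (\<Sum>i\<le>degree p. monom (coeff p i) i)"
    by (simp add: monom_altdef)
  finally show ?thesis by (simp add: poly_as_sum_of_monoms)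
qed

lemma dvd_diff_msubst: "(mvar c - s) dvd P - msubst (mvar(c := s)) P"
proof -
  let ?p = "to_uni c P"
  have "poly (?p - [:poly ?p s:]) s = 0" by simp
  then obtain r where "?p - [:poly ?p s:] = [:- s, 1:] * r"
    by (metis dvd_def poly_eq_0_iff_dvd)
  then have "poly (?p - [:poly ?p s:]) (mvar c) = poly ([:- s, 1:] * r) (mvar c)" by simp
  then have "P - msubst (mvar(c := s)) P = (mvar c - s) * poly r (mvar c)"
    by (simp add: poly_to_uni algebra_simps)
  then show ?thesis by simp
qed

lemma dvd_iff_msubst_eq_0:
  fixes P :: "'a::comm_ring_1 mpoly"
  assumes "s \<in> mpolys_in (- {c})"
  shows "(mvar c - s) dvd P \<longleftrightarrow> msubst (mvar(c := s)) P = 0"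
proof
  assume "(mvar c - s) dvd P"
  then obtain r where "P = (mvar c - s) * r" by (elim dvdE)
  moreover have "msubst (mvar(c := s)) s = s" by (rule msubst_id_on[OF assms]) auto
  ultimately show "msubst (mvar(c := s)) P = 0" by (simp add: msubst_hom)
next
  assume "msubst (mvar(c := s)) P = 0"
  then show "(mvar c - s) dvd P" using dvd_diff_msubst[of c s P] by simp
qed

lemma prime_elem_linear:
  assumes "s \<in> mpolys_in (- {c})"
  shows "prime_elem (mvar c - s :: 'a::idom mpoly)"
proof (rule prime_elemI)
  show "mvar c - s \<noteq> 0" using assms by auto
  show "\<not> (mvar c - s) dvd 1" by (simp add: dvd_iff_msubst_eq_0[OF assms])
qed (simp add: dvd_iff_msubst_eq_0[OF assms] msubst_hom)

text \<open>
  Pairwise non-associated primes that divide \<open>f\<close> can be split off one after the other.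
\<close>

lemma prod_primes_dvd:
  fixes f :: "'b::idom"
  assumes "finite A" "\<And>a. a \<in> A \<Longrightarrow> prime_elem (g a)" "\<And>a. a \<in> A \<Longrightarrow> g a dvd f"
    and "\<And>a b. a \<in> A \<Longrightarrow> b \<in> A \<Longrightarrow> g a dvd g b \<Longrightarrow> a = b"
  shows "prod g A dvd f"
  using assms
proof (induction A)
  case (insert a A)
  then have "prod g A dvd f" by blast
  then obtain r where r: "f = prod g A * r" by (elim dvdE)
  have "\<not> g a dvd prod g A"
  proof
    assume "g a dvd prod g A"
    with insert.hyps(1) have "\<exists>b\<in>A. g a dvd g b"
      using insert.prems(1)[of a] insert.prems(1)
      by (induction A rule: finite_induct) (auto simp: prime_elem_dvd_mult_iff dest: prime_elem_not_unit)
    then obtain b where "b \<in> A" "g a dvd g b" by blast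
    then show False using insert.hyps insert.prems(3)[of a b] by auto
  qed
  moreover have "g a dvd prod g A * r" using insert.prems(2) r by auto
  ultimately have "g a dvd r" using insert.prems(1) prime_elem_dvd_multD by blast
  then show ?case using insert.hyps r by (simp add: mult.commute mult_dvd_mono)
qed simp

subsection \<open>Replacing variables by powers\<close>

text \<open>
  The substitution \<open>t\<^sub>i \<mapsto> t\<^sub>i ^ k\<close> for \<open>i\<close> in \<open>A\<close>. For \<open>k = q\<close> it commutes with the linear substitutions
  of the variables in \<open>A\<close> over the field with \<open>q\<close> elements.
\<close>

definition var_powers :: "nat set \<Rightarrow> nat \<Rightarrow> 'a::comm_ring_1 mpoly \<Rightarrow> 'a mpoly" where
  "var_powers A k = msubst (\<lambda>i. if i \<in> A then mvar i ^ k else mvar i)"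

lift_definition scale_exps :: "nat set \<Rightarrow> nat \<Rightarrow> (nat \<Rightarrow>\<^sub>0 nat) \<Rightarrow> (nat \<Rightarrow>\<^sub>0 nat)"
  is "\<lambda>A k m i. if i \<in> A then k * m i else m i"
  by (rule finite_subset) auto

lemma var_powers_single:
  "var_powers A k (Poly_Mapping.single m c) = Poly_Mapping.single (scale_exps A k m) c"
proof -
  let ?e = "\<lambda>i. if i \<in> A then k * Poly_Mapping.lookup m i else Poly_Mapping.lookup m i"
  have "var_powers A k (Poly_Mapping.single m c) =
      mconst c * (\<Prod>i\<in>Poly_Mapping.keys m. mvar i ^ ?e i)"
    unfolding var_powers_def msubst_single by (intro arg_cong2[where f = "(*)"] prod.cong) (auto simp: power_mult)
  also have "(\<Prod>i\<in>Poly_Mapping.keys m. mvar i ^ ?e i) =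
      (\<Prod>i\<in>Poly_Mapping.keys (scale_exps A k m). mvar i ^ Poly_Mapping.lookup (scale_exps A k m) i)"
    by (rule prod.mono_neutral_cong_right) (auto simp: in_keys_iff scale_exps.rep_eq split: if_splits)
  finally show ?thesis by (simp flip: single_eq_mconst_prod)
qed

lemma scale_exps_inj: "k > 0 \<Longrightarrow> scale_exps A k m = scale_exps A k m' \<Longrightarrow> m = m'"
  by (rule poly_mapping_eqI) (metis (full_types) scale_exps.rep_eq mult_cancel1 less_irrefl)

lemma lookup_var_powers:
  assumes "k > 0"
  shows "Poly_Mapping.lookup (var_powers A k P) (scale_exps A k m) = Poly_Mapping.lookup P m"
proof -
  have "var_powers A k P = var_powers A k
      (\<Sum>m\<in>Poly_Mapping.keys P. Poly_Mapping.single m (Poly_Mapping.lookup P m))"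
    using sum_monomials[of P] by simp
  also have "\<dots> = (\<Sum>m\<in>Poly_Mapping.keys P.
      Poly_Mapping.single (scale_exps A k m) (Poly_Mapping.lookup P m))"
    by (simp add: var_powers_def msubst_sum flip: var_powers_single)
  also have "Poly_Mapping.lookup \<dots> (scale_exps A k m) =
      (\<Sum>m'\<in>Poly_Mapping.keys P. if m' = m then Poly_Mapping.lookup P m else 0)"
    unfolding lookup_sum using scale_exps_inj[OF assms]
    by (intro sum.cong) (auto simp: lookup_single when_def)
  also have "\<dots> = Poly_Mapping.lookup P m" by (simp add: in_keys_iff)
  finally show ?thesis .
qed

lemma var_powers_inj: "k > 0 \<Longrightarrow> var_powers A k P = var_powers A k Q \<Longrightarrow> P = Q"
  by (rule poly_mapping_eqI) (metis lookup_var_powers)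

lemma var_powersE:
  assumes "P \<in> mpolys_in V" "k > 0"
    and "\<And>m i. m \<in> Poly_Mapping.keys P \<Longrightarrow> i \<in> A \<Longrightarrow> k dvd Poly_Mapping.lookup m i"
  obtains Q where "Q \<in> mpolys_in V" "P = var_powers A k Q"
    "\<And>m. m \<in> Poly_Mapping.keys Q \<Longrightarrow> scale_exps A k m \<in> Poly_Mapping.keys P"
proof -
  define d where "d m = Abs_poly_mapping (\<lambda>i. if i \<in> A then Poly_Mapping.lookup m i div k else Poly_Mapping.lookup m i)"
    for m :: "nat \<Rightarrow>\<^sub>0 nat"
  have d: "Poly_Mapping.lookup (d m) i =
      (if i \<in> A then Poly_Mapping.lookup m i div k else Poly_Mapping.lookup m i)" for m i
    unfolding d_def by (subst lookup_Abs_poly_mapping)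
      (auto intro: finite_subset[OF _ finite_keys[of m]] simp: in_keys_iff)
  define Q where "Q = (\<Sum>m\<in>Poly_Mapping.keys P. Poly_Mapping.single (d m) (Poly_Mapping.lookup P m))"
  have scale: "scale_exps A k (d m) = m" if "m \<in> Poly_Mapping.keys P" for m
    by (rule poly_mapping_eqI) (use assms(3)[OF that] in \<open>simp add: scale_exps.rep_eq d\<close>)
  have "var_powers A k Q = (\<Sum>m\<in>Poly_Mapping.keys P. Poly_Mapping.single m (Poly_Mapping.lookup P m))"
    unfolding Q_def by (simp add: var_powers_def msubst_sum)
      (simp add: var_powers_single[unfolded var_powers_def] scale)
  then have P: "P = var_powers A k Q" by (simp flip: sum_monomials)
  have "Poly_Mapping.keys (d m) \<subseteq> V" if "m \<in> Poly_Mapping.keys P" for m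
  proof
    fix i assume "i \<in> Poly_Mapping.keys (d m)"
    then have "i \<in> Poly_Mapping.keys m" by (cases "i \<in> A") (auto simp: in_keys_iff d intro!: Nat.gr0I)
    then show "i \<in> V" using assms(1) that by (auto simp: mpolys_in_def)
  qed
  then have "Q \<in> mpolys_in V"
    unfolding Q_def by (intro mpolys_in_sum) (auto simp: mpolys_in_def)
  moreover have "scale_exps A k m \<in> Poly_Mapping.keys P" if "m \<in> Poly_Mapping.keys Q" for m
    using that lookup_var_powers[OF assms(2), of A Q m] P by (simp add: in_keys_iff)
  ultimately show ?thesis using that P by blast
qed

section \<open>Products over linear forms\<close>

subsection \<open>The Frobenius map\<close>

text \<open>
  The formal parameter only makes the field \<open>'a\<close> a parameter of the locale.
\<close>

locale prime_order =
  fixes ty :: "'a::{finite,field} itself"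
  assumes prime_card: "prime CARD('a)"
begin

lemma of_nat_card: "of_nat CARD('a) = (0 :: 'a)"
proof -
  have "(\<Sum>x::'a\<in>UNIV. x) = (\<Sum>x::'a\<in>UNIV. x + 1)"
    by (rule sum.reindex_bij_witness[of _ "\<lambda>x. x + 1" "\<lambda>x. x - 1"]) auto
  then show ?thesis by (simp add: sum.distrib)
qed

lemma CHAR_card: "CHAR('a) = CARD('a)"
proof -
  have "CHAR('a) dvd CARD('a)" using of_nat_card by (simp add: of_nat_eq_0_iff_char_dvd)
  moreover have "CHAR('a) \<noteq> 1" by (metis of_nat_1 of_nat_eq_0_iff_char_dvd one_dvd zero_neq_one)
  ultimately show ?thesis using prime_card prime_nat_iff by blast
qed

lemma card_gt_1: "CARD('a) > 1"
  using prime_card prime_gt_1_nat by blast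

lemma card_pos [simp]: "CARD('a) > 0"
  using card_gt_1 by linarith

lemma power_card: "x ^ CARD('a) = (x :: 'a)"
proof (cases "x = 0")
  case False
  have "x * (\<Prod>y\<in>UNIV-{0}. x * y) = x * x ^ (CARD('a) - 1) * \<Prod>(UNIV-{0::'a})"
    by (simp add: prod.distrib mult_ac card_Diff_singleton)
  also have "x * x ^ (CARD('a) - 1) = x ^ CARD('a)"
    using card_pos by (metis power_Suc Suc_diff_1)
  also have "(\<Prod>y\<in>UNIV-{0}. x * y) = (\<Prod>y\<in>UNIV-{0}. y)"
    by (rule prod.reindex_bij_witness[of _ "\<lambda>y. y / x" "\<lambda>y. x * y"]) (use False in auto)
  finally show ?thesis by simp
qed (use card_gt_1 in simp)

lemma power_card_minus_1: "x \<noteq> 0 \<Longrightarrow> x ^ (CARD('a) - 1) = (1 :: 'a)"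
  using power_card[of x] card_pos by (metis power_Suc Suc_diff_1 mult_cancel_left2)

lemma power_card_power: "x ^ (CARD('a) ^ k) = (x :: 'a)"
  by (induction k) (simp_all add: power_card power_mult)

lemma mconst_power_card: "mconst (x :: 'a) ^ (CARD('a) ^ k) = mconst x"
  by (metis mconst_power power_card_power)

lemma frob_add: "(x + y) ^ (CARD('a) ^ k) = x ^ (CARD('a) ^ k) + (y :: 'a mpoly) ^ (CARD('a) ^ k)"
  by (rule freshmans_dream') (simp_all add: CHAR_mpoly CHAR_card prime_card)

lemma frob_sum: "sum f A ^ (CARD('a) ^ k) = (\<Sum>i\<in>A. (f i :: 'a mpoly) ^ (CARD('a) ^ k))"
  by (rule freshmans_dream_sum') (simp_all add: CHAR_mpoly CHAR_card prime_card)

lemma frob_linear_form: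
  "(\<Sum>j\<in>A. mconst (c j) * (f j :: 'a mpoly)) ^ (CARD('a) ^ k) = (\<Sum>j\<in>A. mconst (c j) * f j ^ (CARD('a) ^ k))"
  by (simp add: frob_sum power_mult_distrib mconst_power_card)

lemma frob_eq_var_powers:
  "f \<in> mpolys_in A \<Longrightarrow> f ^ CARD('a) = var_powers A CARD('a) (f :: 'a mpoly)"
proof (induction rule: mpoly_induct)
  case (const c)
  then show ?case using mconst_power_card[of c 1] by (simp add: var_powers_def)
next
  case (add f g)
  then show ?case using frob_add[of f g 1] by (simp add: var_powers_def msubst_hom)
qed (simp add: var_powers_def msubst_hom power_mult_distrib)

text \<open>
  As a polynomial in \<open>A\<close>, the right-hand side is monic of degree \<open>q\<close> and vanishes at the
  \<open>q\<close> points \<open>- c B\<close>.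
\<close>

lemma prod_translates:
  "(\<Prod>c\<in>UNIV. A + mconst c * B) = A ^ CARD('a) - B ^ (CARD('a) - 1) * (A :: 'a mpoly)"
proof (cases "B = 0")
  case True
  then show ?thesis using card_gt_1 by simp
next
  case False
  let ?q = "CARD('a)"
  let ?l = "\<Prod>c\<in>UNIV. [:mconst c * B, 1:]" and ?r = "monom 1 ?q - monom (B ^ (?q - 1)) 1 :: 'a mpoly poly"
  have degl: "degree ?l = ?q" by (subst degree_prod_eq_sum_degree) auto
  have degr: "degree ?r = ?q"
  proof -
    have "degree (- monom (B ^ (?q - 1)) 1) < degree (monom (1 :: 'a mpoly) ?q)"
      using card_gt_1 degree_monom_le[of "B ^ (?q - 1)" 1] by (simp add: degree_monom_eq)
    from degree_add_eq_left[OF this] show ?thesis by (simp add: degree_monom_eq)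
  qed
  have coeff: "poly.coeff ?l ?q = poly.coeff ?r ?q"
  proof -
    have "lead_coeff ?l = 1" by (simp add: lead_coeff_prod)
    then show ?thesis using card_gt_1 degl by simp
  qed
  have inj: "inj (\<lambda>c. - (mconst c * B))" using False by (auto simp: inj_def)
  have "?l = ?r"
  proof (rule poly_eqI_degree_lead_coeff[OF coeff, of "range (\<lambda>c. - (mconst c * B))"])
    show "card (range (\<lambda>c. - (mconst c * B))) \<ge> ?q" using card_image[OF inj] by simp
    fix z assume "z \<in> range (\<lambda>c. - (mconst c * B))"
    then obtain c where z: "z = mconst (- c) * B" by (auto simp: mconst_uminus)
    have "poly ?l z = 0" using z by (simp add: poly_prod prod_zero_iff) (metis mconst_uminus mult_minus_left neg_eq_iff_add_eq_0)
    moreover have "z ^ ?q = B ^ (?q - 1) * z"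
    proof -
      have "z ^ ?q = mconst (- c) * B ^ ?q"
        using mconst_power_card[of "- c" 1] by (simp add: z power_mult_distrib)
      also have "B ^ ?q = B ^ (?q - 1) * B" by (metis card_pos power_minus_mult)
      finally show ?thesis using z by (simp add: mult_ac)
    qed
    ultimately show "poly ?l z = poly ?r z" by (simp add: poly_monom)
  qed (use degl degr in auto)
  then have "poly ?l A = poly ?r A" by simp
  then show ?thesis by (simp add: poly_prod poly_monom add.commute)
qed

end

subsection \<open>Linear forms\<close>

lemma lin_forms_in: "v \<in> lin_forms ys \<Longrightarrow> v \<in> mpolys_in (set ys)"
  by (auto simp: lin_forms_def intro!: mpolys_in_intros)

lemma lin_forms_cong: "set ys = set zs \<Longrightarrow> lin_forms ys = lin_forms zs"
  by (simp add: lin_forms_def)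

lemma lin_formsI: "(\<Sum>i\<in>set ys. mconst (a i) * mvar i) \<in> lin_forms ys"
  by (auto simp: lin_forms_def)

lemma lin_forms_0 [simp]: "0 \<in> lin_forms ys"
  using lin_formsI[of "\<lambda>_. 0" ys] by simp

lemma lin_forms_add: "u \<in> lin_forms ys \<Longrightarrow> v \<in> lin_forms ys \<Longrightarrow> u + v \<in> lin_forms ys"
proof -
  assume "u \<in> lin_forms ys" "v \<in> lin_forms ys"
  then obtain a b where "u = (\<Sum>i\<in>set ys. mconst (a i) * mvar i)" "v = (\<Sum>i\<in>set ys. mconst (b i) * mvar i)"
    by (auto simp: lin_forms_def)
  then have "u + v = (\<Sum>i\<in>set ys. mconst (a i + b i) * mvar i)"
    by (simp add: sum.distrib algebra_simps)
  then show ?thesis by (simp only: lin_formsI)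
qed

lemma lin_forms_scale: "u \<in> lin_forms ys \<Longrightarrow> mconst c * u \<in> lin_forms ys"
proof -
  assume "u \<in> lin_forms ys"
  then obtain a where "u = (\<Sum>i\<in>set ys. mconst (a i) * mvar i)"
    by (auto simp: lin_forms_def)
  then have "mconst c * u = (\<Sum>i\<in>set ys. mconst (c * a i) * mvar i)"
    by (simp add: sum_distrib_left algebra_simps)
  then show ?thesis by (simp only: lin_formsI)
qed

lemma lin_forms_uminus: "u \<in> lin_forms ys \<Longrightarrow> - u \<in> lin_forms ys"
  using lin_forms_scale[of u ys "- 1"] by (simp add: mconst_uminus)

lemma lin_forms_sum: "(\<And>i. i \<in> I \<Longrightarrow> f i \<in> lin_forms ys) \<Longrightarrow> sum f I \<in> lin_forms ys"
  by (induction I rule: infinite_finite_induct) (auto intro: lin_forms_add)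

lemma lin_forms_var: "i \<in> set ys \<Longrightarrow> (mvar i :: 'a::comm_ring_1 mpoly) \<in> lin_forms ys"
proof -
  assume i: "i \<in> set ys"
  have "mconst (if j = i then 1 else 0) * mvar j = (if j = i then mvar i else 0 :: 'a mpoly)" for j
    by (cases "j = i") simp_all
  then have "(\<Sum>j\<in>set ys. mconst (if j = i then 1 else 0) * mvar j) =
      (\<Sum>j\<in>set ys. if j = i then mvar i else 0 :: 'a mpoly)" by (rule sum.cong[OF refl])
  also have "\<dots> = mvar i" using i by (simp only: sum.delta finite_set if_True)
  finally show ?thesis using lin_formsI[of "\<lambda>j. if j = i then 1 else 0 :: 'a" ys] by (simp only:)
qed

lemma lin_forms_mono: "set ys \<subseteq> set zs \<Longrightarrow> lin_forms ys \<subseteq> lin_forms zs"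
  by (auto simp: lin_forms_def[of ys] intro!: lin_forms_sum lin_forms_scale lin_forms_var)

lemma lin_forms_Nil [simp]: "lin_forms [] = {0}"
  by (auto simp: lin_forms_def)

lemma lin_forms_Cons:
  assumes "z \<notin> set ys"
  shows "bij_betw (\<lambda>(c, v). mconst c * mvar z + v) (UNIV \<times> lin_forms ys)
    (lin_forms (z # ys) :: 'a::comm_ring_1 mpoly set)"
proof (rule bij_betw_imageI)
  have free: "msubst (mvar(z := s)) v = v" if "v \<in> lin_forms ys" for v :: "'a mpoly" and s
    using lin_forms_in[OF that] assms by (intro msubst_id_on[of v "set ys"]) auto
  show "inj_on (\<lambda>(c, v). mconst c * mvar z + v) (UNIV \<times> lin_forms ys :: ('a \<times> 'a mpoly) set)"
  proof (rule inj_onI; clarify)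
    fix c d :: 'a and u v :: "'a mpoly"
    assume uv: "u \<in> lin_forms ys" "v \<in> lin_forms ys" and eq: "mconst c * mvar z + u = mconst d * mvar z + v"
    from arg_cong[OF eq, of "msubst (mvar(z := 0))"] have [simp]: "u = v"
      by (simp add: msubst_hom free[OF uv(1)] free[OF uv(2)])
    from arg_cong[OF eq, of "msubst (mvar(z := 1))"] have "mconst c = mconst d"
      by (simp add: msubst_hom free[OF uv(2)])
    then show "c = d \<and> u = v" by simp
  qed
  show "(\<lambda>(c, v). mconst c * mvar z + v) ` (UNIV \<times> lin_forms ys) = (lin_forms (z # ys) :: 'a mpoly set)"
  proof (intro equalityI subsetI)
    fix u :: "'a mpoly" assume "u \<in> (\<lambda>(c, v). mconst c * mvar z + v) ` (UNIV \<times> lin_forms ys)"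
    then show "u \<in> lin_forms (z # ys)"
      using lin_forms_mono[of ys "z # ys"] by (auto intro!: lin_forms_add lin_forms_scale lin_forms_var)
  next
    fix u :: "'a mpoly" assume "u \<in> lin_forms (z # ys)"
    then obtain a where "u = (\<Sum>i\<in>set (z # ys). mconst (a i) * mvar i)" by (auto simp: lin_forms_def)
    then have "u = mconst (a z) * mvar z + (\<Sum>i\<in>set ys. mconst (a i) * mvar i)" using assms by simp
    then show "u \<in> (\<lambda>(c, v). mconst c * mvar z + v) ` (UNIV \<times> lin_forms ys)"
      using lin_formsI[of a ys] by (auto intro!: image_eqI[of _ _ "(a z, \<Sum>i\<in>set ys. mconst (a i) * mvar i)"])
  qed
qed

lemma finite_lin_forms [simp]: "finite (lin_forms ys :: 'a::{finite,comm_ring_1} mpoly set)"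
proof -
  have "finite ((\<lambda>a. \<Sum>i\<in>set ys. mconst (a i) * mvar i) ` (PiE (set ys) (\<lambda>_. UNIV :: 'a set)) :: 'a mpoly set)"
    by (intro finite_imageI finite_PiE) simp_all
  moreover have "lin_forms ys \<subseteq> (\<lambda>a. \<Sum>i\<in>set ys. mconst (a i) * mvar i) ` (PiE (set ys) (\<lambda>_. UNIV :: 'a set))"
  proof
    fix u :: "'a mpoly" assume "u \<in> lin_forms ys"
    then obtain a where "u = (\<Sum>i\<in>set ys. mconst (a i) * mvar i)" by (auto simp: lin_forms_def)
    then have "u = (\<Sum>i\<in>set ys. mconst (restrict a (set ys) i) * mvar i)" by simp
    moreover have "restrict a (set ys) \<in> PiE (set ys) (\<lambda>_. UNIV :: 'a set)" by simp
    ultimately show "u \<in> (\<lambda>a. \<Sum>i\<in>set ys. mconst (a i) * mvar i) ` (PiE (set ys) (\<lambda>_. UNIV :: 'a set))"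
      by (rule image_eqI)
  qed
  ultimately show ?thesis by (rule finite_subset[rotated])
qed

lemma card_lin_forms:
  "distinct ys \<Longrightarrow> card (lin_forms ys :: 'a::{finite,comm_ring_1} mpoly set) = CARD('a) ^ length ys"
proof (induction ys)
  case (Cons z ys)
  then show ?case
    using bij_betw_same_card[OF lin_forms_Cons[of z ys, where 'a = 'a]] by (simp add: card_cartesian_product)
qed simp

subsection \<open>The Dickson polynomial\<close>

definition dickson_poly :: "nat list \<Rightarrow> 'a::{finite,comm_ring_1} mpoly poly" where
  "dickson_poly ys = (\<Prod>y\<in>lin_forms ys. [:y, 1:])"

lemma dickson_poly_cong: "set ys = set zs \<Longrightarrow> dickson_poly ys = dickson_poly zs"
  by (simp add: dickson_poly_def lin_forms_cong[of ys zs])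

lemma poly_dickson_poly: "poly (dickson_poly ys) x = (\<Prod>y\<in>lin_forms ys. x + y)"
  by (simp add: dickson_poly_def poly_prod add.commute)

lemma smult_sum_right: "smult c (sum f A) = (\<Sum>i\<in>A. smult c (f i))"
  by (induction A rule: infinite_finite_induct) (simp_all add: smult_add_right)

lemma poly_eqI_infinite:
  fixes p q :: "'b::idom poly"
  assumes "infinite (UNIV :: 'b set)" "\<And>x. poly p x = poly q x"
  shows "p = q"
proof (rule ccontr)
  assume "p \<noteq> q"
  then have "finite {x. poly (p - q) x = 0}" by (intro poly_roots_finite) simp
  then show False using assms by simp
qed

lemma poly_dickson_poly_eq_0_iff:
  "poly (dickson_poly ys) x = 0 \<longleftrightarrow> x \<in> (lin_forms ys :: 'a::{finite,idom} mpoly set)"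
proof
  assume "poly (dickson_poly ys) x = 0"
  then obtain y where "y \<in> lin_forms ys" "x + y = 0" by (auto simp: poly_dickson_poly prod_zero_iff)
  then show "x \<in> lin_forms ys" using lin_forms_uminus[of y ys] by (simp add: eq_neg_iff_add_eq_0[symmetric])
next
  assume "x \<in> lin_forms ys"
  then have "- x \<in> lin_forms ys" by (rule lin_forms_uminus)
  then show "poly (dickson_poly ys) x = 0" by (auto simp: poly_dickson_poly prod_zero_iff intro!: bexI[of _ "- x"])
qed

lemma coeff_prod_in:
  assumes "\<And>y k. y \<in> A \<Longrightarrow> poly.coeff (f y) k \<in> mpolys_in V"
  shows "poly.coeff (prod f A) k \<in> mpolys_in V"
  using assms
proof (induction A arbitrary: k rule: infinite_finite_induct)
  case (insert y A)
  then show ?case by (simp add: coeff_mult mpolys_in_intros)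
qed (simp_all add: coeff_1)

lemma coeff_dickson_poly_in: "poly.coeff (dickson_poly ys) k \<in> mpolys_in (set ys)"
  unfolding dickson_poly_def
  by (rule coeff_prod_in) (auto simp: coeff_pCons lin_forms_in split: nat.splits)

context prime_order
begin

lemma poly_linearized:
  "poly (\<Sum>j\<le>m. monom (a j) (CARD('a) ^ j)) (u + mconst c * v) =
    poly (\<Sum>j\<le>m. monom (a j) (CARD('a) ^ j)) u + mconst (c :: 'a) * poly (\<Sum>j\<le>m. monom (a j) (CARD('a) ^ j)) v"
  by (simp add: poly_sum poly_monom frob_add power_mult_distrib mconst_power_card
      sum.distrib sum_distrib_left algebra_simps)

text \<open>
  Grouping the linear forms \<open>c z + v\<close> by \<open>v\<close> and using that \<open>dickson_poly ys\<close> is additive and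
  homogeneous over the field with \<open>q\<close> elements gives a recursion that shows at the same time
  that only the powers \<open>X ^ (q ^ j)\<close> occur.
\<close>

lemma dickson_poly_aux:
  assumes "distinct ys"
  shows "(\<exists>a. (dickson_poly ys :: 'a mpoly poly) = (\<Sum>j\<le>length ys. monom (a j) (CARD('a) ^ j)) \<and> a (length ys) = 1) \<and>
    (\<forall>z. z \<notin> set ys \<longrightarrow> (dickson_poly (z # ys) :: 'a mpoly poly) = dickson_poly ys ^ CARD('a) -
      smult (poly (dickson_poly ys) (mvar z) ^ (CARD('a) - 1)) (dickson_poly ys))"
  using assms
proof (induction ys)
  case Nil
  have "(dickson_poly [] :: 'a mpoly poly) = monom 1 1" by (simp add: dickson_poly_def monom_altdef)
  moreover have "(dickson_poly [z] :: 'a mpoly poly) = dickson_poly [] ^ CARD('a) -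
      smult (poly (dickson_poly []) (mvar z) ^ (CARD('a) - 1)) (dickson_poly [])" for z
  proof (rule poly_eqI_infinite[OF infinite_mpoly])
    fix x :: "'a mpoly"
    have "poly (dickson_poly [z]) x = (\<Prod>(c, v)\<in>UNIV \<times> {0}. x + (mconst c * mvar z + v))"
      unfolding poly_dickson_poly
      by (subst prod.reindex_bij_betw[OF lin_forms_Cons[of z "[]", where 'a = 'a], symmetric])
        (simp_all add: case_prod_beta)
    also have "\<dots> = (\<Prod>c\<in>UNIV. x + mconst c * mvar z)"
      by (rule prod.reindex_bij_witness[of _ "\<lambda>c. (c, 0)" fst]) auto
    finally show "poly (dickson_poly [z]) x = poly (dickson_poly [] ^ CARD('a) -
        smult (poly (dickson_poly []) (mvar z) ^ (CARD('a) - 1)) (dickson_poly [])) x"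
      by (simp add: prod_translates poly_dickson_poly)
  qed
  ultimately show ?case by (auto intro!: exI[of _ "\<lambda>_. 1"])
next
  case (Cons y ys)
  let ?q = "CARD('a)"
  let ?F = "dickson_poly ys :: 'a mpoly poly" and ?G = "dickson_poly (y # ys) :: 'a mpoly poly"
  let ?n = "length ys"
  have ys: "distinct ys" "y \<notin> set ys" using Cons.prems by auto
  obtain a where a: "?F = (\<Sum>j\<le>?n. monom (a j) (?q ^ j))" "a ?n = 1"
    using Cons.IH[OF ys(1)] by blast
  have rec: "?G = ?F ^ ?q - smult (poly ?F (mvar y) ^ (?q - 1)) ?F"
    using Cons.IH[OF ys(1)] ys(2) by blast
  define B where "B = poly ?F (mvar y) ^ (?q - 1)"
  define b where "b j = (case j of 0 \<Rightarrow> 0 | Suc k \<Rightarrow> a k ^ ?q) - (if j \<le> ?n then B * a j else 0)" for j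
  have Fq: "?F ^ ?q = (\<Sum>j\<le>?n. monom (a j ^ ?q) (?q ^ Suc j))"
  proof (rule poly_eqI_infinite[OF infinite_mpoly])
    fix x :: "'a mpoly"
    show "poly (?F ^ ?q) x = poly (\<Sum>j\<le>?n. monom (a j ^ ?q) (?q ^ Suc j)) x"
      unfolding a(1)
      by (simp add: poly_sum poly_monom frob_sum[of _ _ 1, simplified] power_mult_distrib mult.commute[of "CARD('a)"]
          power_mult)
  qed
  have G: "?G = (\<Sum>j\<le>Suc ?n. monom (b j) (?q ^ j))"
  proof -
    have "(\<Sum>j\<le>Suc ?n. monom (b j) (?q ^ j)) =
        (\<Sum>j\<le>Suc ?n. monom (case j of 0 \<Rightarrow> 0 | Suc k \<Rightarrow> a k ^ ?q) (?q ^ j)) -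
        (\<Sum>j\<le>Suc ?n. monom (if j \<le> ?n then B * a j else 0) (?q ^ j))"
      unfolding b_def by (simp only: diff_monom[symmetric] sum_subtractf)
    also have "(\<Sum>j\<le>Suc ?n. monom (case j of 0 \<Rightarrow> 0 | Suc k \<Rightarrow> a k ^ ?q) (?q ^ j)) = ?F ^ ?q"
      unfolding Fq by (subst sum.atMost_Suc_shift) simp
    also have "(\<Sum>j\<le>Suc ?n. monom (if j \<le> ?n then B * a j else 0) (?q ^ j)) = smult B ?F"
      unfolding a(1) by (simp add: smult_sum_right smult_monom)
    finally show ?thesis using rec by (simp add: B_def)
  qed
  have "b (Suc ?n) = 1" by (simp add: b_def a(2))
  with G have 1: "\<exists>b. ?G = (\<Sum>j\<le>length (y # ys). monom (b j) (?q ^ j)) \<and> b (length (y # ys)) = 1"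
    by (intro exI[of _ b]) (simp only: list.size add_0_right add_Suc_right simp_thms)
  have lin: "poly ?G (u + mconst c * v) = poly ?G u + mconst c * poly ?G v" for u v c
    unfolding G by (rule poly_linearized)
  have "dickson_poly (z # y # ys) = ?G ^ ?q - smult (poly ?G (mvar z) ^ (?q - 1)) ?G"
    if z: "z \<notin> set (y # ys)" for z
  proof (rule poly_eqI_infinite[OF infinite_mpoly])
    fix x :: "'a mpoly"
    have "poly (dickson_poly (z # y # ys)) x =
        (\<Prod>(c, v)\<in>UNIV \<times> lin_forms (y # ys). x + (mconst c * mvar z + v))"
      unfolding poly_dickson_poly
      by (subst prod.reindex_bij_betw[OF lin_forms_Cons[OF z, where 'a = 'a], symmetric])
        (simp_all add: case_prod_beta)
    also have "\<dots> = (\<Prod>c\<in>UNIV. \<Prod>v\<in>lin_forms (y # ys). x + (mconst c * mvar z + v))"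
      by (rule prod.cartesian_product[symmetric])
    also have "\<dots> = (\<Prod>c\<in>UNIV. poly ?G x + mconst c * poly ?G (mvar z))"
      by (simp only: lin[symmetric]) (simp only: poly_dickson_poly add.assoc)
    finally show "poly (dickson_poly (z # y # ys)) x =
        poly (?G ^ ?q - smult (poly ?G (mvar z) ^ (?q - 1)) ?G) x"
      by (simp add: prod_translates)
  qed
  with 1 show ?case by blast
qed

lemma dickson_poly_Cons:
  "distinct (z # ys) \<Longrightarrow> (dickson_poly (z # ys) :: 'a mpoly poly) = dickson_poly ys ^ CARD('a) -
      smult (poly (dickson_poly ys) (mvar z) ^ (CARD('a) - 1)) (dickson_poly ys)"
  using dickson_poly_aux[of ys] by auto

lemma power_card_inj: "CARD('a) ^ i = CARD('a) ^ j \<longleftrightarrow> i = j"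
  using card_gt_1 power_inject_exp by blast

lemma dickson_poly_expansion:
  assumes "distinct ys"
  shows "(dickson_poly ys :: 'a mpoly poly) =
      (\<Sum>j\<le>length ys. monom (poly.coeff (dickson_poly ys) (CARD('a) ^ j)) (CARD('a) ^ j))"
    and "poly.coeff (dickson_poly ys :: 'a mpoly poly) (CARD('a) ^ length ys) = 1"
proof -
  obtain a where a: "(dickson_poly ys :: 'a mpoly poly) = (\<Sum>j\<le>length ys. monom (a j) (CARD('a) ^ j))"
    "a (length ys) = 1"
    using dickson_poly_aux[OF assms] by auto
  have co: "poly.coeff (dickson_poly ys :: 'a mpoly poly) (CARD('a) ^ j) = a j" if "j \<le> length ys" for j
    unfolding a(1) using that by (simp add: coeff_sum power_card_inj)
  show "poly.coeff (dickson_poly ys :: 'a mpoly poly) (CARD('a) ^ length ys) = 1"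
    using co a(2) by simp
  show "(dickson_poly ys :: 'a mpoly poly) =
      (\<Sum>j\<le>length ys. monom (poly.coeff (dickson_poly ys) (CARD('a) ^ j)) (CARD('a) ^ j))"
    using a(1) co by (metis (no_types, lifting) atMost_iff sum.cong)
qed

lemma poly_dickson_poly_linear:
  assumes "distinct ys"
  shows "poly (dickson_poly ys) (u + mconst c * v) =
    poly (dickson_poly ys) u + mconst (c :: 'a) * poly (dickson_poly ys) v"
proof -
  obtain a where a: "(dickson_poly ys :: 'a mpoly poly) = (\<Sum>j\<le>length ys. monom (a j) (CARD('a) ^ j))"
    using dickson_poly_aux[OF assms] by blast
  show ?thesis unfolding a by (rule poly_linearized)
qed

lemma degree_dickson_poly:
  assumes "distinct ys"
  shows "degree (dickson_poly ys :: 'a mpoly poly) = CARD('a) ^ length ys" "lead_coeff (dickson_poly ys :: 'a mpoly poly) = 1"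
proof -
  show 1: "degree (dickson_poly ys :: 'a mpoly poly) = CARD('a) ^ length ys"
    unfolding dickson_poly_def by (subst degree_prod_eq_sum_degree) (auto simp: card_lin_forms[OF assms])
  show "lead_coeff (dickson_poly ys :: 'a mpoly poly) = 1"
    using dickson_poly_expansion(2)[OF assms] 1 by simp
qed

end

section \<open>Milnor operations on exterior algebras\<close>

subsection \<open>Exterior algebras on sets of generators\<close>

definition ext_in :: "nat set \<Rightarrow> 'r::comm_ring_1 exterior set" where
  "ext_in Y = {x. \<forall>S. ext_coeff x S \<noteq> 0 \<longrightarrow> S \<subseteq> Y}"

lemma ext_in_0 [simp]: "0 \<in> ext_in Y"
  by (simp add: ext_in_def)

lemma ext_inD: "x \<in> ext_in Y \<Longrightarrow> \<not> S \<subseteq> Y \<Longrightarrow> ext_coeff x S = 0"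
  by (auto simp: ext_in_def)

lemma ext_inI: "(\<And>S. \<not> S \<subseteq> Y \<Longrightarrow> ext_coeff x S = 0) \<Longrightarrow> x \<in> ext_in Y"
  by (auto simp: ext_in_def)

lemma ext_in_add: "x \<in> ext_in Y \<Longrightarrow> y \<in> ext_in Y \<Longrightarrow> x + y \<in> ext_in Y"
  by (rule ext_inI) (simp add: ext_inD)

lemma ext_in_uminus: "x \<in> ext_in Y \<Longrightarrow> - x \<in> ext_in Y"
  by (simp add: ext_in_def)

lemma ext_in_diff: "x \<in> ext_in Y \<Longrightarrow> y \<in> ext_in Y \<Longrightarrow> x - y \<in> ext_in Y"
  using ext_in_add[of x Y "- y"] ext_in_uminus[of y Y] by simp

lemma ext_in_scalar_mult: "x \<in> ext_in Y \<Longrightarrow> ext_scalar c * x \<in> ext_in Y"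
  by (rule ext_inI) (simp add: ext_inD)

lemma ext_in_sum: "(\<And>i. i \<in> I \<Longrightarrow> f i \<in> ext_in Y) \<Longrightarrow> sum f I \<in> ext_in Y"
  by (induction I rule: infinite_finite_induct) (auto intro: ext_in_add)

lemma ext_in_basis: "S \<subseteq> Y \<Longrightarrow> ext_basis S \<in> ext_in Y"
  by (simp add: ext_in_def ext_coeff_basis)

lemma ext_in_mono: "x \<in> ext_in Y \<Longrightarrow> Y \<subseteq> Z \<Longrightarrow> x \<in> ext_in Z"
  unfolding ext_in_def by blast

lemma ext_in_scalar: "ext_scalar c \<in> ext_in Y"
  by (simp add: ext_in_def ext_scalar.rep_eq)

lemma ext_coeff_gen_dt_mult:
  fixes x :: "'a::comm_ring_1 coh"
  shows "ext_coeff (gen_dt i * x) T = (if i \<in> T then (-1) ^ card {k \<in> T - {i}. k < i} * ext_coeff x (T - {i}) else 0)"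
proof (cases "finite T")
  case True
  have "ext_coeff (gen_dt i * x) T = (\<Sum>A\<in>Pow T. ext_sign A (T - A) * ext_coeff (ext_basis {i}) A * ext_coeff x (T - A))"
    by (simp add: gen_dt_def times_exterior.rep_eq)
  also have "\<dots> = (\<Sum>A\<in>Pow T. if A = {i} then ext_sign {i} (T - {i}) * ext_coeff x (T - {i}) else 0)"
    by (rule sum.cong) (auto simp: ext_coeff_basis)
  also have "\<dots> = (if i \<in> T then ext_sign {i} (T - {i}) * ext_coeff x (T - {i}) else 0)"
    using True by (subst sum.delta) auto
  finally show ?thesis by (simp only: ext_sign_singleton)
next
  case False
  then have "infinite (T - {i})" by simp
  with False show ?thesis by (simp add: ext_coeff_infinite)
qed

lemma ext_in_gen_dt_mult:
  assumes "x \<in> ext_in Y" shows "gen_dt i * x \<in> ext_in (insert i Y)"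
  unfolding ext_in_def
proof (intro CollectI allI impI)
  fix T assume "ext_coeff (gen_dt i * x) T \<noteq> 0"
  then have "ext_coeff x (T - {i}) \<noteq> 0" by (auto simp: ext_coeff_gen_dt_mult split: if_splits)
  then have "T - {i} \<subseteq> Y" using assms by (simp add: ext_in_def)
  then show "T \<subseteq> insert i Y" by blast
qed

lemma ext_induct [case_names zero add basis]:
  assumes "P 0" "\<And>x y. P x \<Longrightarrow> P y \<Longrightarrow> P (x + y)" "\<And>c S. finite S \<Longrightarrow> P (ext_scalar c * ext_basis S)"
  shows "P (x :: 'r::comm_ring_1 exterior)"
proof -
  have "P (\<Sum>S\<in>A. ext_scalar (ext_coeff x S) * ext_basis S)" if "\<forall>S\<in>A. finite S" for A
    using that by (induction A rule: infinite_finite_induct) (simp_all add: assms)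
  moreover have "\<forall>S\<in>{S. ext_coeff x S \<noteq> 0}. finite S" using ext_coeff_infinite by blast
  ultimately show ?thesis using ext_expansion[of x] by metis
qed

lemma coh_induct [case_names one add scalar gen_dt]:
  assumes "P 1" "\<And>x y. P x \<Longrightarrow> P y \<Longrightarrow> P (x + y)" "\<And>c x. P x \<Longrightarrow> P (ext_scalar c * x)"
    "\<And>i x. P x \<Longrightarrow> P (gen_dt i * x)"
  shows "P (x :: 'a::comm_ring_1 coh)"
proof (induction x rule: ext_induct)
  case zero
  show ?case using assms(3)[OF assms(1), of 0] by simp
next
  case (add x y)
  then show ?case by (rule assms(2))
next
  case (basis c S)
  have "P (\<Prod>i\<leftarrow>l. gen_dt i)" for l by (induction l) (simp_all add: assms)
  then show ?case using basis by (simp add: assms ext_basis_eq_prod flip: gen_dt_def)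
qed

lemma gen_dt_square: "gen_dt i * (gen_dt i * x) = 0"
  by (simp add: gen_dt_def ext_basis_mult flip: mult.assoc)

lemma gen_dt_anticomm: "gen_dt i * (gen_dt j * x) = - (gen_dt j * (gen_dt i * x))"
  unfolding gen_dt_def mult.assoc[symmetric] by (subst ext_basis_anticomm) simp

text \<open>
  This decomposition isolates \<open>dt\<^sub>i\<close> and replaces contractions in arguments that compare the parts with
  and without \<open>dt\<^sub>i\<close>.
\<close>

lemma gen_dt_split:
  assumes "x \<in> ext_in Y"
  obtains \<alpha> \<beta> where "\<alpha> \<in> ext_in (Y - {i})" "\<beta> \<in> ext_in (Y - {i})" "(x :: 'a::comm_ring_1 coh) = gen_dt i * \<alpha> + \<beta>"
proof -
  have basis: "\<exists>\<alpha>\<in>ext_in (Y - {i}). \<exists>\<beta>\<in>ext_in (Y - {i}). ext_basis S = gen_dt i * \<alpha> + (\<beta> :: 'a coh)"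
    if "S \<subseteq> Y" "finite S" for S
  proof (cases "i \<in> S")
    case True
    let ?s = "ext_sign {i} (S - {i}) :: 'a mpoly"
    have sq: "?s * ?s = 1" by (simp add: ext_sign_def flip: power_add mult_2)
    have "gen_dt i * (ext_scalar ?s * ext_basis (S - {i})) = ext_scalar (?s * ?s) * ext_basis (insert i (S - {i}))"
      using that unfolding gen_dt_def mult_scalar_left_commute by (subst ext_basis_mult) (auto simp: mult.assoc)
    also have "\<dots> = ext_basis S" using True by (simp add: sq insert_absorb)
    finally have "ext_basis S = gen_dt i * (ext_scalar ?s * ext_basis (S - {i})) + 0" by simp
    moreover have "ext_scalar ?s * ext_basis (S - {i}) \<in> ext_in (Y - {i})"
      by (intro ext_in_scalar_mult ext_in_basis) (use that in auto)
    ultimately show ?thesis by (intro bexI[OF _ ext_in_0] bexI) assumption+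
  next
    case False
    then have "ext_basis S \<in> (ext_in (Y - {i}) :: 'a coh set)" using that by (intro ext_in_basis) auto
    moreover have "ext_basis S = gen_dt i * 0 + (ext_basis S :: 'a coh)" by simp
    ultimately show ?thesis by (intro bexI[OF _ ext_in_0] bexI) assumption+
  qed
  have "\<exists>\<alpha>\<in>ext_in (Y - {i}). \<exists>\<beta>\<in>ext_in (Y - {i}).
      (\<Sum>S\<in>A. ext_scalar (ext_coeff x S) * ext_basis S) = gen_dt i * \<alpha> + \<beta>"
    if "\<forall>S\<in>A. S \<subseteq> Y \<and> finite S" for A
    using that
  proof (induction A rule: infinite_finite_induct)
    case (insert S A)
    from insert.IH obtain a b where ab: "a \<in> ext_in (Y - {i})" "b \<in> ext_in (Y - {i})"
      "(\<Sum>S\<in>A. ext_scalar (ext_coeff x S) * ext_basis S) = gen_dt i * a + b"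
      using insert.prems by blast
    have "S \<subseteq> Y" "finite S" using insert.prems by simp_all
    from basis[OF this] obtain c d where cd: "c \<in> ext_in (Y - {i})" "d \<in> ext_in (Y - {i})"
      "ext_basis S = gen_dt i * c + (d :: 'a coh)"
      by blast
    let ?c = "ext_scalar (ext_coeff x S)"
    have "(\<Sum>S\<in>insert S A. ext_scalar (ext_coeff x S) * ext_basis S) =
        gen_dt i * (?c * c + a) + (?c * d + b)"
      using insert.hyps ab(3) cd(3) by (simp add: distrib_left mult_scalar_left_commute)
    moreover have "?c * c + a \<in> ext_in (Y - {i})" "?c * d + b \<in> ext_in (Y - {i})"
      using ab cd by (auto intro: ext_in_add ext_in_scalar_mult)
    ultimately show ?case by (intro bexI) assumption+
  qed (rule bexI[OF _ ext_in_0], rule bexI[OF _ ext_in_0], simp)+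
  moreover have "\<forall>S\<in>{S. ext_coeff x S \<noteq> 0}. S \<subseteq> Y \<and> finite S"
    using assms ext_coeff_infinite by (auto simp: ext_in_def)
  ultimately obtain \<alpha> \<beta> where "\<alpha> \<in> ext_in (Y - {i})" "\<beta> \<in> ext_in (Y - {i})"
    "(\<Sum>S\<in>{S. ext_coeff x S \<noteq> 0}. ext_scalar (ext_coeff x S) * ext_basis S) = gen_dt i * \<alpha> + \<beta>"
    by blast
  then show ?thesis using that by (simp only: ext_expansion[of x, symmetric])
qed

lemma gen_dt_split_unique:
  assumes "\<alpha> \<in> ext_in (- {i})" "\<beta> \<in> ext_in (- {i})" "gen_dt i * \<alpha> + \<beta> = (0 :: 'a::comm_ring_1 coh)"
  shows "\<alpha> = 0" "\<beta> = 0"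
proof -
  have zero: "ext_coeff (gen_dt i * \<alpha>) T + ext_coeff \<beta> T = 0" for T
    using arg_cong[OF assms(3), of "\<lambda>x. ext_coeff x T"] by simp
  show "\<alpha> = 0"
  proof (rule exterior_eqI)
    fix S :: "nat set"
    show "ext_coeff \<alpha> S = ext_coeff 0 S"
    proof (cases "i \<in> S")
      case True
      then show ?thesis using assms(1) by (auto simp: ext_in_def)
    next
      case False
      have "ext_coeff \<beta> (insert i S) = 0" using assms(2) by (auto simp: ext_in_def)
      then have "(-1) ^ card {k \<in> S. k < i} * ext_coeff \<alpha> S = 0"
        using zero[of "insert i S"] False by (simp add: ext_coeff_gen_dt_mult insert_Diff_if)
      then have "(-1) ^ card {k \<in> S. k < i} * ((-1) ^ card {k \<in> S. k < i} * ext_coeff \<alpha> S) = 0" by simp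
      then show ?thesis by (simp flip: mult.assoc power_add mult_2)
    qed
  qed
  with assms(3) show "\<beta> = 0" by simp
qed

lemma gen_dt_split_eq:
  assumes "\<alpha> \<in> ext_in (- {i})" "\<beta> \<in> ext_in (- {i})" "\<alpha>' \<in> ext_in (- {i})" "\<beta>' \<in> ext_in (- {i})"
    and "gen_dt i * \<alpha> + \<beta> = gen_dt i * \<alpha>' + (\<beta>' :: 'a::comm_ring_1 coh)"
  shows "\<alpha> = \<alpha>'" "\<beta> = \<beta>'"
  using gen_dt_split_unique[of "\<alpha> - \<alpha>'" i "\<beta> - \<beta>'"] ext_in_diff assms by (auto simp: algebra_simps)

subsection \<open>Composites of Milnor operations\<close>

lemma milnor_Q_gen_dt_mult:
  "milnor_Q j (gen_dt i * x :: 'a::{finite,field} coh) =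
    ext_scalar (mvar i ^ (CARD('a) ^ j)) * x - gen_dt i * milnor_Q j x"
proof -
  have "milnor_Q j (gen_dt i * x) = milnor_Q j (gen_dt i) * x + (-1) ^ 1 * gen_dt i * milnor_Q j x"
    by (rule milnor_Q_mult) (auto simp: gen_dt_def ext_coeff_basis split: if_splits)
  moreover have "ext_scalar (c ^ k) = (ext_scalar c :: 'a coh) ^ k" for c k by (induction k) simp_all
  ultimately show ?thesis by (simp add: milnor_Q_gen_dt gen_t_def)
qed

lemma milnor_Q_uminus: "milnor_Q j (- x) = - milnor_Q j x"
  using milnor_Q_scalar_mult[of j "- 1" x] by simp

lemma milnor_Q_diff: "milnor_Q j (x - y) = milnor_Q j x - milnor_Q j y"
  using milnor_Q_add[of j x "- y"] by (simp add: milnor_Q_uminus)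

lemma milnor_Q_in: "x \<in> ext_in Y \<Longrightarrow> milnor_Q j x \<in> ext_in Y"
  unfolding milnor_Q_def milnor_Q_on_basis_def
  by (intro ext_in_sum ext_in_scalar_mult ext_in_basis) (auto simp: ext_in_def)

lemma milnor_Q_anticomm: "milnor_Q j (milnor_Q k x) = - milnor_Q k (milnor_Q j x)"
proof (induction x rule: coh_induct)
  case (gen_dt i x)
  then show ?case
    by (simp add: milnor_Q_gen_dt_mult milnor_Q_diff milnor_Q_scalar_mult algebra_simps)
qed (simp_all add: milnor_Q_add milnor_Q_scalar_mult)

lemma milnor_Q_square: "milnor_Q j (milnor_Q j x) = 0"
proof (induction x rule: coh_induct)
  case (gen_dt i x)
  then show ?case
    by (simp add: milnor_Q_gen_dt_mult milnor_Q_diff milnor_Q_scalar_mult)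
qed (simp_all add: milnor_Q_add milnor_Q_scalar_mult)

lemma milnor_Qs_empty [simp]: "milnor_Qs {} x = x"
  by (simp add: milnor_Qs_def)

lemma milnor_Qs_singleton [simp]: "milnor_Qs {j} x = milnor_Q j x"
  by (simp add: milnor_Qs_def)

lemma milnor_Qs_insert_min:
  "finite B \<Longrightarrow> (\<And>b. b \<in> B \<Longrightarrow> a < b) \<Longrightarrow> milnor_Qs (insert a B) x = milnor_Q a (milnor_Qs B x)"
  unfolding milnor_Qs_def by (subst sorted_list_of_set_insert_min) simp_all

lemma milnor_Qs_induct:
  assumes "finite J" "P x" "\<And>j x. P x \<Longrightarrow> P (milnor_Q j x)"
  shows "P (milnor_Qs J x)"
  using assms(1) by (induction rule: finite_linorder_min_induct) (simp_all add: assms milnor_Qs_insert_min)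

lemma milnor_Qs_in: "finite J \<Longrightarrow> x \<in> ext_in Y \<Longrightarrow> milnor_Qs J x \<in> ext_in Y"
  by (rule milnor_Qs_induct) (simp_all add: milnor_Q_in)

lemma milnor_Qs_linear:
  assumes "finite J"
  shows "milnor_Qs J (x + y) = milnor_Qs J x + milnor_Qs J y"
    "milnor_Qs J (ext_scalar c * x) = ext_scalar c * milnor_Qs J x"
    "milnor_Qs J 0 = 0" "milnor_Qs J (- x) = - milnor_Qs J x" "milnor_Qs J (x - y) = milnor_Qs J x - milnor_Qs J y"
  using assms by (induction rule: finite_linorder_min_induct)
    (simp_all add: milnor_Qs_insert_min milnor_Q_add milnor_Q_scalar_mult milnor_Q_uminus milnor_Q_diff)

lemma milnor_Qs_sum: "finite J \<Longrightarrow> milnor_Qs J (sum f A) = (\<Sum>i\<in>A. milnor_Qs J (f i))"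
  by (induction A rule: infinite_finite_induct) (simp_all add: milnor_Qs_linear)

lemma milnor_Qs_scalar: "finite J \<Longrightarrow> J \<noteq> {} \<Longrightarrow> milnor_Qs J (ext_scalar c) = 0"
proof (induction rule: finite_linorder_min_induct)
  case (insert b B)
  then show ?case by (cases "B = {}") (simp_all add: milnor_Qs_insert_min)
qed simp

lemma milnor_Q_milnor_Qs:
  assumes "finite J"
  shows "milnor_Q j (milnor_Qs J x) =
    (if j \<in> J then 0 else ext_scalar ((-1) ^ card {k \<in> J. k < j}) * milnor_Qs (insert j J) x)"
  using assms
proof (induction J rule: finite_linorder_min_induct)
  case (insert b B)
  have b: "b \<notin> B" using insert.hyps by auto
  have Qb: "milnor_Qs (insert b B) x = milnor_Q b (milnor_Qs B x)"
    using insert.hyps by (simp add: milnor_Qs_insert_min)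
  consider "j < b" | "j = b" | "b < j" by linarith
  then show ?case
  proof cases
    case 1
    then have "{k \<in> insert b B. k < j} = {}" "j \<notin> insert b B" using insert.hyps by auto
    moreover have "milnor_Qs (insert j (insert b B)) x = milnor_Q j (milnor_Qs (insert b B) x)"
      by (rule milnor_Qs_insert_min) (use 1 insert.hyps in auto)
    ultimately show ?thesis by (simp only:) simp
  next
    case 2
    then show ?thesis by (simp add: Qb milnor_Q_square)
  next
    case 3
    have eq: "milnor_Q j (milnor_Qs (insert b B) x) = - milnor_Q b (milnor_Q j (milnor_Qs B x))"
      unfolding Qb by (rule milnor_Q_anticomm)
    show ?thesis
    proof (cases "j \<in> B")
      case True
      then show ?thesis using eq insert.IH by simp
    next
      case False
      have set: "{k \<in> insert b B. k < j} = insert b {k \<in> B. k < j}" using 3 by auto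
      have "milnor_Qs (insert j (insert b B)) x = milnor_Q b (milnor_Qs (insert j B) x)"
        unfolding insert_commute[of j b] by (rule milnor_Qs_insert_min) (use 3 insert.hyps in auto)
      moreover have "card {k \<in> insert b B. k < j} = Suc (card {k \<in> B. k < j})"
        unfolding set using insert.hyps b by simp
      ultimately show ?thesis using eq insert.IH False 3 by (simp add: milnor_Q_scalar_mult)
    qed
  qed
qed (simp add: milnor_Qs_def)

lemma milnor_Qs_milnor_Q:
  assumes "finite J"
  shows "\<exists>k. milnor_Qs J (milnor_Q j x) =
    (if j \<in> J then 0 else ext_scalar ((-1) ^ k) * milnor_Qs (insert j J) x)"
proof -
  have comm: "\<exists>k. milnor_Qs J (milnor_Q j x) = ext_scalar ((-1) ^ k) * milnor_Q j (milnor_Qs J x)"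
    using assms
  proof (induction J rule: finite_linorder_min_induct)
    case empty
    show ?case by (intro exI[of _ 0]) simp
  next
    case (insert b B)
    then obtain k where "milnor_Qs B (milnor_Q j x) = ext_scalar ((-1) ^ k) * milnor_Q j (milnor_Qs B x)" by auto
    then have "milnor_Qs (insert b B) (milnor_Q j x) = ext_scalar ((-1) ^ Suc k) * milnor_Q j (milnor_Qs (insert b B) x)"
      using insert.hyps milnor_Q_anticomm[of b j "milnor_Qs B x"]
      by (simp add: milnor_Qs_insert_min milnor_Q_scalar_mult)
    then show ?case by blast
  qed
  then obtain k where "milnor_Qs J (milnor_Q j x) = ext_scalar ((-1) ^ k) * milnor_Q j (milnor_Qs J x)" by auto
  then show ?thesis
    by (intro exI[of _ "k + card {i \<in> J. i < j}"]) (simp add: milnor_Q_milnor_Qs[OF assms] power_add mult.assoc)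
qed

lemma milnor_Qs_milnor_Qs:
  assumes "finite I" "finite J"
  shows "\<exists>k. milnor_Qs J (milnor_Qs I x) =
    (if I \<inter> J = {} then ext_scalar ((-1) ^ k) * milnor_Qs (J \<union> I) x else 0)"
  using assms(2)
proof (induction J rule: finite_linorder_min_induct)
  case empty
  show ?case by (intro exI[of _ 0]) simp
next
  case (insert b B)
  then obtain k where k: "milnor_Qs B (milnor_Qs I x) =
      (if I \<inter> B = {} then ext_scalar ((-1) ^ k) * milnor_Qs (B \<union> I) x else 0)" by auto
  have b: "b \<notin> B" using insert.hyps by auto
  have Qb: "milnor_Qs (insert b B) (milnor_Qs I x) = milnor_Q b (milnor_Qs B (milnor_Qs I x))"
    using insert.hyps by (simp add: milnor_Qs_insert_min)
  show ?case
  proof (cases "I \<inter> B = {}")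
    case True
    then have "milnor_Qs (insert b B) (milnor_Qs I x) = (if b \<in> I then 0 else
        ext_scalar ((-1) ^ (k + card {i \<in> B \<union> I. i < b})) * milnor_Qs (insert b (B \<union> I)) x)"
      using insert.hyps assms(1) b
      by (simp add: Qb k milnor_Q_scalar_mult milnor_Q_milnor_Qs power_add mult.assoc)
    then show ?thesis using True by auto
  next
    case False
    then show ?thesis using k Qb by auto
  qed
qed

lemma sorted_list_of_set_lessThan: "sorted_list_of_set {..<n} = [0..<n]"
  by (simp add: lessThan_atLeast0)

lemma milnor_Qs_lessThan_Suc: "milnor_Qs {..<Suc n} x = milnor_Qs {..<n} (milnor_Q n x)"
  by (simp add: milnor_Qs_def sorted_list_of_set_lessThan)

text \<open>
  The exterior degree, which \<open>Q\<^sub>j\<close> lowers by one; the degree of the polynomial coefficients is ignored.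
\<close>

definition hom_degree :: "nat \<Rightarrow> 'r::comm_ring_1 exterior \<Rightarrow> bool" where
  "hom_degree k x \<longleftrightarrow> (\<forall>S. ext_coeff x S \<noteq> 0 \<longrightarrow> card S = k)"

lemma hom_degree_milnor_Q:
  fixes x :: "'a::{finite,field} coh"
  assumes "hom_degree k x" shows "hom_degree (k - 1) (milnor_Q j x)"
  unfolding hom_degree_def
proof (intro allI impI)
  fix T assume "ext_coeff (milnor_Q j x) T \<noteq> 0"
  then have "(\<Sum>S | ext_coeff x S \<noteq> 0. ext_coeff (ext_scalar (ext_coeff x S) * milnor_Q_on_basis j S) T) \<noteq> 0"
    by (simp add: milnor_Q_def)
  then obtain S where S: "S \<in> {S. ext_coeff x S \<noteq> 0}"
    "ext_coeff (ext_scalar (ext_coeff x S) * milnor_Q_on_basis j S) T \<noteq> 0"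
    by (rule sum.not_neutral_contains_not_neutral)
  from S(2) have "(\<Sum>i\<in>S. ext_coeff (ext_scalar ((-1) ^ card {k \<in> S. k < i} * mvar i ^ (CARD('a) ^ j)) *
      ext_basis (S - {i}) :: 'a coh) T) \<noteq> 0"
    unfolding milnor_Q_on_basis_def ext_coeff_sum ext_coeff_scalar_mult by auto
  then obtain i where "i \<in> S" "ext_coeff (ext_scalar ((-1) ^ card {k \<in> S. k < i} * mvar i ^ (CARD('a) ^ j)) *
      ext_basis (S - {i}) :: 'a coh) T \<noteq> 0"
    by (rule sum.not_neutral_contains_not_neutral)
  then have "ext_coeff (ext_basis (S - {i}) :: 'a coh) T \<noteq> 0" unfolding ext_coeff_scalar_mult by auto
  then have "T = S - {i}" "finite T" by (auto simp: ext_coeff_basis split: if_splits)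
  with \<open>i \<in> S\<close> S(1) assms show "card T = k - 1" by (auto simp: hom_degree_def)
qed

lemma hom_degree_milnor_Qs:
  "finite J \<Longrightarrow> hom_degree k x \<Longrightarrow> hom_degree (k - card J) (milnor_Qs J x)"
proof (induction J rule: finite_linorder_min_induct)
  case (insert b B)
  then have "b \<notin> B" by auto
  with insert show ?case
    using hom_degree_milnor_Q[of "k - card B" "milnor_Qs B x" b] by (simp add: milnor_Qs_insert_min)
qed simp

lemma hom_degree_gen_dt_mult:
  assumes "hom_degree k x" shows "hom_degree (Suc k) (gen_dt i * x)"
  unfolding hom_degree_def
proof (intro allI impI)
  fix T assume T: "ext_coeff (gen_dt i * x) T \<noteq> 0"
  then have "finite T" using ext_coeff_infinite by blast
  moreover have "i \<in> T" "ext_coeff x (T - {i}) \<noteq> 0"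
    using T by (auto simp: ext_coeff_gen_dt_mult split: if_splits)
  moreover from this(2) have "card (T - {i}) = k" using assms unfolding hom_degree_def by blast
  ultimately show "card T = Suc k" by (metis card_Suc_Diff1)
qed

lemma hom_degree_0_scalar: "hom_degree 0 x \<Longrightarrow> x = ext_scalar (ext_coeff x {})"
  by (rule exterior_eqI) (auto simp: hom_degree_def ext_scalar.rep_eq)

abbreviation top_form :: "nat list \<Rightarrow> 'a::comm_ring_1 coh" where
  "top_form ys \<equiv> (\<Prod>i\<leftarrow>ys. gen_dt i)"

lemma hom_degree_top_form: "hom_degree (length ys) (top_form ys)"
proof (induction ys)
  case Nil
  show ?case by (simp add: hom_degree_def one_exterior.rep_eq)
qed (simp add: hom_degree_gen_dt_mult)

lemma top_form_in: "top_form ys \<in> ext_in (set ys)"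
proof (induction ys)
  case Nil
  show ?case using ext_in_scalar[of 1] by simp
qed (simp add: ext_in_gen_dt_mult)

subsection \<open>Combinations of Milnor operations\<close>

text \<open>
  With the coefficients of the Dickson polynomial of \<open>ys\<close>, the operations \<open>Q\<^sub>j\<close> combine to a
  derivation with \<open>dt\<^sub>i \<mapsto> F(t\<^sub>i)\<close>. It kills \<open>dt\<^sub>y\<close> for all \<open>y\<close> in \<open>ys\<close>, and no other \<open>dt\<^sub>i\<close>.
\<close>

definition dickson_Q :: "nat list \<Rightarrow> 'a::{finite,field} coh \<Rightarrow> 'a coh" where
  "dickson_Q ys x = (\<Sum>j\<le>length ys. ext_scalar (poly.coeff (dickson_poly ys) (CARD('a) ^ j)) * milnor_Q j x)"

text \<open>
  The polynomial underlying \<open>e\<^sub>k\<close>, which is a scalar because \<open>k\<close> Milnor operations use up the \<open>k\<close> factors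
  \<open>dt\<^sub>y\<close>. It is the Moore determinant.
\<close>

definition dickson_det :: "nat list \<Rightarrow> 'a::{finite,field} mpoly" where
  "dickson_det ys = ext_coeff (dickson_e ys) {}"

lemma ext_scalar_sum: "ext_scalar (sum f A) = (\<Sum>i\<in>A. ext_scalar (f i))"
  by (induction A rule: infinite_finite_induct) simp_all

lemma ext_scalar_prod: "ext_scalar (c ^ k) = (ext_scalar c :: 'r::comm_ring_1 exterior) ^ k"
  by (induction k) simp_all

lemma ext_scalar_diff: "ext_scalar (a - b) = ext_scalar a - ext_scalar b"
  by (rule exterior_eqI) (simp add: ext_scalar.rep_eq)

lemma ext_coeff_ext_scalar [simp]: "ext_coeff (ext_scalar c) {} = c"
  by (simp add: ext_scalar.rep_eq)

lemma ext_scalar_inj [simp]: "ext_scalar a = ext_scalar b \<longleftrightarrow> a = b"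
  by (metis ext_coeff_ext_scalar)

lemma dickson_e_eq: "dickson_e ys = ext_scalar (dickson_det ys)"
proof -
  have "hom_degree (length ys - card {..<length ys}) (milnor_Qs {..<length ys} (top_form ys) :: 'a coh)"
    by (rule hom_degree_milnor_Qs[OF _ hom_degree_top_form]) simp
  then show ?thesis unfolding dickson_det_def dickson_e_def by (intro hom_degree_0_scalar) simp
qed

lemma dickson_det_scalar: "milnor_Qs {..<length ys} (top_form ys) = ext_scalar (dickson_det ys)"
  using dickson_e_eq[of ys] by (simp add: dickson_e_def)

lemma lin_subst_gen_dt_mult: "lin_subst n h (gen_dt i * x) = lin_dt n h i * lin_subst n h x"
  by (simp add: lin_subst_mult lin_subst_gen_dt lin_dt_def)

lemma milnor_Qs_lessThan_milnor_Q: "j < n \<Longrightarrow> milnor_Qs {..<n} (milnor_Q j x) = 0"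
  using milnor_Qs_milnor_Q[of "{..<n}" j x] by simp

context prime_order
begin

lemma dickson_Q_gen_dt_mult:
  assumes "distinct ys"
  shows "dickson_Q ys (gen_dt i * x :: 'a coh) =
    ext_scalar (poly (dickson_poly ys) (mvar i)) * x - gen_dt i * dickson_Q ys x"
proof -
  have "poly (dickson_poly ys) (mvar i :: 'a mpoly) =
      poly (\<Sum>j\<le>length ys. monom (poly.coeff (dickson_poly ys) (CARD('a) ^ j)) (CARD('a) ^ j)) (mvar i)"
    by (rule arg_cong[OF dickson_poly_expansion(1)[OF assms]])
  also have "\<dots> = (\<Sum>j\<le>length ys. poly.coeff (dickson_poly ys) (CARD('a) ^ j) * mvar i ^ (CARD('a) ^ j))"
    by (simp add: poly_sum poly_monom)
  finally have F: "poly (dickson_poly ys) (mvar i :: 'a mpoly) = \<dots>" .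
  show ?thesis
    unfolding dickson_Q_def F ext_scalar_sum sum_distrib_left sum_distrib_right sum_subtractf[symmetric]
    by (rule sum.cong[OF refl])
      (simp only: milnor_Q_gen_dt_mult right_diff_distrib mult_scalar_left_commute[of "gen_dt i"]
        ext_scalar_hom(5) mult.assoc)
qed

lemma dickson_Q_top_form:
  assumes "distinct ys" "set zs \<subseteq> set ys"
  shows "\<exists>k. dickson_Q ys (top_form zs * x :: 'a coh) = ext_scalar ((-1) ^ k) * (top_form zs * dickson_Q ys x)"
  using assms(2)
proof (induction zs)
  case Nil
  show ?case by (intro exI[of _ 0]) simp
next
  case (Cons z zs)
  then obtain k where k: "dickson_Q ys (top_form zs * x :: 'a coh) = ext_scalar ((-1) ^ k) * (top_form zs * dickson_Q ys x)"
    by auto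
  have "poly (dickson_poly ys) (mvar z :: 'a mpoly) = 0"
    unfolding poly_dickson_poly_eq_0_iff using Cons.prems by (intro lin_forms_var) simp
  then have "dickson_Q ys (top_form (z # zs) * x :: 'a coh) = - (gen_dt z * (ext_scalar ((-1) ^ k) * (top_form zs * dickson_Q ys x)))"
    using dickson_Q_gen_dt_mult[OF assms(1), of z "top_form zs * x"] k by (simp add: mult.assoc)
  also have "\<dots> = ext_scalar ((-1) ^ Suc k) * (top_form (z # zs) * dickson_Q ys x)"
    by (simp add: mult.assoc mult_scalar_left_commute)
  finally show ?case by (rule exI)
qed

text \<open>
  In \<open>Q\<^sub>0 \<cdots> Q\<^sub>n\<close> the last operation may be replaced by the combination above, since the
  \<open>Q\<^sub>j\<close> anticommute and have square zero. This is the column expansion of the Moore determinant.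
\<close>

lemma dickson_det_snoc:
  assumes "distinct ys"
  shows "\<exists>k. (dickson_det (ys @ [z]) :: 'a mpoly) =
    (-1) ^ k * dickson_det ys * poly (dickson_poly ys) (mvar z)"
proof -
  let ?n = "length ys" and ?u = "top_form (ys @ [z]) :: 'a coh" and ?F = "poly (dickson_poly ys) (mvar z) :: 'a mpoly"
  have "milnor_Qs {..<?n} (dickson_Q ys ?u) =
      (\<Sum>j\<le>?n. ext_scalar (poly.coeff (dickson_poly ys) (CARD('a) ^ j)) * milnor_Qs {..<?n} (milnor_Q j ?u))"
    unfolding dickson_Q_def by (simp only: milnor_Qs_sum milnor_Qs_linear finite_lessThan)
  also have "\<dots> = (\<Sum>j\<le>?n. if j = ?n then milnor_Qs {..<?n} (milnor_Q ?n ?u) else 0)"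
    by (rule sum.cong) (auto simp: milnor_Qs_lessThan_milnor_Q dickson_poly_expansion(2)[OF assms])
  also have "\<dots> = milnor_Qs {..<?n} (milnor_Q ?n ?u)" by (simp only: sum.delta finite_atMost atMost_iff order_refl if_True)
  also have "\<dots> = milnor_Qs {..<length (ys @ [z])} ?u" by (simp only: milnor_Qs_lessThan_Suc length_append_singleton)
  also have "\<dots> = ext_scalar (dickson_det (ys @ [z]))" by (rule dickson_det_scalar)
  finally have 1: "milnor_Qs {..<?n} (dickson_Q ys ?u) = ext_scalar (dickson_det (ys @ [z]))" .
  obtain k where k: "dickson_Q ys (top_form ys * gen_dt z :: 'a coh) =
      ext_scalar ((-1) ^ k) * (top_form ys * dickson_Q ys (gen_dt z))"
    using dickson_Q_top_form[OF assms order_refl] by blast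
  have "dickson_Q ys (gen_dt z * 1 :: 'a coh) = ext_scalar ?F * 1 - gen_dt z * dickson_Q ys 1"
    by (rule dickson_Q_gen_dt_mult[OF assms])
  moreover have "dickson_Q ys 1 = (0 :: 'a coh)" by (simp add: dickson_Q_def)
  ultimately have "dickson_Q ys (gen_dt z :: 'a coh) = ext_scalar ?F" by simp
  moreover have "?u = top_form ys * gen_dt z" by simp
  ultimately have "dickson_Q ys ?u = ext_scalar ((-1) ^ k * ?F) * top_form ys"
    using k by (simp only: ext_scalar_commute[of "top_form ys"] ext_scalar_hom(5) mult.assoc)
  then have "ext_scalar (dickson_det (ys @ [z])) = ext_scalar ((-1) ^ k * ?F * dickson_det ys)"
    using 1 by (simp only: milnor_Qs_linear(2)[OF finite_lessThan] dickson_det_scalar ext_scalar_hom(5)[symmetric])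
  then have "dickson_det (ys @ [z]) = (-1) ^ k * ?F * dickson_det ys" by (simp only: ext_scalar_inj)
  then show ?thesis by (intro exI[of _ k]) (simp only: mult_ac)
qed

lemma dickson_det_Nil [simp]: "dickson_det [] = (1 :: 'a mpoly)"
  by (simp add: dickson_det_def dickson_e_def lessThan_atLeast0 one_exterior.rep_eq)

lemma poly_dickson_poly_nonzero:
  "z \<notin> set ys \<Longrightarrow> poly (dickson_poly ys) (mvar z :: 'a mpoly) \<noteq> 0"
  unfolding poly_dickson_poly_eq_0_iff using lin_forms_in[of "mvar z :: 'a mpoly" ys] by auto

lemma dickson_det_nonzero: "distinct ys \<Longrightarrow> dickson_det ys \<noteq> (0 :: 'a mpoly)"
proof (induction ys rule: rev_induct)
  case (snoc z ys)
  then obtain k where "(dickson_det (ys @ [z]) :: 'a mpoly) = (-1) ^ k * dickson_det ys * poly (dickson_poly ys) (mvar z)"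
    using dickson_det_snoc[of ys z] by auto
  with snoc show ?case using poly_dickson_poly_nonzero[of z ys] by simp
qed simp

lemma dickson_det_in: "distinct ys \<Longrightarrow> dickson_det ys \<in> (mpolys_in (set ys) :: 'a mpoly set)"
proof (induction ys rule: rev_induct)
  case (snoc z ys)
  then obtain k where k: "(dickson_det (ys @ [z]) :: 'a mpoly) = (-1) ^ k * dickson_det ys * poly (dickson_poly ys) (mvar z)"
    using dickson_det_snoc[of ys z] by auto
  have "poly (dickson_poly ys) (mvar z :: 'a mpoly) \<in> mpolys_in (set (ys @ [z]))"
    unfolding poly_dickson_poly by (intro mpolys_in_prod mpolys_in_add)
      (auto dest: lin_forms_in intro: mpolys_in_mono)
  moreover have "dickson_det ys \<in> (mpolys_in (set (ys @ [z])) :: 'a mpoly set)"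
    using snoc by (auto intro: mpolys_in_mono)
  ultimately show ?case unfolding k
    by (intro mpolys_in_mult mpolys_in_power mpolys_in_uminus mpolys_in_1)
qed simp

text \<open>Up to sign, \<open>dickson_det ys\<close> is the product of one linear form from each line.\<close>

lemma dickson_det_dvd:
  assumes "distinct ys" "\<And>l. l \<in> lin_forms ys \<Longrightarrow> l \<noteq> 0 \<Longrightarrow> l dvd f"
  shows "dickson_det ys dvd (f :: 'a mpoly)"
  using assms
proof (induction ys rule: rev_induct)
  case (snoc z ys)
  have z: "z \<notin> set ys" "distinct ys" using snoc.prems by auto
  have "dickson_det ys dvd f"
    using snoc.IH[OF z(2)] snoc.prems(2) lin_forms_mono[of ys "ys @ [z]", where 'a = 'a] by auto
  then obtain g where g: "f = dickson_det ys * g" by (elim dvdE)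
  have free: "v \<in> mpolys_in (- {z})" if "v \<in> lin_forms ys" for v :: "'a mpoly"
    using lin_forms_in[OF that] z by (auto intro: mpolys_in_mono)
  have "(\<Prod>v\<in>lin_forms ys. mvar z + v) dvd g"
  proof (rule prod_primes_dvd)
    fix v :: "'a mpoly" assume v: "v \<in> lin_forms ys"
    have prime: "prime_elem (mvar z + v)"
      using prime_elem_linear[of "- v" z] mpolys_in_uminus[OF free[OF v]] by simp
    then show "prime_elem (mvar z + v)" .
    have "mvar z + v \<in> lin_forms (ys @ [z])"
      using v lin_forms_mono[of ys "ys @ [z]", where 'a = 'a] by (intro lin_forms_add lin_forms_var) auto
    then have dvd: "mvar z + v dvd f" by (rule snoc.prems(2)) (use prime in simp)
    have "\<not> mvar z + v dvd dickson_det ys"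
    proof
      assume "mvar z + v dvd dickson_det ys"
      then have "msubst (mvar(z := - v)) (dickson_det ys) = 0"
        using dvd_iff_msubst_eq_0[of "- v" z "dickson_det ys"] mpolys_in_uminus[OF free[OF v]] by simp
      moreover have "msubst (mvar(z := - v)) (dickson_det ys) = dickson_det ys"
        using dickson_det_in[OF z(2)] z(1) by (intro msubst_id_on) auto
      ultimately show False using dickson_det_nonzero[OF z(2)] by simp
    qed
    then show "mvar z + v dvd g"
      using prime_elem_dvd_multD[OF prime, of "dickson_det ys" g] dvd unfolding g by blast
  next
    fix u v :: "'a mpoly" assume uv: "u \<in> lin_forms ys" "v \<in> lin_forms ys" "mvar z + u dvd mvar z + v"
    then have "msubst (mvar(z := - u)) (mvar z + v) = 0"
      using dvd_iff_msubst_eq_0[of "- u" z "mvar z + v"] mpolys_in_uminus[OF free[OF uv(1)]] by simp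
    moreover have "msubst (mvar(z := - u)) v = v"
      using free[OF uv(2)] by (intro msubst_id_on) auto
    ultimately show "u = v" by (simp add: msubst_add)
  qed simp
  then have "dickson_det ys * poly (dickson_poly ys) (mvar z) dvd f"
    unfolding g poly_dickson_poly by (rule mult_dvd_mono[OF dvd_refl])
  moreover obtain k where "(dickson_det (ys @ [z]) :: 'a mpoly) = (-1) ^ k * dickson_det ys * poly (dickson_poly ys) (mvar z)"
    using dickson_det_snoc[OF z(2)] by blast
  ultimately show ?case by (cases "even k") (simp_all add: mult.assoc)
qed simp

subsection \<open>Nondegeneracy\<close>

text \<open>
  The scalar parts of all \<open>Q\<^sub>J z\<close> determine \<open>z\<close>: for \<open>i\<close> in \<open>ys\<close>, the combination of Milnor
  operations built on the other indices is a nonzero multiple of the contraction that removes \<open>dt\<^sub>i\<close>, so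
  that it isolates the part of \<open>z\<close> that contains \<open>dt\<^sub>i\<close>. The induction removes one exterior generator at
  a time.
\<close>

lemma milnor_nondegenerate:
  fixes z :: "'a coh"
  assumes ys: "distinct ys"
    and "Y \<subseteq> set ys" "z \<in> ext_in Y"
    and "\<And>J. J \<subseteq> {..<length ys} \<Longrightarrow> ext_coeff (milnor_Qs J z) {} = 0"
  shows "z = 0"
proof -
  have "finite Y" using assms(2) finite_subset by blast
  then show ?thesis using assms(2-)
  proof (induction Y arbitrary: z)
    case empty
    have "z = ext_scalar (ext_coeff z {})"
      by (rule exterior_eqI) (use empty.prems in \<open>auto simp: ext_in_def ext_scalar.rep_eq\<close>)
    then show ?case using empty.prems(3)[of "{}"] by simp
  next
    case (insert i Y)
    have sub: "insert i Y - {i} \<subseteq> Y" by auto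
    obtain \<alpha> \<beta> where "\<alpha> \<in> ext_in (insert i Y - {i})" "\<beta> \<in> ext_in (insert i Y - {i})" and z: "z = gen_dt i * \<alpha> + \<beta>"
      using gen_dt_split[OF insert.prems(2)] by blast
    then have ab: "\<alpha> \<in> ext_in Y" "\<beta> \<in> ext_in Y" using ext_in_mono[OF _ sub] by auto
    define zs where "zs = remove1 i ys"
    have i: "i \<in> set ys" using insert.prems(1) by simp
    have zs: "distinct zs" "set zs = set ys - {i}" "length ys = Suc (length zs)"
      using ys i length_pos_if_in_set[OF i] by (simp_all add: zs_def length_remove1)
    let ?F = "poly (dickson_poly zs) (mvar i) :: 'a mpoly"
    have F: "?F \<noteq> 0" using zs by (intro poly_dickson_poly_nonzero) auto
    have add: "dickson_Q zs (x + y) = dickson_Q zs x + (dickson_Q zs y :: 'a coh)" for x y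
      by (simp add: dickson_Q_def milnor_Q_add distrib_left sum.distrib)
    have kill: "dickson_Q zs x = 0" if "x \<in> ext_in Y" for x :: "'a coh"
    proof -
      have "dickson_Q zs (ext_basis S) = (0 :: 'a coh)" if S: "S \<subseteq> Y" "finite S" for S
      proof -
        have "set (sorted_list_of_set S) \<subseteq> set zs" using S insert.prems(1) insert.hyps zs(2) by auto
        then obtain k where "dickson_Q zs (top_form (sorted_list_of_set S) * 1 :: 'a coh) =
            ext_scalar ((-1) ^ k) * (top_form (sorted_list_of_set S) * dickson_Q zs 1)"
          using dickson_Q_top_form[OF zs(1)] by blast
        moreover have "dickson_Q zs 1 = (0 :: 'a coh)" by (simp add: dickson_Q_def)
        ultimately show ?thesis unfolding ext_basis_eq_prod[OF S(2)] gen_dt_def[symmetric] by simp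
      qed
      moreover have scal: "dickson_Q zs (ext_scalar c * x) = ext_scalar c * (dickson_Q zs x :: 'a coh)" for c x
        by (simp only: dickson_Q_def milnor_Q_scalar_mult mult_scalar_left_commute[of _ c] sum_distrib_left)
      moreover have "dickson_Q zs (sum f A) = (\<Sum>S\<in>A. dickson_Q zs (f S :: 'a coh))" for f and A :: "nat set set"
        by (induction A rule: infinite_finite_induct) (simp_all add: add, simp_all add: dickson_Q_def)
      moreover have "S \<subseteq> Y \<and> finite S" if "ext_coeff x S \<noteq> 0" for S
        using \<open>x \<in> ext_in Y\<close> that ext_coeff_infinite by (auto simp: ext_in_def)
      ultimately have "dickson_Q zs (\<Sum>S | ext_coeff x S \<noteq> 0. ext_scalar (ext_coeff x S) * ext_basis S) = 0"
        by (intro trans[OF _ sum.neutral]) auto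
      then show ?thesis by (simp only: ext_expansion[of x, symmetric])
    qed
    have D: "dickson_Q zs z = ext_scalar ?F * \<alpha>"
      unfolding z add dickson_Q_gen_dt_mult[OF zs(1)] using kill ab by simp
    have "ext_coeff (milnor_Qs J \<alpha>) {} = 0" if J: "J \<subseteq> {..<length ys}" for J
    proof -
      have fJ: "finite J" using J finite_subset by blast
      have Qj: "ext_coeff (milnor_Qs J (milnor_Q j z)) {} = 0" if "j \<le> length zs" for j
      proof -
        obtain k where "milnor_Qs J (milnor_Q j z) =
            (if j \<in> J then 0 else ext_scalar ((-1) ^ k) * milnor_Qs (insert j J) z)"
          using milnor_Qs_milnor_Q[OF fJ] by blast
        moreover have "insert j J \<subseteq> {..<length ys}" using J that zs(3) by auto
        ultimately show ?thesis using insert.prems(3) by (simp add: ext_scalar.rep_eq)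
      qed
      have "ext_coeff (milnor_Qs J (dickson_Q zs z)) {} = 0"
        unfolding dickson_Q_def by (simp add: milnor_Qs_sum milnor_Qs_linear fJ Qj)
      then show ?thesis using F fJ by (simp add: D milnor_Qs_linear)
    qed
    then have "\<alpha> = 0" using insert.IH[of \<alpha>] insert.prems(1) ab by auto
    then have "z = \<beta>" using z by simp
    then show ?case using insert.IH[of z] insert.prems ab by auto
  qed
qed

text \<open>
  For exterior degree reasons a scalar part can only arise if \<open>I\<close> and \<open>J\<close> together make up all operations,
  and repeated operations give zero.
\<close>

lemma milnor_pairing:
  assumes "I \<subseteq> {..<length ys}" "J \<subseteq> {..<length ys}"
  shows "\<exists>k. ext_coeff (milnor_Qs J (milnor_Qs I (top_form ys))) {} =
    (if J = {..<length ys} - I then (-1) ^ k * dickson_det ys else (0 :: 'a mpoly))"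
proof -
  let ?n = "length ys"
  have fin: "finite I" "finite J" using assms finite_subset by blast+
  obtain k where k: "milnor_Qs J (milnor_Qs I (top_form ys :: 'a coh)) =
      (if I \<inter> J = {} then ext_scalar ((-1) ^ k) * milnor_Qs (J \<union> I) (top_form ys) else 0)"
    using milnor_Qs_milnor_Qs[OF fin] by blast
  show ?thesis
  proof (cases "J \<union> I = {..<?n}")
    case True
    have det: "ext_coeff (milnor_Qs (J \<union> I) (top_form ys :: 'a coh)) {} = dickson_det ys"
      unfolding True dickson_det_scalar by simp
    have iff: "I \<inter> J = {} \<longleftrightarrow> J = {..<?n} - I" using True by auto
    show ?thesis
    proof (cases "I \<inter> J = {}")
      case True
      show ?thesis unfolding k iff[symmetric] if_P[OF True] ext_coeff_scalar_mult det by (rule exI[of _ k]) (rule refl)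
    next
      case False
      show ?thesis unfolding k iff[symmetric] if_not_P[OF False] by simp
    qed
  next
    case False
    have "card (J \<union> I) < ?n"
      using psubset_card_mono[of "{..<?n}" "J \<union> I"] False assms by auto
    moreover have "hom_degree (?n - card (J \<union> I)) (milnor_Qs (J \<union> I) (top_form ys :: 'a coh))"
      using fin by (intro hom_degree_milnor_Qs hom_degree_top_form) simp
    ultimately have "ext_coeff (milnor_Qs (J \<union> I) (top_form ys :: 'a coh)) {} = 0"
      unfolding hom_degree_def by fastforce
    moreover have "J \<noteq> {..<?n} - I" using False assms by auto
    ultimately show ?thesis using k by simp
  qed
qed

lemma milnor_Qs_independent:
  assumes "distinct ys" "(\<Sum>I\<in>Pow {..<length ys}. ext_scalar (f I) * milnor_Qs I (top_form ys)) = (0 :: 'a coh)"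
    and "I \<subseteq> {..<length ys}"
  shows "f I = 0"
proof -
  let ?n = "length ys" let ?J = "{..<?n} - I"
  have pair: "ext_coeff (ext_scalar (f I') * milnor_Qs ?J (milnor_Qs I' (top_form ys))) {} = 0"
    if I': "I' \<in> Pow {..<?n}" "I' \<noteq> I" for I'
  proof -
    have "?J \<noteq> {..<?n} - I'" using I' assms(3) by blast
    then show ?thesis using milnor_pairing[of I' ys ?J] I' by auto
  qed
  have "ext_coeff (milnor_Qs ?J (\<Sum>I\<in>Pow {..<?n}. ext_scalar (f I) * milnor_Qs I (top_form ys) :: 'a coh)) {} = 0"
    unfolding assms(2) by (simp add: milnor_Qs_linear)
  then have "(\<Sum>I'\<in>Pow {..<?n}. ext_coeff (ext_scalar (f I') * milnor_Qs ?J (milnor_Qs I' (top_form ys))) {}) = 0"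
    by (simp add: milnor_Qs_sum milnor_Qs_linear)
  then have "ext_coeff (ext_scalar (f I) * milnor_Qs ?J (milnor_Qs I (top_form ys))) {} = 0"
    using sum.remove[of "Pow {..<?n}" I "\<lambda>I'. ext_coeff (ext_scalar (f I') * milnor_Qs ?J (milnor_Qs I' (top_form ys))) {}"]
      sum.neutral[of "Pow {..<?n} - {I}" "\<lambda>I'. ext_coeff (ext_scalar (f I') * milnor_Qs ?J (milnor_Qs I' (top_form ys))) {}"]
      pair assms(3) by simp
  moreover obtain k where "ext_coeff (milnor_Qs ?J (milnor_Qs I (top_form ys))) {} = (-1) ^ k * (dickson_det ys :: 'a mpoly)"
    using milnor_pairing[of I ys ?J] assms(3) by auto
  ultimately show ?thesis using dickson_det_nonzero[OF assms(1)] by simp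
qed

text \<open>
  Cramer's rule: the matrix of the scalar parts of the \<open>Q\<^sub>J Q\<^sub>I u\<close> has, up to order and signs, the
  determinant \<open>e\<close> on the diagonal and zeros elsewhere. Dividing the scalar parts of \<open>Q\<^sub>J x\<close> by \<open>e\<close> gives a
  combination with the same scalar parts as \<open>x\<close>.
\<close>

lemma milnor_Qs_expansion:
  fixes x :: "'a coh"
  assumes "distinct ys" "x \<in> ext_in (set ys)"
    and "\<And>J. J \<subseteq> {..<length ys} \<Longrightarrow> dickson_det ys dvd ext_coeff (milnor_Qs J x) {}"
  obtains f where "x = (\<Sum>I\<in>Pow {..<length ys}. ext_scalar (f I) * milnor_Qs I (top_form ys))"
proof -
  let ?n = "length ys" and ?u = "top_form ys :: 'a coh"
  have "\<exists>c. ext_coeff (milnor_Qs ({..<?n} - I) x) {} = c * ext_coeff (milnor_Qs ({..<?n} - I) (milnor_Qs I ?u)) {}"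
    if I: "I \<in> Pow {..<?n}" for I
  proof -
    obtain k where k: "ext_coeff (milnor_Qs ({..<?n} - I) (milnor_Qs I ?u)) {} = (-1) ^ k * dickson_det ys"
      using milnor_pairing[of I ys "{..<?n} - I"] I by auto
    obtain c where c: "ext_coeff (milnor_Qs ({..<?n} - I) x) {} = dickson_det ys * c"
      using assms(3)[of "{..<?n} - I"] by (auto elim: dvdE)
    have "dickson_det ys * c = (-1) ^ k * c * ((-1) ^ k * dickson_det ys)"
      by (cases "even k") (simp_all add: mult.commute)
    then show ?thesis unfolding k c by blast
  qed
  then obtain f where f: "ext_coeff (milnor_Qs ({..<?n} - I) x) {} =
      f I * ext_coeff (milnor_Qs ({..<?n} - I) (milnor_Qs I ?u)) {}" if "I \<in> Pow {..<?n}" for I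
    by metis
  define y where "y = (\<Sum>I\<in>Pow {..<?n}. ext_scalar (f I) * milnor_Qs I ?u)"
  have fin: "finite I" if "I \<subseteq> {..<?n}" for I using that finite_subset by blast
  have "x - y = 0"
  proof (rule milnor_nondegenerate[OF assms(1) order_refl])
    show "x - y \<in> ext_in (set ys)"
      unfolding y_def by (intro ext_in_diff assms(2) ext_in_sum ext_in_scalar_mult milnor_Qs_in top_form_in)
        (use fin in auto)
    fix J assume J: "J \<subseteq> {..<?n}"
    have J2: "J = {..<?n} - ({..<?n} - J)" using J by auto
    have "ext_coeff (milnor_Qs J y) {} = (\<Sum>I\<in>Pow {..<?n}. f I * ext_coeff (milnor_Qs J (milnor_Qs I ?u)) {})"
      unfolding y_def using fin[OF J] by (simp add: milnor_Qs_sum milnor_Qs_linear)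
    also have "\<dots> = (\<Sum>I\<in>Pow {..<?n}. if I = {..<?n} - J then ext_coeff (milnor_Qs J x) {} else 0)"
    proof (rule sum.cong[OF refl])
      fix I assume I: "I \<in> Pow {..<?n}"
      show "f I * ext_coeff (milnor_Qs J (milnor_Qs I ?u)) {} =
          (if I = {..<?n} - J then ext_coeff (milnor_Qs J x) {} else 0)"
      proof (cases "I = {..<?n} - J")
        case True
        then show ?thesis using f[OF I] J2 by simp
      next
        case False
        then have "J \<noteq> {..<?n} - I" using I by auto
        then show ?thesis using False milnor_pairing[of I ys J] I J by auto
      qed
    qed
    also have "\<dots> = ext_coeff (milnor_Qs J x) {}" by (subst sum.delta) auto
    finally show "ext_coeff (milnor_Qs J (x - y)) {} = 0" using fin[OF J] by (simp add: milnor_Qs_linear)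
  qed
  then show ?thesis using that[of f] by (simp add: y_def)
qed

text \<open>
  Multiplication by \<open>dl\<close> commutes with \<open>Q\<^sub>j\<close> up to sign and multiples of \<open>l\<close>. Hence if \<open>dl \<alpha>\<close>
  vanishes modulo \<open>l\<close>, then so does \<open>dl (Q\<^sub>J \<alpha>)\<close>, which contains \<open>dl\<close> times the scalar part of \<open>Q\<^sub>J \<alpha>\<close>.
\<close>

lemma lin_form_dvd_milnor_Qs:
  fixes \<alpha> y :: "'a coh" and a :: "nat \<Rightarrow> 'a" and A :: "nat set"
  defines "l \<equiv> (\<Sum>i\<in>A. mconst (a i) * mvar i)" and "dl \<equiv> (\<Sum>i\<in>A. ext_scalar (mconst (a i)) * gen_dt i)"
  assumes "finite A" "b \<in> A" "a b \<noteq> 0" "dl * \<alpha> = ext_scalar l * y" "finite J"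
  shows "l dvd ext_coeff (milnor_Qs J \<alpha>) {}"
proof -
  have Q: "milnor_Q j (dl * x) = ext_scalar (l ^ (CARD('a) ^ j)) * x - dl * milnor_Q j x" for j and x :: "'a coh"
  proof -
    have "milnor_Q j (dl * x) = (\<Sum>i\<in>A. ext_scalar (mconst (a i)) * milnor_Q j (gen_dt i * x))"
      unfolding dl_def sum_distrib_right by (simp only: milnor_Q_sum mult.assoc milnor_Q_scalar_mult)
    also have "\<dots> = (\<Sum>i\<in>A. ext_scalar (mconst (a i) * mvar i ^ (CARD('a) ^ j)) * x) - dl * milnor_Q j x"
      unfolding milnor_Q_gen_dt_mult dl_def sum_distrib_right sum_subtractf[symmetric]
      by (rule sum.cong[OF refl]) (simp only: right_diff_distrib mult.assoc ext_scalar_hom(5))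
    also have "(\<Sum>i\<in>A. ext_scalar (mconst (a i) * mvar i ^ (CARD('a) ^ j)) * x) = ext_scalar (l ^ (CARD('a) ^ j)) * x"
      unfolding l_def frob_linear_form ext_scalar_sum sum_distrib_right ..
    finally show ?thesis .
  qed
  have "\<exists>y. dl * milnor_Qs J \<alpha> = ext_scalar l * y"
  proof (rule milnor_Qs_induct[OF assms(7)])
    show "\<exists>y. dl * \<alpha> = ext_scalar l * y" using assms(6) by blast
    fix j and x :: "'a coh" assume "\<exists>y. dl * x = ext_scalar l * y"
    then obtain y where y: "dl * x = ext_scalar l * y" by blast
    have "dl * milnor_Q j x = ext_scalar (l ^ (CARD('a) ^ j)) * x - milnor_Q j (dl * x)"
      unfolding Q by simp
    also have "\<dots> = ext_scalar l * (ext_scalar (l ^ (CARD('a) ^ j - 1)) * x - milnor_Q j y)"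
    proof -
      have "l ^ (CARD('a) ^ j) = l * l ^ (CARD('a) ^ j - 1)"
        by (metis Suc_diff_1 card_pos power_Suc zero_less_power)
      then show ?thesis unfolding y milnor_Q_scalar_mult
        by (simp only: ext_scalar_hom(5) mult.assoc right_diff_distrib)
    qed
    finally show "\<exists>y. dl * milnor_Q j x = ext_scalar l * y" by (rule exI)
  qed
  then obtain y' where y': "dl * milnor_Qs J \<alpha> = ext_scalar l * y'" by blast
  have "ext_coeff (dl * milnor_Qs J \<alpha>) {b} =
      (\<Sum>i\<in>A. mconst (a i) * ext_coeff (gen_dt i * milnor_Qs J \<alpha>) {b})"
    unfolding dl_def sum_distrib_right by (simp add: mult.assoc)
  also have "\<dots> = (\<Sum>i\<in>A. if i = b then mconst (a b) * ext_coeff (milnor_Qs J \<alpha>) {} else 0)"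
  proof (rule sum.cong[OF refl])
    fix i
    have "{k. k = b \<and> k \<noteq> b \<and> k < b} = {}" by auto
    then show "mconst (a i) * ext_coeff (gen_dt i * milnor_Qs J \<alpha>) {b} =
        (if i = b then mconst (a b) * ext_coeff (milnor_Qs J \<alpha>) {} else 0)"
      by (cases "i = b") (simp_all add: ext_coeff_gen_dt_mult)
  qed
  also have "\<dots> = mconst (a b) * ext_coeff (milnor_Qs J \<alpha>) {}" using assms(3,4) by simp
  finally have "mconst (a b) * ext_coeff (milnor_Qs J \<alpha>) {} = l * ext_coeff y' {b}"
    unfolding y' by simp
  moreover have inv: "mconst (inverse (a b)) * mconst (a b) = 1"
    using assms(5) by (simp flip: mconst_hom(4))
  ultimately have "mconst (inverse (a b)) * (mconst (a b) * ext_coeff (milnor_Qs J \<alpha>) {}) = l * (mconst (inverse (a b)) * ext_coeff y' {b})"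
    by (simp only: mult_ac)
  then have "ext_coeff (milnor_Qs J \<alpha>) {} = l * (mconst (inverse (a b)) * ext_coeff y' {b})"
    using inv by (simp only: mult.assoc[symmetric] mult_1_left)
  then show ?thesis by simp
qed

subsection \<open>Linear substitutions\<close>

text \<open>
  Linear substitutions commute with \<open>Q\<^sub>j\<close> because \<open>l \<mapsto> l ^ (q ^ j)\<close> is linear on linear forms over the field
  with \<open>q\<close> elements.
\<close>

lemma milnor_Q_lin_subst: "milnor_Q j (lin_subst n h x) = lin_subst n h (milnor_Q j (x :: 'a coh))"
proof (induction x rule: coh_induct)
  case (gen_dt i x)
  have "milnor_Q j (lin_dt n h i * y) = ext_scalar (lin_t n h i ^ (CARD('a) ^ j)) * y - lin_dt n h i * milnor_Q j y"
    for y :: "'a coh"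
  proof -
    have "milnor_Q j (lin_dt n h i * y) = (\<Sum>k=1..n. ext_scalar (mconst (h $$ (i - 1, k - 1))) * milnor_Q j (gen_dt k * y))"
      unfolding lin_dt_def sum_distrib_right by (simp only: milnor_Q_sum mult.assoc milnor_Q_scalar_mult)
    also have "\<dots> = (\<Sum>k=1..n. ext_scalar (mconst (h $$ (i - 1, k - 1)) * mvar k ^ (CARD('a) ^ j)) * y) - lin_dt n h i * milnor_Q j y"
      unfolding milnor_Q_gen_dt_mult lin_dt_def sum_distrib_right sum_subtractf[symmetric]
      by (rule sum.cong[OF refl]) (simp only: right_diff_distrib mult.assoc ext_scalar_hom(5))
    also have "(\<Sum>k=1..n. ext_scalar (mconst (h $$ (i - 1, k - 1)) * mvar k ^ (CARD('a) ^ j)) * y) =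
        ext_scalar (lin_t n h i ^ (CARD('a) ^ j)) * y"
      unfolding lin_t_def frob_linear_form ext_scalar_sum sum_distrib_right ..
    finally show ?thesis .
  qed
  moreover have "lin_subst n h (x - y) = lin_subst n h x - lin_subst n h y" for x y :: "'a coh"
    using lin_subst_add[of n h "x - y" y] by simp
  ultimately show ?case using gen_dt
    by (simp add: lin_subst_gen_dt_mult milnor_Q_gen_dt_mult lin_subst_scalar_mult msubst_power)
qed (simp_all add: lin_subst_add milnor_Q_add lin_subst_scalar_mult milnor_Q_scalar_mult)

lemma milnor_Qs_lin_subst:
  "finite J \<Longrightarrow> milnor_Qs J (lin_subst n h x) = lin_subst n h (milnor_Qs J (x :: 'a coh))"
  by (induction rule: finite_linorder_min_induct) (simp_all add: milnor_Qs_insert_min milnor_Q_lin_subst)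

end

section \<open>Dickson invariants\<close>

subsection \<open>Degrees and derivatives in one variable\<close>

lemma lookup_mult_var_power:
  assumes "g \<in> mpolys_in (- {i})" "Poly_Mapping.lookup m i \<noteq> k"
  shows "Poly_Mapping.lookup (g * mvar i ^ k) m = 0"
proof (rule ccontr)
  assume "Poly_Mapping.lookup (g * mvar i ^ k) m \<noteq> 0"
  then have "m \<in> Poly_Mapping.keys (g * mvar i ^ k)" by (simp add: in_keys_iff)
  then obtain a where a: "a \<in> Poly_Mapping.keys g" "m = a + Poly_Mapping.single i k"
    using keys_mult[of g "mvar i ^ k"] unfolding mvar_power by (auto split: if_splits)
  have "Poly_Mapping.lookup a i = 0" using a(1) assms(1) by (auto simp: mpolys_in_def in_keys_iff)
  then show False using a(2) assms(2) by (simp add: lookup_add)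
qed

lemma coeff_to_uni_free: "poly.coeff (to_uni i f) k \<in> mpolys_in (- {i})"
  using coeff_to_uni_in[OF mpolys_in_UNIV, of i f k] by (simp add: Compl_eq_Diff_UNIV)

lemma coeff_to_uni_nonzero:
  assumes "m \<in> Poly_Mapping.keys f"
  shows "poly.coeff (to_uni i f) (Poly_Mapping.lookup m i) \<noteq> 0"
proof
  let ?p = "to_uni i f" and ?d = "Poly_Mapping.lookup m i"
  assume zero: "poly.coeff ?p ?d = 0"
  have "Poly_Mapping.lookup (poly.coeff ?p k * mvar i ^ k) m = 0" for k
    using zero lookup_mult_var_power[OF coeff_to_uni_free, of m i k f] by (cases "k = ?d") auto
  then have "Poly_Mapping.lookup (poly ?p (mvar i)) m = 0"
    unfolding poly_altdef lookup_sum by simp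
  then show False using assms by (simp add: in_keys_iff)
qed

lemma degree_to_uni_sum: "(\<And>x. x \<in> A \<Longrightarrow> degree (f x :: 'b::comm_ring_1 poly) \<le> D) \<Longrightarrow> degree (sum f A) \<le> D"
  by (induction A rule: infinite_finite_induct) (auto intro: degree_add_le)

lemma degree_prod_power_le:
  "degree (\<Prod>v\<in>K. (f v :: 'b::comm_ring_1 poly) ^ g v) \<le> (\<Sum>v\<in>K. degree (f v) * g v)"
proof (induction K rule: infinite_finite_induct)
  case (insert v K)
  have "degree (f v ^ g v * (\<Prod>v\<in>K. f v ^ g v)) \<le> degree (f v ^ g v) + degree (\<Prod>v\<in>K. f v ^ g v)"
    by (rule degree_mult_le)
  also have "\<dots> \<le> degree (f v) * g v + (\<Sum>v\<in>K. degree (f v) * g v)"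
    using insert.IH degree_power_le[of "f v" "g v"] by (rule add_mono[rotated])
  finally show ?case using insert.hyps by simp
qed simp_all

lemma degree_to_uni_msubst:
  assumes "\<And>v. degree (to_uni L (x v)) \<le> w v"
    and "\<And>m. m \<in> Poly_Mapping.keys P \<Longrightarrow> (\<Sum>v\<in>Poly_Mapping.keys m. w v * Poly_Mapping.lookup m v) \<le> D"
  shows "degree (to_uni L (msubst x P)) \<le> D"
proof -
  have prod: "to_uni L (prod f A) = (\<Prod>v\<in>A. to_uni L (f v))" for f and A :: "nat set"
    by (induction A rule: infinite_finite_induct) (simp_all add: to_uni_mult)
  have "degree (to_uni L (mconst (Poly_Mapping.lookup P m) *
      (\<Prod>v\<in>Poly_Mapping.keys m. x v ^ Poly_Mapping.lookup m v))) \<le> D"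
    if m: "m \<in> Poly_Mapping.keys P" for m
  proof -
    let ?q = "\<Prod>v\<in>Poly_Mapping.keys m. to_uni L (x v) ^ Poly_Mapping.lookup m v"
    have "degree ?q \<le> (\<Sum>v\<in>Poly_Mapping.keys m. degree (to_uni L (x v)) * Poly_Mapping.lookup m v)"
      by (rule degree_prod_power_le)
    also have "\<dots> \<le> (\<Sum>v\<in>Poly_Mapping.keys m. w v * Poly_Mapping.lookup m v)"
      by (intro sum_mono mult_right_mono assms(1)) simp
    also have "\<dots> \<le> D" by (rule assms(2)[OF m])
    finally have "degree ?q \<le> D" .
    then show ?thesis unfolding to_uni_mult to_uni_const prod to_uni_power
      using degree_smult_le[of "mconst (Poly_Mapping.lookup P m)" ?q] by simp
  qed
  then show ?thesis unfolding msubst_def to_uni_sum by (rule degree_to_uni_sum)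
qed

lemma degree_to_uni_le_iff:
  "degree (to_uni i f) \<le> D \<longleftrightarrow> (\<forall>m\<in>Poly_Mapping.keys f. Poly_Mapping.lookup m i \<le> D)"
proof
  assume "degree (to_uni i f) \<le> D"
  then show "\<forall>m\<in>Poly_Mapping.keys f. Poly_Mapping.lookup m i \<le> D"
    using coeff_to_uni_nonzero le_degree le_trans by blast
next
  assume le: "\<forall>m\<in>Poly_Mapping.keys f. Poly_Mapping.lookup m i \<le> D"
  have "degree (to_uni i (msubst mvar f)) \<le> D"
  proof (rule degree_to_uni_msubst[where w = "\<lambda>v. if v = i then 1 else 0"])
    show "degree (to_uni i (mvar v :: 'a mpoly)) \<le> (if v = i then 1 else 0)" for v
      by (simp add: to_uni_var)
    fix m assume m: "m \<in> Poly_Mapping.keys f"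
    have "(\<Sum>v\<in>Poly_Mapping.keys m. (if v = i then 1 else 0) * Poly_Mapping.lookup m v) =
        (\<Sum>v\<in>Poly_Mapping.keys m. if v = i then Poly_Mapping.lookup m i else 0)"
      by (rule sum.cong) auto
    also have "\<dots> \<le> Poly_Mapping.lookup m i" by (simp add: sum.delta)
    also have "\<dots> \<le> D" using le m by blast
    finally show "(\<Sum>v\<in>Poly_Mapping.keys m. (if v = i then 1 else 0) * Poly_Mapping.lookup m v) \<le> D" .
  qed
  then show "degree (to_uni i f) \<le> D" by simp
qed

lemma keys_msubst_zero: "Poly_Mapping.keys (msubst (mvar(a := 0)) f) \<subseteq> Poly_Mapping.keys f"
proof -
  have mono: "Poly_Mapping.keys (msubst (mvar(a := 0)) (Poly_Mapping.single m c)) \<subseteq> {m}" for m and c :: 'a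
  proof (cases "a \<in> Poly_Mapping.keys m")
    case True
    then have "Poly_Mapping.lookup m a \<noteq> 0" by (simp add: in_keys_iff)
    then have "(\<Prod>i\<in>Poly_Mapping.keys m. (mvar(a := 0)) i ^ Poly_Mapping.lookup m i) = (0 :: 'a mpoly)"
      using True prod.remove[of "Poly_Mapping.keys m" a "\<lambda>i. (mvar(a := 0 :: 'a mpoly)) i ^ Poly_Mapping.lookup m i"]
      by (simp add: power_0_left)
    then show ?thesis unfolding msubst_single by simp
  next
    case False
    then have "(\<Prod>i\<in>Poly_Mapping.keys m. (mvar(a := 0)) i ^ Poly_Mapping.lookup m i) =
        (\<Prod>i\<in>Poly_Mapping.keys m. mvar i ^ Poly_Mapping.lookup m i :: 'a mpoly)"
      by (intro prod.cong) auto
    then show ?thesis unfolding msubst_single by (simp flip: single_eq_mconst_prod)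
  qed
  have "Poly_Mapping.keys (\<Sum>m\<in>A. msubst (mvar(a := 0)) (Poly_Mapping.single m (Poly_Mapping.lookup f m))) \<subseteq> A"
    if "finite A" for A
    using that
  proof (induction A)
    case (insert m A)
    let ?s = "\<lambda>m. msubst (mvar(a := 0)) (Poly_Mapping.single m (Poly_Mapping.lookup f m))"
    have "Poly_Mapping.keys (\<Sum>m\<in>insert m A. ?s m) \<subseteq> Poly_Mapping.keys (?s m) \<union> Poly_Mapping.keys (\<Sum>m\<in>A. ?s m)"
      unfolding sum.insert[OF insert.hyps] by (rule Poly_Mapping.keys_add)
    also have "\<dots> \<subseteq> {m} \<union> A" by (rule Un_mono[OF mono insert.IH])
    finally show ?case by (simp only: insert_is_Un[symmetric])
  qed simp
  from this[OF finite_keys[of f]] show ?thesis by (simp flip: msubst_sum sum_monomials)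
qed

lemma lookup_msubst_scale:
  "Poly_Mapping.lookup (msubst (mvar(b := mconst c * mvar b)) P) m = c ^ Poly_Mapping.lookup m b * Poly_Mapping.lookup P m"
proof -
  have mono: "msubst (mvar(b := mconst c * mvar b)) (Poly_Mapping.single m d) =
      Poly_Mapping.single m (c ^ Poly_Mapping.lookup m b * d)" for m d
  proof -
    have "(\<Prod>i\<in>Poly_Mapping.keys m. (mvar(b := mconst c * mvar b)) i ^ Poly_Mapping.lookup m i) =
        (\<Prod>i\<in>Poly_Mapping.keys m. (if i = b then mconst c ^ Poly_Mapping.lookup m b else 1) * mvar i ^ Poly_Mapping.lookup m i)"
      by (rule prod.cong) (auto simp: power_mult_distrib)
    also have "\<dots> = mconst (c ^ Poly_Mapping.lookup m b) * (\<Prod>i\<in>Poly_Mapping.keys m. mvar i ^ Poly_Mapping.lookup m i)"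
      by (simp add: prod.distrib prod.delta mconst_power in_keys_iff)
    finally show ?thesis
      unfolding msubst_single single_eq_mconst_prod[of m "c ^ Poly_Mapping.lookup m b * d"]
      by (simp add: mult_ac)
  qed
  have "msubst (mvar(b := mconst c * mvar b)) P = msubst (mvar(b := mconst c * mvar b))
      (\<Sum>m\<in>Poly_Mapping.keys P. Poly_Mapping.single m (Poly_Mapping.lookup P m))"
    using sum_monomials[of P] by simp
  also have "\<dots> = (\<Sum>m\<in>Poly_Mapping.keys P.
      Poly_Mapping.single m (c ^ Poly_Mapping.lookup m b * Poly_Mapping.lookup P m))"
    by (simp only: msubst_sum mono)
  also have "Poly_Mapping.lookup \<dots> m = (\<Sum>m'\<in>Poly_Mapping.keys P.
      if m' = m then c ^ Poly_Mapping.lookup m b * Poly_Mapping.lookup P m else 0)"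
    unfolding lookup_sum by (intro sum.cong) (auto simp: lookup_single when_def)
  also have "\<dots> = c ^ Poly_Mapping.lookup m b * Poly_Mapping.lookup P m" by (simp add: in_keys_iff)
  finally show ?thesis .
qed

definition mderiv :: "nat \<Rightarrow> 'a::idom mpoly \<Rightarrow> 'a mpoly" where
  "mderiv i f = poly (pderiv (to_uni i f)) (mvar i)"

lemma mderiv_simps [simp]:
  "mderiv i (mconst c) = 0" "mderiv i (f + g) = mderiv i f + mderiv i g"
  "mderiv i (f * g) = mderiv i f * g + f * mderiv i g" "mderiv i (mvar j) = (if i = j then 1 else 0)"
  by (simp_all add: mderiv_def to_uni_hom pderiv_add pderiv_mult to_uni_var pderiv_pCons)

lemma msubst_zero_mderiv: "i \<noteq> a \<Longrightarrow> msubst (mvar(a := 0)) (mderiv i f) = mderiv i (msubst (mvar(a := 0)) f)"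
proof (induction f rule: mpoly_induct_UNIV)
  case (const c)
  then show ?case using mderiv_simps(1)[of i c] mderiv_simps(1)[of i 0] by simp
next
  case (var f j)
  have "mderiv i (0 :: 'a mpoly) = 0" using mderiv_simps(1)[of i 0] by simp
  with var show ?case by (simp add: msubst_hom)
qed (simp add: msubst_hom)

lemma poly_taylor: "\<exists>r. poly p (x + h) = poly p x + h * poly (pderiv p) x + h * h * (r :: 'b::idom)"
proof (induction p)
  case (pCons a p)
  then obtain r where r: "poly p (x + h) = poly p x + h * poly (pderiv p) x + h * h * r" by blast
  have "poly (pCons a p) (x + h) = poly (pCons a p) x + h * poly (pderiv (pCons a p)) x +
      h * h * (poly (pderiv p) x + (x + h) * r)"
    unfolding poly_pCons r pderiv_pCons poly_add by (simp add: algebra_simps)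
  then show ?case by blast
qed (simp add: exI[of _ 0])

context prime_order
begin

text \<open>
  The derivative multiplies the coefficients by exponents, which vanish in the field only if they are
  divisible by the characteristic.
\<close>

lemma mderiv_eq_0_imp_dvd:
  assumes "mderiv i f = 0" "m \<in> Poly_Mapping.keys (f :: 'a mpoly)"
  shows "CARD('a) dvd Poly_Mapping.lookup m i"
proof (cases "Poly_Mapping.lookup m i")
  case (Suc k)
  let ?p = "to_uni i f"
  have free: "poly.coeff (pderiv ?p) k \<in> mpolys_in (- {i})" for k
    unfolding coeff_pderiv of_nat_mpoly by (intro mpolys_in_mult mpolys_in_const coeff_to_uni_free)
  have "to_uni i (poly (pderiv ?p) (mvar i)) = pderiv ?p" by (rule to_uni_poly[OF free])
  then have "pderiv ?p = 0" using assms(1) by (simp add: mderiv_def)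
  then have "of_nat (Suc k) * poly.coeff ?p (Suc k) = 0" by (metis coeff_0 coeff_pderiv)
  moreover have "poly.coeff ?p (Suc k) \<noteq> 0" using coeff_to_uni_nonzero[OF assms(2), of i] Suc by simp
  ultimately have "of_nat (Suc k) = (0 :: 'a mpoly)" by (simp del: of_nat_Suc)
  then show ?thesis using Suc of_nat_eq_0_iff_char_dvd[where 'a = "'a mpoly", of "Suc k"]
    by (simp add: CHAR_mpoly CHAR_card del: of_nat_Suc)
qed simp

subsection \<open>Transvections\<close>

text \<open>
  The special linear group enters through the transvections, which generate it.
\<close>

definition transv_inv :: "nat list \<Rightarrow> 'a mpoly \<Rightarrow> bool" where
  "transv_inv ys f \<longleftrightarrow> (\<forall>i\<in>set ys. \<forall>j\<in>set ys. \<forall>c. i \<noteq> j \<longrightarrow>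
    msubst (mvar(i := mvar i + mconst c * mvar j)) f = f)"

lemma transv_invD:
  "transv_inv ys f \<Longrightarrow> i \<in> set ys \<Longrightarrow> j \<in> set ys \<Longrightarrow> i \<noteq> j \<Longrightarrow>
    msubst (mvar(i := mvar i + mconst c * mvar j)) f = f"
  by (auto simp: transv_inv_def)

lemma transv_inv_diff: "transv_inv ys f \<Longrightarrow> transv_inv ys g \<Longrightarrow> transv_inv ys (f - g)"
  by (auto simp: transv_inv_def msubst_diff)

lemma transv_inv_cancel:
  assumes "transv_inv ys (e * f)" "transv_inv ys e" "e \<noteq> 0"
  shows "transv_inv ys f"
  unfolding transv_inv_def
proof (intro ballI allI impI)
  fix i j c assume ij: "i \<in> set ys" "j \<in> set ys" "i \<noteq> j"
  have "e * msubst (mvar(i := mvar i + mconst c * mvar j)) f = e * f"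
    using transv_invD[OF assms(1) ij, of c] transv_invD[OF assms(2) ij, of c] by (simp add: msubst_mult)
  then show "msubst (mvar(i := mvar i + mconst c * mvar j)) f = f" using assms(3) by simp
qed

lemma transv_inv_form:
  assumes "transv_inv ys f" "i \<in> set ys" "finite A" "A \<subseteq> set ys - {i}"
  shows "msubst (mvar(i := mvar i + (\<Sum>j\<in>A. mconst (c j) * mvar j))) f = f"
  using assms(3,4)
proof (induction A)
  case empty
  then show ?case by (simp add: fun_upd_idem)
next
  case (insert j A)
  let ?v = "\<Sum>j\<in>A. mconst (c j) * mvar j :: 'a mpoly"
  have j: "j \<in> set ys" "j \<noteq> i" using insert.prems by auto
  have "msubst (mvar(i := mvar i + (\<Sum>j\<in>insert j A. mconst (c j) * mvar j))) f =
      msubst (mvar(i := mvar i + ?v)) (msubst (mvar(i := mvar i + mconst (c j) * mvar j)) f)"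
    unfolding msubst_msubst
    by (rule arg_cong[of _ _ "\<lambda>g. msubst g f"], rule ext) (use j insert.hyps in \<open>simp add: msubst_hom algebra_simps\<close>)
  also have "\<dots> = msubst (mvar(i := mvar i + ?v)) f"
    by (simp only: transv_invD[OF assms(1,2) j(1) j(2)[symmetric], of "c j"])
  also have "\<dots> = f" by (rule insert.IH) (use insert.prems in auto)
  finally show ?case .
qed

text \<open>
  Writing \<open>f(u, v)\<close> for the substitution of \<open>u\<close> and \<open>v\<close> for two of the variables, invariance under
  transvections gives \<open>f(x, y) = f(c y, - x / c)\<close>, and by iteration invariance under the diagonal
  matrices of determinant 1.
\<close>

lemma transv_inv_torus:
  assumes f: "transv_inv ys f" and ij: "i \<in> set ys" "j \<in> set ys" "i \<noteq> j" and c: "c \<noteq> 0"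
  shows "msubst (mvar(i := mconst c * mvar i, j := mconst (inverse c) * mvar j)) f = f"
proof -
  let ?s = "\<lambda>u v. msubst (mvar(i := u, j := v)) f"
  have 1: "?s (u + mconst d * v) v = ?s u v" for u v d
  proof -
    have "?s u v = msubst (mvar(i := u, j := v)) (msubst (mvar(i := mvar i + mconst d * mvar j)) f)"
      by (simp only: transv_invD[OF f ij])
    also have "\<dots> = ?s (u + mconst d * v) v"
      unfolding msubst_msubst
      by (rule arg_cong[of _ _ "\<lambda>g. msubst g f"], rule ext) (use ij in \<open>simp add: msubst_hom\<close>)
    finally show ?thesis by simp
  qed
  have 2: "?s u (v + mconst d * u) = ?s u v" for u v d
  proof -
    have "?s u v = msubst (mvar(i := u, j := v)) (msubst (mvar(j := mvar j + mconst d * mvar i)) f)"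
      by (simp only: transv_invD[OF f ij(2,1) ij(3)[symmetric]])
    also have "\<dots> = ?s u (v + mconst d * u)"
      unfolding msubst_msubst
      by (rule arg_cong[of _ _ "\<lambda>g. msubst g f"], rule ext) (use ij in \<open>simp add: msubst_hom\<close>)
    finally show ?thesis by simp
  qed
  have 3: "?s (mconst d * v) (mconst (- inverse d) * u) = ?s u v" if "d \<noteq> 0" for u v d
  proof -
    have dd: "mconst d * (mconst (inverse d) * w) = w" "mconst (inverse d) * (mconst d * w) = w" for w :: "'a mpoly"
      using that by (simp_all flip: mult.assoc mconst_hom(4))
    have "?s u v = ?s (u + mconst d * v) v" by (simp only: 1)
    also have "\<dots> = ?s (u + mconst d * v) (v + mconst (- inverse d) * (u + mconst d * v))" by (simp only: 2)
    also have "v + mconst (- inverse d) * (u + mconst d * v) = mconst (- inverse d) * u"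
      by (simp add: mconst_uminus distrib_left dd)
    also have "?s (u + mconst d * v) (mconst (- inverse d) * u) =
        ?s (u + mconst d * v + mconst d * (mconst (- inverse d) * u)) (mconst (- inverse d) * u)" by (simp only: 1)
    also have "u + mconst d * v + mconst d * (mconst (- inverse d) * u) = mconst d * v"
      by (simp add: mconst_uminus dd)
    finally show ?thesis by (rule sym)
  qed
  have "?s (mconst c * mvar i) (mconst (inverse c) * mvar j) =
      ?s (mconst (- 1) * (mconst (- c) * mvar i)) (mconst (- inverse (- 1)) * (mconst (inverse c) * mvar j))"
    by (simp add: mconst_uminus)
  also have "\<dots> = ?s (mconst (inverse c) * mvar j) (mconst (- c) * mvar i)" by (rule 3) simp
  also have "\<dots> = ?s (mconst (inverse c) * mvar j) (mconst (- inverse (inverse c)) * mvar i)" by simp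
  also have "\<dots> = ?s (mvar i) (mvar j)" by (rule 3) (use c in simp)
  also have "\<dots> = f" by (simp add: fun_upd_idem)
  finally show ?thesis .
qed

text \<open>
  A composition of transvections carries \<open>t\<^sub>a\<close> to any given linear form that is not a multiple of \<open>t\<^sub>a\<close>,
  and it fixes \<open>f\<close>.
\<close>

lemma transv_inv_dvd_forms:
  assumes f: "transv_inv ys f" and a: "a \<in> set ys" "mvar a dvd f" and l: "l \<in> lin_forms ys" "l \<noteq> 0"
  shows "l dvd f"
proof -
  obtain c where c: "l = (\<Sum>i\<in>set ys. mconst (c i) * mvar i)" using l by (auto simp: lin_forms_def)
  have dvd: "msubst s k dvd msubst s f" if "k dvd f" for s k
    using that by (auto elim!: dvdE simp: msubst_mult)
  show ?thesis
  proof (cases "\<exists>b\<in>set ys - {a}. c b \<noteq> 0")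
    case False
    then have "l = (\<Sum>i\<in>set ys. if i = a then mconst (c a) * mvar a else 0)"
      unfolding c by (intro sum.cong) auto
    then have la: "l = mconst (c a) * mvar a" using a by simp
    then have "c a \<noteq> 0" using l by auto
    then have "mvar a = mconst (inverse (c a)) * l" unfolding la by (simp flip: mult.assoc mconst_hom(4))
    then have "l dvd mvar a" by simp
    from this a(2) show ?thesis by (rule dvd_trans)
  next
    case True
    then obtain b where b: "b \<in> set ys" "b \<noteq> a" "c b \<noteq> 0" by auto
    have "mvar a + mconst (c b) * mvar b dvd f"
      using dvd[OF a(2), of "mvar(a := mvar a + mconst (c b) * mvar b)"] transv_invD[OF f a(1) b(1), of "c b"] b by simp
    note step = dvd[OF this]
    define d where "d j = inverse (c b) * (if j = a then c a - 1 else c j)" for j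
    let ?A = "set ys - {b}"
    have "mvar a + mconst (c b) * (mvar b + (\<Sum>j\<in>?A. mconst (d j) * mvar j)) dvd f"
      using step[of "mvar(b := mvar b + (\<Sum>j\<in>?A. mconst (d j) * mvar j))"]
        transv_inv_form[OF f b(1), of ?A d] b by (simp add: msubst_hom)
    also have "mvar a + mconst (c b) * (mvar b + (\<Sum>j\<in>?A. mconst (d j) * mvar j)) = l"
    proof -
      have "mconst (c b) * (\<Sum>j\<in>?A. mconst (d j) * mvar j) =
          (\<Sum>j\<in>?A. mconst (if j = a then c a - 1 else c j) * mvar j)"
        unfolding sum_distrib_left by (rule sum.cong[OF refl]) (use b in \<open>simp add: d_def flip: mult.assoc mconst_hom(4)\<close>)
      also have "\<dots> = (\<Sum>j\<in>?A. mconst (c j) * mvar j) - mvar a"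
      proof -
        have "(\<Sum>j\<in>?A. mconst (if j = a then c a - 1 else c j) * mvar j) =
            (\<Sum>j\<in>?A. mconst (c j) * mvar j + (if j = a then - mvar a else 0))"
          by (rule sum.cong[OF refl])
            (auto simp: mconst_uminus left_diff_distrib diff_conv_add_uminus[of "c a" 1] distrib_right
              simp del: add_uminus_conv_diff)
        then show ?thesis using a b by (simp add: sum.distrib)
      qed
      finally have "mconst (c b) * (\<Sum>j\<in>?A. mconst (d j) * mvar j) = (\<Sum>j\<in>?A. mconst (c j) * mvar j) - mvar a" .
      moreover have "l = mconst (c b) * mvar b + (\<Sum>j\<in>?A. mconst (c j) * mvar j)"
        unfolding c using b by (simp add: sum.remove)
      ultimately show ?thesis by (simp add: distrib_left)
    qed
    finally show ?thesis .
  qed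
qed

text \<open>
  Modulo \<open>t\<^sub>a ^ 2\<close>, the transvection \<open>t\<^sub>i \<mapsto> t\<^sub>i + t\<^sub>a\<close> changes \<open>f\<close> by \<open>t\<^sub>a\<close> times its derivative
  with respect to \<open>t\<^sub>i\<close>, which therefore vanishes for \<open>t\<^sub>a = 0\<close>.
\<close>

lemma transv_inv_restrict_exps:
  assumes f: "transv_inv ys f" and ia: "i \<in> set ys" "a \<in> set ys" "i \<noteq> a"
    and m: "m \<in> Poly_Mapping.keys (msubst (mvar(a := 0)) f)"
  shows "CARD('a) dvd Poly_Mapping.lookup m i"
proof (rule mderiv_eq_0_imp_dvd[OF _ m])
  let ?p = "to_uni i f" and ?r = "msubst (mvar(a := 0)) :: 'a mpoly \<Rightarrow> 'a mpoly"
  obtain r where r: "poly ?p (mvar i + mvar a) = poly ?p (mvar i) + mvar a * poly (pderiv ?p) (mvar i) + mvar a * mvar a * r"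
    using poly_taylor by blast
  have "poly ?p (mvar i + mvar a) = f"
    using transv_invD[OF f ia, of 1] unfolding poly_to_uni by simp
  then have "mvar a * (mderiv i f + mvar a * r) = 0"
    using r by (simp add: mderiv_def algebra_simps)
  then have "mderiv i f = - mvar a * r" by (simp add: eq_neg_iff_add_eq_0)
  then have "?r (mderiv i f) = 0" by (simp add: msubst_hom)
  then show "mderiv i (?r f) = 0" using ia by (simp add: msubst_zero_mderiv)
qed

end

subsection \<open>The generators\<close>

definition position :: "nat list \<Rightarrow> nat \<Rightarrow> nat" where
  "position ys v = length (takeWhile (\<lambda>w. w \<noteq> v) ys)"

lemma position_Cons: "position (y # ys) v = (if v = y then 0 else Suc (position ys v))"
  by (simp add: position_def)

definition dickson_coeff :: "nat list \<Rightarrow> nat \<Rightarrow> 'a::{finite,field} mpoly" where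
  "dickson_coeff ys i = (-1) ^ (length ys - i) * poly.coeff (dickson_poly ys) (CARD('a) ^ i)"

lemma dickson_c_eq: "dickson_c ys i = ext_scalar (dickson_coeff ys i)"
  by (simp add: dickson_c_def dickson_coeff_def dickson_poly_def)

text \<open>
  The Dickson invariants are numbered by the variables in \<open>ys\<close>, the first of which is sent to
  the determinant; the remaining variables are parameters. Thus Dickson's theorem becomes the
  statement that the substitution \<open>dickson_gen ys\<close> is an isomorphism of the polynomial ring onto
  the ring of invariants.
\<close>

definition dickson_gen :: "nat list \<Rightarrow> nat \<Rightarrow> 'a::{finite,field} mpoly" where
  "dickson_gen ys v = (if v \<notin> set ys then mvar v
     else if position ys v = 0 then dickson_det ys else dickson_coeff ys (position ys v))"

lemma coeff_prod_linear_msubst: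
  "msubst s (poly.coeff (\<Prod>y\<in>A. [:f y, 1:]) k) = poly.coeff (\<Prod>y\<in>A. [:msubst s (f y), 1:]) k"
proof (induction A arbitrary: k rule: infinite_finite_induct)
  case (insert y A)
  then show ?case
    by (simp add: msubst_hom coeff_pCons split: nat.split)
qed (simp_all add: coeff_1)

lemma coeff_dickson_poly_msubst:
  assumes "bij_betw (msubst s) (lin_forms ys) (lin_forms ys)"
  shows "msubst s (poly.coeff (dickson_poly ys) k) = poly.coeff (dickson_poly ys) k"
proof -
  have "(\<Prod>y\<in>lin_forms ys. [:msubst s y, 1:]) = (\<Prod>y\<in>lin_forms ys. [:y, 1:])"
    by (rule prod.reindex_bij_betw[OF assms])
  then show ?thesis unfolding dickson_poly_def coeff_prod_linear_msubst by simp
qed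

lemma dickson_coeff_msubst:
  "bij_betw (msubst s) (lin_forms ys) (lin_forms ys) \<Longrightarrow> msubst s (dickson_coeff ys i) = dickson_coeff ys i"
  by (simp add: dickson_coeff_def msubst_hom msubst_sign coeff_dickson_poly_msubst)

lemma bij_betw_lin_forms:
  fixes s t :: "nat \<Rightarrow> 'a::{finite,comm_ring_1} mpoly"
  assumes "\<And>i. i \<in> set ys \<Longrightarrow> s i \<in> lin_forms ys" "\<And>i. i \<in> set ys \<Longrightarrow> msubst t (s i) = mvar i"
  shows "bij_betw (msubst s) (lin_forms ys) (lin_forms ys)"
proof -
  have lin: "msubst s v \<in> lin_forms ys" if v: "v \<in> lin_forms ys" for v
  proof -
    obtain a where "v = (\<Sum>i\<in>set ys. mconst (a i) * mvar i)" using v by (auto simp: lin_forms_def)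
    then show ?thesis by (simp add: msubst_hom assms(1) lin_forms_sum lin_forms_scale)
  qed
  have "inj_on (msubst s) (lin_forms ys)"
  proof (rule inj_on_inverseI)
    fix v :: "'a mpoly" assume "v \<in> lin_forms ys"
    then show "msubst t (msubst s v) = v"
      unfolding msubst_msubst by (intro msubst_id_on[OF lin_forms_in] assms(2))
  qed
  moreover have "msubst s ` lin_forms ys \<subseteq> lin_forms ys" using lin by blast
  ultimately show ?thesis by (simp add: bij_betw_def endo_inj_surj)
qed

lemma bij_betw_lin_forms_transv:
  assumes "i \<in> set ys" "j \<in> set ys" "i \<noteq> j"
  shows "bij_betw (msubst (mvar(i := mvar i + mconst c * mvar j))) (lin_forms ys) (lin_forms ys :: 'a::{finite,comm_ring_1} mpoly set)"
proof (rule bij_betw_lin_forms[where t = "mvar(i := mvar i - mconst c * mvar j)"])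
  fix k assume k: "k \<in> set ys"
  show "(mvar(i := mvar i + mconst c * mvar j)) k \<in> (lin_forms ys :: 'a mpoly set)"
    using k assms by (simp add: lin_forms_add lin_forms_scale lin_forms_var)
  show "msubst (mvar(i := mvar i - mconst c * mvar j)) ((mvar(i := mvar i + mconst c * mvar j)) k) = (mvar k :: 'a mpoly)"
    using assms(3) by (simp add: msubst_hom)
qed

lemma bij_betw_lin_forms_scale:
  fixes c :: "'a::{finite,field}"
  assumes "c \<noteq> 0"
  shows "bij_betw (msubst (mvar(i := mconst c * mvar i))) (lin_forms ys) (lin_forms ys)"
proof (rule bij_betw_lin_forms[where t = "mvar(i := mconst (inverse c) * mvar i)"])
  fix k assume k: "k \<in> set ys"
  show "(mvar(i := mconst c * mvar i)) k \<in> lin_forms ys"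
    using k by (cases "k = i") (auto intro: lin_forms_scale lin_forms_var)
  show "msubst (mvar(i := mconst (inverse c) * mvar i)) ((mvar(i := mconst c * mvar i)) k) = mvar k"
    using assms by (simp add: msubst_hom flip: mult.assoc mconst_hom(4))
qed

lemma dickson_coeff_in: "dickson_coeff ys i \<in> mpolys_in (set ys)"
  unfolding dickson_coeff_def
  by (intro mpolys_in_mult mpolys_in_power mpolys_in_uminus mpolys_in_1 coeff_dickson_poly_in)

lemma gen_dt_top_form:
  "gen_dt i * top_form zs = ext_scalar ((-1) ^ length zs) * (top_form zs * gen_dt i :: 'a::comm_ring_1 coh)"
proof (induction zs)
  case (Cons z zs)
  have "gen_dt i * top_form (z # zs) = - (gen_dt z * (gen_dt i * top_form zs) :: 'a coh)"
    by (simp add: gen_dt_anticomm[of i z])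
  also have "\<dots> = ext_scalar ((-1) ^ length (z # zs)) * (top_form (z # zs) * gen_dt i)"
    unfolding Cons.IH mult_scalar_left_commute[of "gen_dt z"] by (simp add: mult.assoc)
  finally show ?case .
qed simp

lemma top_form_swap_end:
  "\<exists>k. top_form (xs @ i # zs) = ext_scalar ((-1) ^ k) * (top_form (xs @ zs @ [i]) :: 'a::comm_ring_1 coh)"
proof -
  have "top_form (xs @ i # zs) = top_form xs * (gen_dt i * top_form zs :: 'a coh)" by simp
  also have "\<dots> = ext_scalar ((-1) ^ length zs) * top_form (xs @ zs @ [i])"
    unfolding gen_dt_top_form mult_scalar_left_commute[of "top_form xs"] by simp
  finally show ?thesis by (rule exI)
qed

context prime_order
begin

text \<open>
  Moving \<open>dt\<^sub>i\<close> to the end of the product only changes the sign, so that any variable can play the part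
  of the last one.
\<close>

lemma dickson_det_expand:
  assumes "distinct ys" "i \<in> set ys"
  shows "\<exists>k. (dickson_det ys :: 'a mpoly) =
    (-1) ^ k * dickson_det (remove1 i ys) * poly (dickson_poly (remove1 i ys)) (mvar i)"
proof -
  obtain xs zs where ys: "ys = xs @ i # zs" using assms(2) split_list by metis
  then have rem: "remove1 i ys = xs @ zs" using assms(1) by (simp add: remove1_append)
  have dist: "distinct (xs @ zs)" using assms(1) ys by auto
  obtain k where k: "top_form ys = ext_scalar ((-1) ^ k) * (top_form ((xs @ zs) @ [i]) :: 'a coh)"
    using top_form_swap_end[of xs i zs] ys by auto
  have len: "length ys = length ((xs @ zs) @ [i])" using ys by simp
  have "ext_scalar (dickson_det ys :: 'a mpoly) = milnor_Qs {..<length ys} (top_form ys)"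
    by (rule dickson_det_scalar[symmetric])
  also have "\<dots> = ext_scalar ((-1) ^ k) * milnor_Qs {..<length ((xs @ zs) @ [i])} (top_form ((xs @ zs) @ [i]))"
    unfolding k len by (rule milnor_Qs_linear(2)) simp
  also have "\<dots> = ext_scalar ((-1) ^ k * dickson_det ((xs @ zs) @ [i]))"
    unfolding dickson_det_scalar ext_scalar_hom(5) ..
  finally have 1: "(dickson_det ys :: 'a mpoly) = (-1) ^ k * dickson_det ((xs @ zs) @ [i])"
    by (simp only: ext_scalar_inj)
  obtain k' where "(dickson_det ((xs @ zs) @ [i]) :: 'a mpoly) =
      (-1) ^ k' * dickson_det (xs @ zs) * poly (dickson_poly (xs @ zs)) (mvar i)"
    using dickson_det_snoc[OF dist] by blast
  then show ?thesis unfolding 1 rem by (intro exI[of _ "k + k'"]) (simp add: power_add mult.assoc)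
qed

text \<open>
  The determinant is linear in \<open>F(t\<^sub>i)\<close>, where \<open>F\<close> is the Dickson polynomial of the other variables. It is
  homogeneous over the field and vanishes on \<open>v\<close>.
\<close>

lemma dickson_det_subst:
  assumes "distinct ys" "i \<in> set ys" "v \<in> lin_forms (remove1 i ys)"
  shows "msubst (mvar(i := mconst c * mvar i + v)) (dickson_det ys) = mconst c * (dickson_det ys :: 'a mpoly)"
proof -
  let ?zs = "remove1 i ys" and ?s = "mvar(i := mconst c * mvar i + v) :: nat \<Rightarrow> 'a mpoly"
  have zs: "distinct ?zs" "i \<notin> set ?zs" using assms(1) by auto
  obtain k where k: "(dickson_det ys :: 'a mpoly) = (-1) ^ k * dickson_det ?zs * poly (dickson_poly ?zs) (mvar i)"
    using dickson_det_expand[OF assms(1,2)] by blast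
  have free: "msubst ?s f = f" if "f \<in> mpolys_in (set ?zs)" for f
    by (rule msubst_id_on[OF that]) (use zs in auto)
  have "msubst ?s (poly (dickson_poly ?zs) (mvar i)) = poly (dickson_poly ?zs) (mconst c * mvar i + v)"
    unfolding poly_dickson_poly msubst_prod msubst_add
    by (rule prod.cong[OF refl]) (simp add: free lin_forms_in)
  also have "\<dots> = poly (dickson_poly ?zs) (v + mconst c * mvar i)" by (simp add: add.commute)
  also have "\<dots> = mconst c * poly (dickson_poly ?zs) (mvar i)"
    unfolding poly_dickson_poly_linear[OF zs(1)] using assms(3) by (simp add: poly_dickson_poly_eq_0_iff)
  finally have F: "msubst ?s (poly (dickson_poly ?zs) (mvar i)) = mconst c * poly (dickson_poly ?zs) (mvar i)" .
  show ?thesis unfolding k msubst_mult msubst_sign F free[OF dickson_det_in[OF zs(1)]] by (simp only: mult_ac)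
qed

lemma transv_inv_dickson_gen:
  assumes "distinct ys"
  shows "transv_inv ys (dickson_gen ys v :: 'a mpoly)"
  unfolding transv_inv_def
proof (intro ballI allI impI)
  fix i j and c :: 'a assume ij: "i \<in> set ys" "j \<in> set ys" "i \<noteq> j"
  have "mconst c * mvar j \<in> lin_forms (remove1 i ys)"
    using ij assms by (intro lin_forms_scale lin_forms_var) simp
  from dickson_det_subst[OF assms ij(1) this, of 1] have
    "msubst (mvar(i := mvar i + mconst c * mvar j)) (dickson_det ys) = dickson_det ys" by simp
  moreover have "msubst (mvar(i := mvar i + mconst c * mvar j)) (dickson_coeff ys k) = dickson_coeff ys k" for k
    by (rule dickson_coeff_msubst[OF bij_betw_lin_forms_transv[OF ij]])
  moreover have "v \<notin> set ys \<Longrightarrow> v \<noteq> i" using ij by auto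
  ultimately show "msubst (mvar(i := mvar i + mconst c * mvar j)) (dickson_gen ys v) = dickson_gen ys v"
    by (simp add: dickson_gen_def)
qed

lemma dickson_gen_in: "distinct ys \<Longrightarrow> (dickson_gen ys v :: 'a mpoly) \<in> mpolys_in (insert v (set ys))"
  unfolding dickson_gen_def
  using dickson_det_in[of ys] dickson_coeff_in[of ys "position ys v"] by (auto intro: mpolys_in_mono)

lemma transv_inv_msubst:
  assumes "\<And>v. transv_inv ys (x v)" shows "transv_inv ys (msubst x P)"
  unfolding transv_inv_def
proof (intro ballI allI impI)
  fix i j c assume "i \<in> set ys" "j \<in> set ys" "i \<noteq> j"
  then have "(\<lambda>v. msubst (mvar(i := mvar i + mconst c * mvar j)) (x v)) = x"
    using assms by (intro ext transv_invD)
  then show "msubst (mvar(i := mvar i + mconst c * mvar j)) (msubst x P) = msubst x P"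
    unfolding msubst_msubst by (rule arg_cong)
qed

lemma dickson_poly_power:
  assumes "distinct ys"
  shows "poly.coeff ((dickson_poly ys :: 'a mpoly poly) ^ CARD('a)) (CARD('a) ^ Suc i) =
      poly.coeff (dickson_poly ys) (CARD('a) ^ i) ^ CARD('a)"
    and "poly.coeff ((dickson_poly ys :: 'a mpoly poly) ^ CARD('a)) 1 = 0"
proof -
  let ?q = "CARD('a)" and ?n = "length ys" and ?F = "dickson_poly ys :: 'a mpoly poly"
  let ?a = "\<lambda>j. poly.coeff ?F (?q ^ j)"
  have Fq: "?F ^ ?q = (\<Sum>j\<le>?n. monom (?a j ^ ?q) (?q ^ Suc j))"
  proof (rule poly_eqI_infinite[OF infinite_mpoly])
    fix x :: "'a mpoly"
    have "poly ?F x = poly (\<Sum>j\<le>?n. monom (?a j) (?q ^ j)) x"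
      by (rule arg_cong[OF dickson_poly_expansion(1)[OF assms]])
    then have "poly (?F ^ ?q) x = (\<Sum>j\<le>?n. ?a j * x ^ (?q ^ j)) ^ ?q"
      by (simp add: poly_sum poly_monom)
    also have "\<dots> = (\<Sum>j\<le>?n. (?a j * x ^ (?q ^ j)) ^ ?q)"
      by (rule frob_sum[of _ _ 1, simplified])
    also have "\<dots> = poly (\<Sum>j\<le>?n. monom (?a j ^ ?q) (?q ^ Suc j)) x"
      by (simp add: poly_sum poly_monom power_mult_distrib mult.commute[of "?q"] power_mult)
    finally show "poly (?F ^ ?q) x = poly (\<Sum>j\<le>?n. monom (?a j ^ ?q) (?q ^ Suc j)) x" .
  qed
  have top: "?a j = 0" if "j > ?n" for j
  proof (rule coeff_eq_0)
    show "degree ?F < ?q ^ j" unfolding degree_dickson_poly(1)[OF assms]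
      using card_gt_1 that by (rule power_strict_increasing[rotated])
  qed
  have "poly.coeff (?F ^ ?q) (?q ^ Suc i) = (\<Sum>j\<le>?n. if j = i then ?a i ^ ?q else 0)"
    unfolding Fq coeff_sum by (rule sum.cong[OF refl]) (auto simp: power_card_inj simp del: power_Suc)
  also have "\<dots> = ?a i ^ ?q" using top[of i] by (auto simp: not_le)
  finally show "poly.coeff (?F ^ ?q) (?q ^ Suc i) = ?a i ^ ?q" .
  have "?q ^ Suc j \<noteq> 1" for j using power_card_inj[of "Suc j" 0] by simp
  then show "poly.coeff (?F ^ ?q) 1 = 0" unfolding Fq coeff_sum by (intro sum.neutral) auto
qed

text \<open>
  Both sides satisfy the same recursion in the number of variables.
\<close>

lemma dickson_coeff_0:
  "distinct ys \<Longrightarrow> dickson_coeff ys 0 = (dickson_det ys :: 'a mpoly) ^ (CARD('a) - 1)"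
proof (induction ys rule: rev_induct)
  case Nil
  have "(dickson_poly [] :: 'a mpoly poly) = monom 1 1" by (simp add: dickson_poly_def monom_altdef)
  then show ?case by (simp add: dickson_coeff_def)
next
  case (snoc z ys)
  let ?q = "CARD('a)" and ?F = "dickson_poly ys :: 'a mpoly poly"
  let ?B = "poly ?F (mvar z) ^ (?q - 1)"
  have ys: "distinct ys" "distinct (z # ys)" using snoc.prems by auto
  obtain k where k: "(dickson_det (ys @ [z]) :: 'a mpoly) = (-1) ^ k * dickson_det ys * poly ?F (mvar z)"
    using dickson_det_snoc[OF ys(1)] by blast
  have "(- 1 :: 'a mpoly) ^ (?q - 1) = 1"
    using power_card_minus_1[of "- 1"] by (metis mconst_hom(2) mconst_power mconst_uminus neg_equal_0_iff_equal zero_neq_one)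
  then have sgn: "((-1 :: 'a mpoly) ^ k) ^ (?q - 1) = 1" by (metis power_commutes power_mult mult.commute power_one)
  have "(dickson_poly (ys @ [z]) :: 'a mpoly poly) = dickson_poly (z # ys)" by (rule dickson_poly_cong) simp
  also have "\<dots> = ?F ^ ?q - smult ?B ?F" by (rule dickson_poly_Cons[OF ys(2)])
  finally have "poly.coeff (dickson_poly (ys @ [z]) :: 'a mpoly poly) 1 = - (?B * poly.coeff ?F 1)"
    using dickson_poly_power(2)[OF ys(1)] by simp
  then have "dickson_coeff (ys @ [z]) 0 = (?B * dickson_coeff ys 0 :: 'a mpoly)"
    by (simp add: dickson_coeff_def)
  also have "\<dots> = dickson_det (ys @ [z]) ^ (?q - 1)"
    unfolding k snoc.IH[OF ys(1)] power_mult_distrib sgn by simp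
  finally show ?case .
qed

text \<open>
  Setting the first variable to \<open>0\<close> turns the Dickson invariants in \<open>n\<close> variables into those in
  \<open>n - 1\<close> variables, evaluated at the \<open>q\<close>-th powers.
\<close>

lemma dickson_coeff_restrict:
  assumes "distinct (a # ys)"
  shows "msubst (mvar(a := 0)) (dickson_coeff (a # ys) (Suc i)) =
    var_powers (set ys) CARD('a) (dickson_coeff ys i :: 'a mpoly)"
proof -
  let ?q = "CARD('a)" and ?F = "dickson_poly ys :: 'a mpoly poly" and ?r = "msubst (mvar(a := 0)) :: 'a mpoly \<Rightarrow> 'a mpoly"
  have ys: "distinct ys" "a \<notin> set ys" using assms by auto
  have free: "?r f = f" if "f \<in> mpolys_in (set ys)" for f
    by (rule msubst_id_on[OF that]) (use ys in auto)
  have "poly ?F 0 = 0" by (simp add: poly_dickson_poly_eq_0_iff)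
  moreover have "?r (poly ?F (mvar a)) = poly ?F 0"
    unfolding poly_dickson_poly msubst_prod msubst_add
    by (rule prod.cong[OF refl]) (simp add: free lin_forms_in)
  ultimately have Fa: "?r (poly ?F (mvar a)) = 0" by simp
  have "?q - 1 > 0" using card_gt_1 by simp
  then have Fa': "?r (poly ?F (mvar a) ^ (?q - 1)) = 0" unfolding msubst_power Fa by simp
  have co: "poly.coeff (?F ^ ?q) (?q ^ Suc i) = poly.coeff ?F (?q ^ i) ^ ?q"
    by (rule dickson_poly_power(1)[OF ys(1)])
  have "?r (poly.coeff (dickson_poly (a # ys)) (?q ^ Suc i)) = ?r (poly.coeff ?F (?q ^ i) ^ ?q)"
    unfolding dickson_poly_Cons[OF assms] coeff_diff coeff_smult msubst_diff msubst_mult Fa' co by simp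
  also have "\<dots> = poly.coeff ?F (?q ^ i) ^ ?q"
    by (rule free) (intro mpolys_in_power coeff_dickson_poly_in)
  also have "\<dots> = var_powers (set ys) ?q (poly.coeff ?F (?q ^ i))"
    by (rule frob_eq_var_powers[OF coeff_dickson_poly_in])
  finally show ?thesis
    by (simp add: dickson_coeff_def msubst_mult msubst_sign var_powers_def del: power_Suc)
qed

lemma dickson_det_restrict:
  assumes "distinct ys" "a \<in> set ys"
  shows "msubst (mvar(a := 0)) (dickson_det ys :: 'a mpoly) = 0"
  using dickson_det_subst[OF assms, of 0 0] by simp

text \<open>
  For \<open>t\<^sub>a = 0\<close> the invariant \<open>c\<^sub>n\<^sub>,\<^sub>1\<close> becomes the \<open>q\<close>-th power of \<open>c\<^sub>n\<^sub>-\<^sub>1\<^sub>,\<^sub>0\<close>, which is the \<open>(q - 1)\<close>-st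
  power of the determinant in one variable less. This is the reason for the substitution at the first of the
  remaining variables.
\<close>

lemma dickson_gen_restrict:
  assumes "distinct (a # ys)" "ys \<noteq> []" "P \<in> mpolys_in (- {a})"
  shows "msubst (mvar(a := 0)) (msubst (dickson_gen (a # ys)) P) =
    var_powers (set ys) CARD('a) (msubst (dickson_gen ys) (var_powers {hd ys} (CARD('a) - 1) (P :: 'a mpoly)))"
proof -
  let ?q = "CARD('a)" and ?r = "msubst (mvar(a := 0)) :: 'a mpoly \<Rightarrow> 'a mpoly"
  have ys: "distinct ys" "a \<notin> set ys" using assms by auto
  have "?r (dickson_gen (a # ys) v) =
      var_powers (set ys) ?q (msubst (dickson_gen ys) (if v \<in> {hd ys} then mvar v ^ (?q - 1) else mvar v))"
    if "v \<in> - {a}" for v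
  proof (cases "v \<in> set ys")
    case False
    then have "v \<noteq> hd ys" using assms(2) by auto
    with False that show ?thesis by (simp add: dickson_gen_def var_powers_def)
  next
    case True
    have hd: "v = hd ys \<longleftrightarrow> position ys v = 0"
      using assms(2) by (cases ys) (auto simp: position_Cons)
    have "?r (dickson_gen (a # ys) v) = var_powers (set ys) ?q (dickson_coeff ys (position ys v))"
      using that True dickson_coeff_restrict[OF assms(1), of "position ys v"]
      by (simp add: dickson_gen_def position_Cons)
    also have "(dickson_coeff ys (position ys v) :: 'a mpoly) =
        msubst (dickson_gen ys) (if v \<in> {hd ys} then mvar v ^ (?q - 1) else mvar v)"
      using True hd dickson_coeff_0[OF ys(1)] by (auto simp: dickson_gen_def msubst_hom)
    finally show ?thesis .
  qed
  then show ?thesis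
    unfolding var_powers_def msubst_msubst by (intro msubst_cong[OF assms(3)]) simp
qed

lemma dickson_gen_hd: "ys \<noteq> [] \<Longrightarrow> dickson_gen ys (hd ys) = (dickson_det ys :: 'a mpoly)"
  by (cases ys) (simp_all add: dickson_gen_def position_Cons)

lemma dickson_gen_single: "dickson_gen [b] = (mvar :: nat \<Rightarrow> 'a mpoly)"
proof
  fix v
  have "(dickson_e [b] :: 'a coh) = gen_t b"
    using milnor_Q_gen_dt[of 0 b, where 'a = 'a]
    by (simp add: dickson_e_def lessThan_Suc)
  then show "dickson_gen [b] v = (mvar v :: 'a mpoly)"
    by (simp add: dickson_gen_def position_Cons dickson_det_def gen_t_def)
qed

text \<open>
  An algebraic relation between the invariants may be assumed not to be divisible by the variable
  that stands for the determinant. Setting the first variable to \<open>0\<close> then gives a nontrivial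
  relation in \<open>n - 1\<close> variables.
\<close>

theorem dickson_gen_independent:
  assumes "distinct ys" "ys \<noteq> []" "msubst (dickson_gen ys) P = (0 :: 'a mpoly)"
  shows "P = 0"
  using assms
proof (induction ys arbitrary: P)
  case (Cons a ys)
  show ?case
  proof (cases "ys = []")
    case True
    then show ?thesis using Cons.prems dickson_gen_single[of a] by simp
  next
    case ys: False
    let ?x = "dickson_gen (a # ys) :: nat \<Rightarrow> 'a mpoly" and ?r = "msubst (mvar(a := 0)) :: 'a mpoly \<Rightarrow> 'a mpoly"
    have xa: "?x a = dickson_det (a # ys)" using dickson_gen_hd[of "a # ys"] by simp
    have dist: "distinct ys" "distinct (a # ys)" using Cons.prems by auto
    show ?thesis using Cons.prems(3)
    proof (induction "degree (to_uni a P)" arbitrary: P rule: less_induct)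
      case less
      have rP: "?r P \<in> mpolys_in (- {a})" by (rule msubst_in[OF mpolys_in_UNIV]) auto
      obtain P' where P': "P - ?r P = mvar a * P'" using dvd_diff_msubst[of a 0 P] by (auto elim: dvdE)
      then have P: "P = ?r P + mvar a * P'" by (simp add: algebra_simps)
      have "msubst ?x P = msubst ?x (?r P) + dickson_det (a # ys) * msubst ?x P'"
        by (subst P) (simp add: msubst_hom xa)
      then have rel: "msubst ?x (?r P) + dickson_det (a # ys) * msubst ?x P' = 0" using less.prems by simp
      then have "?r (msubst ?x (?r P) + dickson_det (a # ys) * msubst ?x P') = 0" by simp
      then have "?r (msubst ?x (?r P)) = 0"
        using dickson_det_restrict[OF dist(2), of a] by (simp add: msubst_hom)
      then have "var_powers (set ys) CARD('a) (msubst (dickson_gen ys) (var_powers {hd ys} (CARD('a) - 1) (?r P))) =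
          var_powers (set ys) CARD('a) 0"
        unfolding dickson_gen_restrict[OF dist(2) ys rP] by (simp add: var_powers_def)
      then have "msubst (dickson_gen ys) (var_powers {hd ys} (CARD('a) - 1) (?r P)) = 0"
        by (rule var_powers_inj[OF card_pos])
      then have "var_powers {hd ys} (CARD('a) - 1) (?r P) = var_powers {hd ys} (CARD('a) - 1) 0"
        using Cons.IH[OF dist(1) ys] by (simp add: var_powers_def)
      then have r0: "?r P = 0" by (rule var_powers_inj[rotated]) (use card_gt_1 in simp)
      then have zero: "msubst ?x P' = 0"
        using rel dickson_det_nonzero[OF dist(2)] by simp
      show "P = 0"
      proof (rule ccontr)
        assume "P \<noteq> 0"
        then have "P' \<noteq> 0" using P r0 by auto
        have "to_uni a P = pCons 0 (to_uni a P')"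
          using P r0 by (simp add: to_uni_hom to_uni_var)
        then have "degree (to_uni a P') < degree (to_uni a P)"
          using \<open>P' \<noteq> 0\<close> by simp
        from less.hyps[OF this zero] show False using \<open>P' \<noteq> 0\<close> by simp
      qed
    qed
  qed
qed simp

end

subsection \<open>Dickson's theorem\<close>

text \<open>The degree of a monomial in the Dickson invariants with respect to the last variable is this
  weight times \<open>q ^ (n - 1)\<close>.\<close>

definition dickson_weight :: "nat \<Rightarrow> nat list \<Rightarrow> (nat \<Rightarrow>\<^sub>0 nat) \<Rightarrow> nat" where
  "dickson_weight q ys m = Poly_Mapping.lookup m (hd ys) + (q - 1) * (\<Sum>v\<in>set (tl ys). Poly_Mapping.lookup m v)"

lemma degree_to_uni_coeff_prod:
  "degree (to_uni L (poly.coeff (\<Prod>y\<in>A. [:f y, 1:]) k)) \<le> (\<Sum>y\<in>A. degree (to_uni L (f y)))"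
proof (induction A arbitrary: k rule: infinite_finite_induct)
  case (insert y A)
  let ?p = "\<Prod>y\<in>A. [:f y, 1:]"
  have 1: "degree (to_uni L (f y * poly.coeff ?p k)) \<le> degree (to_uni L (f y)) + (\<Sum>y\<in>A. degree (to_uni L (f y)))" for k
    unfolding to_uni_mult using degree_mult_le[of "to_uni L (f y)" "to_uni L (poly.coeff ?p k)"] insert.IH[of k] by linarith
  have 2: "degree (to_uni L (case k of 0 \<Rightarrow> 0 | Suc k \<Rightarrow> poly.coeff ?p k)) \<le>
      degree (to_uni L (f y)) + (\<Sum>y\<in>A. degree (to_uni L (f y)))"
    using insert.IH[of "k - 1"] by (cases k) auto
  show ?case using insert.hyps 1[of k] 2
    by (auto simp: to_uni_add coeff_pCons intro!: degree_add_le)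
qed (simp_all add: coeff_1)

context prime_order
begin

lemma degree_dickson_coeff:
  assumes "distinct (zs @ [L])"
  shows "degree (to_uni L (dickson_coeff (zs @ [L]) i :: 'a mpoly)) \<le> CARD('a) ^ length zs * (CARD('a) - 1)"
proof -
  let ?q = "CARD('a)" and ?ys = "zs @ [L]"
  have zs: "distinct zs" "L \<notin> set zs" using assms by auto
  have sub: "lin_forms zs \<subseteq> (lin_forms ?ys :: 'a mpoly set)" by (rule lin_forms_mono) auto
  have one: "degree (to_uni L y) \<le> 1" if y: "y \<in> lin_forms ?ys" for y :: "'a mpoly"
  proof -
    obtain a where "y = (\<Sum>i\<in>set ?ys. mconst (a i) * mvar i)" using y by (auto simp: lin_forms_def)
    then show ?thesis unfolding to_uni_hom
      by (simp only: to_uni_sum) (auto intro!: degree_to_uni_sum simp: to_uni_mult to_uni_var)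
  qed
  have zero: "degree (to_uni L y) = 0" if "y \<in> lin_forms zs" for y :: "'a mpoly"
    using to_uni_free[OF lin_forms_in[OF that] zs(2)] by simp
  have "degree (to_uni L (poly.coeff (dickson_poly ?ys :: 'a mpoly poly) k)) \<le> (\<Sum>y\<in>lin_forms ?ys. degree (to_uni L (y :: 'a mpoly)))" for k
    unfolding dickson_poly_def by (rule degree_to_uni_coeff_prod)
  also have "\<dots> = (\<Sum>y\<in>lin_forms ?ys - lin_forms zs. degree (to_uni L (y :: 'a mpoly)))"
    by (rule sum.mono_neutral_right) (auto simp: zero)
  also have "\<dots> \<le> (\<Sum>y\<in>(lin_forms ?ys - lin_forms zs :: 'a mpoly set). 1)"
    by (rule sum_mono) (use one in auto)
  also have "\<dots> = ?q ^ length zs * (?q - 1)"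
    using card_Diff_subset[OF _ sub] card_lin_forms[OF assms, where 'a = 'a] card_lin_forms[OF zs(1), where 'a = 'a]
    by (simp add: algebra_simps)
  finally have "degree (to_uni L (poly.coeff (dickson_poly ?ys :: 'a mpoly poly) (?q ^ i))) \<le> ?q ^ length zs * (?q - 1)" .
  moreover have "to_uni L ((-1) ^ k * f) = (-1) ^ k * to_uni L f" for k and f :: "'a mpoly"
    by (simp add: to_uni_mult to_uni_power to_uni_uminus)
  moreover have "degree ((-1) ^ k * p) = degree p" for k and p :: "'a mpoly poly"
    by (cases "even k") simp_all
  ultimately show ?thesis by (simp add: dickson_coeff_def)
qed

lemma degree_dickson_det:
  assumes "distinct (zs @ [L])"
  shows "degree (to_uni L (dickson_det (zs @ [L]) :: 'a mpoly)) = CARD('a) ^ length zs"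
proof -
  have zs: "distinct zs" "L \<notin> set zs" using assms by auto
  obtain k where k: "(dickson_det (zs @ [L]) :: 'a mpoly) = (-1) ^ k * dickson_det zs * poly (dickson_poly zs) (mvar L)"
    using dickson_det_snoc[OF zs(1)] by blast
  have "to_uni L (poly (dickson_poly zs) (mvar L)) = (dickson_poly zs :: 'a mpoly poly)"
  proof (rule to_uni_poly)
    show "poly.coeff (dickson_poly zs :: 'a mpoly poly) k \<in> mpolys_in (- {L})" for k
      by (rule mpolys_in_mono[OF coeff_dickson_poly_in]) (use zs(2) in auto)
  qed
  moreover have "to_uni L (dickson_det zs :: 'a mpoly) = [:dickson_det zs:]"
    by (rule to_uni_free[OF dickson_det_in[OF zs(1)] zs(2)])
  ultimately have "to_uni L (dickson_det (zs @ [L]) :: 'a mpoly) = (-1) ^ k * smult (dickson_det zs) (dickson_poly zs)"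
    unfolding k by (simp add: to_uni_mult to_uni_power to_uni_uminus)
  moreover have "degree ((-1) ^ k * p) = degree p" for p :: "'a mpoly poly"
    by (cases "even k") simp_all
  ultimately show ?thesis using dickson_det_nonzero[OF zs(1)] degree_dickson_poly(1)[OF zs(1)] by simp
qed

text \<open>
  The determinant has degree \<open>q ^ (n - 1)\<close> in the last variable, the other Dickson invariants have at most
  \<open>q - 1\<close> times this degree, and the parameters have degree zero.
\<close>

lemma degree_dickson_gen_msubst:
  assumes "distinct ys" "ys \<noteq> []"
    and "\<And>m. m \<in> Poly_Mapping.keys P \<Longrightarrow> CARD('a) ^ (length ys - 1) * dickson_weight CARD('a) ys m \<le> D"
  shows "degree (to_uni (last ys) (msubst (dickson_gen ys) (P :: 'a mpoly))) \<le> D"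
proof (rule degree_to_uni_msubst)
  let ?q = "CARD('a)" and ?L = "last ys" and ?k = "length ys - 1"
  define w where "w v = ?q ^ ?k * (if v = hd ys then 1 else if v \<in> set (tl ys) then ?q - 1 else 0)" for v
  have ys: "ys = butlast ys @ [?L]" "distinct (butlast ys @ [?L])" "length (butlast ys) = ?k"
    using assms(1,2) by auto
  have tl: "set ys = insert (hd ys) (set (tl ys))" "hd ys \<notin> set (tl ys)"
    using assms(1,2) by (cases ys; auto)+
  show "degree (to_uni ?L (dickson_gen ys v :: 'a mpoly)) \<le> w v" for v
  proof (cases "v \<in> set ys")
    case False
    then have "v \<noteq> ?L" using assms(2) last_in_set by blast
    then show ?thesis using False by (simp add: dickson_gen_def to_uni_var)
  next
    case True
    have hd: "v = hd ys \<longleftrightarrow> position ys v = 0" using assms(2) by (cases ys) (auto simp: position_Cons)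
    show ?thesis
    proof (cases "v = hd ys")
      case True
      have "degree (to_uni ?L (dickson_det ys :: 'a mpoly)) = ?q ^ ?k"
        using degree_dickson_det[OF ys(2)] unfolding ys(1)[symmetric] ys(3) .
      then show ?thesis using dickson_gen_hd[OF assms(2)] True by (simp add: w_def)
    next
      case False
      have "degree (to_uni ?L (dickson_coeff ys (position ys v) :: 'a mpoly)) \<le> ?q ^ ?k * (?q - 1)"
        using degree_dickson_coeff[OF ys(2)] unfolding ys(1)[symmetric] ys(3) .
      moreover have "v \<in> set (tl ys)" using True False tl by auto
      ultimately show ?thesis using True False hd by (simp add: dickson_gen_def w_def)
    qed
  qed
  fix m assume m: "m \<in> Poly_Mapping.keys P"
  have "(\<Sum>v\<in>Poly_Mapping.keys m. w v * Poly_Mapping.lookup m v) = (\<Sum>v\<in>set ys \<union> Poly_Mapping.keys m. w v * Poly_Mapping.lookup m v)"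
    by (rule sum.mono_neutral_left) (auto simp: in_keys_iff)
  also have "\<dots> = (\<Sum>v\<in>set ys. w v * Poly_Mapping.lookup m v)"
    by (rule sum.mono_neutral_right) (use tl in \<open>auto simp: w_def\<close>)
  also have "\<dots> = w (hd ys) * Poly_Mapping.lookup m (hd ys) + (\<Sum>v\<in>set (tl ys). w v * Poly_Mapping.lookup m v)"
    unfolding tl(1) using tl(2) by (subst sum.insert) auto
  also have "(\<Sum>v\<in>set (tl ys). w v * Poly_Mapping.lookup m v) =
      (\<Sum>v\<in>set (tl ys). ?q ^ ?k * (?q - 1) * Poly_Mapping.lookup m v)"
    by (rule sum.cong) (use tl(2) in \<open>auto simp: w_def\<close>)
  also have "w (hd ys) * Poly_Mapping.lookup m (hd ys) + \<dots> = ?q ^ ?k * dickson_weight ?q ys m"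
    by (simp add: w_def dickson_weight_def distrib_left sum_distrib_left mult.assoc)
  also have "\<dots> \<le> D" by (rule assms(3)[OF m])
  finally show "(\<Sum>v\<in>Poly_Mapping.keys m. w v * Poly_Mapping.lookup m v) \<le> D" .
qed

text \<open>
  If \<open>r\<close> is the remainder of \<open>k\<close> modulo \<open>q - 1\<close>, then all nonzero elements are roots of \<open>X ^ r - 1\<close>. There
  are too many of them unless \<open>r = 0\<close>.
\<close>

lemma card_minus_1_dvd:
  assumes "\<And>c :: 'a. c \<noteq> 0 \<Longrightarrow> c ^ k = 1"
  shows "CARD('a) - 1 dvd k"
proof -
  let ?q = "CARD('a)" and ?r = "k mod (CARD('a) - 1)"
  have q: "?q - 1 > 0" using card_gt_1 by simp
  have r: "c ^ ?r = 1" if "c \<noteq> 0" for c :: 'a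
  proof -
    have "c ^ k = c ^ ((?q - 1) * (k div (?q - 1)) + ?r)" by simp
    also have "\<dots> = (c ^ (?q - 1)) ^ (k div (?q - 1)) * c ^ ?r" by (simp only: power_add power_mult)
    finally show ?thesis using assms[OF that] power_card_minus_1[OF that] by simp
  qed
  have "?r = 0"
  proof (rule ccontr)
    assume "?r \<noteq> 0"
    let ?p = "monom (1 :: 'a) ?r - 1"
    have "poly.coeff ?p ?r = 1" using \<open>?r \<noteq> 0\<close> by (simp add: coeff_1)
    then have "?p \<noteq> 0" by (metis coeff_0 zero_neq_one)
    have "degree ?p \<le> ?r" by (intro degree_diff_le degree_monom_le) simp
    have "UNIV - {0} \<subseteq> {c. poly ?p c = 0}" using r by (auto simp: poly_monom)
    then have "card (UNIV - {0 :: 'a}) \<le> card {c. poly ?p c = 0}" by (rule card_mono[rotated]) simp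
    also have "\<dots> \<le> degree ?p" using \<open>?p \<noteq> 0\<close> by (rule card_poly_roots_bound)
    also have "\<dots> \<le> ?r" by fact
    also have "?r < ?q - 1" using q by simp
    finally show False by (simp add: card_Diff_singleton)
  qed
  then show ?thesis by auto
qed

text \<open>
  Let \<open>f\<close> be invariant. For \<open>t\<^sub>a = 0\<close> it becomes a polynomial in the \<open>q\<close>-th powers of the other
  variables, which is invariant under their full linear group and hence, by induction, comes from a
  polynomial \<open>P\<close> in the Dickson invariants other than the determinant. Since \<open>f - P\<close> is divisible by
  \<open>t\<^sub>a\<close>, it is divisible by the determinant. The bound on the degree in the last variable ensures
  that the quotient is smaller than \<open>f\<close>.
\<close>

theorem dickson_gen_surjective:
  assumes "distinct ys" "ys \<noteq> []" "set ys \<subseteq> V" "f \<in> mpolys_in V" "transv_inv ys f"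
    and "degree (to_uni (last ys) f) \<le> D"
  shows "\<exists>P\<in>mpolys_in V. msubst (dickson_gen ys) P = (f :: 'a mpoly) \<and>
    (\<forall>m\<in>Poly_Mapping.keys P. CARD('a) ^ (length ys - 1) * dickson_weight CARD('a) ys m \<le> D)"
  using assms
proof (induction ys arbitrary: V f D)
  case (Cons a ys)
  let ?q = "CARD('a)" and ?r = "msubst (mvar(a := 0)) :: 'a mpoly \<Rightarrow> 'a mpoly"
  show ?case
  proof (cases "ys = []")
    case True
    have "Poly_Mapping.lookup m a \<le> D" if "m \<in> Poly_Mapping.keys f" for m
      using Cons.prems(6) that unfolding degree_to_uni_le_iff by (auto simp: True)
    then show ?thesis
      using Cons.prems(4) dickson_gen_single[of a] by (intro bexI[of _ f]) (simp_all add: True dickson_weight_def)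
  next
    case ne: False
    let ?x = "dickson_gen (a # ys) :: nat \<Rightarrow> 'a mpoly" and ?n = "length ys" and ?b = "hd ys" and ?e = "dickson_det (a # ys) :: 'a mpoly"
    let ?W = "dickson_weight ?q"
    have dist: "distinct ys" "a \<notin> set ys" "distinct (a # ys)" using Cons.prems(1) by auto
    have xa: "?x a = ?e" using dickson_gen_hd[of "a # ys"] by simp
    have b: "?b \<in> set ys" using ne by simp
    have last: "last (a # ys) = last ys" using ne by simp
    have L: "last ys \<in> set ys" using ne by simp
    have sub: "set ys \<subseteq> V - {a}" "a \<in> V" using Cons.prems(3) dist(2) by auto
    show ?thesis using Cons.prems(4-6)
    proof (induction D arbitrary: f rule: less_induct)
      case (less D)
      note f = less.prems(1,2) and D = less.prems(3)[unfolded last]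
      have rf: "?r f \<in> mpolys_in (V - {a})" by (rule msubst_in[OF f(1)]) auto
      have exps_f: "?q dvd Poly_Mapping.lookup m i" if "m \<in> Poly_Mapping.keys (?r f)" "i \<in> set ys" for m i
        using transv_inv_restrict_exps[OF f(2), of i a m] that dist(2) by auto
      have "\<exists>g\<in>mpolys_in (V - {a}). ?r f = var_powers (set ys) ?q g \<and>
          (\<forall>m\<in>Poly_Mapping.keys g. scale_exps (set ys) ?q m \<in> Poly_Mapping.keys (?r f))"
        by (rule var_powersE[OF rf card_pos exps_f]) blast+
      then obtain g where g: "g \<in> mpolys_in (V - {a})" "?r f = var_powers (set ys) ?q g"
        "\<And>m. m \<in> Poly_Mapping.keys g \<Longrightarrow> scale_exps (set ys) ?q m \<in> Poly_Mapping.keys (?r f)"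
        by blast
      have commute: "msubst (mvar(i := mconst c * mvar i + mconst d * mvar j)) (var_powers (set ys) ?q h) =
          var_powers (set ys) ?q (msubst (mvar(i := mconst c * mvar i + mconst d * mvar j)) h)"
        if "i \<in> set ys" "j \<in> set ys" for i j c d and h :: "'a mpoly"
        unfolding var_powers_def msubst_msubst
        by (rule arg_cong[of _ _ "\<lambda>g. msubst g h"], rule ext)
          (use that frob_add[of _ _ 1] mconst_power_card[of _ 1] in \<open>simp add: msubst_hom power_mult_distrib\<close>)
      have fix_g: "msubst (mvar(i := mconst c * mvar i + mconst d * mvar j)) g = g"
        if "i \<in> set ys" "j \<in> set ys" "msubst (mvar(i := mconst c * mvar i + mconst d * mvar j)) (?r f) = ?r f" for i j c d
      proof -
        have "var_powers (set ys) ?q (msubst (mvar(i := mconst c * mvar i + mconst d * mvar j)) g) = var_powers (set ys) ?q g"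
          using commute[OF that(1,2)] that(3) g(2) by simp
        then show ?thesis by (rule var_powers_inj[OF card_pos])
      qed
      have g_inv: "transv_inv ys g"
        unfolding transv_inv_def
      proof (intro ballI allI impI)
        fix i j c assume ij: "i \<in> set ys" "j \<in> set ys" "i \<noteq> j"
        have ia: "i \<noteq> a" "j \<noteq> a" using ij dist(2) by auto
        have "?r (msubst (mvar(i := mvar i + mconst c * mvar j)) f) = msubst (mvar(i := mvar i + mconst c * mvar j)) (?r f)"
          unfolding msubst_msubst
          by (rule arg_cong[of _ _ "\<lambda>g. msubst g f"], rule ext) (use ia in \<open>simp add: msubst_hom\<close>)
        then have "msubst (mvar(i := mvar i + mconst c * mvar j)) (?r f) = ?r f"
          using transv_invD[OF f(2), of i j c] ij by simp
        then show "msubst (mvar(i := mvar i + mconst c * mvar j)) g = g"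
          using fix_g[OF ij(1,2), of 1 c] by simp
      qed
      \<comment> \<open>The factor that makes the determinant one is put on \<open>t\<^sub>a\<close>, which is set to zero. So \<open>g\<close> is invariant under
          the full linear group of the remaining variables.\<close>
      have g_scale: "msubst (mvar(?b := mconst c * mvar ?b)) g = g" if c: "c \<noteq> 0" for c
      proof -
        have ba: "?b \<noteq> a" using b dist(2) by auto
        have "?r (msubst (mvar(?b := mconst c * mvar ?b, a := mconst (inverse c) * mvar a)) f) =
            msubst (mvar(?b := mconst c * mvar ?b)) (?r f)"
          unfolding msubst_msubst
          by (rule arg_cong[of _ _ "\<lambda>g. msubst g f"], rule ext) (use ba in \<open>simp add: msubst_hom\<close>)
        then have "msubst (mvar(?b := mconst c * mvar ?b)) (?r f) = ?r f"
          using transv_inv_torus[OF f(2), of ?b a c] b ba c by simp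
        then show ?thesis using fix_g[OF b b, of c 0] by simp
      qed
      have "degree (to_uni (last ys) g) \<le> D div ?q"
        unfolding degree_to_uni_le_iff
      proof
        fix m assume "m \<in> Poly_Mapping.keys g"
        then have "scale_exps (set ys) ?q m \<in> Poly_Mapping.keys f" using g(3) keys_msubst_zero by blast
        then have "Poly_Mapping.lookup (scale_exps (set ys) ?q m) (last ys) \<le> D"
          using D unfolding degree_to_uni_le_iff by blast
        then have "?q * Poly_Mapping.lookup m (last ys) \<le> D" using L by (simp add: scale_exps.rep_eq)
        then show "Poly_Mapping.lookup m (last ys) \<le> D div ?q"
          by (simp add: less_eq_div_iff_mult_less_eq mult.commute)
      qed
      from Cons.IH[OF dist(1) ne sub(1) g(1) g_inv this] obtain P1 where
        P1: "P1 \<in> mpolys_in (V - {a})" "msubst (dickson_gen ys) P1 = g"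
        "\<And>m. m \<in> Poly_Mapping.keys P1 \<Longrightarrow> ?q ^ (?n - 1) * ?W ys m \<le> D div ?q" by blast
      \<comment> \<open>Scaling a variable scales the determinant and fixes the other Dickson invariants. Hence the determinant
          occurs in \<open>g\<close> with exponents divisible by \<open>q - 1\<close> only, and its \<open>(q - 1)\<close>-st power is \<open>c\<^sub>n\<^sub>-\<^sub>1\<^sub>,\<^sub>0\<close>.\<close>
      have exps: "?q - 1 dvd Poly_Mapping.lookup m i" if m: "m \<in> Poly_Mapping.keys P1" and i: "i \<in> {?b}" for m i
      proof -
        have "c ^ Poly_Mapping.lookup m ?b = 1" if c: "c \<noteq> 0" for c :: 'a
        proof -
          let ?s = "mvar(?b := mconst c * mvar ?b) :: nat \<Rightarrow> 'a mpoly"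
          have "msubst ?s (dickson_gen ys v) = msubst (dickson_gen ys) (?s v)" for v
          proof (cases "v = ?b")
            case True
            have "msubst ?s (dickson_det ys) = mconst c * dickson_det ys"
              using dickson_det_subst[OF dist(1) b, of 0 c] by simp
            then show ?thesis using True dickson_gen_hd[OF ne] by (simp add: msubst_hom)
          next
            case False
            then have "position ys v \<noteq> 0" using ne by (cases ys) (auto simp: position_Cons)
            then have "msubst ?s (dickson_gen ys v) = dickson_gen ys v"
              using False dickson_coeff_msubst[OF bij_betw_lin_forms_scale[OF c]] by (simp add: dickson_gen_def)
            then show ?thesis using False by simp
          qed
          then have "msubst (dickson_gen ys) (msubst ?s P1) = msubst ?s (msubst (dickson_gen ys) P1)"
            unfolding msubst_msubst by simp
          also have "\<dots> = msubst (dickson_gen ys) P1" unfolding P1(2) by (rule g_scale[OF c])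
          finally have "msubst (dickson_gen ys) (msubst ?s P1 - P1) = 0" by (simp add: msubst_diff)
          then have "msubst ?s P1 - P1 = 0" by (rule dickson_gen_independent[OF dist(1) ne])
          then have "msubst ?s P1 = P1" by simp
          then have "c ^ Poly_Mapping.lookup m ?b * Poly_Mapping.lookup P1 m = Poly_Mapping.lookup P1 m"
            using lookup_msubst_scale[of ?b c P1 m] by simp
          then show ?thesis using m by (simp add: in_keys_iff)
        qed
        then show ?thesis using card_minus_1_dvd[of "Poly_Mapping.lookup m ?b"] i by simp
      qed
      have q1: "?q - 1 > 0" using card_gt_1 by simp
      have "\<exists>P0\<in>mpolys_in (V - {a}). P1 = var_powers {?b} (?q - 1) P0 \<and>
          (\<forall>m\<in>Poly_Mapping.keys P0. scale_exps {?b} (?q - 1) m \<in> Poly_Mapping.keys P1)"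
        by (rule var_powersE[OF P1(1) q1 exps]) blast+
      then obtain P0 where P0: "P0 \<in> mpolys_in (V - {a})" "P1 = var_powers {?b} (?q - 1) P0"
        "\<And>m. m \<in> Poly_Mapping.keys P0 \<Longrightarrow> scale_exps {?b} (?q - 1) m \<in> Poly_Mapping.keys P1"
        by blast
      have P0': "P0 \<in> mpolys_in (- {a})" "P0 \<in> mpolys_in V" using P0(1) by (auto intro: mpolys_in_mono)
      have weight0: "?q ^ ?n * ?W (a # ys) m \<le> D" if m: "m \<in> Poly_Mapping.keys P0" for m
      proof -
        have ma: "Poly_Mapping.lookup m a = 0" using m P0'(1) by (auto simp: mpolys_in_def in_keys_iff)
        have "set ys = insert ?b (set (tl ys))" "?b \<notin> set (tl ys)" using ne dist(1) by (cases ys; auto)+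
        then have "(\<Sum>v\<in>set ys. Poly_Mapping.lookup m v) = Poly_Mapping.lookup m ?b + (\<Sum>v\<in>set (tl ys). Poly_Mapping.lookup m v)"
          "(\<Sum>v\<in>set (tl ys). Poly_Mapping.lookup (scale_exps {?b} (?q - 1) m) v) = (\<Sum>v\<in>set (tl ys). Poly_Mapping.lookup m v)"
          by (auto simp: scale_exps.rep_eq intro!: sum.cong)
        then have "?W ys (scale_exps {?b} (?q - 1) m) = ?W (a # ys) m"
          by (simp add: dickson_weight_def ma scale_exps.rep_eq distrib_left)
        then have "?q ^ (?n - 1) * ?W (a # ys) m \<le> D div ?q" using P1(3)[OF P0(3)[OF m]] by simp
        then have "?q * (?q ^ (?n - 1) * ?W (a # ys) m) \<le> ?q * (D div ?q)" by simp
        also have "\<dots> \<le> D" by simp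
        also have "?q * (?q ^ (?n - 1) * ?W (a # ys) m) = ?q ^ ?n * ?W (a # ys) m"
          using ne by (metis length_greater_0_conv mult.assoc power_eq_if less_not_refl)
        finally show ?thesis .
      qed
      let ?h = "msubst ?x P0"
      have degh: "degree (to_uni (last ys) ?h) \<le> D"
        using degree_dickson_gen_msubst[OF dist(3), of P0 D] weight0 unfolding last by simp
      have "?r ?h = ?r f"
        unfolding dickson_gen_restrict[OF dist(3) ne P0'(1)] P0(2)[symmetric] P1(2) g(2) ..
      then have "mvar a dvd f - ?h"
        using dvd_iff_msubst_eq_0[of 0 a "f - ?h"] by (simp add: msubst_diff)
      moreover have fh: "transv_inv (a # ys) (f - ?h)"
        by (intro transv_inv_diff f(2) transv_inv_msubst transv_inv_dickson_gen[OF dist(3)])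
      ultimately have "l dvd f - ?h" if "l \<in> lin_forms (a # ys)" "l \<noteq> 0" for l
        using transv_inv_dvd_forms[OF fh, of a l] that by simp
      then have "?e dvd f - ?h" by (rule dickson_det_dvd[OF dist(3)])
      then obtain f' where f': "f - ?h = ?e * f'" by (elim dvdE)
      have e0: "?e \<noteq> 0" by (rule dickson_det_nonzero[OF dist(3)])
      have ein: "?e \<in> mpolys_in V" using mpolys_in_mono[OF dickson_det_in[OF dist(3)]] Cons.prems(3) by simp
      show ?case
      proof (cases "f' = 0")
        case True
        then show ?thesis using f' P0'(2) weight0 by (intro bexI[of _ P0]) auto
      next
        case nz: False
        have hin: "?h \<in> mpolys_in V"
        proof (rule msubst_in[OF P0'(2)])
          fix v assume "v \<in> V"
          then show "?x v \<in> mpolys_in V"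
            using mpolys_in_mono[OF dickson_gen_in[OF dist(3), of v]] Cons.prems(3) by auto
        qed
        \<comment> \<open>Setting the variables outside \<open>V\<close> to zero shows that the quotient involves none of them.\<close>
        define s where "s i = (if i \<in> V then mvar i else 0 :: 'a mpoly)" for i
        have s: "msubst s k = k" if "k \<in> mpolys_in V" for k
          by (rule msubst_id_on[OF that]) (simp add: s_def)
        have "msubst s (f - ?h) = f - ?h" by (rule s) (intro mpolys_in_diff f(1) hin)
        then have "?e * msubst s f' = ?e * f'" unfolding f' msubst_mult s[OF ein] .
        then have "msubst s f' = f'" using e0 by simp
        moreover have "msubst s f' \<in> mpolys_in V" by (rule msubst_in[OF mpolys_in_UNIV]) (simp add: s_def)
        ultimately have f'in: "f' \<in> mpolys_in V" by simp
        have "transv_inv (a # ys) ?e" using transv_inv_dickson_gen[OF dist(3), of a] unfolding xa .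
        then have f'inv: "transv_inv (a # ys) f'" using transv_inv_cancel[OF fh[unfolded f']] e0 by blast
        have dege: "degree (to_uni (last ys) ?e) = ?q ^ ?n"
        proof -
          have ys': "(a # butlast ys) @ [last ys] = a # ys" "length (a # butlast ys) = ?n" using ne by simp_all
          have "distinct ((a # butlast ys) @ [last ys])" unfolding ys' by (rule dist(3))
          from degree_dickson_det[OF this] show ?thesis unfolding ys' .
        qed
        have "degree (to_uni (last ys) (?e * f')) = ?q ^ ?n + degree (to_uni (last ys) f')"
          unfolding to_uni_mult dege[symmetric] using nz e0 by (intro degree_mult_eq) simp_all
        moreover have "degree (to_uni (last ys) (f - ?h)) \<le> D"
          unfolding to_uni_diff by (rule degree_diff_le[OF D degh])
        ultimately have deg: "?q ^ ?n + degree (to_uni (last ys) f') \<le> D" unfolding f' by simp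
        have qn: "?q ^ ?n > 0" by simp
        have "D - ?q ^ ?n < D" "degree (to_uni (last (a # ys)) f') \<le> D - ?q ^ ?n"
          using deg qn unfolding last by linarith+
        from less.IH[OF this(1) f'in f'inv this(2)] obtain P' where
          P': "P' \<in> mpolys_in V" "msubst ?x P' = f'"
          "\<And>m. m \<in> Poly_Mapping.keys P' \<Longrightarrow> ?q ^ ?n * ?W (a # ys) m \<le> D - ?q ^ ?n" by auto
        have "?q ^ ?n * ?W (a # ys) m \<le> D" if m: "m \<in> Poly_Mapping.keys (P0 + mvar a * P')" for m
        proof -
          consider "m \<in> Poly_Mapping.keys P0" | "m \<in> Poly_Mapping.keys (mvar a * P')"
            using m Poly_Mapping.keys_add[of P0 "mvar a * P'"] by auto
          then show ?thesis
          proof cases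
            case 1
            then show ?thesis by (rule weight0)
          next
            case 2
            then obtain m' where m': "m' \<in> Poly_Mapping.keys P'" "m = Poly_Mapping.single a 1 + m'"
              using keys_mult[of "mvar a" P'] by (auto simp: mvar_def)
            have "(\<Sum>v\<in>set ys. Poly_Mapping.lookup m v) = (\<Sum>v\<in>set ys. Poly_Mapping.lookup m' v)"
              using dist(2) by (intro sum.cong) (auto simp: m'(2) lookup_add lookup_single when_def)
            then have "?W (a # ys) m = Suc (?W (a # ys) m')"
              by (simp add: dickson_weight_def m'(2) lookup_add)
            then show ?thesis using P'(3)[OF m'(1)] deg by simp
          qed
        qed
        moreover have "msubst ?x (P0 + mvar a * P') = f"
          using f' by (simp add: msubst_hom xa P'(2) algebra_simps)
        moreover have "P0 + mvar a * P' \<in> mpolys_in V"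
          using sub(2) by (intro mpolys_in_add mpolys_in_mult P0'(2) P'(1)) simp
        ultimately show ?thesis by (intro bexI[of _ "P0 + mvar a * P'"]) auto
      qed
    qed
  qed
qed simp

text \<open>
  The variables in \<open>V\<close> outside \<open>ys\<close> are parameters. They are needed for the groups that act on further
  variables besides the block of the special linear group.
\<close>

theorem dickson_theorem:
  assumes "distinct ys" "ys \<noteq> []" "set ys \<subseteq> V"
  shows "bij_betw (msubst (dickson_gen ys)) (mpolys_in V) {f \<in> mpolys_in V. transv_inv ys (f :: 'a mpoly)}"
proof (rule bij_betw_imageI)
  show "inj_on (msubst (dickson_gen ys)) (mpolys_in V :: 'a mpoly set)"
  proof (rule inj_onI)
    fix P Q :: "'a mpoly" assume "msubst (dickson_gen ys) P = msubst (dickson_gen ys) Q"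
    then show "P = Q" using dickson_gen_independent[OF assms(1,2), of "P - Q"] by (simp add: msubst_diff)
  qed
  have "msubst (dickson_gen ys) P \<in> mpolys_in V" if "P \<in> mpolys_in V" for P :: "'a mpoly"
  proof (rule msubst_in[OF that])
    fix v assume "v \<in> V"
    then show "(dickson_gen ys v :: 'a mpoly) \<in> mpolys_in V"
      using mpolys_in_mono[OF dickson_gen_in[OF assms(1), of v]] assms(3) by auto
  qed
  moreover have "transv_inv ys (msubst (dickson_gen ys) P)" for P :: "'a mpoly"
    by (rule transv_inv_msubst[OF transv_inv_dickson_gen[OF assms(1)]])
  moreover have "f \<in> msubst (dickson_gen ys) ` mpolys_in V" if "f \<in> mpolys_in V" "transv_inv ys f" for f :: "'a mpoly"
    using dickson_gen_surjective[OF assms that order_refl] by auto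
  ultimately show "msubst (dickson_gen ys) ` mpolys_in V = {f \<in> mpolys_in V. transv_inv ys (f :: 'a mpoly)}"
    by auto
qed

end

subsection \<open>Adjoining norms and squares\<close>

lemma bij_betw_msubst_reindex:
  assumes bij: "bij_betw (msubst x) (mpolys_in V) M" and p: "bij_betw p A V"
  shows "bij_betw (msubst (\<lambda>i. x (p i))) (mpolys_in A) M"
proof -
  let ?s = "msubst (\<lambda>i. mvar (p i))" and ?t = "msubst (\<lambda>v. mvar (inv_into A p v))"
  have "bij_betw ?s (mpolys_in A) (mpolys_in V)"
  proof (rule bij_betw_byWitness[where f' = ?t])
    show "\<forall>f\<in>mpolys_in A. ?t (?s f) = f"
      unfolding msubst_msubst using p
      by (intro ballI msubst_id_on) (auto simp: bij_betw_inv_into_left)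
    show "\<forall>f\<in>mpolys_in V. ?s (?t f) = f"
      unfolding msubst_msubst using p
      by (intro ballI msubst_id_on) (auto simp: bij_betw_inv_into_right)
    show "?s ` mpolys_in A \<subseteq> mpolys_in V"
      using p by (auto intro!: msubst_in dest: bij_betwE)
    show "?t ` mpolys_in V \<subseteq> mpolys_in A"
      using bij_betw_inv_into[OF p] by (auto intro!: msubst_in dest: bij_betwE)
  qed
  from bij_betw_trans[OF this bij] show ?thesis by (simp add: comp_def msubst_msubst)
qed

text \<open>
  The polynomials fixed by the sign change of one generator are those in the square of that generator.
\<close>

lemma bij_betw_msubst_square:
  fixes x :: "nat \<Rightarrow> 'a::idom mpoly"
  assumes bij: "bij_betw (msubst x) (mpolys_in V) M" and i: "i \<in> V" and two: "(2 :: 'a) \<noteq> 0"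
    and s: "msubst s (x i) = - x i" "\<And>v. v \<in> V \<Longrightarrow> v \<noteq> i \<Longrightarrow> msubst s (x v) = x v"
  shows "bij_betw (msubst (x(i := x i ^ 2))) (mpolys_in V) {f \<in> M. msubst s f = f}"
proof -
  have sq: "msubst (x(i := x i ^ 2)) P = msubst x (var_powers {i} 2 P)" for P
    unfolding var_powers_def msubst_msubst
    by (rule arg_cong[of _ _ "\<lambda>g. msubst g P"], rule ext) (simp add: msubst_power)
  have vp: "var_powers {i} 2 P \<in> mpolys_in V" if "P \<in> mpolys_in V" for P :: "'a mpoly"
    unfolding var_powers_def by (rule msubst_in[OF that]) (auto intro: mpolys_in_power)
  have act: "msubst s (msubst x P) = msubst x (msubst (mvar(i := mconst (- 1) * mvar i)) P)" if "P \<in> mpolys_in V" for P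
    unfolding msubst_msubst by (rule msubst_cong[OF that]) (use s in \<open>simp add: msubst_hom mconst_uminus\<close>)
  have inj: "P = Q" if "P \<in> mpolys_in V" "Q \<in> mpolys_in V" "msubst x P = msubst x Q" for P Q
    using bij that by (meson bij_betw_imp_inj_on inj_onD)
  show ?thesis
  proof (rule bij_betw_imageI)
    show "inj_on (msubst (x(i := x i ^ 2))) (mpolys_in V)"
    proof (rule inj_onI)
      fix P Q assume PQ: "P \<in> mpolys_in V" "Q \<in> mpolys_in V" "msubst (x(i := x i ^ 2)) P = msubst (x(i := x i ^ 2)) Q"
      have "var_powers {i} 2 P = var_powers {i} 2 Q"
        by (rule inj[OF vp[OF PQ(1)] vp[OF PQ(2)] PQ(3)[unfolded sq]])
      then show "P = Q" by (rule var_powers_inj[rotated]) simp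
    qed
    show "msubst (x(i := x i ^ 2)) ` mpolys_in V = {f \<in> M. msubst s f = f}"
    proof (intro equalityI subsetI)
      fix f assume "f \<in> msubst (x(i := x i ^ 2)) ` mpolys_in V"
      then obtain P where P: "P \<in> mpolys_in V" "f = msubst x (var_powers {i} 2 P)" unfolding sq by blast
      then have "f \<in> M" using bij vp by (auto dest: bij_betwE)
      moreover have "msubst (mvar(i := mconst (- 1) * mvar i)) (var_powers {i} 2 P) = var_powers {i} 2 P"
        unfolding var_powers_def msubst_msubst
        by (rule arg_cong[of _ _ "\<lambda>g. msubst g P"], rule ext) (simp add: msubst_hom mconst_uminus)
      ultimately show "f \<in> {f \<in> M. msubst s f = f}" using act[OF vp[OF P(1)]] P(2) by simp
    next
      fix f assume f: "f \<in> {f \<in> M. msubst s f = f}"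
      then obtain P where P: "P \<in> mpolys_in V" "f = msubst x P" using bij by (auto simp: bij_betw_def)
      have "msubst (mvar(i := mconst (- 1) * mvar i)) P \<in> mpolys_in V"
        by (rule msubst_in[OF P(1)]) (auto intro: mpolys_in_mult)
      then have inv: "msubst (mvar(i := mconst (- 1) * mvar i)) P = P"
        by (rule inj[OF _ P(1)]) (use f P act in simp)
      have even: "2 dvd Poly_Mapping.lookup m j" if m: "m \<in> Poly_Mapping.keys P" and j: "j \<in> {i}" for m j
      proof (rule ccontr)
        assume "\<not> 2 dvd Poly_Mapping.lookup m j"
        then show False
          using lookup_msubst_scale[of i "- 1" P m] inv j m two two[symmetric] by (auto simp: in_keys_iff)
      qed
      have "\<exists>Q\<in>mpolys_in V. P = var_powers {i} 2 Q"
        by (rule var_powersE[of P V 2 "{i}"]) (use P(1) even in auto)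
      then show "f \<in> msubst (x(i := x i ^ 2)) ` mpolys_in V" using P(2) unfolding sq by blast
    qed
  qed
qed

lemma translate_dvd:
  assumes l: "l \<in> mpolys_in (- {a})" and f: "msubst (mvar(a := mvar a + l)) f = f"
  shows "msubst (mvar(a := - l)) f = msubst (mvar(a := 0)) (f :: 'a::comm_ring_1 mpoly)"
proof -
  have "msubst (mvar(a := - l)) l = l" by (rule msubst_id_on[OF l]) auto
  then have "msubst (mvar(a := - l)) (msubst (mvar(a := mvar a + l)) f) = msubst (mvar(a := 0)) f"
    unfolding msubst_msubst
    by (intro arg_cong[of _ _ "\<lambda>g. msubst g f"] ext) (simp add: msubst_hom)
  then show ?thesis using f by simp
qed

context prime_order
begin

text \<open>
  The product of the translates of \<open>t\<^sub>a\<close> by the linear forms in \<open>ys\<close>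
\<close>

abbreviation norm_poly :: "nat \<Rightarrow> nat list \<Rightarrow> 'a mpoly" where
  "norm_poly a ys \<equiv> poly (dickson_poly ys) (mvar a)"

text \<open>
  The factors \<open>t\<^sub>a + l\<close> of the norm are pairwise non-associated primes, and \<open>t\<^sub>a + l\<close> divides \<open>f\<close> if \<open>f\<close>
  vanishes for \<open>t\<^sub>a = - l\<close>.
\<close>

lemma norm_poly_dvd:
  assumes a: "a \<notin> set ys" and f: "\<And>l. l \<in> lin_forms ys \<Longrightarrow> msubst (mvar(a := - l)) f = 0"
  shows "norm_poly a ys dvd (f :: 'a mpoly)"
proof -
  have free: "l \<in> mpolys_in (- {a})" if "l \<in> lin_forms ys" for l :: "'a mpoly"
    by (rule mpolys_in_mono[OF lin_forms_in[OF that]]) (use a in auto)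
  show ?thesis
    unfolding poly_dickson_poly
  proof (rule prod_primes_dvd)
    fix l :: "'a mpoly" assume l: "l \<in> lin_forms ys"
    show "prime_elem (mvar a + l)"
      using prime_elem_linear[OF mpolys_in_uminus[OF free[OF l]]] by simp
    show "mvar a + l dvd f"
      using dvd_iff_msubst_eq_0[OF mpolys_in_uminus[OF free[OF l]], of f] f[OF l] by simp
  next
    fix u v :: "'a mpoly" assume uv: "u \<in> lin_forms ys" "v \<in> lin_forms ys" "mvar a + u dvd mvar a + v"
    then have "msubst (mvar(a := - u)) (mvar a + v) = 0"
      using dvd_iff_msubst_eq_0[OF mpolys_in_uminus[OF free[OF uv(1)]], of "mvar a + v"] by simp
    moreover have "msubst (mvar(a := - u)) v = v"
      using free[OF uv(2)] by (intro msubst_id_on) auto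
    ultimately show "u = v" by (simp add: msubst_add)
  qed simp
qed

lemma norm_poly_translate:
  assumes "distinct ys" "a \<notin> set ys" "l \<in> lin_forms ys"
  shows "msubst (mvar(a := mvar a + l)) (norm_poly a ys) = norm_poly a ys"
proof -
  have free: "msubst (mvar(a := mvar a + l)) k = k" if "k \<in> lin_forms ys" for k
    by (rule msubst_id_on[OF lin_forms_in[OF that]]) (use assms(2) in auto)
  have "msubst (mvar(a := mvar a + l)) (norm_poly a ys) = poly (dickson_poly ys) (mvar a + mconst 1 * l)"
    unfolding poly_dickson_poly msubst_prod msubst_add by (rule prod.cong[OF refl]) (simp add: free)
  also have "\<dots> = norm_poly a ys"
    unfolding poly_dickson_poly_linear[OF assms(1)] using assms(3) by (simp add: poly_dickson_poly_eq_0_iff)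
  finally show ?thesis .
qed

text \<open>
  Transvections of the variables in \<open>ys\<close> permute the factors.
\<close>

lemma norm_poly_transv:
  assumes "a \<notin> set ys" "set zs \<subseteq> set ys"
  shows "transv_inv zs (norm_poly a ys)"
  unfolding transv_inv_def
proof (intro ballI allI impI)
  fix i j c assume ij: "i \<in> set zs" "j \<in> set zs" "i \<noteq> j"
  let ?s = "mvar(i := mvar i + mconst c * mvar j) :: nat \<Rightarrow> 'a mpoly"
  have bij: "bij_betw (msubst ?s) (lin_forms ys) (lin_forms ys)"
    by (rule bij_betw_lin_forms_transv) (use ij assms in auto)
  have "i \<noteq> a" using ij assms by auto
  then have "msubst ?s (norm_poly a ys) = (\<Prod>y\<in>lin_forms ys. mvar a + msubst ?s y)"
    unfolding poly_dickson_poly by (simp add: msubst_hom)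
  also have "\<dots> = norm_poly a ys"
    unfolding poly_dickson_poly by (rule prod.reindex_bij_betw[OF bij])
  finally show "msubst ?s (norm_poly a ys) = norm_poly a ys" .
qed

lemma norm_poly_in: "norm_poly a ys \<in> mpolys_in (insert a (set ys))"
  unfolding poly_dickson_poly
  by (intro mpolys_in_prod mpolys_in_add) (auto dest: lin_forms_in intro: mpolys_in_mono)

lemma norm_poly_zero: "a \<notin> set ys \<Longrightarrow> msubst (mvar(a := 0)) (norm_poly a ys) = 0"
proof -
  assume a: "a \<notin> set ys"
  have "msubst (mvar(a := 0)) (mvar a + 0) = (0 :: 'a mpoly)" by (simp add: msubst_hom)
  then show ?thesis
    unfolding poly_dickson_poly msubst_prod by (intro prod_zero finite_lin_forms bexI[of _ 0]) auto
qed

text \<open>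
  An invariant \<open>f\<close> of the translations of \<open>t\<^sub>a\<close> takes the same value for \<open>t\<^sub>a = 0\<close> and \<open>t\<^sub>a = - l\<close>, so that
  the norm divides the difference of \<open>f\<close> and its value for \<open>t\<^sub>a = 0\<close>.
\<close>

theorem adjoin_norm:
  assumes bij: "bij_betw (msubst x) (mpolys_in V) {f \<in> mpolys_in V. transv_inv zs (f :: 'a mpoly)}"
    and ys: "distinct ys" "set zs \<subseteq> set ys" "set ys \<subseteq> V" and a: "a \<notin> V"
  shows "bij_betw (msubst (x(a := norm_poly a ys))) (mpolys_in (insert a V))
    {f \<in> mpolys_in (insert a V). transv_inv zs f \<and> (\<forall>l\<in>lin_forms ys. msubst (mvar(a := mvar a + l)) f = f)}"
proof -
  let ?N = "norm_poly a ys" and ?r = "msubst (mvar(a := 0)) :: 'a mpoly \<Rightarrow> 'a mpoly"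
  let ?x = "x(a := ?N)" and ?inv = "\<lambda>f. transv_inv zs f \<and> (\<forall>l\<in>lin_forms ys. msubst (mvar(a := mvar a + l)) f = f)"
  have ay: "a \<notin> set ys" "a \<notin> set zs" using a ys by auto
  have N0: "?N \<noteq> 0" by (rule poly_dickson_poly_nonzero[OF ay(1)])
  have xin: "x v \<in> mpolys_in V" "transv_inv zs (x v)" if "v \<in> V" for v
    using bij_betwE[OF bij] that by (metis (mono_tags, lifting) mem_Collect_eq mpolys_in_var msubst_mvar)+
  have xsub: "msubst ?x P = msubst x P" if "P \<in> mpolys_in V" for P
    by (rule msubst_cong[OF that]) (use a in auto)
  have xP: "msubst x P \<in> mpolys_in V" if "P \<in> mpolys_in V" for P
    by (rule msubst_in[OF that]) (rule xin)
  have rid: "?r f = f" if "f \<in> mpolys_in V" for f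
    by (rule msubst_id_on[OF that]) (use a in auto)
  have rin: "?r f \<in> mpolys_in V" if "f \<in> mpolys_in (insert a V)" for f
    by (rule msubst_in[OF that]) auto
  have degN: "degree (to_uni a ?N) > 0"
  proof -
    have "to_uni a ?N = (dickson_poly ys :: 'a mpoly poly)"
    proof (rule to_uni_poly)
      show "poly.coeff (dickson_poly ys :: 'a mpoly poly) k \<in> mpolys_in (- {a})" for k
        by (rule mpolys_in_mono[OF coeff_dickson_poly_in]) (use ay in auto)
    qed
    then show ?thesis using degree_dickson_poly(1)[OF ys(1)] by simp
  qed
  have Nin: "?N \<in> mpolys_in (insert a V)" by (rule mpolys_in_mono[OF norm_poly_in]) (use ys in auto)
  have Ninv: "?inv ?N" using norm_poly_transv[OF ay(1) ys(2)] norm_poly_translate[OF ys(1) ay(1)] by blast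
  have indep: "P = 0" if "P \<in> mpolys_in (insert a V)" "msubst ?x P = 0" for P
    using that
  proof (induction "degree (to_uni a P)" arbitrary: P rule: less_induct)
    case less
    obtain P' where P': "P - ?r P = mvar a * P'" using dvd_diff_msubst[of a 0 P] by (auto elim: dvdE)
    then have P: "P = ?r P + mvar a * P'" by (simp add: algebra_simps)
    have rP: "?r P \<in> mpolys_in V" by (rule rin[OF less.prems(1)])
    have "msubst ?x P = msubst ?x (?r P) + ?N * msubst ?x P'" by (subst P) (simp only: msubst_hom msubst_mvar fun_upd_same)
    then have rel: "msubst x (?r P) + ?N * msubst ?x P' = 0" using less.prems(2) by (simp only: xsub[OF rP])
    then have "?r (msubst x (?r P) + ?N * msubst ?x P') = 0" by simp
    then have "msubst x (?r P) = msubst x 0"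
      unfolding msubst_add msubst_mult norm_poly_zero[OF ay(1)] rid[OF xP[OF rP]] by simp
    then have r0: "?r P = 0" using bij_betw_imp_inj_on[OF bij] rP by (metis inj_onD mpolys_in_0)
    then have zero: "msubst ?x P' = 0" using rel N0 by (simp only: msubst_0 add_0_left mult_eq_0_iff simp_thms)
    show "P = 0"
    proof (rule ccontr)
      assume "P \<noteq> 0"
      then have "P' \<noteq> 0" using P r0 by auto
      have Pa: "P = mvar a * P'" using P r0 by simp
      have "to_uni a P = pCons 0 (to_uni a P')" unfolding Pa by (simp add: to_uni_hom to_uni_var)
      then have deg: "degree (to_uni a P') < degree (to_uni a P)"
        using \<open>P' \<noteq> 0\<close> by simp
      have P'in: "P' \<in> mpolys_in (insert a V)"
      proof -
        define s where "s i = (if i \<in> insert a V then mvar i else 0 :: 'a mpoly)" for i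
        have "msubst s P = P" by (rule msubst_id_on[OF less.prems(1)]) (simp add: s_def)
        then have "mvar a * msubst s P' = mvar a * P'" unfolding Pa by (simp add: msubst_mult s_def)
        then have "msubst s P' = P'" by simp
        moreover have "msubst s P' \<in> mpolys_in (insert a V)" by (rule msubst_in[OF mpolys_in_UNIV]) (simp add: s_def)
        ultimately show ?thesis by simp
      qed
      from less.hyps[OF deg P'in zero] show False using \<open>P' \<noteq> 0\<close> by simp
    qed
  qed
  have surj: "\<exists>P\<in>mpolys_in (insert a V). msubst ?x P = f" if "f \<in> mpolys_in (insert a V)" "?inv f" for f
    using that
  proof (induction "degree (to_uni a f)" arbitrary: f rule: less_induct)
    case less
    have rf: "?r f \<in> mpolys_in V" by (rule rin[OF less.prems(1)])
    have rinv: "transv_inv zs (?r f)"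
      unfolding transv_inv_def
    proof (intro ballI allI impI)
      fix i j c assume ij: "i \<in> set zs" "j \<in> set zs" "i \<noteq> j"
      then have "i \<noteq> a" "j \<noteq> a" using ay by auto
      then have "msubst (mvar(i := mvar i + mconst c * mvar j)) (?r f) = ?r (msubst (mvar(i := mvar i + mconst c * mvar j)) f)"
        unfolding msubst_msubst
        by (intro arg_cong[of _ _ "\<lambda>g. msubst g f"] ext) (simp add: msubst_hom)
      then show "msubst (mvar(i := mvar i + mconst c * mvar j)) (?r f) = ?r f"
        using transv_invD[of zs f i j c] less.prems(2) ij by simp
    qed
    obtain P0 where P0: "P0 \<in> mpolys_in V" "msubst x P0 = ?r f"
      using bij rf rinv unfolding bij_betw_def by (metis (mono_tags, lifting) imageE mem_Collect_eq)
    have "?N dvd f - ?r f"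
    proof (rule norm_poly_dvd[OF ay(1)])
      fix l :: "'a mpoly" assume l: "l \<in> lin_forms ys"
      have "l \<in> mpolys_in (- {a})" by (rule mpolys_in_mono[OF lin_forms_in[OF l]]) (use ay in auto)
      then have "msubst (mvar(a := - l)) f = ?r f" using less.prems(2) l by (intro translate_dvd) auto
      moreover have "msubst (mvar(a := - l)) (?r f) = ?r f" by (rule msubst_id_on[OF rf]) (use a in auto)
      ultimately show "msubst (mvar(a := - l)) (f - ?r f) = 0" by (simp add: msubst_diff)
    qed
    then obtain f' where f': "f - ?r f = ?N * f'" by (elim dvdE)
    have P0': "P0 \<in> mpolys_in (insert a V)" by (rule mpolys_in_mono[OF P0(1)]) auto
    show ?case
    proof (cases "f' = 0")
      case True
      then show ?thesis using f' P0 P0' xsub[OF P0(1)] by (intro bexI[of _ P0]) simp_all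
    next
      case False
      have f'in: "f' \<in> mpolys_in (insert a V)"
      proof -
        define s where "s i = (if i \<in> insert a V then mvar i else 0 :: 'a mpoly)" for i
        have s: "msubst s k = k" if "k \<in> mpolys_in (insert a V)" for k by (rule msubst_id_on[OF that]) (simp add: s_def)
        have "msubst s (f - ?r f) = f - ?r f"
          by (rule s) (intro mpolys_in_diff less.prems(1) mpolys_in_mono[OF rf] subset_insertI)
        then have "?N * msubst s f' = ?N * f'" unfolding f' msubst_mult s[OF Nin] .
        then have "msubst s f' = f'" using N0 by simp
        moreover have "msubst s f' \<in> mpolys_in (insert a V)" by (rule msubst_in[OF mpolys_in_UNIV]) (simp add: s_def)
        ultimately show ?thesis by simp
      qed
      have f'inv: "?inv f'"
      proof
        have "transv_inv zs (?N * f')" unfolding f'[symmetric] using less.prems(2) rinv by (blast intro: transv_inv_diff)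
        then show "transv_inv zs f'" using Ninv N0 transv_inv_cancel by blast
        show "\<forall>l\<in>lin_forms ys. msubst (mvar(a := mvar a + l)) f' = f'"
        proof
          fix l :: "'a mpoly" assume l: "l \<in> lin_forms ys"
          have "msubst (mvar(a := mvar a + l)) (?r f) = ?r f" by (rule msubst_id_on[OF rf]) (use a in auto)
          then have "msubst (mvar(a := mvar a + l)) (?N * f') = ?N * f'"
            using less.prems(2) l by (simp only: f'[symmetric] msubst_diff)
          then have "?N * msubst (mvar(a := mvar a + l)) f' = ?N * f'"
            using norm_poly_translate[OF ys(1) ay(1) l] by (simp only: msubst_mult)
          then show "msubst (mvar(a := mvar a + l)) f' = f'" using N0 by simp
        qed
      qed
      have "degree (to_uni a (?N * f')) = degree (to_uni a ?N) + degree (to_uni a f')"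
        unfolding to_uni_mult using False N0 by (intro degree_mult_eq) simp_all
      moreover have "degree (to_uni a (?r f)) = 0" using to_uni_free[OF rf a] by simp
      then have "degree (to_uni a (f - ?r f)) \<le> degree (to_uni a f)"
        unfolding to_uni_diff by (intro degree_diff_le) simp_all
      ultimately have "degree (to_uni a f') < degree (to_uni a f)" using degN unfolding f' by linarith
      from less.hyps[OF this f'in f'inv] obtain P' where P': "P' \<in> mpolys_in (insert a V)" "msubst ?x P' = f'" by blast
      have "msubst ?x (P0 + mvar a * P') = ?r f + ?N * f'"
        by (simp only: msubst_hom msubst_mvar fun_upd_same xsub[OF P0(1)] P0(2) P'(2))
      also have "\<dots> = f" unfolding f'[symmetric] by simp
      finally have "msubst ?x (P0 + mvar a * P') = f" .
      moreover have "P0 + mvar a * P' \<in> mpolys_in (insert a V)"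
        by (intro mpolys_in_add mpolys_in_mult P0' P'(1)) simp
      ultimately show ?thesis by blast
    qed
  qed
  have img: "msubst ?x P \<in> mpolys_in (insert a V) \<and> ?inv (msubst ?x P)" if P: "P \<in> mpolys_in (insert a V)" for P
  proof (intro conjI ballI)
    have xv: "?x v \<in> mpolys_in (insert a V)" if "v \<in> insert a V" for v
      using Nin that by (auto intro: mpolys_in_mono[OF xin(1)])
    show "msubst ?x P \<in> mpolys_in (insert a V)" by (rule msubst_in[OF P xv])
    have xinv: "transv_inv zs (?x v)" if "v \<in> insert a V" for v
      using Ninv that xin(2) by auto
    show "transv_inv zs (msubst ?x P)"
      unfolding transv_inv_def
    proof (intro ballI allI impI)
      fix i j c assume ij: "i \<in> set zs" "j \<in> set zs" "i \<noteq> j"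
      show "msubst (mvar(i := mvar i + mconst c * mvar j)) (msubst ?x P) = msubst ?x P"
        unfolding msubst_msubst by (rule msubst_cong[OF P]) (rule transv_invD[OF xinv ij])
    qed
    fix l :: "'a mpoly" assume l: "l \<in> lin_forms ys"
    show "msubst (mvar(a := mvar a + l)) (msubst ?x P) = msubst ?x P"
      unfolding msubst_msubst
    proof (rule msubst_cong[OF P])
      fix v assume v: "v \<in> insert a V"
      show "msubst (mvar(a := mvar a + l)) (?x v) = ?x v"
      proof (cases "v = a")
        case True
        then show ?thesis using Ninv l by simp
      next
        case False
        then have "x v \<in> mpolys_in V" using v xin by auto
        then have "msubst (mvar(a := mvar a + l)) (x v) = x v" by (rule msubst_id_on) (use a in auto)
        then show ?thesis using False by simp
      qed
    qed
  qed
  show ?thesis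
  proof (rule bij_betw_imageI)
    show "inj_on (msubst ?x) (mpolys_in (insert a V))"
    proof (rule inj_onI)
      fix P Q assume "P \<in> mpolys_in (insert a V)" "Q \<in> mpolys_in (insert a V)" "msubst ?x P = msubst ?x Q"
      then show "P = Q" using indep[of "P - Q"] by (simp add: msubst_diff mpolys_in_diff)
    qed
    show "msubst ?x ` mpolys_in (insert a V) = {f \<in> mpolys_in (insert a V). ?inv f}"
      using img surj by blast
  qed
qed

end

section \<open>Modules of invariants\<close>

subsection \<open>Polynomial tensor products in terms of polynomials\<close>

lemma coh_value_scalars:
  assumes "P \<in> mpolys_in {..<length fs}"
  shows "coh_value (map ext_scalar fs) P = ext_scalar (msubst (\<lambda>i. fs ! i) P)"
proof -
  have prod: "(\<Prod>i\<leftarrow>l. ext_scalar (g i)) = ext_scalar (\<Prod>i\<leftarrow>l. g i)" for l and g :: "nat \<Rightarrow> 'a mpoly"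
    by (induction l) simp_all
  have "coh_value (map ext_scalar fs) P = (\<Sum>m\<in>Poly_Mapping.keys P. ext_scalar (mconst (Poly_Mapping.lookup P m) *
      (\<Prod>i\<in>Poly_Mapping.keys m. (fs ! i) ^ Poly_Mapping.lookup m i)))"
    unfolding coh_value_def
  proof (rule sum.cong[OF refl])
    fix m assume m: "m \<in> Poly_Mapping.keys P"
    have "(\<Prod>i\<leftarrow>[0..<length (map ext_scalar fs)]. (map ext_scalar fs ! i :: 'a coh) ^ Poly_Mapping.lookup m i) =
        (\<Prod>i\<leftarrow>[0..<length fs]. ext_scalar ((fs ! i) ^ Poly_Mapping.lookup m i))"
      by (intro arg_cong[of _ _ prod_list] map_cong) (simp_all add: ext_scalar_prod)
    also have "\<dots> = ext_scalar (\<Prod>i\<in>{..<length fs}. (fs ! i) ^ Poly_Mapping.lookup m i)"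
      unfolding prod by (subst prod.distinct_set_conv_list[symmetric]) (simp_all add: lessThan_atLeast0)
    also have "(\<Prod>i\<in>{..<length fs}. (fs ! i) ^ Poly_Mapping.lookup m i) =
        (\<Prod>i\<in>Poly_Mapping.keys m. (fs ! i) ^ Poly_Mapping.lookup m i)"
      by (rule prod.mono_neutral_right) (use assms m in \<open>auto simp: mpolys_in_def in_keys_iff\<close>)
    finally show "ext_scalar (mconst (Poly_Mapping.lookup P m)) *
        (\<Prod>i\<leftarrow>[0..<length (map ext_scalar fs)]. (map ext_scalar fs ! i) ^ Poly_Mapping.lookup m i) =
        ext_scalar (mconst (Poly_Mapping.lookup P m) * (\<Prod>i\<in>Poly_Mapping.keys m. (fs ! i) ^ Poly_Mapping.lookup m i))"
      by (simp only: ext_scalar_hom(5))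
  qed
  then show ?thesis unfolding msubst_def ext_scalar_sum .
qed

text \<open>
  The module is described by functions on a set of keys rather than on positions of lists, and the
  algebra by polynomials rather than by cohomology classes.
\<close>

lemma polynomial_tensorI:
  fixes R :: "'a::comm_ring_1 mpoly set" and b :: "'k \<Rightarrow> 'a coh"
  assumes bij: "bij_betw (msubst (\<lambda>i. fs ! i)) (mpolys_in {..<length fs}) R"
    and ks: "distinct ks"
    and M: "M = {\<Sum>k\<in>set ks. ext_scalar (c k) * b k | c. \<forall>k\<in>set ks. c k \<in> R}"
    and indep: "\<And>c. (\<Sum>k\<in>set ks. ext_scalar (c k) * b k) = 0 \<Longrightarrow> \<forall>k\<in>set ks. c k = 0"
  shows "is_polynomial_tensor M (map ext_scalar fs) (map b ks)"
proof -
  have gen: "generated_subalgebra (map ext_scalar fs) = ext_scalar ` R"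
  proof -
    have "generated_subalgebra (map ext_scalar fs) = (\<lambda>P. ext_scalar (msubst (\<lambda>i. fs ! i) P)) ` mpolys_in {..<length fs}"
      unfolding generated_subalgebra_def length_map by (rule image_cong[OF refl coh_value_scalars])
    also have "\<dots> = ext_scalar ` R" using bij by (simp add: bij_betw_def image_image[symmetric])
    finally show ?thesis .
  qed
  have "alg_independent (map ext_scalar fs)"
    unfolding alg_independent_def length_map
  proof (rule inj_onI)
    fix P Q assume PQ: "P \<in> mpolys_in {..<length fs}" "Q \<in> mpolys_in {..<length fs}"
      "coh_value (map ext_scalar fs) P = coh_value (map ext_scalar fs) Q"
    then have "msubst (\<lambda>i. fs ! i) P = msubst (\<lambda>i. fs ! i) Q" by (simp add: coh_value_scalars)
    then show "P = Q" using bij_betw_imp_inj_on[OF bij] PQ by (meson inj_onD)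
  qed
  moreover have sum: "(\<Sum>i<length (map b ks). d i * map b ks ! i) = (\<Sum>k\<in>set ks. d (the_inv_into {..<length ks} (nth ks) k) * b k)" for d
  proof -
    have bn: "bij_betw (nth ks) {..<length ks} (set ks)" by (rule bij_betw_nth[OF ks refl refl])
    have "(\<Sum>i<length ks. d (the_inv_into {..<length ks} (nth ks) (ks ! i)) * b (ks ! i)) =
        (\<Sum>k\<in>set ks. d (the_inv_into {..<length ks} (nth ks) k) * b k)"
      by (rule sum.reindex_bij_betw[OF bn])
    moreover have "the_inv_into {..<length ks} (nth ks) (ks ! i) = i" if "i < length ks" for i
      using bn that by (auto simp: bij_betw_def the_inv_into_f_f)
    ultimately show ?thesis by simp
  qed
  have pos: "the_inv_into {..<length ks} (nth ks) k < length ks \<and> ks ! the_inv_into {..<length ks} (nth ks) k = k" if "k \<in> set ks" for k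
    using the_inv_into_into[of "nth ks" "{..<length ks}" k] f_the_inv_into_f[of "nth ks" "{..<length ks}" k]
      bij_betw_nth[OF ks refl refl] that by (auto simp: bij_betw_def)
  have "is_free_module (ext_scalar ` R) (map b ks) M"
    unfolding is_free_module_def
  proof (intro conjI allI impI)
    show "M = {\<Sum>i<length (map b ks). d i * map b ks ! i | d. \<forall>i<length (map b ks). d i \<in> ext_scalar ` R}"
    proof (intro equalityI subsetI)
      fix x assume "x \<in> M"
      then obtain c where c: "x = (\<Sum>k\<in>set ks. ext_scalar (c k) * b k)" "\<forall>k\<in>set ks. c k \<in> R" using M by auto
      have "x = (\<Sum>i<length (map b ks). ext_scalar (c (ks ! i)) * map b ks ! i)"
        unfolding sum c(1) by (rule sum.cong[OF refl]) (simp add: pos)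
      moreover have "\<forall>i<length (map b ks). ext_scalar (c (ks ! i)) \<in> ext_scalar ` R" using c(2) by simp
      ultimately show "x \<in> {\<Sum>i<length (map b ks). d i * map b ks ! i | d. \<forall>i<length (map b ks). d i \<in> ext_scalar ` R}"
        by (intro CollectI exI[of _ "\<lambda>i. ext_scalar (c (ks ! i))"] conjI)
    next
      fix x assume "x \<in> {\<Sum>i<length (map b ks). d i * map b ks ! i | d. \<forall>i<length (map b ks). d i \<in> ext_scalar ` R}"
      then obtain d where d: "x = (\<Sum>i<length (map b ks). d i * map b ks ! i)" "\<forall>i<length ks. d i \<in> ext_scalar ` R" by auto
      define c where "c k = ext_coeff (d (the_inv_into {..<length ks} (nth ks) k)) {}" for k
      have dc: "d (the_inv_into {..<length ks} (nth ks) k) = ext_scalar (c k) \<and> c k \<in> R" if "k \<in> set ks" for k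
        using d(2) pos[OF that] unfolding c_def by auto
      have "x = (\<Sum>k\<in>set ks. ext_scalar (c k) * b k)"
        unfolding d(1) sum by (rule sum.cong[OF refl]) (simp add: dc)
      then show "x \<in> M" unfolding M using dc by auto
    qed
    fix d i assume d: "(\<forall>i<length (map b ks). d i \<in> ext_scalar ` R) \<and> (\<Sum>i<length (map b ks). d i * map b ks ! i) = 0"
      and i: "i < length (map b ks)"
    define c where "c k = ext_coeff (d (the_inv_into {..<length ks} (nth ks) k)) {}" for k
    have dc: "d (the_inv_into {..<length ks} (nth ks) k) = ext_scalar (c k)" if "k \<in> set ks" for k
      using d pos[OF that] unfolding c_def by auto
    have "(\<Sum>k\<in>set ks. ext_scalar (c k) * b k) = (\<Sum>i<length (map b ks). d i * map b ks ! i)"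
      unfolding sum by (rule sum.cong[OF refl]) (simp add: dc)
    then have "\<forall>k\<in>set ks. c k = 0" using d by (intro indep) simp
    then have "c (ks ! i) = 0" using i by simp
    moreover have "the_inv_into {..<length ks} (nth ks) (ks ! i) = i"
      using bij_betw_nth[OF ks refl refl] i by (auto simp: bij_betw_def the_inv_into_f_f)
    ultimately show "d i = 0" using dc[of "ks ! i"] i by simp
  qed
  with \<open>alg_independent (map ext_scalar fs)\<close> gen show ?thesis by (simp add: is_polynomial_tensor_def)
qed

subsection \<open>Linear substitutions and their composition\<close>

(* The variables are numbered from 1, which is to stay a numeral. *)
declare One_nat_def [simp del]

lemma mconst_sum: "mconst (sum f A) = (\<Sum>i\<in>A. mconst (f i))"
  by (induction A rule: infinite_finite_induct) simp_all

lemma lin_t_in: "lin_t n g i \<in> mpolys_in {1..n}"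
  unfolding lin_t_def by (intro mpolys_in_sum mpolys_in_mult mpolys_in_const) simp

lemma msubst_lin_t_in: "msubst (lin_t n g) f \<in> mpolys_in {1..n}"
  by (rule msubst_in[OF mpolys_in_UNIV lin_t_in])

lemma HBA_iff: "x \<in> HBA n \<longleftrightarrow> x \<in> ext_in {1..n} \<and> (\<forall>S. ext_coeff x S \<in> mpolys_in {1..n})"
  unfolding HBA_def ext_in_def by (auto, metis mpolys_in_0)

lemma HBA_in: "x \<in> HBA n \<Longrightarrow> ext_coeff x S \<in> mpolys_in {1..n}"
  by (simp add: HBA_iff)

lemma HBA_add: "x \<in> HBA n \<Longrightarrow> y \<in> HBA n \<Longrightarrow> x + y \<in> HBA n"
  by (simp add: HBA_iff ext_in_add mpolys_in_add)

lemma HBA_diff: "x \<in> HBA n \<Longrightarrow> y \<in> HBA n \<Longrightarrow> x - y \<in> HBA n"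
  by (simp add: HBA_iff ext_in_diff mpolys_in_diff)

lemma HBA_scalar_mult: "f \<in> mpolys_in {1..n} \<Longrightarrow> x \<in> HBA n \<Longrightarrow> ext_scalar f * x \<in> HBA n"
  by (simp add: HBA_iff ext_in_scalar_mult mpolys_in_mult)

lemma HBA_0: "0 \<in> HBA n"
  by (simp add: HBA_iff)

lemma HBA_sum: "(\<And>i. i \<in> I \<Longrightarrow> f i \<in> HBA n) \<Longrightarrow> sum f I \<in> HBA n"
  by (induction I rule: infinite_finite_induct) (simp_all add: HBA_0 HBA_add)

lemma HBA_basis: "S \<subseteq> {1..n} \<Longrightarrow> ext_basis S \<in> HBA n"
  by (simp add: HBA_iff ext_in_basis ext_coeff_basis)

lemma HBA_1: "1 \<in> HBA n"
  using HBA_basis[of "{}" n] by simp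

lemma HBA_gen_dt_mult: "i \<in> {1..n} \<Longrightarrow> x \<in> HBA n \<Longrightarrow> gen_dt i * x \<in> HBA n"
  unfolding HBA_iff using ext_in_gen_dt_mult[of x "{1..n}" i]
  by (auto simp: insert_absorb ext_coeff_gen_dt_mult intro!: mpolys_in_mult mpolys_in_power mpolys_in_uminus)

lemma HBA_top_form: "set ys \<subseteq> {1..n} \<Longrightarrow> top_form ys \<in> HBA n"
proof (induction ys)
  case (Cons y ys)
  from Cons.prems have y: "y \<in> {1..n}" and ys: "set ys \<subseteq> {1..n}" by auto
  show ?case using HBA_gen_dt_mult[OF y Cons.IH[OF ys]] by simp
qed (simp add: HBA_1)

lemma HBA_milnor_Q: "x \<in> HBA n \<Longrightarrow> milnor_Q j x \<in> HBA n"
proof -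
  assume x: "x \<in> HBA n"
  have S: "S \<subseteq> {1..n}" if "S \<in> {S. ext_coeff x S \<noteq> 0}" for S using x that by (simp add: HBA_def)
  show ?thesis
    unfolding milnor_Q_def milnor_Q_on_basis_def
  proof (intro HBA_sum HBA_scalar_mult mpolys_in_mult mpolys_in_power HBA_basis mpolys_in_uminus mpolys_in_1)
    fix S assume "S \<in> {S. ext_coeff x S \<noteq> 0}"
    note S = S[OF this]
    show "ext_coeff x S \<in> mpolys_in {1..n}" by (rule HBA_in[OF x])
    fix i assume "i \<in> S"
    then show "mvar i \<in> mpolys_in {1..n}" "S - {i} \<subseteq> {1..n}" using S by auto
  qed
qed

lemma HBA_milnor_Qs: "finite J \<Longrightarrow> x \<in> HBA n \<Longrightarrow> milnor_Qs J x \<in> HBA n"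
  by (rule milnor_Qs_induct) (simp_all add: HBA_milnor_Q)

lemma sum_nat_Suc_shift: "(\<Sum>j=1..n. f (j - 1)) = (\<Sum>j<n. f (j :: nat) :: 'b::comm_monoid_add)"
  by (rule sum.reindex_bij_witness[of _ Suc "\<lambda>j. j - 1"]) auto

lemma lin_t_comp:
  assumes "g \<in> carrier_mat n n" "h \<in> carrier_mat n n" "i \<in> {1..n}"
  shows "msubst (lin_t n h) (lin_t n g i) = lin_t n (g * h) i"
proof -
  have entry: "(g * h) $$ (i - 1, k - 1) = (\<Sum>j=1..n. g $$ (i - 1, j - 1) * h $$ (j - 1, k - 1))" if "k \<in> {1..n}" for k
  proof -
    have "i - 1 < n" "k - 1 < n" using assms(3) that by auto
    then show ?thesis
      using assms(1,2) unfolding sum_nat_Suc_shift[of "\<lambda>j. g $$ (i - 1, j) * h $$ (j, k - 1)"]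
      by (simp add: scalar_prod_def lessThan_atLeast0)
  qed
  have "msubst (lin_t n h) (lin_t n g i) = (\<Sum>j=1..n. mconst (g $$ (i - 1, j - 1)) * lin_t n h j)"
    unfolding lin_t_def[of n g] by (simp add: msubst_hom)
  also have "\<dots> = (\<Sum>j=1..n. \<Sum>k=1..n. mconst (g $$ (i - 1, j - 1) * h $$ (j - 1, k - 1)) * mvar k)"
    unfolding lin_t_def by (simp add: sum_distrib_left mult.assoc)
  also have "\<dots> = (\<Sum>k=1..n. \<Sum>j=1..n. mconst (g $$ (i - 1, j - 1) * h $$ (j - 1, k - 1)) * mvar k)"
    by (rule sum.swap)
  also have "\<dots> = lin_t n (g * h) i"
    unfolding lin_t_def by (rule sum.cong[OF refl]) (simp only: entry mconst_sum sum_distrib_right)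
  finally show ?thesis .
qed

lemma lin_dt_comp:
  assumes "g \<in> carrier_mat n n" "h \<in> carrier_mat n n" "i \<in> {1..n}"
  shows "lin_subst n h (lin_dt n g i) = lin_dt n (g * h) i"
proof -
  have entry: "(g * h) $$ (i - 1, k - 1) = (\<Sum>j=1..n. g $$ (i - 1, j - 1) * h $$ (j - 1, k - 1))" if "k \<in> {1..n}" for k
  proof -
    have "i - 1 < n" "k - 1 < n" using assms(3) that by auto
    then show ?thesis
      using assms(1,2) unfolding sum_nat_Suc_shift[of "\<lambda>j. g $$ (i - 1, j) * h $$ (j, k - 1)"]
      by (simp add: scalar_prod_def lessThan_atLeast0)
  qed
  have "lin_subst n h (lin_dt n g i) = (\<Sum>j=1..n. ext_scalar (mconst (g $$ (i - 1, j - 1))) * lin_dt n h j)"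
    unfolding lin_dt_def[of n g] by (simp add: lin_subst_sum lin_subst_scalar_mult lin_subst_gen_dt lin_dt_def)
  also have "\<dots> = (\<Sum>j=1..n. \<Sum>k=1..n. ext_scalar (mconst (g $$ (i - 1, j - 1) * h $$ (j - 1, k - 1))) * gen_dt k)"
    unfolding lin_dt_def by (simp add: sum_distrib_left mult.assoc)
  also have "\<dots> = (\<Sum>k=1..n. \<Sum>j=1..n. ext_scalar (mconst (g $$ (i - 1, j - 1) * h $$ (j - 1, k - 1))) * gen_dt k)"
    by (rule sum.swap)
  also have "\<dots> = lin_dt n (g * h) i"
    unfolding lin_dt_def by (rule sum.cong[OF refl]) (simp only: entry mconst_sum ext_scalar_sum sum_distrib_right)
  finally show ?thesis .
qed

lemma lin_subst_prod_list: "lin_subst n h (\<Prod>i\<leftarrow>l. f i) = (\<Prod>i\<leftarrow>l. lin_subst n h (f i))"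
  by (induction l) (simp_all add: lin_subst_mult)

lemma lin_subst_comp:
  assumes "g \<in> carrier_mat n n" "h \<in> carrier_mat n n" "x \<in> HBA n"
  shows "lin_subst n h (lin_subst n g x) = lin_subst n (g * h) x"
proof -
  have "lin_subst n h (lin_subst n g (ext_scalar f * ext_basis S)) = lin_subst n (g * h) (ext_scalar f * ext_basis S)"
    if f: "f \<in> mpolys_in {1..n}" and S: "S \<subseteq> {1..n}" for f S
  proof -
    have fS: "finite S" using S finite_subset by blast
    have "msubst (lin_t n h) (msubst (lin_t n g) f) = msubst (lin_t n (g * h)) f"
      unfolding msubst_msubst by (rule msubst_cong[OF f]) (rule lin_t_comp[OF assms(1,2)])
    moreover have "(\<Prod>i\<leftarrow>sorted_list_of_set S. lin_subst n h (lin_dt n g i)) = (\<Prod>i\<leftarrow>sorted_list_of_set S. lin_dt n (g * h) i)"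
      using S fS by (intro arg_cong[of _ _ prod_list] map_cong refl lin_dt_comp[OF assms(1,2)]) auto
    ultimately show ?thesis
      by (simp only: lin_subst_scalar_mult lin_subst_basis[OF fS] lin_subst_prod_list)
  qed
  moreover have "ext_coeff x S \<in> mpolys_in {1..n} \<and> S \<subseteq> {1..n}" if "S \<in> {S. ext_coeff x S \<noteq> 0}" for S
    using assms(3) that by (auto simp: HBA_def)
  ultimately have "(\<Sum>S | ext_coeff x S \<noteq> 0. lin_subst n h (lin_subst n g (ext_scalar (ext_coeff x S) * ext_basis S))) =
      (\<Sum>S | ext_coeff x S \<noteq> 0. lin_subst n (g * h) (ext_scalar (ext_coeff x S) * ext_basis S))"
    by (intro sum.cong refl) blast
  then show ?thesis by (simp only: lin_subst_sum[symmetric] ext_expansion[of x, symmetric])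
qed

text \<open>
  If the \<open>dt\<^sub>i\<close> that occur in \<open>x\<close> are fixed, the substitution acts on the polynomial coefficients alone.
\<close>

lemma ext_coeff_lin_subst:
  assumes "\<And>i. i \<in> A \<Longrightarrow> lin_dt n g i = gen_dt i" "x \<in> ext_in A"
  shows "ext_coeff (lin_subst n g x) S = msubst (lin_t n g) (ext_coeff x S)"
proof -
  let ?T = "{T. ext_coeff x T \<noteq> 0}"
  have "lin_subst n g x = (\<Sum>T\<in>?T. ext_scalar (msubst (lin_t n g) (ext_coeff x T)) * ext_basis T)"
    unfolding lin_subst_def
  proof (rule sum.cong[OF refl])
    fix T assume T: "T \<in> ?T"
    then have "T \<subseteq> A" "finite T" using assms(2) ext_coeff_infinite by (auto simp: ext_in_def)
    then have "(\<Prod>i\<leftarrow>sorted_list_of_set T. lin_dt n g i) = (\<Prod>i\<leftarrow>sorted_list_of_set T. ext_basis {i})"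
      using assms(1) by (intro arg_cong[of _ _ prod_list] map_cong) (auto simp: gen_dt_def)
    then show "ext_scalar (msubst (lin_t n g) (ext_coeff x T)) * (\<Prod>i\<leftarrow>sorted_list_of_set T. lin_dt n g i) =
        ext_scalar (msubst (lin_t n g) (ext_coeff x T)) * ext_basis T"
      unfolding ext_basis_eq_prod[OF \<open>finite T\<close>] by (simp only:)
  qed
  then have "ext_coeff (lin_subst n g x) S = (\<Sum>T\<in>?T. msubst (lin_t n g) (ext_coeff x T) * ext_coeff (ext_basis T) S)"
    by simp
  also have "\<dots> = (\<Sum>T\<in>?T. if T = S then msubst (lin_t n g) (ext_coeff x S) else 0)"
    by (rule sum.cong[OF refl]) (use ext_coeff_infinite in \<open>auto simp: ext_coeff_basis\<close>)
  also have "\<dots> = msubst (lin_t n g) (ext_coeff x S)" by (simp add: sum.delta)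
  finally show ?thesis .
qed

lemma lin_subst_in:
  assumes dt: "\<And>i. i \<in> A \<Longrightarrow> lin_dt n g i = gen_dt i" and x: "x \<in> ext_in A"
  shows "lin_subst n g x \<in> ext_in A"
proof (rule ext_inI)
  fix S :: "nat set" assume S: "\<not> S \<subseteq> A"
  show "ext_coeff (lin_subst n g x) S = 0"
    using ext_coeff_lin_subst[OF dt x, of S] ext_inD[OF x S] by simp
qed

text \<open>
  The substitution that adds a linear form in the other variables to \<open>t\<^sub>i\<close>. Its coefficients are
  numbered from 1, like the variables; rows and columns are numbered from 0.
\<close>

definition row_mat :: "nat \<Rightarrow> nat \<Rightarrow> (nat \<Rightarrow> 'a) \<Rightarrow> 'a::comm_ring_1 mat" where
  "row_mat n i c = mat n n (\<lambda>(k, l). if k = l then 1 else if k = i - 1 then c (Suc l) else 0)"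

lemma row_mat_entry:
  assumes "i \<in> {1..n}" "j \<in> {1..n}" "l \<in> {1..n}"
  shows "row_mat n i c $$ (j - 1, l - 1) = (if l = j then 1 else 0) + (if j = i \<and> l \<noteq> i then c l else 0)"
  using assms by (auto simp: row_mat_def)

lemma lin_row_mat:
  assumes "i \<in> {1..n}" "j \<in> {1..n}"
  shows "lin_t n (row_mat n i c) j = mvar j + (if j = i then \<Sum>l\<in>{1..n} - {i}. mconst (c l) * mvar l else 0)"
    and "lin_dt n (row_mat n i c) j = gen_dt j + (if j = i then \<Sum>l\<in>{1..n} - {i}. ext_scalar (mconst (c l)) * gen_dt l else 0)"
proof -
  have if0: "(if P then a else 0) * b = (if P then a * b else 0)" for P and a b :: "'b::ring_1" by simp
  have 1: "mconst (row_mat n i c $$ (j - 1, l - 1)) = (if l = j then 1 else 0) + (if j = i \<and> l \<noteq> i then mconst (c l) else 0)"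
    if "l \<in> {1..n}" for l
    using row_mat_entry[OF assms that, of c] by auto
  have e: "ext_scalar (if P then a else 0) = (if P then ext_scalar a else 0)" for P and a :: "'a mpoly" by simp
  have restr: "(\<Sum>l=1..n. if l \<noteq> i then f l else 0) = (\<Sum>l\<in>{1..n} - {i}. f l)" for f :: "nat \<Rightarrow> 'b::comm_monoid_add"
    by (rule sum.mono_neutral_cong_right) auto
  show "lin_t n (row_mat n i c) j = mvar j + (if j = i then \<Sum>l\<in>{1..n} - {i}. mconst (c l) * mvar l else 0)"
  proof -
    have "lin_t n (row_mat n i c) j = (\<Sum>l=1..n. (if l = j then mvar l else 0) + (if j = i \<and> l \<noteq> i then mconst (c l) * mvar l else 0))"
      unfolding lin_t_def by (rule sum.cong[OF refl]) (simp only: 1 distrib_right if0 mult_1_left)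
    then show ?thesis using assms restr[of "\<lambda>l. mconst (c l) * mvar l"] by (cases "j = i") (simp_all add: sum.distrib)
  qed
  show "lin_dt n (row_mat n i c) j = gen_dt j + (if j = i then \<Sum>l\<in>{1..n} - {i}. ext_scalar (mconst (c l)) * gen_dt l else 0)"
  proof -
    have "lin_dt n (row_mat n i c) j = (\<Sum>l=1..n. (if l = j then gen_dt l else 0) + (if j = i \<and> l \<noteq> i then ext_scalar (mconst (c l)) * gen_dt l else 0))"
      unfolding lin_dt_def by (rule sum.cong[OF refl]) (simp only: 1 ext_scalar_hom(2,3) e distrib_right if0 mult_1_left)
    then show ?thesis using assms restr[of "\<lambda>l. ext_scalar (mconst (c l)) * gen_dt l"] by (cases "j = i") (simp_all add: sum.distrib)
  qed
qed

lemma row_mat_0: "row_mat n i (\<lambda>_. 0) = 1\<^sub>m n"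
  by (rule eq_matI) (auto simp: row_mat_def)

lemma msubst_row_mat:
  assumes "i \<in> {1..n}" "f \<in> mpolys_in {1..n}"
  shows "msubst (lin_t n (row_mat n i c)) f = msubst (mvar(i := mvar i + (\<Sum>l\<in>{1..n} - {i}. mconst (c l) * mvar l))) f"
  by (rule msubst_cong[OF assms(2)]) (simp add: lin_row_mat(1)[OF assms(1)])

lemma lin_subst_1_HBA: "x \<in> HBA n \<Longrightarrow> lin_subst n (1\<^sub>m n) x = x"
proof (cases "n = 0")
  case True
  assume "x \<in> HBA n"
  moreover have none: "{1..n} = {}" using True by simp
  ultimately have x: "x \<in> ext_in {}" "\<And>S. ext_coeff x S \<in> mpolys_in {}" unfolding HBA_iff none by blast+
  have "ext_coeff (lin_subst n (1\<^sub>m n) x) S = ext_coeff x S" for S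
  proof -
    have "ext_coeff (lin_subst n (1\<^sub>m n) x) S = msubst (lin_t n (1\<^sub>m n)) (ext_coeff x S)"
      by (rule ext_coeff_lin_subst[OF _ x(1)]) simp
    also have "\<dots> = ext_coeff x S" by (rule msubst_id_on[OF x(2)]) simp
    finally show ?thesis .
  qed
  then show ?thesis by (intro exterior_eqI) simp
next
  case False
  assume x: "x \<in> HBA n"
  have 1: "1 \<in> {1..n}" using False by simp
  have row: "lin_t n (1\<^sub>m n) j = mvar j" "lin_dt n (1\<^sub>m n) j = gen_dt j" if "j \<in> {1..n}" for j
    using lin_row_mat[OF 1 that, of "\<lambda>_. 0"] by (cases "j = 1"; simp add: row_mat_0)+
  have "ext_coeff (lin_subst n (1\<^sub>m n) x) S = ext_coeff x S" for S
  proof -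
    have "ext_coeff (lin_subst n (1\<^sub>m n) x) S = msubst (lin_t n (1\<^sub>m n)) (ext_coeff x S)"
      by (rule ext_coeff_lin_subst[of "{1..n}"]) (use x row(2) in \<open>auto simp: HBA_iff\<close>)
    also have "\<dots> = ext_coeff x S" by (rule msubst_id_on[OF HBA_in[OF x]]) (rule row(1))
    finally show ?thesis .
  qed
  then show ?thesis by (intro exterior_eqI) simp
qed

text \<open>
  The action of \<open>g\<close> is the substitution by its inverse, and both have the same fixed elements.
\<close>

lemma invariants_eq:
  assumes "\<And>g. g \<in> W \<Longrightarrow> g \<in> carrier_mat n n \<and> det g \<noteq> 0"
  shows "invariants n W = {x \<in> HBA n. \<forall>g\<in>W. lin_subst n g x = x}"
proof -
  have "act n g x = x \<longleftrightarrow> lin_subst n g x = x" if g: "g \<in> W" and x: "x \<in> HBA n" for g x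
  proof -
    let ?h = "the (mat_inverse g)"
    have gc: "g \<in> carrier_mat n n" "det g \<noteq> 0" using assms[OF g] by auto
    note inv = mat_inverse_nonsingular[OF gc]
    have 1: "lin_subst n g (lin_subst n ?h x) = x" "lin_subst n ?h (lin_subst n g x) = x"
      using lin_subst_comp[OF inv(1) gc(1) x] lin_subst_comp[OF gc(1) inv(1) x] inv lin_subst_1_HBA[OF x] by simp_all
    show ?thesis unfolding act_def using 1 by metis
  qed
  then show ?thesis unfolding invariants_def by auto
qed

subsection \<open>Congruences from transvections\<close>

lemma scalar_dvdI:
  assumes "\<And>S. l dvd ext_coeff z S"
  shows "\<exists>y. z = ext_scalar l * y"
proof -
  have "\<forall>S. \<exists>k. ext_coeff z S = l * k" using assms by (simp add: dvd_def)
  then obtain q where q: "\<And>S. ext_coeff z S = l * q S" by (auto dest: choice)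
  have "z = (\<Sum>S | ext_coeff z S \<noteq> 0. ext_scalar (ext_coeff z S) * ext_basis S)" by (rule ext_expansion)
  also have "\<dots> = ext_scalar l * (\<Sum>S | ext_coeff z S \<noteq> 0. ext_scalar (q S) * ext_basis S)"
    unfolding sum_distrib_left by (rule sum.cong[OF refl]) (simp only: q ext_scalar_hom(5) mult.assoc)
  finally show ?thesis by (rule exI)
qed

lemma gen_dt_split_HBA:
  assumes x: "x \<in> HBA n" "x = gen_dt i * \<alpha> + \<beta>" and ab: "\<alpha> \<in> ext_in ({1..n} - {i})" "\<beta> \<in> ext_in ({1..n} - {i})"
  shows "\<alpha> \<in> HBA n" "\<beta> \<in> HBA n" "\<And>S. i \<notin> S \<Longrightarrow> ext_coeff x (insert i S) = (-1) ^ card {k \<in> S. k < i} * ext_coeff \<alpha> S"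
proof -
  have not_i: "ext_coeff \<alpha> S = 0" "ext_coeff \<beta> S = 0" if "i \<in> S" for S
    using ab that by (auto simp: ext_in_def)
  show eq: "ext_coeff x (insert i S) = (-1) ^ card {k \<in> S. k < i} * ext_coeff \<alpha> S" if "i \<notin> S" for S
    unfolding x(2) using that not_i(2)[of "insert i S"] by (simp add: ext_coeff_gen_dt_mult)
  have "ext_coeff \<alpha> S \<in> mpolys_in {1..n}" for S
  proof (cases "i \<in> S")
    case False
    have "ext_coeff \<alpha> S = (-1) ^ card {k \<in> S. k < i} * ext_coeff x (insert i S)"
      unfolding eq[OF False] by (simp flip: mult.assoc power_add mult_2)
    then show ?thesis using HBA_in[OF x(1)] by (simp add: mpolys_in_mult mpolys_in_power mpolys_in_uminus)
  qed (simp add: not_i)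
  then show "\<alpha> \<in> HBA n" using ext_in_mono[OF ab(1), of "{1..n}"] by (auto simp: HBA_iff)
  have "ext_coeff \<beta> S \<in> mpolys_in {1..n}" for S
  proof (cases "i \<in> S")
    case False
    then have "ext_coeff \<beta> S = ext_coeff x S" unfolding x(2) by (simp add: ext_coeff_gen_dt_mult)
    then show ?thesis using HBA_in[OF x(1)] by simp
  qed (simp add: not_i)
  then show "\<beta> \<in> HBA n" using ext_in_mono[OF ab(2), of "{1..n}"] by (auto simp: HBA_iff)
qed

text \<open>
  If \<open>x = dt\<^sub>i \<alpha> + \<beta>\<close> is invariant under \<open>t\<^sub>i \<mapsto> t\<^sub>i + l\<close>, comparing the parts without \<open>dt\<^sub>i\<close> shows that
  \<open>dl \<alpha>\<close> is the change of \<open>\<beta>\<close>. Only the polynomial coefficients of \<open>\<beta>\<close> change, and only by multiples of \<open>l\<close>.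
\<close>

lemma transvection_congruence:
  fixes x :: "'a::comm_ring_1 coh"
  assumes x: "x \<in> HBA n" "x = gen_dt i * \<alpha> + \<beta>" and ab: "\<alpha> \<in> ext_in ({1..n} - {i})" "\<beta> \<in> ext_in ({1..n} - {i})"
    and i: "i \<in> {1..n}" and inv: "lin_subst n (row_mat n i c) x = x"
  shows "\<exists>y. (\<Sum>l\<in>{1..n} - {i}. ext_scalar (mconst (c l)) * gen_dt l) * \<alpha> =
    ext_scalar (\<Sum>l\<in>{1..n} - {i}. mconst (c l) * mvar l) * y"
proof -
  let ?A = "{1..n} - {i}" and ?g = "row_mat n i c"
  let ?dl = "\<Sum>l\<in>?A. ext_scalar (mconst (c l)) * gen_dt l" and ?l = "\<Sum>l\<in>?A. mconst (c l) * mvar l :: 'a mpoly"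
  let ?t = "lin_subst n ?g"
  note abH = gen_dt_split_HBA(1,2)[OF x ab]
  have fix_dt: "lin_dt n ?g j = gen_dt j" if "j \<in> ?A" for j
    using lin_row_mat(2)[OF i, of j c] that by simp
  have sub: "ext_in ?A \<subseteq> (ext_in (- {i}) :: 'a coh set)" by (auto intro: ext_in_mono)
  have tin: "?t \<alpha> \<in> ext_in ?A" "?t \<beta> \<in> ext_in ?A" using lin_subst_in[OF fix_dt] ab by blast+
  have dlin: "?dl * z \<in> ext_in ?A" if "z \<in> ext_in ?A" for z
  proof -
    have "gen_dt l * z \<in> ext_in ?A" if "l \<in> ?A" for l
      using ext_in_gen_dt_mult[OF \<open>z \<in> ext_in ?A\<close>, of l] that by (simp add: insert_absorb)
    then show ?thesis unfolding sum_distrib_right by (intro ext_in_sum) (simp add: mult.assoc ext_in_scalar_mult)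
  qed
  have "gen_dt i * ?t \<alpha> + (?dl * ?t \<alpha> + ?t \<beta>) = ?t x"
    unfolding x(2) lin_subst_add lin_subst_gen_dt_mult using lin_row_mat(2)[OF i i, of c]
    by (simp add: distrib_right add.assoc)
  also have "\<dots> = gen_dt i * \<alpha> + \<beta>" using inv x(2) by simp
  finally have eq: "gen_dt i * ?t \<alpha> + (?dl * ?t \<alpha> + ?t \<beta>) = gen_dt i * \<alpha> + \<beta>" .
  have "?t \<alpha> = \<alpha>" "?dl * ?t \<alpha> + ?t \<beta> = \<beta>"
    using gen_dt_split_eq[OF _ _ _ _ eq] sub tin ab ext_in_add[OF dlin[OF tin(1)] tin(2)] by blast+
  then have dl: "?dl * \<alpha> = \<beta> - ?t \<beta>" by (simp add: algebra_simps)
  have "\<exists>y. \<beta> - ?t \<beta> = ext_scalar ?l * y"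
  proof (rule scalar_dvdI)
    fix S
    have "ext_coeff (\<beta> - ?t \<beta>) S = ext_coeff \<beta> S - msubst (mvar(i := mvar i + ?l)) (ext_coeff \<beta> S)"
      using ext_coeff_lin_subst[OF fix_dt ab(2), of S] msubst_row_mat[OF i HBA_in[OF abH(2)], of c S] by simp
    moreover have "- ?l dvd ext_coeff \<beta> S - msubst (mvar(i := mvar i + ?l)) (ext_coeff \<beta> S)"
      using dvd_diff_msubst[of i "mvar i + ?l" "ext_coeff \<beta> S"] by simp
    ultimately show "?l dvd ext_coeff (\<beta> - ?t \<beta>) S" by simp
  qed
  then show ?thesis unfolding dl .
qed

abbreviation elem_mat :: "nat \<Rightarrow> nat \<Rightarrow> nat \<Rightarrow> 'a \<Rightarrow> 'a::comm_ring_1 mat" where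
  "elem_mat n i j c \<equiv> row_mat n i (\<lambda>l. if l = j then c else 0)"

lemma sum_elem:
  assumes "j \<in> {1..n}" "i \<noteq> j"
  shows "(\<Sum>l\<in>{1..n} - {i}. mconst (if l = j then c else 0) * mvar l) = mconst c * mvar j"
    and "(\<Sum>l\<in>{1..n} - {i}. ext_scalar (mconst (if l = j then c else 0)) * gen_dt l) = ext_scalar (mconst c) * gen_dt j"
proof -
  have "(\<Sum>l\<in>{1..n} - {i}. mconst (if l = j then c else 0) * mvar l) = (\<Sum>l\<in>{1..n} - {i}. if l = j then mconst c * mvar j else 0)"
    by (rule sum.cong[OF refl]) (auto split: if_splits)
  then show "(\<Sum>l\<in>{1..n} - {i}. mconst (if l = j then c else 0) * mvar l) = mconst c * mvar j"
    using assms by simp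
  have "(\<Sum>l\<in>{1..n} - {i}. ext_scalar (mconst (if l = j then c else 0)) * gen_dt l) =
      (\<Sum>l\<in>{1..n} - {i}. if l = j then ext_scalar (mconst c) * gen_dt j else 0)"
    by (rule sum.cong[OF refl]) (auto split: if_splits)
  then show "(\<Sum>l\<in>{1..n} - {i}. ext_scalar (mconst (if l = j then c else 0)) * gen_dt l) = ext_scalar (mconst c) * gen_dt j"
    using assms by simp
qed

definition ext_transv_inv :: "nat \<Rightarrow> nat list \<Rightarrow> 'a::comm_ring_1 coh \<Rightarrow> bool" where
  "ext_transv_inv n ys x \<longleftrightarrow> (\<forall>i\<in>set ys. \<forall>j\<in>set ys. \<forall>c. i \<noteq> j \<longrightarrow> lin_subst n (elem_mat n i j c) x = x)"

lemma ext_transv_invD: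
  "ext_transv_inv n ys x \<Longrightarrow> i \<in> set ys \<Longrightarrow> j \<in> set ys \<Longrightarrow> i \<noteq> j \<Longrightarrow> lin_subst n (elem_mat n i j c) x = x"
  by (auto simp: ext_transv_inv_def)

text \<open>
  Let \<open>x\<close> be invariant and without scalar part. A monomial of \<open>x\<close> with a factor \<open>dt\<^sub>i\<close>, but without \<open>dt\<^sub>b\<close>,
  has a coefficient divisible by \<open>t\<^sub>b\<close>, because the transvection \<open>t\<^sub>i \<mapsto> t\<^sub>i + t\<^sub>b\<close> turns \<open>dt\<^sub>i\<close> into \<open>dt\<^sub>b\<close>.
\<close>

lemma ext_transv_inv_dvd:
  fixes x :: "'a::comm_ring_1 coh"
  assumes x: "x \<in> HBA n" "x \<in> ext_in (set ys)" "ext_transv_inv n ys x" and ys: "set ys \<subseteq> {1..n}" and b: "b \<in> set ys"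
  shows "\<exists>y. gen_dt b * (x - ext_scalar (ext_coeff x {})) = ext_scalar (mvar b) * y"
proof (rule scalar_dvdI)
  fix T
  have coeff: "mvar b dvd ext_coeff x S" if S: "S \<noteq> {}" "b \<notin> S" for S
  proof (cases "S \<subseteq> set ys")
    case False
    then show ?thesis using ext_inD[OF x(2)] by simp
  next
    case True
    then obtain i where i: "i \<in> S" "i \<in> set ys" "i \<noteq> b" using S by auto
    have in_n: "i \<in> {1..n}" "b \<in> {1..n}" using ys i b by auto
    obtain \<alpha> \<beta> where ab: "\<alpha> \<in> ext_in ({1..n} - {i})" "\<beta> \<in> ext_in ({1..n} - {i})" "x = gen_dt i * \<alpha> + \<beta>"
      using gen_dt_split[of x "{1..n}" i] x(1) by (auto simp: HBA_iff)
    obtain y where "(\<Sum>l\<in>{1..n} - {i}. ext_scalar (mconst (if l = b then 1 else 0)) * gen_dt l) * \<alpha> =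
        ext_scalar (\<Sum>l\<in>{1..n} - {i}. mconst (if l = b then 1 else 0) * mvar l) * y"
      using transvection_congruence[OF x(1) ab(3,1,2) in_n(1) ext_transv_invD[OF x(3) i(2) b i(3), of 1]] by blast
    then have y: "gen_dt b * \<alpha> = ext_scalar (mvar b) * y"
      unfolding sum_elem[OF in_n(2) i(3)] by simp
    let ?S = "S - {i}"
    have "ext_coeff (gen_dt b * \<alpha>) (insert b ?S) = (-1) ^ card {k \<in> ?S. k < b} * ext_coeff \<alpha> ?S"
      using S by (simp add: ext_coeff_gen_dt_mult insert_Diff_if)
    then have "mvar b dvd (-1) ^ card {k \<in> ?S. k < b} * ext_coeff \<alpha> ?S"
      unfolding y by (metis dvd_triv_left ext_coeff_scalar_mult)
    then have "mvar b dvd ext_coeff \<alpha> ?S"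
      by (cases "even (card {k \<in> ?S. k < b})") simp_all
    moreover have "ext_coeff x (insert i ?S) = (-1) ^ card {k \<in> ?S. k < i} * ext_coeff \<alpha> ?S"
      by (rule gen_dt_split_HBA(3)[OF x(1) ab(3,1,2)]) simp
    ultimately show ?thesis using i(1) by (simp add: insert_absorb)
  qed
  show "mvar b dvd ext_coeff (gen_dt b * (x - ext_scalar (ext_coeff x {}))) T"
  proof (cases "b \<in> T")
    case True
    show ?thesis
    proof (cases "T - {b} = {}")
      case True
      have "ext_coeff (x - ext_scalar (ext_coeff x {})) (T - {b}) = 0"
        unfolding True by (simp add: ext_scalar.rep_eq)
      then show ?thesis by (simp add: ext_coeff_gen_dt_mult)
    next
      case False
      then have "mvar b dvd ext_coeff x (T - {b})" by (intro coeff) auto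
      then show ?thesis using False \<open>b \<in> T\<close> by (simp add: ext_coeff_gen_dt_mult ext_scalar.rep_eq)
    qed
  qed (simp add: ext_coeff_gen_dt_mult)
qed

context prime_order
begin

lemma transv_inv_coeff:
  assumes x: "x \<in> HBA n" "ext_transv_inv n ys x" and ys: "set ys \<subseteq> {1..n}"
  shows "transv_inv ys (ext_coeff (x :: 'a coh) {})"
  unfolding transv_inv_def
proof (intro ballI allI impI)
  fix i j and c :: 'a assume ij: "i \<in> set ys" "j \<in> set ys" "i \<noteq> j"
  have in_n: "i \<in> {1..n}" "j \<in> {1..n}" using ij ys by auto
  let ?g = "elem_mat n i j c"
  have aug: "ext_coeff (lin_subst n ?g y) {} = msubst (lin_t n ?g) (ext_coeff y {})" for y :: "'a coh"
  proof (induction y rule: coh_induct)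
    case one
    show ?case by (simp add: one_exterior.rep_eq)
  next
    case (gen_dt k y)
    have "ext_coeff (lin_dt n ?g k * z) {} = 0" for z :: "'a coh"
      unfolding lin_dt_def sum_distrib_right by (simp add: mult.assoc ext_coeff_gen_dt_mult)
    then show ?case by (simp add: lin_subst_gen_dt_mult ext_coeff_gen_dt_mult)
  qed (simp_all add: lin_subst_add lin_subst_scalar_mult msubst_hom)
  have "msubst (mvar(i := mvar i + mconst c * mvar j)) (ext_coeff x {}) = msubst (lin_t n ?g) (ext_coeff x {})"
    using msubst_row_mat[OF in_n(1) HBA_in[OF x(1)], of "\<lambda>l. if l = j then c else 0" "{}"]
    unfolding sum_elem(1)[OF in_n(2) ij(3)] by (simp only:)
  also have "\<dots> = ext_coeff x {}" using aug[of x] ext_transv_invD[OF x(2) ij, of c] by simp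
  finally show "msubst (mvar(i := mvar i + mconst c * mvar j)) (ext_coeff x {}) = ext_coeff x {}" .
qed

lemma ext_transv_inv_milnor_Qs: "finite J \<Longrightarrow> ext_transv_inv n ys x \<Longrightarrow> ext_transv_inv n ys (milnor_Qs J (x :: 'a coh))"
  unfolding ext_transv_inv_def by (metis milnor_Qs_lin_subst)

text \<open>
  An invariant \<open>x\<close> is a combination of the \<open>Q\<^sub>I u\<close> as soon as the determinant divides all scalar parts
  of the \<open>Q\<^sub>J x\<close>. These are invariant polynomials, so that divisibility by one variable is enough.
\<close>

theorem mui_expansion:
  fixes x :: "'a coh"
  assumes ys: "distinct ys" "ys \<noteq> []" "set ys \<subseteq> {1..n}"
    and x: "x \<in> HBA n" "x \<in> ext_in (set ys)" "ext_transv_inv n ys x"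
  shows "\<exists>f. x = ext_scalar (ext_coeff x {}) +
    (\<Sum>I\<in>Pow {..<length ys} - {{..<length ys}}. ext_scalar (f I) * milnor_Qs I (top_form ys))"
proof -
  let ?n = "length ys" and ?b = "hd ys" and ?z = "x - ext_scalar (ext_coeff x {})" and ?u = "top_form ys :: 'a coh"
  have b: "?b \<in> set ys" using ys(2) by simp
  have "dickson_det ys dvd ext_coeff (milnor_Qs J ?z) {}" if J: "J \<subseteq> {..<?n}" for J
  proof (cases "J = {}")
    case False
    have fJ: "finite J" using J finite_subset by blast
    have Jz: "milnor_Qs J ?z = milnor_Qs J x" using fJ False by (simp add: milnor_Qs_linear milnor_Qs_scalar)
    obtain y where "gen_dt ?b * ?z = ext_scalar (mvar ?b) * y" using ext_transv_inv_dvd[OF x ys(3) b] by blast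
    then have "mvar ?b dvd ext_coeff (milnor_Qs J ?z) {}"
      using lin_form_dvd_milnor_Qs[of "{?b}" ?b "\<lambda>_. 1" ?z y J] fJ by simp
    moreover have "transv_inv ys (ext_coeff (milnor_Qs J ?z) {})"
      unfolding Jz by (rule transv_inv_coeff[OF HBA_milnor_Qs[OF fJ x(1)] ext_transv_inv_milnor_Qs[OF fJ x(3)] ys(3)])
    ultimately show ?thesis using transv_inv_dvd_forms[OF _ b] by (intro dickson_det_dvd[OF ys(1)]) blast
  qed simp
  moreover have "?z \<in> ext_in (set ys)" by (intro ext_in_diff x(2) ext_in_scalar)
  ultimately obtain f where f: "?z = (\<Sum>I\<in>Pow {..<?n}. ext_scalar (f I) * milnor_Qs I ?u)"
    using milnor_Qs_expansion[OF ys(1)] by blast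
  have "f {..<?n} = 0"
  proof -
    have "0 = ext_coeff ?z {}" by simp
    also have "\<dots> = (\<Sum>I\<in>Pow {..<?n}. f I * ext_coeff (milnor_Qs {} (milnor_Qs I ?u)) {})" unfolding f by simp
    also have "\<dots> = (\<Sum>I\<in>Pow {..<?n}. if I = {..<?n} then f {..<?n} * dickson_det ys else 0)"
    proof (rule sum.cong[OF refl])
      fix I assume I: "I \<in> Pow {..<?n}"
      show "f I * ext_coeff (milnor_Qs {} (milnor_Qs I ?u)) {} = (if I = {..<?n} then f {..<?n} * dickson_det ys else 0)"
      proof (cases "I = {..<?n}")
        case True
        then show ?thesis by (simp add: dickson_det_scalar)
      next
        case False
        then have "{} \<noteq> {..<?n} - I" using I by auto
        then show ?thesis using False milnor_pairing[of I ys "{}"] I by auto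
      qed
    qed
    also have "\<dots> = f {..<?n} * dickson_det ys" by (subst sum.delta) auto
    finally show ?thesis using dickson_det_nonzero[OF ys(1)] by simp
  qed
  then have "(\<Sum>I\<in>Pow {..<?n}. ext_scalar (f I) * milnor_Qs I ?u) =
      (\<Sum>I\<in>Pow {..<?n} - {{..<?n}}. ext_scalar (f I) * milnor_Qs I ?u)"
    by (intro sum.mono_neutral_right) auto
  then have "x = ext_scalar (ext_coeff x {}) + (\<Sum>I\<in>Pow {..<?n} - {{..<?n}}. ext_scalar (f I) * milnor_Qs I ?u)"
    using f by (simp add: algebra_simps)
  then show ?thesis by blast
qed

text \<open>
  Multiplied by the determinant, which is \<open>Q\<^sub>0 \<cdots> Q\<^sub>n\<^sub>-\<^sub>1 u\<close>, the relation becomes one between the \<open>Q\<^sub>I u\<close> for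
  all \<open>I\<close>.
\<close>

lemma mui_independent:
  assumes "distinct ys"
    and "ext_scalar c + (\<Sum>I\<in>Pow {..<length ys} - {{..<length ys}}. ext_scalar (f I) * milnor_Qs I (top_form ys)) = (0 :: 'a coh)"
  shows "c = 0 \<and> (\<forall>I\<in>Pow {..<length ys} - {{..<length ys}}. f I = 0)"
proof -
  let ?n = "length ys" and ?u = "top_form ys :: 'a coh" and ?e = "dickson_det ys :: 'a mpoly"
  let ?f = "\<lambda>I. if I = {..<?n} then c else ?e * f I"
  have e: "?e \<noteq> 0" by (rule dickson_det_nonzero[OF assms(1)])
  have "(\<Sum>I\<in>Pow {..<?n}. ext_scalar (?f I) * milnor_Qs I ?u) =
      ext_scalar (?f {..<?n}) * milnor_Qs {..<?n} ?u + (\<Sum>I\<in>Pow {..<?n} - {{..<?n}}. ext_scalar (?f I) * milnor_Qs I ?u)"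
    by (rule sum.remove) auto
  also have "ext_scalar (?f {..<?n}) * milnor_Qs {..<?n} ?u = ext_scalar ?e * ext_scalar c"
    unfolding dickson_det_scalar by (simp add: mult.commute flip: ext_scalar_hom(5))
  also have "(\<Sum>I\<in>Pow {..<?n} - {{..<?n}}. ext_scalar (?f I) * milnor_Qs I ?u) =
      ext_scalar ?e * (\<Sum>I\<in>Pow {..<?n} - {{..<?n}}. ext_scalar (f I) * milnor_Qs I ?u)"
    unfolding sum_distrib_left by (rule sum.cong[OF refl]) (simp add: mult.assoc)
  finally have "(\<Sum>I\<in>Pow {..<?n}. ext_scalar (?f I) * milnor_Qs I ?u) = 0"
    using assms(2) by (simp only: distrib_left[symmetric]) simp
  from milnor_Qs_independent[OF assms(1) this] have z: "?f I = 0" if "I \<subseteq> {..<?n}" for I using that .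
  have "f I = 0" if "I \<in> Pow {..<?n} - {{..<?n}}" for I using z[of I] that e by simp
  then show ?thesis using z[of "{..<?n}"] by simp
qed

text \<open>
  In \<open>Q\<^sub>J (dt\<^sub>a v)\<close> the factor \<open>dt\<^sub>a\<close> survives only if every operation acts on \<open>v\<close>; the sign comes from
  moving the odd operations past \<open>dt\<^sub>a\<close>.
\<close>

lemma milnor_Qs_gen_dt_mult:
  assumes "finite J" "v \<in> ext_in Y"
  shows "\<exists>r\<in>ext_in Y. milnor_Qs J (gen_dt a * v :: 'a coh) = gen_dt a * (ext_scalar ((-1) ^ card J) * milnor_Qs J v) + r"
  using assms(1)
proof (induction J rule: finite_linorder_min_induct)
  case empty
  show ?case by (intro bexI[of _ 0]) simp_all
next
  case (insert b B)
  then obtain r where r: "r \<in> ext_in Y" "milnor_Qs B (gen_dt a * v :: 'a coh) = gen_dt a * (ext_scalar ((-1) ^ card B) * milnor_Qs B v) + r"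
    by blast
  let ?w = "ext_scalar ((-1) ^ card B) * milnor_Qs B v" and ?t = "ext_scalar (mvar a ^ (CARD('a) ^ b))"
  have "b \<notin> B" using insert.hyps by auto
  then have "card (insert b B) = Suc (card B)" using insert.hyps by simp
  then have "milnor_Qs (insert b B) (gen_dt a * v) =
      gen_dt a * (ext_scalar ((-1) ^ card (insert b B)) * milnor_Qs (insert b B) v) + (?t * ?w + milnor_Q b r)"
    using insert.hyps r(2) by (simp add: milnor_Qs_insert_min milnor_Q_add milnor_Q_gen_dt_mult milnor_Q_scalar_mult)
  moreover have "?t * ?w + milnor_Q b r \<in> ext_in Y"
    by (intro ext_in_add ext_in_scalar_mult milnor_Qs_in insert.hyps(1) assms(2) milnor_Q_in r(1))
  ultimately show ?case by blast
qed

text \<open>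
  If \<open>x = dt\<^sub>a \<alpha> + \<beta>\<close> is invariant under all translations of \<open>t\<^sub>a\<close> by linear forms \<open>l\<close>, then \<open>dl \<alpha>\<close> vanishes
  modulo \<open>l\<close> for every \<open>l\<close>. So \<open>\<alpha>\<close> is a combination of the \<open>Q\<^sub>J u\<close>, which up to sign are the parts with
  \<open>dt\<^sub>a\<close> of the \<open>Q\<^sub>J (dt\<^sub>a u)\<close>.
\<close>

theorem translation_expansion:
  fixes x :: "'a coh"
  assumes zs: "distinct zs" "{1..n} - {a} = set zs" and a: "a \<in> {1..n}" and x: "x \<in> HBA n"
    and inv: "\<And>c. lin_subst n (row_mat n a c) x = x"
  shows "\<exists>h. x - (\<Sum>J\<in>Pow {..<length zs}. ext_scalar (h J) * milnor_Qs J (top_form (a # zs))) \<in> ext_in (set zs)"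
proof -
  let ?n = "length zs" and ?u = "top_form zs :: 'a coh"
  obtain \<alpha> \<beta> where ab: "\<alpha> \<in> ext_in ({1..n} - {a})" "\<beta> \<in> ext_in ({1..n} - {a})" "x = gen_dt a * \<alpha> + \<beta>"
    using gen_dt_split[of x "{1..n}" a] x by (auto simp: HBA_iff)
  have "dickson_det zs dvd ext_coeff (milnor_Qs J \<alpha>) {}" if J: "J \<subseteq> {..<?n}" for J
  proof (rule dickson_det_dvd[OF zs(1)])
    fix l :: "'a mpoly" assume l: "l \<in> lin_forms zs" "l \<noteq> 0"
    then obtain c where c: "l = (\<Sum>i\<in>set zs. mconst (c i) * mvar i)" by (auto simp: lin_forms_def)
    have "\<exists>b\<in>set zs. c b \<noteq> 0"
    proof (rule ccontr)
      assume "\<not> (\<exists>b\<in>set zs. c b \<noteq> 0)"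
      then have "l = 0" unfolding c by simp
      with l(2) show False by simp
    qed
    then obtain b where b: "b \<in> set zs" "c b \<noteq> 0" by blast
    obtain y where y: "(\<Sum>i\<in>set zs. ext_scalar (mconst (c i)) * gen_dt i) * \<alpha> = ext_scalar (\<Sum>i\<in>set zs. mconst (c i) * mvar i) * y"
      using transvection_congruence[OF x ab(3,1,2) a inv, of c] unfolding zs(2) by blast
    have fJ: "finite J" using J finite_subset by blast
    show "l dvd ext_coeff (milnor_Qs J \<alpha>) {}"
      unfolding c by (rule lin_form_dvd_milnor_Qs[OF finite_set b y fJ])
  qed
  then obtain f where f: "\<alpha> = (\<Sum>J\<in>Pow {..<?n}. ext_scalar (f J) * milnor_Qs J ?u)"
    using milnor_Qs_expansion[OF zs(1)] ab(1) unfolding zs(2) by blast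
  define h where "h J = (-1) ^ card J * f J" for J :: "nat set"
  have "\<exists>r\<in>ext_in (set zs). ext_scalar (h J) * milnor_Qs J (gen_dt a * ?u) = gen_dt a * (ext_scalar (f J) * milnor_Qs J ?u) + r"
    if J: "J \<in> Pow {..<?n}" for J
  proof -
    have fJ: "finite J" using J finite_subset by blast
    obtain r where r: "r \<in> ext_in (set zs)" "milnor_Qs J (gen_dt a * ?u) = gen_dt a * (ext_scalar ((-1) ^ card J) * milnor_Qs J ?u) + r"
      using milnor_Qs_gen_dt_mult[OF fJ top_form_in[of zs], of a] by (elim bexE)
    have sq: "h J * (-1) ^ card J = f J"
      by (cases "even (card J)") (simp_all add: h_def)
    have "ext_scalar (h J) * milnor_Qs J (gen_dt a * ?u) =
        gen_dt a * (ext_scalar (h J * (-1) ^ card J) * milnor_Qs J ?u) + ext_scalar (h J) * r"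
      unfolding r(2) by (simp only: distrib_left mult_scalar_left_commute[of "gen_dt a"] ext_scalar_hom(5) mult.assoc)
    then show ?thesis unfolding sq using ext_in_scalar_mult[OF r(1)] by blast
  qed
  then have "\<forall>J\<in>Pow {..<?n}. \<exists>r. r \<in> ext_in (set zs) \<and>
      ext_scalar (h J) * milnor_Qs J (gen_dt a * ?u) = gen_dt a * (ext_scalar (f J) * milnor_Qs J ?u) + r"
    by (simp add: Bex_def)
  from bchoice[OF this] obtain r where r_all: "\<forall>J\<in>Pow {..<?n}. r J \<in> ext_in (set zs) \<and>
      ext_scalar (h J) * milnor_Qs J (gen_dt a * ?u) = gen_dt a * (ext_scalar (f J) * milnor_Qs J ?u) + r J"
    by (rule exE)
  note r = conjunct1[OF bspec[OF r_all]] conjunct2[OF bspec[OF r_all]]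
  have "(\<Sum>J\<in>Pow {..<?n}. ext_scalar (h J) * milnor_Qs J (top_form (a # zs))) =
      (\<Sum>J\<in>Pow {..<?n}. gen_dt a * (ext_scalar (f J) * milnor_Qs J ?u) + r J)"
    by (rule sum.cong[OF refl]) (simp add: r(2))
  also have "\<dots> = gen_dt a * \<alpha> + (\<Sum>J\<in>Pow {..<?n}. r J)" unfolding f by (simp add: sum.distrib sum_distrib_left)
  finally have "x - (\<Sum>J\<in>Pow {..<?n}. ext_scalar (h J) * milnor_Qs J (top_form (a # zs))) = \<beta> - (\<Sum>J\<in>Pow {..<?n}. r J)"
    unfolding ab(3) by simp
  moreover have "\<beta> - (\<Sum>J\<in>Pow {..<?n}. r J) \<in> ext_in (set zs)"
    using ab(2) unfolding zs(2) by (intro ext_in_diff ext_in_sum r(1))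
  ultimately show ?thesis by (intro exI[of _ h]) simp
qed

text \<open>
  An element without \<open>dt\<^sub>a\<close> has no part \<open>dt\<^sub>a \<alpha>\<close>, and for the given combination \<open>\<alpha>\<close> is a combination of the
  independent \<open>Q\<^sub>J u\<close>.
\<close>

lemma translation_independent:
  assumes zs: "distinct zs" "a \<notin> set zs"
    and "(\<Sum>J\<in>Pow {..<length zs}. ext_scalar (h J) * milnor_Qs J (top_form (a # zs))) \<in> (ext_in (- {a}) :: 'a coh set)"
  shows "\<forall>J\<in>Pow {..<length zs}. h J = 0"
proof -
  let ?n = "length zs" and ?u = "top_form zs :: 'a coh"
  have sub: "ext_in (set zs) \<subseteq> (ext_in (- {a}) :: 'a coh set)"
    by (rule subsetI, rule ext_in_mono) (use zs(2) in auto)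
  have "\<forall>J\<in>Pow {..<?n}. \<exists>r. r \<in> ext_in (set zs) \<and>
      milnor_Qs J (gen_dt a * ?u) = gen_dt a * (ext_scalar ((-1) ^ card J) * milnor_Qs J ?u) + r"
  proof
    fix J assume "J \<in> Pow {..<?n}"
    then have "finite J" using finite_subset by blast
    then show "\<exists>r. r \<in> ext_in (set zs) \<and>
        milnor_Qs J (gen_dt a * ?u) = gen_dt a * (ext_scalar ((-1) ^ card J) * milnor_Qs J ?u) + r"
      using milnor_Qs_gen_dt_mult[OF _ top_form_in, of J zs a] by (simp add: Bex_def)
  qed
  from bchoice[OF this] obtain r where r_all: "\<forall>J\<in>Pow {..<?n}. r J \<in> ext_in (set zs) \<and>
      milnor_Qs J (gen_dt a * ?u) = gen_dt a * (ext_scalar ((-1) ^ card J) * milnor_Qs J ?u) + r J"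
    by (rule exE)
  note r = conjunct1[OF bspec[OF r_all]] conjunct2[OF bspec[OF r_all]]
  define y where "y = (\<Sum>J\<in>Pow {..<?n}. ext_scalar (h J) * milnor_Qs J (top_form (a # zs)) :: 'a coh)"
  let ?\<alpha> = "\<Sum>J\<in>Pow {..<?n}. ext_scalar (h J * (-1) ^ card J) * milnor_Qs J ?u"
  have "y = (\<Sum>J\<in>Pow {..<?n}. gen_dt a * (ext_scalar (h J * (-1) ^ card J) * milnor_Qs J ?u) + ext_scalar (h J) * r J)"
    unfolding y_def
  proof (rule sum.cong[OF refl])
    fix J assume J: "J \<in> Pow {..<?n}"
    have "top_form (a # zs) = gen_dt a * ?u" by simp
    then show "ext_scalar (h J) * milnor_Qs J (top_form (a # zs)) =
        gen_dt a * (ext_scalar (h J * (-1) ^ card J) * milnor_Qs J ?u) + ext_scalar (h J) * r J"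
      by (simp only: r(2)[OF J] distrib_left mult_scalar_left_commute[of "gen_dt a"] ext_scalar_hom(5) mult.assoc)
  qed
  then have y: "y = gen_dt a * ?\<alpha> + (\<Sum>J\<in>Pow {..<?n}. ext_scalar (h J) * r J)"
    by (simp only: sum.distrib sum_distrib_left)
  have cancel: "u + (v - w) = 0" if "w = u + v" for u v w :: "'a coh" using that by simp
  have e0: "gen_dt a * ?\<alpha> + ((\<Sum>J\<in>Pow {..<?n}. ext_scalar (h J) * r J) - y) = 0" by (rule cancel[OF y])
  have e1: "?\<alpha> \<in> ext_in (- {a})"
  proof -
    have "?\<alpha> \<in> ext_in (set zs)"
    proof (intro ext_in_sum ext_in_scalar_mult milnor_Qs_in top_form_in)
      fix J assume "J \<in> Pow {..<?n}"
      then show "finite J" by (meson PowD finite_lessThan finite_subset)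
    qed
    then show ?thesis by (rule subsetD[OF sub])
  qed
  have e2: "(\<Sum>J\<in>Pow {..<?n}. ext_scalar (h J) * r J) - y \<in> ext_in (- {a})"
  proof (rule ext_in_diff)
    have "(\<Sum>J\<in>Pow {..<?n}. ext_scalar (h J) * r J) \<in> ext_in (set zs)"
      by (intro ext_in_sum ext_in_scalar_mult r(1))
    then show "(\<Sum>J\<in>Pow {..<?n}. ext_scalar (h J) * r J) \<in> ext_in (- {a})" by (rule subsetD[OF sub])
    show "y \<in> ext_in (- {a})" using assms(3) unfolding y_def .
  qed
  have "?\<alpha> = 0" by (rule gen_dt_split_unique(1)[OF e1 e2 e0])
  then have "h J * (-1) ^ card J = 0" if "J \<subseteq> {..<?n}" for J by (rule milnor_Qs_independent[OF zs(1) _ that])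
  then show ?thesis by simp
qed

end

section \<open>The Weyl groups\<close>

subsection \<open>Matrices with a block of determinant one\<close>

lemma mconst_diff: "mconst (a - b) = mconst a - mconst (b :: 'a::comm_ring_1)"
  using mconst_hom(3)[of "a" "- b"] by (simp add: mconst_uminus)

lemma sum_lessThan_numeral:
  "(\<Sum>j<2. h j) = h 0 + h (1 :: nat)" "(\<Sum>j<3. h j) = h 0 + h 1 + (h (2 :: nat) :: 'b::comm_monoid_add)"
  by (simp_all add: numeral_2_eq_2 numeral_3_eq_3 One_nat_def)

lemma det_2_mat: "det (mat 2 2 f :: 'a::comm_ring_1 mat) = f (0, 0) * f (1, 1) - f (0, 1) * f (1, 0)"
proof -
  have m: "mat_delete (mat 2 2 f) 0 0 = mat 1 1 (\<lambda>_. f (1, 1))" "mat_delete (mat 2 2 f) 0 1 = mat 1 1 (\<lambda>_. f (1, 0))"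
    by (rule eq_matI; auto simp: mat_delete_def One_nat_def)+
  have "det (mat 2 2 f) = (\<Sum>j<2. mat 2 2 f $$ (0, j) * cofactor (mat 2 2 f) 0 j)"
    by (rule laplace_expansion_row) auto
  also have "\<dots> = f (0, 0) * f (1, 1) - f (0, 1) * f (1, 0)"
    unfolding sum_lessThan_numeral cofactor_def m by (simp add: det_single)
  finally show ?thesis .
qed

lemma det_3:
  fixes A :: "'a::comm_ring_1 mat"
  assumes A: "A \<in> carrier_mat 3 3"
  shows "det A = A $$ (0, 0) * (A $$ (1, 1) * A $$ (2, 2) - A $$ (1, 2) * A $$ (2, 1))
    - A $$ (0, 1) * (A $$ (1, 0) * A $$ (2, 2) - A $$ (1, 2) * A $$ (2, 0))
    + A $$ (0, 2) * (A $$ (1, 0) * A $$ (2, 1) - A $$ (1, 1) * A $$ (2, 0))"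
proof -
  have m: "mat_delete A 0 j = mat 2 2 (\<lambda>(i', j'). A $$ (Suc i', if j' < j then j' else Suc j'))" for j
    using A by (intro eq_matI) (auto simp: mat_delete_def)
  have "det A = (\<Sum>j<3. A $$ (0, j) * cofactor A 0 j)"
    by (rule laplace_expansion_row[OF A]) simp
  then show ?thesis
    unfolding sum_lessThan_numeral cofactor_def m det_2_mat
    by (simp add: One_nat_def[symmetric] Suc_1 right_diff_distrib)
qed

text \<open>
  The expansion of the product along the first factor is that of the determinant along the first row.
\<close>

lemma lin_comb_mult_top_form:
  fixes x y z :: "'a::comm_ring_1 coh"
  assumes "x = gen_dt i" "y = gen_dt j" "z = gen_dt k"
  shows "(ext_scalar a1 * x + ext_scalar a2 * y + ext_scalar a3 * z) *
    ((ext_scalar b1 * x + ext_scalar b2 * y + ext_scalar b3 * z) *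
     (ext_scalar c1 * x + ext_scalar c2 * y + ext_scalar c3 * z)) =
    ext_scalar (a1 * (b2 * c3 - b3 * c2) - a2 * (b1 * c3 - b3 * c1) + a3 * (b1 * c2 - b2 * c1)) * (x * (y * z))"
proof -
  have sq: "gen_dt l * gen_dt l = (0 :: 'a coh)" and ac: "gen_dt l * gen_dt m = - (gen_dt m * gen_dt l :: 'a coh)" for l m
    using gen_dt_square[of l "1 :: 'a coh"] gen_dt_anticomm[of l m "1 :: 'a coh"] by simp_all
  have pairs: "x * x = 0" "y * y = 0" "z * z = 0" "y * x = - (x * y)" "z * x = - (x * z)" "z * y = - (y * z)"
    unfolding assms using sq ac by blast+
  have triples: "x * (x * y) = 0" "x * (x * z) = 0" "y * (y * z) = 0" "y * (x * y) = 0" "z * (x * z) = 0" "z * (y * z) = 0"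
    "y * (x * z) = - (x * (y * z))" "z * (x * y) = x * (y * z)"
    using pairs by (simp_all flip: mult.assoc) (simp_all add: mult.assoc pairs)
  have "(ext_scalar b1 * x + ext_scalar b2 * y + ext_scalar b3 * z) *
     (ext_scalar c1 * x + ext_scalar c2 * y + ext_scalar c3 * z) =
     ext_scalar (b1 * c2 - b2 * c1) * (x * y) + ext_scalar (b1 * c3 - b3 * c1) * (x * z) + ext_scalar (b2 * c3 - b3 * c2) * (y * z)"
    by (simp only: distrib_left distrib_right scalar_mult_swap pairs ext_scalar_diff left_diff_distrib)
      (simp add: mult.commute)
  note two = this
  show ?thesis
    unfolding two
    by (simp only: distrib_left distrib_right scalar_mult_swap triples mult_minus_right mult_zero_right
        add_0_left add_0_right)
      (simp only: ext_scalar_diff ext_scalar_hom(3) distrib_right left_diff_distrib, simp)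
qed

definition block :: "nat \<Rightarrow> 'a mat \<Rightarrow> 'a mat" where
  "block k g = mat 3 3 (\<lambda>(i, j). g $$ (i + k, j + k))"

text \<open>
  The rows \<open>k, k + 1, k + 2\<close>, counted from 0, consist of a block of determinant one and zeros. They belong to
  the variables with the numbers \<open>k + 1, k + 2, k + 3\<close>.
\<close>

definition block_mat :: "nat \<Rightarrow> nat \<Rightarrow> 'a::comm_ring_1 mat \<Rightarrow> bool" where
  "block_mat n k g \<longleftrightarrow> g \<in> carrier_mat n n \<and> k + 3 \<le> n \<and> det (block k g) = 1 \<and>
     (\<forall>i\<in>{k..<k+3}. \<forall>j\<in>{..<n} - {k..<k+3}. g $$ (i, j) = 0)"

abbreviation block_list :: "nat \<Rightarrow> nat list" where
  "block_list k \<equiv> [k + 1, k + 2, k + 3]"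

lemma lin_block_mat:
  assumes g: "block_mat n k g" and i: "i \<in> set (block_list k)"
  shows "lin_t n g i = (\<Sum>j\<in>set (block_list k). mconst (g $$ (i - 1, j - 1)) * mvar j)"
    and "lin_dt n g i = (\<Sum>j\<in>set (block_list k). ext_scalar (mconst (g $$ (i - 1, j - 1))) * gen_dt j)"
proof -
  have sub: "set (block_list k) \<subseteq> {1..n}" using g by (auto simp: block_mat_def)
  have zero: "g $$ (i - 1, j - 1) = 0" if "j \<in> {1..n} - set (block_list k)" for j
  proof -
    have "i - 1 \<in> {k..<k+3}" using i by auto
    moreover have "j - 1 \<in> {..<n} - {k..<k+3}" using that by auto
    ultimately show ?thesis using g unfolding block_mat_def by blast
  qed
  show "lin_t n g i = (\<Sum>j\<in>set (block_list k). mconst (g $$ (i - 1, j - 1)) * mvar j)"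
    unfolding lin_t_def by (rule sum.mono_neutral_right[OF _ sub]) (auto simp: zero)
  show "lin_dt n g i = (\<Sum>j\<in>set (block_list k). ext_scalar (mconst (g $$ (i - 1, j - 1))) * gen_dt j)"
    unfolding lin_dt_def by (rule sum.mono_neutral_right[OF _ sub]) (auto simp: zero)
qed

lemma lin_subst_block_top_form:
  assumes g: "block_mat n k g"
  shows "lin_subst n g (top_form (block_list k)) = top_form (block_list k)"
proof -
  have one: "det (block k g) = 1" using g by (simp add: block_mat_def)
  let ?e = "\<lambda>i j. mconst (g $$ (k + i, k + j))"
  have row: "lin_dt n g (k + Suc i) = ext_scalar (?e i 0) * gen_dt (k + 1) + ext_scalar (?e i 1) * gen_dt (k + 2) +
      ext_scalar (?e i 2) * gen_dt (k + 3)" if "i < 3" for i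
  proof -
    have i: "k + Suc i \<in> set (block_list k)" using that by auto
    show ?thesis unfolding lin_block_mat(2)[OF g i] by (simp add: One_nat_def numeral_2_eq_2 numeral_3_eq_3 add.assoc)
  qed
  have rows: "lin_dt n g (k + 1) = ext_scalar (?e 0 0) * gen_dt (k + 1) + ext_scalar (?e 0 1) * gen_dt (k + 2) + ext_scalar (?e 0 2) * gen_dt (k + 3)"
    "lin_dt n g (k + 2) = ext_scalar (?e 1 0) * gen_dt (k + 1) + ext_scalar (?e 1 1) * gen_dt (k + 2) + ext_scalar (?e 1 2) * gen_dt (k + 3)"
    "lin_dt n g (k + 3) = ext_scalar (?e 2 0) * gen_dt (k + 1) + ext_scalar (?e 2 1) * gen_dt (k + 2) + ext_scalar (?e 2 2) * gen_dt (k + 3)"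
    using row[of 0] row[of 1] row[of 2] by (simp_all add: One_nat_def numeral_2_eq_2 numeral_3_eq_3)
  have entry: "block k g $$ (i, j) = g $$ (k + i, k + j)" if "i < 3" "j < 3" for i j
    using that by (simp add: block_def add.commute)
  have B: "block k g \<in> carrier_mat 3 3" by (simp add: block_def)
  have "?e 0 0 * (?e 1 1 * ?e 2 2 - ?e 1 2 * ?e 2 1) - ?e 0 1 * (?e 1 0 * ?e 2 2 - ?e 1 2 * ?e 2 0) +
      ?e 0 2 * (?e 1 0 * ?e 2 1 - ?e 1 1 * ?e 2 0) = mconst (det (block k g))"
    unfolding det_3[OF B] by (simp add: entry mconst_diff)
  then have det: "?e 0 0 * (?e 1 1 * ?e 2 2 - ?e 1 2 * ?e 2 1) - ?e 0 1 * (?e 1 0 * ?e 2 2 - ?e 1 2 * ?e 2 0) +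
      ?e 0 2 * (?e 1 0 * ?e 2 1 - ?e 1 1 * ?e 2 0) = 1"
    using one by simp
  have "lin_subst n g (top_form (block_list k)) = lin_dt n g (k + 1) * (lin_dt n g (k + 2) * lin_dt n g (k + 3))"
    by (simp only: list.map prod_list.Cons prod_list.Nil lin_subst_gen_dt_mult mult_1_right
        lin_subst_gen_dt[folded lin_dt_def])
  also have "\<dots> = top_form (block_list k)"
    unfolding rows lin_comb_mult_top_form[OF refl refl refl] det
    by (simp only: list.map prod_list.Cons prod_list.Nil ext_scalar_hom(2) mult_1_left mult_1_right)
  finally show ?thesis .
qed

lemma gen_dt_mult_top_form: "i \<in> set ys \<Longrightarrow> gen_dt i * top_form ys = (0 :: 'a::comm_ring_1 coh)"
proof (induction ys)
  case (Cons y ys)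
  show ?case
  proof (cases "i = y")
    case True
    then show ?thesis using gen_dt_square[of y "top_form ys :: 'a coh"] by simp
  next
    case False
    then have "gen_dt i * top_form ys = (0 :: 'a coh)" using Cons by simp
    then show ?thesis using gen_dt_anticomm[of i y "top_form ys :: 'a coh"] by simp
  qed
qed simp

lemma lin_t_first:
  assumes "n \<ge> 1" "set ys = {2..n}"
  shows "\<exists>l\<in>lin_forms ys. lin_t n g 1 = mconst (g $$ (0, 0)) * mvar 1 + l"
proof -
  have "{1..n} = insert 1 {2..n}" using assms(1) by auto
  then have "lin_t n g 1 = mconst (g $$ (0, 0)) * mvar 1 + (\<Sum>j\<in>set ys. mconst (g $$ (0, j - 1)) * mvar j)"
    unfolding lin_t_def assms(2) by simp
  then show ?thesis using lin_formsI[of "\<lambda>j. g $$ (0, j - 1)" ys] by (rule bexI)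
qed

text \<open>
  The other variables in the image of \<open>t\<^sub>1\<close> do not contribute, because their differentials already occur in the
  product.
\<close>

lemma lin_subst_first_top_form:
  assumes n: "n \<ge> 1" "set ys = {2..n}"
    and ys: "lin_subst n g (top_form ys) = ext_scalar (mconst c) * (top_form ys :: 'a::comm_ring_1 coh)"
  shows "lin_subst n g (top_form (1 # ys)) = ext_scalar (mconst (g $$ (0, 0) * c)) * top_form (1 # ys)"
proof -
  let ?u = "top_form ys :: 'a coh"
  have "{1..n} = insert 1 {2..n}" using n(1) by auto
  then have dt: "lin_dt n g 1 = ext_scalar (mconst (g $$ (0, 0))) * gen_dt 1 + (\<Sum>j\<in>set ys. ext_scalar (mconst (g $$ (0, j - 1))) * gen_dt j)"
    unfolding lin_dt_def n(2) by simp
  have "(\<Sum>j\<in>set ys. ext_scalar (mconst (g $$ (0, j - 1))) * gen_dt j) * ?u = 0"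
    unfolding sum_distrib_right by (rule sum.neutral) (simp add: mult.assoc gen_dt_mult_top_form)
  then have "(\<Sum>j\<in>set ys. ext_scalar (mconst (g $$ (0, j - 1))) * gen_dt j) * (ext_scalar (mconst c) * ?u) = 0"
    by (simp only: mult_scalar_left_commute[of _ "mconst c"] mult_zero_right)
  then have "lin_dt n g 1 * (ext_scalar (mconst c) * ?u) = ext_scalar (mconst (g $$ (0, 0)) * mconst c) * (gen_dt 1 * ?u)"
    unfolding dt by (simp only: distrib_right scalar_mult_swap add_0_right)
  then show ?thesis by (simp add: lin_subst_gen_dt_mult ys)
qed

subsection \<open>The entries of the elements of the Weyl groups\<close>

lemma SL_3_eq: "SL 3 = {g. block_mat 3 0 g}"
proof -
  have "block 0 g = g" if "g \<in> carrier_mat 3 3" for g :: "'a mat"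
    using that by (intro eq_matI) (auto simp: block_def)
  then show ?thesis by (auto simp: SL_def block_mat_def)
qed

lemma block_four_block:
  assumes "A \<in> carrier_mat 1 1" "m \<in> carrier_mat 1 3" "g \<in> SL 3"
  shows "block_mat 4 1 (four_block_mat A m (0\<^sub>m 3 1) g)"
proof -
  have "block 1 (four_block_mat A m (0\<^sub>m 3 1) g) = g"
    using assms by (intro eq_matI) (auto simp: block_def SL_def One_nat_def)
  then show ?thesis using assms by (auto simp: block_mat_def SL_def One_nat_def)
qed

lemma block_four_blockE:
  fixes g :: "'a::comm_ring_1 mat"
  assumes "block_mat 4 1 g"
  obtains m g\<^sub>1 where "m \<in> carrier_mat 1 3" "g\<^sub>1 \<in> SL 3" "g = four_block_mat (scalar_mat (g $$ (0, 0))) m (0\<^sub>m 3 1) g\<^sub>1"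
proof
  show "mat 1 3 (\<lambda>(i, j). g $$ (0, j + 1)) \<in> carrier_mat 1 3" by simp
  show "block 1 g \<in> SL 3" using assms by (simp add: SL_def block_mat_def block_def)
  show "g = four_block_mat (scalar_mat (g $$ (0, 0))) (mat 1 3 (\<lambda>(i, j). g $$ (0, j + 1))) (0\<^sub>m 3 1) (block 1 g)"
    using assms by (intro eq_matI) (auto simp: block_mat_def block_def scalar_mat_def One_nat_def)
qed

lemma weyl_3E6_eq: "weyl_3E6 = {g. block_mat 4 1 g \<and> g $$ (0, 0) = 1}"
proof -
  have one: "scalar_mat 1 = (1\<^sub>m 1 :: 'a mat)" by (intro eq_matI) (auto simp: scalar_mat_def)
  have "g \<in> weyl_3E6" if g: "block_mat 4 1 g" "g $$ (0, 0) = 1" for g :: "'a mat"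
  proof -
    obtain m g\<^sub>1 where "m \<in> carrier_mat 1 3" "g\<^sub>1 \<in> SL 3" "g = four_block_mat (scalar_mat (g $$ (0, 0))) m (0\<^sub>m 3 1) g\<^sub>1"
      by (rule block_four_blockE[OF g(1)])
    then show ?thesis unfolding weyl_3E6_def g(2) one by (intro CollectI exI conjI)
  qed
  moreover have "block_mat 4 1 g \<and> g $$ (0, 0) = 1" if "g \<in> weyl_3E6" for g :: "'a mat"
    using that by (auto simp: weyl_3E6_def intro: block_four_block)
  ultimately show ?thesis by blast
qed

lemma weyl_2E7_eq: "weyl_2E7 = {g. block_mat 4 1 g \<and> g $$ (0, 0) \<noteq> 0}"
proof -
  have "g \<in> weyl_2E7" if g: "block_mat 4 1 g" "g $$ (0, 0) \<noteq> 0" for g :: "'a mat"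
  proof -
    obtain m g\<^sub>1 where "m \<in> carrier_mat 1 3" "g\<^sub>1 \<in> SL 3" "g = four_block_mat (scalar_mat (g $$ (0, 0))) m (0\<^sub>m 3 1) g\<^sub>1"
      by (rule block_four_blockE[OF g(1)])
    with g(2) show ?thesis unfolding weyl_2E7_def by (intro CollectI exI conjI)
  qed
  moreover have "block_mat 4 1 g \<and> g $$ (0, 0) \<noteq> 0" if "g \<in> weyl_2E7" for g :: "'a mat"
    using that by (auto simp: weyl_2E7_def scalar_mat_def intro: block_four_block)
  ultimately show ?thesis by blast
qed

lemma weyl_E8_eq:
  "weyl_E8 = {g. block_mat 5 1 g \<and> g $$ (0, 0) \<noteq> 0 \<and> g $$ (4, 4) \<noteq> 0 \<and> (\<forall>j<4. g $$ (4, j) = 0)}"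
proof (intro equalityI subsetI)
  fix g :: "'a mat" assume "g \<in> weyl_E8"
  then obtain e1 e2 m0 m1 g1 where g: "g = four_block_mat (four_block_mat (scalar_mat e1) m0 (0\<^sub>m 3 1) g1)
      (m1 @\<^sub>r 0\<^sub>m 3 1) (0\<^sub>m 1 4) (scalar_mat e2)" "e1 \<noteq> 0" "e2 \<noteq> 0" "m0 \<in> carrier_mat 1 3" "m1 \<in> carrier_mat 1 1" "g1 \<in> SL 3"
    by (auto simp: weyl_E8_def)
  have car: "g \<in> carrier_mat 5 5" using g by (auto simp: SL_def scalar_mat_def append_rows_def intro!: carrier_matI)
  have "block 1 g = g1"
    using g by (intro eq_matI) (auto simp: block_def SL_def One_nat_def scalar_mat_def append_rows_def)
  then have "block_mat 5 1 g"
    using g car by (auto simp: block_mat_def SL_def One_nat_def scalar_mat_def append_rows_def)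
  then show "g \<in> {g. block_mat 5 1 g \<and> g $$ (0, 0) \<noteq> 0 \<and> g $$ (4, 4) \<noteq> 0 \<and> (\<forall>j<4. g $$ (4, j) = 0)}"
    using g by (auto simp: SL_def scalar_mat_def append_rows_def)
next
  fix g :: "'a mat" assume "g \<in> {g. block_mat 5 1 g \<and> g $$ (0, 0) \<noteq> 0 \<and> g $$ (4, 4) \<noteq> 0 \<and> (\<forall>j<4. g $$ (4, j) = 0)}"
  then have g: "block_mat 5 1 g" "g $$ (0, 0) \<noteq> 0" "g $$ (4, 4) \<noteq> 0" "\<And>j. j < 4 \<Longrightarrow> g $$ (4, j) = 0" by auto
  have "g = four_block_mat (four_block_mat (scalar_mat (g $$ (0, 0))) (mat 1 3 (\<lambda>(i, j). g $$ (0, j + 1))) (0\<^sub>m 3 1) (block 1 g))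
      (mat 1 1 (\<lambda>_. g $$ (0, 4)) @\<^sub>r 0\<^sub>m 3 1) (0\<^sub>m 1 4) (scalar_mat (g $$ (4, 4)))" (is "g = ?h")
  proof (rule eq_matI)
    fix i j assume "i < dim_row ?h" "j < dim_col ?h"
    then have ij: "i < 5" "j < 5" by (simp_all add: scalar_mat_def append_rows_def block_def)
    consider "i = 0" | "i \<in> {1..<4}" | "i = 4" using ij by fastforce
    then show "g $$ (i, j) = ?h $$ (i, j)"
    proof cases
      case 1
      then show ?thesis using ij by (cases "j = 4") (auto simp: scalar_mat_def append_rows_def block_def One_nat_def)
    next
      case 2
      have zero: "g $$ (i, j) = 0" if "j \<in> {0, 4}"
        using g(1) 2 that unfolding block_mat_def by auto
      consider "j = 0" | "j \<in> {1..<4}" | "j = 4" using ij by fastforce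
      then show ?thesis
        by cases (use 2 zero in \<open>auto simp: scalar_mat_def append_rows_def block_def One_nat_def\<close>)
    next
      case 3
      then show ?thesis using ij g(4)[of j] by (cases "j = 4") (auto simp: scalar_mat_def append_rows_def block_def)
    qed
  qed (use g(1) in \<open>auto simp: block_mat_def scalar_mat_def append_rows_def block_def\<close>)
  moreover have "block 1 g \<in> SL 3" using g(1) by (simp add: SL_def block_mat_def block_def)
  ultimately show "g \<in> weyl_E8"
    unfolding weyl_E8_def using g(2,3)
    by (intro CollectI exI[of _ "g $$ (0, 0)"] exI[of _ "g $$ (4, 4)"] exI[of _ "mat 1 3 (\<lambda>(i, j). g $$ (0, j + 1))"]
        exI[of _ "mat 1 1 (\<lambda>_. g $$ (0, 4))"] exI[of _ "block 1 g"] conjI) simp_all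
qed

lemma det_weyl:
  shows "(g :: 'a::field mat) \<in> weyl_2E7 \<Longrightarrow> det g \<noteq> 0" and "(g :: 'a::field mat) \<in> weyl_E8 \<Longrightarrow> det g \<noteq> 0"
proof -
  have four: "det (four_block_mat (scalar_mat e) m (0\<^sub>m 3 1) g1) = e" if "m \<in> carrier_mat 1 3" "g1 \<in> SL 3" for e :: 'a and m g1
    using that det_four_block_mat_lower_left_zero[of "scalar_mat e" 1 m 3 "0\<^sub>m 3 1" g1]
    by (auto simp: SL_def scalar_mat_def det_single)
  then show "det g \<noteq> 0" if "g \<in> weyl_2E7" using that by (auto simp: weyl_2E7_def)
  show "det g \<noteq> 0" if gW: "g \<in> weyl_E8"
  proof -
    obtain e1 e2 m0 m1 g1 where g: "g = four_block_mat (four_block_mat (scalar_mat e1) m0 (0\<^sub>m 3 1) g1)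
      (m1 @\<^sub>r 0\<^sub>m 3 1) (0\<^sub>m 1 4) (scalar_mat e2)" "e1 \<noteq> 0" "e2 \<noteq> 0" "m0 \<in> carrier_mat 1 3" "m1 \<in> carrier_mat 1 1" "g1 \<in> SL 3"
      using gW by (auto simp: weyl_E8_def)
    let ?A = "four_block_mat (scalar_mat e1) m0 (0\<^sub>m 3 1) g1"
    have A: "?A \<in> carrier_mat 4 4" using g by (auto simp: SL_def scalar_mat_def intro!: carrier_matI)
    have c: "m1 @\<^sub>r 0\<^sub>m 3 1 \<in> carrier_mat 4 1" using g by (auto simp: append_rows_def intro!: carrier_matI)
    have "det g = det ?A * det (scalar_mat e2)"
      unfolding g(1) by (rule det_four_block_mat_lower_left_zero[OF A c refl]) (simp add: scalar_mat_def)
    then show ?thesis using four[OF g(4,6)] g(2,3) by (simp add: scalar_mat_def det_single)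
  qed
qed

definition scale_row_mat :: "nat \<Rightarrow> nat \<Rightarrow> 'a \<Rightarrow> 'a::comm_ring_1 mat" where
  "scale_row_mat n i c = mat n n (\<lambda>(k, l). if k = l then if k = i - 1 then c else 1 else 0)"

lemma lin_t_scale_row_mat:
  assumes "i \<in> {1..n}" "j \<in> {1..n}"
  shows "lin_t n (scale_row_mat n i c) j = (if j = i then mconst c * mvar i else mvar j)"
proof -
  have "lin_t n (scale_row_mat n i c) j = (\<Sum>l=1..n. if l = j then if j = i then mconst c * mvar i else mvar j else 0)"
    unfolding lin_t_def by (rule sum.cong[OF refl]) (use assms in \<open>auto simp: scale_row_mat_def\<close>)
  then show ?thesis using assms by simp
qed

lemma block_mat_one:
  assumes "g \<in> carrier_mat n n" "k + 3 \<le> n"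
    and "\<And>i j. i \<in> {k..<k+3} \<Longrightarrow> j < n \<Longrightarrow> g $$ (i, j) = (if i = j then 1 else 0)"
  shows "block_mat n k g"
proof -
  have "block k g = 1\<^sub>m 3" using assms by (intro eq_matI) (auto simp: block_def)
  then show ?thesis using assms by (auto simp: block_mat_def)
qed

lemma block_mat_row_mat: "k + 3 \<le> n \<Longrightarrow> i \<in> {1..n} - set (block_list k) \<Longrightarrow> block_mat n k (row_mat n i c)"
  by (rule block_mat_one) (auto simp: row_mat_def)

lemma block_mat_scale_row_mat: "k + 3 \<le> n \<Longrightarrow> i \<in> {1..n} - set (block_list k) \<Longrightarrow> block_mat n k (scale_row_mat n i c)"
  by (rule block_mat_one) (auto simp: scale_row_mat_def)

lemma block_mat_elem_mat:
  assumes n: "k + 3 \<le> n" and ij: "i \<in> set (block_list k)" "j \<in> set (block_list k)" "i \<noteq> j"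
  shows "block_mat n k (elem_mat n i j c)"
proof -
  let ?g = "elem_mat n i j c"
  have entry: "?g $$ (a, b) = (if a = b then 1 else if a = i - 1 \<and> b = j - 1 then c else 0)" if "a < n" "b < n" for a b
    using that ij by (auto simp: row_mat_def)
  have B: "block k ?g \<in> carrier_mat 3 3" by (simp add: block_def)
  have bentry: "block k ?g $$ (a, b) = (if a = b then 1 else if a + k = i - 1 \<and> b + k = j - 1 then c else 0)" if "a < 3" "b < 3" for a b
    using that n by (simp add: block_def entry)
  have "det (block k ?g) = 1" unfolding det_3[OF B] using ij by (auto simp: bentry)
  moreover have "?g $$ (a, b) = 0" if "a \<in> {k..<k+3}" "b \<in> {..<n} - {k..<k+3}" for a b
    using that n ij by (subst entry) auto
  ultimately show ?thesis using n unfolding block_mat_def by (auto simp: row_mat_def)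
qed

section \<open>The rings of invariants\<close>

subsection \<open>Free modules of invariants\<close>

lemma lin_subst_scalar: "lin_subst n g (ext_scalar f) = ext_scalar (msubst (lin_t n g) f)"
  using lin_subst_scalar_mult[of n g f 1] by simp

lemma ext_in_mult: "x \<in> ext_in A \<Longrightarrow> y \<in> ext_in A \<Longrightarrow> x * y \<in> ext_in A"
proof (rule ext_inI)
  fix S :: "nat set" assume x: "x \<in> ext_in A" and y: "y \<in> ext_in A" and S: "\<not> S \<subseteq> A"
  have zero: "ext_coeff x B = 0 \<or> ext_coeff y (S - B) = 0" if "B \<in> Pow S" for B
  proof (cases "B \<subseteq> A")
    case True
    then have "\<not> S - B \<subseteq> A" using S by blast
    then show ?thesis using ext_inD[OF y] by simp
  qed (use ext_inD[OF x] in simp)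
  then show "ext_coeff (x * y) S = 0" unfolding times_exterior.rep_eq
  proof (intro sum.neutral ballI)
    fix B assume "B \<in> Pow S"
    from zero[OF this] show "ext_sign B (S - B) * ext_coeff x B * ext_coeff y (S - B) = 0" by auto
  qed
qed

lemma lin_subst_ext_in:
  assumes dt: "\<And>i. i \<in> A \<Longrightarrow> lin_dt n g i \<in> ext_in A" and x: "x \<in> ext_in A"
  shows "lin_subst n g x \<in> ext_in A"
proof -
  have prod: "(\<Prod>i\<leftarrow>l. lin_dt n g i) \<in> ext_in A" if "set l \<subseteq> A" for l
    using that
  proof (induction l)
    case Nil
    show ?case using ext_in_scalar[of 1 A] by simp
  next
    case (Cons i l)
    then show ?case by (simp add: ext_in_mult dt)
  qed
  show ?thesis
    unfolding lin_subst_def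
  proof (intro ext_in_sum ext_in_scalar_mult prod)
    fix S assume S: "S \<in> {S. ext_coeff x S \<noteq> 0}"
    then have "finite S" using ext_coeff_infinite by blast
    moreover have "S \<subseteq> A" using S x by (auto simp: ext_in_def)
    ultimately show "set (sorted_list_of_set S) \<subseteq> A" by simp
  qed
qed

text \<open>
  Some basis elements of rank five have \<open>dt\<^sub>5\<close> as a right factor, whereas decompositions put it on the left.
\<close>

lemma gen_dt_hom_degree:
  fixes z :: "'a::comm_ring_1 coh"
  assumes z: "hom_degree d z"
  shows "gen_dt i * z = ext_scalar ((-1) ^ d) * (z * gen_dt i)"
proof -
  have basis: "gen_dt i * (ext_scalar c * ext_basis S) = ext_scalar ((-1) ^ d) * (ext_scalar c * ext_basis S * gen_dt i)"
    if S: "S \<in> {S. ext_coeff z S \<noteq> 0}" for c :: "'a mpoly" and S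
  proof -
    have fS: "finite S" using S ext_coeff_infinite by blast
    have card: "card S = d" using S z by (simp add: hom_degree_def)
    have top: "ext_basis S = (top_form (sorted_list_of_set S) :: 'a coh)"
      using ext_basis_eq_prod[OF fS] by (simp add: gen_dt_def)
    have "gen_dt i * ext_basis S = ext_scalar ((-1) ^ d) * (ext_basis S * gen_dt i :: 'a coh)"
      unfolding top gen_dt_top_form using fS card by simp
    then show ?thesis
      unfolding mult_scalar_left_commute[of "gen_dt i"] by (simp only: mult.assoc mult_scalar_left_commute[of "ext_scalar c"])
  qed
  have "(\<Sum>S | ext_coeff z S \<noteq> 0. gen_dt i * (ext_scalar (ext_coeff z S) * ext_basis S)) =
      (\<Sum>S | ext_coeff z S \<noteq> 0. ext_scalar ((-1) ^ d) * (ext_scalar (ext_coeff z S) * ext_basis S * gen_dt i))"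
    by (rule sum.cong[OF refl basis])
  then show ?thesis
    by (simp only: sum_distrib_left[symmetric] sum_distrib_right[symmetric] ext_expansion[of z, symmetric])
qed

context prime_order
begin

text \<open>
  Let the elements \<open>b\<^sub>k\<close> form a basis of a module that contains the invariants, and let each \<open>b\<^sub>k\<close> be
  multiplied by a character \<open>\<chi>\<^sub>k\<close>. By uniqueness the coefficients of an invariant are semi-invariant for the
  inverse characters. If these semi-invariants are the multiples of one of them, \<open>s\<^sub>k\<close>, then the
  \<open>s\<^sub>k b\<^sub>k\<close> are a basis over the invariant polynomials.
\<close>

theorem invariants_tensor:
  fixes W :: "'a mat set" and b :: "'k \<Rightarrow> 'a coh" and \<chi> :: "'a mat \<Rightarrow> 'k \<Rightarrow> 'a"
  assumes W: "\<And>g. g \<in> W \<Longrightarrow> g \<in> carrier_mat n n \<and> det g \<noteq> 0" "1\<^sub>m n \<in> W"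
    and bij: "bij_betw (msubst (\<lambda>i. fs ! i)) (mpolys_in {..<length fs})
      {f \<in> mpolys_in {1..n}. \<forall>g\<in>W. msubst (lin_t n g) f = f}"
    and ks: "distinct ks"
    and b: "\<And>k. k \<in> set ks \<Longrightarrow> b k \<in> HBA n"
    and indep: "\<And>c. (\<Sum>k\<in>set ks. ext_scalar (c k) * b k) = 0 \<Longrightarrow> \<forall>k\<in>set ks. c k = 0"
    and span: "\<And>x. x \<in> HBA n \<Longrightarrow> (\<And>g. g \<in> W \<Longrightarrow> lin_subst n g x = x) \<Longrightarrow> \<exists>c. x = (\<Sum>k\<in>set ks. ext_scalar (c k) * b k)"
    and \<chi>: "\<And>g k. g \<in> W \<Longrightarrow> k \<in> set ks \<Longrightarrow> lin_subst n g (b k) = ext_scalar (mconst (\<chi> g k)) * b k"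
    and s: "\<And>k. k \<in> set ks \<Longrightarrow> s k \<in> mpolys_in {1..n}" "\<And>k. k \<in> set ks \<Longrightarrow> s k \<noteq> 0"
      "\<And>g k. g \<in> W \<Longrightarrow> k \<in> set ks \<Longrightarrow> mconst (\<chi> g k) * msubst (lin_t n g) (s k) = s k"
    and dvd: "\<And>f k. k \<in> set ks \<Longrightarrow> f \<in> mpolys_in {1..n} \<Longrightarrow>
      (\<And>g. g \<in> W \<Longrightarrow> mconst (\<chi> g k) * msubst (lin_t n g) f = f) \<Longrightarrow> s k dvd f"
  shows "is_polynomial_tensor (invariants n W) (map ext_scalar fs) (map (\<lambda>k. ext_scalar (s k) * b k) ks)"
proof (rule polynomial_tensorI[OF bij ks])
  let ?R = "{f \<in> mpolys_in {1..n}. \<forall>g\<in>W. msubst (lin_t n g) f = (f :: 'a mpoly)}"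
  have swap: "ext_scalar p * (ext_scalar r * y) = ext_scalar (r * p) * y" for p r and y :: "'a coh"
    by (simp only: mult.commute[of r p] ext_scalar_hom(5) mult.assoc)
  have act: "lin_subst n g (\<Sum>k\<in>set ks. ext_scalar (c k) * b k) =
      (\<Sum>k\<in>set ks. ext_scalar (mconst (\<chi> g k) * msubst (lin_t n g) (c k)) * b k)" if "g \<in> W" for c g
    unfolding lin_subst_sum by (rule sum.cong[OF refl]) (simp only: lin_subst_scalar_mult \<chi>[OF that] swap)
  have unique: "c k = d k" if "(\<Sum>k\<in>set ks. ext_scalar (c k) * b k) = (\<Sum>k\<in>set ks. ext_scalar (d k) * b k)" "k \<in> set ks" for c d k
  proof -
    have "(\<Sum>k\<in>set ks. ext_scalar (c k - d k) * b k) = 0"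
      using that(1) by (simp only: ext_scalar_diff left_diff_distrib sum_subtractf diff_self)
    from indep[OF this] show ?thesis using that(2) by simp
  qed
  have sb: "ext_scalar c * (ext_scalar (s k) * b k) = ext_scalar (s k * c) * b k" for c k by (rule swap)
  have spanned: "\<exists>d. x = (\<Sum>k\<in>set ks. ext_scalar (d k) * (ext_scalar (s k) * b k)) \<and> (\<forall>k\<in>set ks. d k \<in> ?R)"
    if x: "x \<in> HBA n" "\<And>g. g \<in> W \<Longrightarrow> lin_subst n g x = x" for x
  proof -
    obtain c where c: "x = (\<Sum>k\<in>set ks. ext_scalar (c k) * b k)" using span[OF x] by blast
    have semi: "mconst (\<chi> g k) * msubst (lin_t n g) (c k) = c k" if "g \<in> W" "k \<in> set ks" for g k
      by (rule unique[OF _ that(2)]) (use x(2)[OF that(1)] in \<open>simp only: c act[OF that(1)]\<close>)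
    have "\<exists>d. c k = s k * d" if k: "k \<in> set ks" for k
    proof -
      have "mconst (\<chi> (1\<^sub>m n) k) * msubst (lin_t n (1\<^sub>m n)) (c k) \<in> mpolys_in {1..n}"
        by (intro mpolys_in_mult mpolys_in_const msubst_lin_t_in)
      then have "c k \<in> mpolys_in {1..n}" unfolding semi[OF W(2) k] .
      from dvd[OF k this semi[OF _ k]] show ?thesis by (auto elim: dvdE)
    qed
    then have "\<forall>k\<in>set ks. \<exists>d. c k = s k * d" by blast
    from bchoice[OF this] obtain d where d: "\<forall>k\<in>set ks. c k = s k * d k" by (rule exE)
    have "d k \<in> ?R" if k: "k \<in> set ks" for k
    proof -
      have inv: "msubst (lin_t n g) (d k) = d k" if g: "g \<in> W" for g
      proof -
        have "s k * msubst (lin_t n g) (d k) = mconst (\<chi> g k) * msubst (lin_t n g) (s k) * msubst (lin_t n g) (d k)"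
          unfolding s(3)[OF g k] ..
        also have "\<dots> = mconst (\<chi> g k) * msubst (lin_t n g) (c k)" using d k by (simp add: msubst_mult mult.assoc)
        also have "\<dots> = s k * d k" using semi[OF g k] d k by simp
        finally show ?thesis using s(2)[OF k] by simp
      qed
      have "d k \<in> mpolys_in {1..n}" using inv[OF W(2)] msubst_lin_t_in[of n "1\<^sub>m n" "d k"] by simp
      with inv show ?thesis by simp
    qed
    moreover have "x = (\<Sum>k\<in>set ks. ext_scalar (d k) * (ext_scalar (s k) * b k))"
      unfolding c sb by (rule sum.cong[OF refl]) (use d in simp)
    ultimately show ?thesis by (intro exI[of _ d] conjI ballI)
  qed
  have invariant: "x \<in> HBA n \<and> (\<forall>g\<in>W. lin_subst n g x = x)"
    if x: "x = (\<Sum>k\<in>set ks. ext_scalar (c k) * (ext_scalar (s k) * b k))" and c: "\<forall>k\<in>set ks. c k \<in> ?R" for x c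
  proof -
    have "x \<in> HBA n"
      unfolding x sb using c by (intro HBA_sum HBA_scalar_mult mpolys_in_mult s(1) b) auto
    moreover have "lin_subst n g x = x" if g: "g \<in> W" for g
      unfolding x sb act[OF g]
    proof (rule sum.cong[OF refl])
      fix k assume k: "k \<in> set ks"
      have "mconst (\<chi> g k) * msubst (lin_t n g) (s k * c k) = mconst (\<chi> g k) * msubst (lin_t n g) (s k) * c k"
        using c k g by (simp add: msubst_mult mult.assoc)
      then show "ext_scalar (mconst (\<chi> g k) * msubst (lin_t n g) (s k * c k)) * b k = ext_scalar (s k * c k) * b k"
        using s(3)[OF g k] by simp
    qed
    ultimately show ?thesis by blast
  qed
  show "invariants n W = {\<Sum>k\<in>set ks. ext_scalar (c k) * (ext_scalar (s k) * b k) | c. \<forall>k\<in>set ks. c k \<in> ?R}"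
  proof -
    have "invariants n W = {x \<in> HBA n. \<forall>g\<in>W. lin_subst n g x = x}" by (rule invariants_eq[OF W(1)])
    also have "\<dots> = {x. \<exists>c. x = (\<Sum>k\<in>set ks. ext_scalar (c k) * (ext_scalar (s k) * b k)) \<and> (\<forall>k\<in>set ks. c k \<in> ?R)}"
    proof (rule Collect_cong, rule iffI)
      fix x assume "x \<in> HBA n \<and> (\<forall>g\<in>W. lin_subst n g x = x)"
      then show "\<exists>c. x = (\<Sum>k\<in>set ks. ext_scalar (c k) * (ext_scalar (s k) * b k)) \<and> (\<forall>k\<in>set ks. c k \<in> ?R)"
        by (intro spanned) simp_all
    next
      fix x assume "\<exists>c. x = (\<Sum>k\<in>set ks. ext_scalar (c k) * (ext_scalar (s k) * b k)) \<and> (\<forall>k\<in>set ks. c k \<in> ?R)"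
      then show "x \<in> HBA n \<and> (\<forall>g\<in>W. lin_subst n g x = x)" using invariant by (elim exE conjE)
    qed
    finally show ?thesis .
  qed
  fix c assume "(\<Sum>k\<in>set ks. ext_scalar (c k) * (ext_scalar (s k) * b k)) = 0"
  then have "\<forall>k\<in>set ks. s k * c k = 0" unfolding sb by (rule indep)
  then show "\<forall>k\<in>set ks. c k = 0" using s(2) by simp
qed

text \<open>
  Invariance of the generators shows that all of \<open>R\<close> is invariant. For the converse only some elements of \<open>W\<close>
  have to be considered, namely those that define \<open>R\<close>.
\<close>

lemma invariant_polynomials_bij:
  fixes W :: "'a mat set"
  assumes bij: "bij_betw (msubst x) (mpolys_in {1..n}) R"
    and gens: "\<And>v g. v \<in> {1..n} \<Longrightarrow> g \<in> W \<Longrightarrow> msubst (lin_t n g) (x v) = x v"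
    and R: "R \<subseteq> mpolys_in {1..n}"
    and W: "\<And>f. f \<in> mpolys_in {1..n} \<Longrightarrow> (\<And>g. g \<in> W \<Longrightarrow> msubst (lin_t n g) f = f) \<Longrightarrow> f \<in> R"
    and ps: "distinct ps" "set ps = {1..n}"
  shows "bij_betw (msubst (\<lambda>i. map x ps ! i)) (mpolys_in {..<length (map x ps)})
    {f \<in> mpolys_in {1..n}. \<forall>g\<in>W. msubst (lin_t n g) f = f}"
proof -
  have "msubst (lin_t n g) f = f" if f: "f \<in> R" and g: "g \<in> W" for f g
  proof -
    obtain P where P: "P \<in> mpolys_in {1..n}" "f = msubst x P" using bij f by (auto simp: bij_betw_def)
    show ?thesis unfolding P(2) msubst_msubst by (rule msubst_cong[OF P(1)]) (rule gens[OF _ g])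
  qed
  then have RW: "R = {f \<in> mpolys_in {1..n}. \<forall>g\<in>W. msubst (lin_t n g) f = f}"
    using R W by auto
  have "bij_betw (msubst (\<lambda>i. x (ps ! i))) (mpolys_in {..<length ps}) R"
    by (rule bij_betw_msubst_reindex[OF bij bij_betw_nth[OF ps(1) refl ps(2)[symmetric]]])
  moreover have "msubst (\<lambda>i. map x ps ! i) P = msubst (\<lambda>i. x (ps ! i)) P" if "P \<in> mpolys_in {..<length ps}" for P
    by (rule msubst_cong[OF that]) simp
  ultimately have "bij_betw (msubst (\<lambda>i. map x ps ! i)) (mpolys_in {..<length ps}) R"
    by (subst bij_betw_cong) simp_all
  then show ?thesis unfolding RW by simp
qed

subsection \<open>The invariance of the generators\<close>

text \<open>
  The inverse matrix undoes the substitution on the variables.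
\<close>

lemma bij_betw_lin_forms_mat:
  fixes g :: "'a mat"
  assumes g: "g \<in> carrier_mat n n" "det g \<noteq> 0" and ys: "set ys \<subseteq> {1..n}"
    and forms: "\<And>i. i \<in> set ys \<Longrightarrow> lin_t n g i \<in> lin_forms ys"
  shows "bij_betw (msubst (lin_t n g)) (lin_forms ys) (lin_forms ys)"
proof (rule bij_betw_lin_forms[OF forms])
  fix i assume "i \<in> set ys"
  then have i: "i \<in> {1..n}" using ys by blast
  note inv = mat_inverse_nonsingular[OF g]
  have "msubst (lin_t n (the (mat_inverse g))) (lin_t n g i) = lin_t n (1\<^sub>m n) i"
    using lin_t_comp[OF g(1) inv(1) i] inv by simp
  also have "\<dots> = mvar i" using lin_row_mat(1)[OF i i, of "\<lambda>_. 0"] by (simp add: row_mat_0)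
  finally show "msubst (lin_t n (the (mat_inverse g))) (lin_t n g i) = mvar i" .
qed

lemma lin_t_block: "block_mat n k g \<Longrightarrow> i \<in> set (block_list k) \<Longrightarrow> lin_t n g i \<in> lin_forms (block_list k)"
  using lin_formsI[of "\<lambda>j. g $$ (i - 1, j - 1)" "block_list k"] by (simp only: lin_block_mat(1))

lemma lin_dt_block: "block_mat n k g \<Longrightarrow> i \<in> set (block_list k) \<Longrightarrow> lin_dt n g i \<in> ext_in (set (block_list k))"
  unfolding lin_block_mat(2)
  by (intro ext_in_sum ext_in_scalar_mult) (simp only: gen_dt_def ext_in_basis empty_subsetI insert_subset)

text \<open>
  The determinant is a composite of Milnor operations, which commute with \<open>g\<close>, applied to the product of the
  \<open>dt\<^sub>y\<close>, which \<open>g\<close> fixes.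
\<close>

lemma dickson_det_block:
  assumes "block_mat n k (g :: 'a mat)"
  shows "msubst (lin_t n g) (dickson_det (block_list k)) = dickson_det (block_list k)"
proof -
  let ?ys = "block_list k"
  have "ext_scalar (msubst (lin_t n g) (dickson_det ?ys)) = lin_subst n g (milnor_Qs {..<length ?ys} (top_form ?ys))"
    unfolding dickson_det_scalar lin_subst_scalar ..
  also have "\<dots> = milnor_Qs {..<length ?ys} (lin_subst n g (top_form ?ys))"
    by (rule milnor_Qs_lin_subst[symmetric]) simp
  also have "\<dots> = ext_scalar (dickson_det ?ys)"
    unfolding lin_subst_block_top_form[OF assms] by (rule dickson_det_scalar)
  finally show ?thesis by (simp only: ext_scalar_inj)
qed

lemma dickson_gen_block:
  assumes g: "block_mat n k (g :: 'a mat)" "det g \<noteq> 0" and v: "v \<in> set (block_list k)"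
  shows "msubst (lin_t n g) (dickson_gen (block_list k) v) = dickson_gen (block_list k) v"
proof -
  have "bij_betw (msubst (lin_t n g)) (lin_forms (block_list k)) (lin_forms (block_list k))"
    using g by (intro bij_betw_lin_forms_mat lin_t_block) (auto simp: block_mat_def)
  then have coeff: "msubst (lin_t n g) (dickson_coeff (block_list k) i) = dickson_coeff (block_list k) i" for i
    by (rule dickson_coeff_msubst)
  have "v \<in> set (block_list k) \<Longrightarrow> ?thesis"
    unfolding dickson_gen_def by (simp only: not_not if_False if_True simp_thms coeff dickson_det_block[OF g(1)] split: if_split)
  then show ?thesis using v by blast
qed

text \<open>
  The norm is \<open>F(t\<^sub>1)\<close> for the Dickson polynomial \<open>F\<close> of \<open>ys\<close>, which is linear over the field, has invariant
  coefficients and vanishes on the linear forms in \<open>ys\<close>.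
\<close>

lemma norm_poly_mat:
  assumes n: "n \<ge> 1" "set ys = {2..n}" "distinct ys"
    and g: "g \<in> carrier_mat n n" "det g \<noteq> 0" and forms: "\<And>i. i \<in> set ys \<Longrightarrow> lin_t n g i \<in> lin_forms ys"
  shows "msubst (lin_t n g) (norm_poly 1 ys) = mconst (g $$ (0, 0)) * norm_poly 1 ys"
proof -
  have bij: "bij_betw (msubst (lin_t n g)) (lin_forms ys) (lin_forms ys)"
    using n by (intro bij_betw_lin_forms_mat[OF g] forms) auto
  obtain l where l: "l \<in> lin_forms ys" "lin_t n g 1 = mconst (g $$ (0, 0)) * mvar 1 + l" using lin_t_first[OF n(1,2)] by blast
  have "msubst (lin_t n g) (norm_poly 1 ys) = (\<Prod>y\<in>lin_forms ys. lin_t n g 1 + msubst (lin_t n g) y)"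
    unfolding poly_dickson_poly by (simp add: msubst_hom)
  also have "\<dots> = (\<Prod>y\<in>lin_forms ys. lin_t n g 1 + y)"
    by (rule prod.reindex_bij_betw[OF bij])
  also have "\<dots> = poly (dickson_poly ys) (l + mconst (g $$ (0, 0)) * mvar 1)"
    unfolding l(2) poly_dickson_poly by (simp only: add.commute[of l])
  also have "\<dots> = mconst (g $$ (0, 0)) * norm_poly 1 ys"
    unfolding poly_dickson_poly_linear[OF n(3)] using l(1) by (simp add: poly_dickson_poly_eq_0_iff)
  finally show ?thesis .
qed

lemma invariant_transv:
  assumes f: "f \<in> mpolys_in {1..n}" and ys: "set ys \<subseteq> {1..n}"
    and inv: "\<And>i j c. i \<in> set ys \<Longrightarrow> j \<in> set ys \<Longrightarrow> i \<noteq> j \<Longrightarrow> msubst (lin_t n (elem_mat n i j c)) f = (f :: 'a mpoly)"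
  shows "transv_inv ys f"
  unfolding transv_inv_def
proof (intro ballI allI impI)
  fix i j and c :: 'a assume ij: "i \<in> set ys" "j \<in> set ys" "i \<noteq> j"
  then have in_n: "i \<in> {1..n}" "j \<in> {1..n}" using ys by auto
  show "msubst (mvar(i := mvar i + mconst c * mvar j)) f = f"
    using msubst_row_mat[OF in_n(1) f, of "\<lambda>l. if l = j then c else 0"] inv[OF ij, of c]
    unfolding sum_elem(1)[OF in_n(2) ij(3)] by simp
qed

lemma invariant_translate:
  assumes f: "f \<in> mpolys_in {1..n}" and a: "a \<in> {1..n}" "{1..n} - {a} = set ys" and l: "l \<in> lin_forms ys"
    and inv: "\<And>c. msubst (lin_t n (row_mat n a c)) f = (f :: 'a mpoly)"
  shows "msubst (mvar(a := mvar a + l)) f = f"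
proof -
  obtain c where "l = (\<Sum>i\<in>set ys. mconst (c i) * mvar i)" using l by (auto simp: lin_forms_def)
  then show ?thesis using msubst_row_mat[OF a(1) f, of c] inv[of c] unfolding a(2) by simp
qed

lemma msubst_scale_row_mat:
  assumes "f \<in> mpolys_in {1..n}" "i \<in> {1..n}"
  shows "msubst (lin_t n (scale_row_mat n i c)) f = msubst (mvar(i := mconst c * mvar i)) f"
  by (rule msubst_cong[OF assms(1)]) (use assms(2) in \<open>simp add: lin_t_scale_row_mat\<close>)

text \<open>
  The value for \<open>t\<^sub>a = 0\<close> is its own negative.
\<close>

lemma mvar_dvd_odd:
  assumes two: "(2 :: 'a) \<noteq> 0" and odd: "- msubst (mvar(a := mconst (- 1) * mvar a)) f = (f :: 'a mpoly)"
  shows "msubst (mvar(a := 0)) f = 0" "mvar a dvd f"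
proof -
  let ?r = "msubst (mvar(a := 0)) :: 'a mpoly \<Rightarrow> 'a mpoly"
  have "?r (msubst (mvar(a := mconst (- 1) * mvar a)) f) = ?r f"
    unfolding msubst_msubst by (intro arg_cong[of _ _ "\<lambda>g. msubst g f"] ext) (simp add: msubst_hom)
  then have "- ?r f = ?r f" using arg_cong[OF odd, of ?r] by (simp only: msubst_uminus)
  then have "?r f + ?r f = 0" by (metis add.left_inverse)
  moreover have "mconst (2 :: 'a) = 1 + 1" using mconst_hom(2,3) by (metis one_add_one)
  ultimately have "mconst 2 * ?r f = 0" by (simp only: distrib_right mult_1_left)
  then show r: "?r f = 0" using two by (simp only: mult_eq_0_iff mconst_eq_0_iff simp_thms)
  show "mvar a dvd f" using dvd_iff_msubst_eq_0[of 0 a f] r by simp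
qed

text \<open>
  An odd polynomial vanishes for \<open>t\<^sub>a = 0\<close> and, by translation invariance, also for \<open>t\<^sub>a = - l\<close>.
\<close>

lemma norm_dvd_odd:
  assumes two: "(2 :: 'a) \<noteq> 0" and a: "a \<notin> set ys"
    and odd: "- msubst (mvar(a := mconst (- 1) * mvar a)) f = (f :: 'a mpoly)"
    and inv: "\<And>l. l \<in> lin_forms ys \<Longrightarrow> msubst (mvar(a := mvar a + l)) f = f"
  shows "norm_poly a ys dvd f"
proof (rule norm_poly_dvd[OF a])
  fix l :: "'a mpoly" assume l: "l \<in> lin_forms ys"
  have "l \<in> mpolys_in (- {a})" by (rule mpolys_in_mono[OF lin_forms_in[OF l]]) (use a in auto)
  then show "msubst (mvar(a := - l)) f = 0"
    using translate_dvd[OF _ inv[OF l]] mvar_dvd_odd(1)[OF two odd] by simp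
qed

lemma norm_poly_neg:
  assumes "distinct ys" "a \<notin> set ys"
  shows "msubst (mvar(a := mconst (- 1) * mvar a)) (norm_poly a ys) = - norm_poly a ys"
proof -
  let ?s = "mvar(a := mconst (- 1) * mvar a) :: nat \<Rightarrow> 'a mpoly"
  have free: "msubst ?s y = y" if "y \<in> lin_forms ys" for y :: "'a mpoly"
    by (rule msubst_id_on[OF lin_forms_in[OF that]]) (use assms(2) in auto)
  have "msubst ?s (norm_poly a ys) = poly (dickson_poly ys) (0 + mconst (- 1) * mvar a)"
    unfolding poly_dickson_poly msubst_prod msubst_add by (rule prod.cong[OF refl]) (simp add: free)
  also have "\<dots> = poly (dickson_poly ys) 0 + mconst (- 1) * norm_poly a ys"
    by (rule poly_dickson_poly_linear[OF assms(1)])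
  also have "poly (dickson_poly ys) 0 = (0 :: 'a mpoly)" by (simp add: poly_dickson_poly_eq_0_iff)
  also have "0 + mconst (- 1) * norm_poly a ys = - norm_poly a ys"
    by (simp only: add_0_left mconst_uminus mconst_hom(2) mult_minus_left mult_1_left)
  finally show ?thesis .
qed

subsection \<open>The exterior part\<close>

text \<open>
  The full set of indices stands for the basis element 1: the corresponding composite of Milnor operations
  is the determinant, a multiple of 1. So the subsets of \<open>{0, \<dots>, n - 1}\<close> number the whole basis.
\<close>

definition mui_basis :: "nat list \<Rightarrow> nat set \<Rightarrow> 'a coh" where
  "mui_basis ys I = (if I = {..<length ys} then 1 else milnor_Qs I (top_form ys))"

lemma mui_basis_sum:
  "(\<Sum>I\<in>Pow {..<length ys}. ext_scalar (f I) * mui_basis ys I) = ext_scalar (f {..<length ys}) +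
    (\<Sum>I\<in>Pow {..<length ys} - {{..<length ys}}. ext_scalar (f I) * milnor_Qs I (top_form ys))"
proof -
  have "(\<Sum>I\<in>Pow {..<length ys}. ext_scalar (f I) * mui_basis ys I) = ext_scalar (f {..<length ys}) * mui_basis ys {..<length ys} +
      (\<Sum>I\<in>Pow {..<length ys} - {{..<length ys}}. ext_scalar (f I) * mui_basis ys I)"
    by (rule sum.remove) auto
  also have "(\<Sum>I\<in>Pow {..<length ys} - {{..<length ys}}. ext_scalar (f I) * mui_basis ys I) =
      (\<Sum>I\<in>Pow {..<length ys} - {{..<length ys}}. ext_scalar (f I) * milnor_Qs I (top_form ys))"
    by (rule sum.cong[OF refl]) (simp add: mui_basis_def)
  finally show ?thesis by (simp add: mui_basis_def)
qed

lemma mui_basis_expansion: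
  assumes ys: "distinct ys" "ys \<noteq> []" "set ys \<subseteq> {1..n}"
    and x: "x \<in> HBA n" "x \<in> ext_in (set ys)" "ext_transv_inv n ys (x :: 'a coh)"
  shows "\<exists>f. x = (\<Sum>I\<in>Pow {..<length ys}. ext_scalar (f I) * mui_basis ys I)"
proof -
  obtain f where f: "x = ext_scalar (ext_coeff x {}) +
      (\<Sum>I\<in>Pow {..<length ys} - {{..<length ys}}. ext_scalar (f I) * milnor_Qs I (top_form ys))"
    using mui_expansion[OF ys x] by blast
  let ?f = "f({..<length ys} := ext_coeff x {})"
  have "x = ext_scalar (?f {..<length ys}) +
      (\<Sum>I\<in>Pow {..<length ys} - {{..<length ys}}. ext_scalar (?f I) * milnor_Qs I (top_form ys))"
    by (subst f) (intro arg_cong2[of _ _ _ _ "(+)"] sum.cong refl; simp)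
  then show ?thesis using mui_basis_sum[of ?f ys] by (intro exI[of _ ?f]) simp
qed

lemma mui_basis_independent:
  assumes "distinct ys" "(\<Sum>I\<in>Pow {..<length ys}. ext_scalar (f I) * mui_basis ys I) = 0"
  shows "\<forall>I\<in>Pow {..<length ys}. f I = 0"
proof -
  have "f {..<length ys} = 0 \<and> (\<forall>I\<in>Pow {..<length ys} - {{..<length ys}}. f I = 0)"
    by (rule mui_independent[OF assms(1)]) (use assms(2) in \<open>simp only: mui_basis_sum\<close>)
  then show ?thesis by blast
qed

lemma mui_basis_in:
  assumes "I \<in> Pow {..<length ys}"
  shows "mui_basis ys I \<in> ext_in (set ys)" "set ys \<subseteq> {1..n} \<Longrightarrow> mui_basis ys I \<in> HBA n"
proof -
  have fI: "finite I" using assms finite_subset by auto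
  show "mui_basis ys I \<in> ext_in (set ys)"
    using ext_in_scalar[of "1 :: 'a mpoly" "set ys"] fI by (simp add: mui_basis_def milnor_Qs_in top_form_in)
  show "mui_basis ys I \<in> HBA n" if "set ys \<subseteq> {1..n}"
    using that fI by (simp add: mui_basis_def HBA_1 HBA_milnor_Qs HBA_top_form)
qed

lemma mui_basis_block:
  assumes "block_mat n k g" "I \<in> Pow {..<3}"
  shows "lin_subst n g (mui_basis (block_list k) I) = mui_basis (block_list k) I"
proof -
  have fI: "finite I" using assms(2) finite_subset by auto
  show ?thesis
    unfolding mui_basis_def using milnor_Qs_lin_subst[OF fI, of n g "top_form (block_list k)"]
    unfolding lin_subst_block_top_form[OF assms(1)] by simp
qed

lemma mui_basis_gen_dt:
  assumes "I \<in> Pow {..<length ys}"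
  shows "\<exists>e. e * e = 1 \<and> e \<in> mpolys_in {} \<and> gen_dt i * mui_basis ys I = ext_scalar e * (mui_basis ys I * gen_dt i)"
proof -
  have fI: "finite I" using assms finite_subset by auto
  have "hom_degree 0 (1 :: 'a coh)" by (simp add: hom_degree_def one_exterior.rep_eq)
  then have "\<exists>d. hom_degree d (mui_basis ys I)"
    using hom_degree_milnor_Qs[OF fI hom_degree_top_form[of ys, where 'a = 'a]] unfolding mui_basis_def by (cases "I = {..<length ys}") auto
  then obtain d where "hom_degree d (mui_basis ys I)" by blast
  moreover have "((-1) ^ d :: 'a mpoly) \<in> mpolys_in {}" by (intro mpolys_in_power mpolys_in_uminus mpolys_in_1)
  moreover have "(-1) ^ d * (-1) ^ d = (1 :: 'a mpoly)" by (cases "even d") simp_all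
  ultimately show ?thesis using gen_dt_hom_degree[of d "mui_basis ys I" i] by blast
qed

text \<open>
  The coefficients \<open>h\<^sub>J\<close> of the part of \<open>x\<close> with the factor \<open>dt\<^sub>a\<close> are unique. If \<open>g\<close> fixes \<open>x\<close> and the volume form,
  it therefore fixes the \<open>h\<^sub>J\<close>, and so also the rest of \<open>x\<close>.
\<close>

lemma translation_invariant_expansion:
  fixes x :: "'a coh" and W :: "'a mat set"
  assumes zs: "distinct zs" "{1..n} - {a} = set zs" and a: "a \<in> {1..n}" and x: "x \<in> HBA n"
    and inv: "\<And>g. g \<in> W \<Longrightarrow> lin_subst n g x = x" and W: "\<And>c. row_mat n a c \<in> W"
  obtains h y where "x = y + (\<Sum>J\<in>Pow {..<length zs}. ext_scalar (h J) * milnor_Qs J (top_form (a # zs)))"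
    "y \<in> HBA n" "y \<in> ext_in (set zs)"
    "\<And>g. g \<in> W \<Longrightarrow> lin_subst n g (top_form (a # zs)) = (top_form (a # zs) :: 'a coh) \<Longrightarrow>
      (\<And>i. i \<in> set zs \<Longrightarrow> lin_dt n g i \<in> ext_in (set zs)) \<Longrightarrow> lin_subst n g y = y"
proof -
  let ?u = "top_form (a # zs) :: 'a coh"
  let ?h = "\<lambda>h. (\<Sum>J\<in>Pow {..<length zs}. ext_scalar (h J) * milnor_Qs J ?u)"
  have az: "a \<notin> set zs" using zs(2) by auto
  obtain h where h: "x - ?h h \<in> ext_in (set zs)"
    using translation_expansion[OF zs a x inv[OF W]] by blast
  let ?y = "x - ?h h"
  have fJ: "finite J" if "J \<in> Pow {..<length zs}" for J
    using that by (meson PowD finite_lessThan finite_subset)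
  have step: "(\<forall>J\<in>Pow {..<length zs}. msubst (lin_t n g) (h J) = h J) \<and> lin_subst n g ?y = ?y"
    if g: "g \<in> W" "lin_subst n g ?u = ?u" "\<And>i. i \<in> set zs \<Longrightarrow> lin_dt n g i \<in> ext_in (set zs)" for g
  proof -
    let ?g = "\<lambda>J. msubst (lin_t n g) (h J)"
    have acts: "lin_subst n g (?h h) = ?h ?g"
      unfolding lin_subst_sum
      by (rule sum.cong[OF refl]) (simp only: lin_subst_scalar_mult milnor_Qs_lin_subst[OF fJ, symmetric] g(2))
    have gy: "lin_subst n g ?y = x - ?h ?g"
      using lin_subst_add[of n g ?y "?h h"] acts inv[OF g(1)] by (simp add: algebra_simps)
    have "lin_subst n g ?y \<in> ext_in (set zs)" by (rule lin_subst_ext_in[OF g(3) h])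
    then have "?y - lin_subst n g ?y \<in> ext_in (set zs)" by (rule ext_in_diff[OF h])
    moreover have "?y - lin_subst n g ?y = ?h (\<lambda>J. ?g J - h J)"
      unfolding gy by (simp only: ext_scalar_diff left_diff_distrib sum_subtractf) simp
    ultimately have "?h (\<lambda>J. ?g J - h J) \<in> ext_in (- {a})"
      using ext_in_mono[of _ "set zs" "- {a}"] az by auto
    from translation_independent[OF zs(1) az this] have eq: "\<forall>J\<in>Pow {..<length zs}. ?g J = h J" by simp
    moreover have "?h ?g = ?h h" by (rule sum.cong[OF refl]) (use eq in simp)
    ultimately show ?thesis using gy by simp
  qed
  have one: "1\<^sub>m n \<in> W" using W[of "\<lambda>_. 0"] by (simp only: row_mat_0)
  have zn: "set zs \<subseteq> {1..n}" using zs(2) by auto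
  have topH: "?u \<in> HBA n" by (rule HBA_top_form) (use a zn in auto)
  have "lin_dt n (1\<^sub>m n :: 'a mat) i \<in> ext_in (set zs)" if "i \<in> set zs" for i
  proof -
    have "i \<in> {1..n}" using that zn by blast
    then have "lin_dt n (1\<^sub>m n) i = (gen_dt i :: 'a coh)" using lin_row_mat(2)[of i n i "\<lambda>_. 0"] by (simp add: row_mat_0)
    then show ?thesis using that by (simp add: gen_dt_def ext_in_basis)
  qed
  from step[OF one lin_subst_1_HBA[OF topH] this]
  have hin: "h J \<in> mpolys_in {1..n}" if "J \<in> Pow {..<length zs}" for J
    using msubst_lin_t_in[of n "1\<^sub>m n" "h J"] that by simp
  have "?y \<in> HBA n"
    by (intro HBA_diff x HBA_sum HBA_scalar_mult hin HBA_milnor_Qs fJ topH)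
  moreover have "x = ?y + ?h h" by simp
  ultimately show thesis using h step that[of ?y h] by blast
qed

end

subsection \<open>The special linear group\<close>

lemma block_list_eq: "block_list 0 = [1, 2, 3]" "block_list 1 = [2, 3, 4]"
  by simp_all

lemma proper_subsets:
  "distinct ({..<k} # proper_subsets k)" "set ({..<k} # proper_subsets k) = Pow {..<k}"
  using subsets[of k] by (auto simp: proper_subsets_def)

lemma shifted_product_eq: "shifted_product i ys = ext_scalar (poly (dickson_poly ys) (mvar i))"
  by (simp only: shifted_product_def poly_dickson_poly)

lemma length_3: "length [a, b, c] = 3"
  by simp

lemma finite_3: "I \<in> Pow {..<3 :: nat} \<Longrightarrow> finite I"
  by (meson PowD finite_lessThan finite_subset)

context prime_order
begin

lemma dickson_gen_3:
  assumes "distinct [a, b, c]"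
  shows "ext_scalar (dickson_gen [a, b, c] a) = (dickson_e [a, b, c] :: 'a coh)"
    "ext_scalar (dickson_gen [a, b, c] b) = (dickson_c [a, b, c] 1 :: 'a coh)"
    "ext_scalar (dickson_gen [a, b, c] c) = (dickson_c [a, b, c] 2 :: 'a coh)"
  using assms by (auto simp: dickson_gen_def position_def dickson_e_eq dickson_c_eq numeral_2_eq_2 One_nat_def)

lemma mui_basis_list:
  "map (mui_basis ys) ({..<length ys} # proper_subsets (length ys)) =
    [1] @ [milnor_Qs I (top_form ys). I \<leftarrow> proper_subsets (length ys)]"
  by (simp add: mui_basis_def) (simp add: proper_subsets_def)

text \<open>
  Here the group acts on the basis elements trivially, so that the coefficients of an invariant are invariant
  polynomials.
\<close>

theorem SL_3_invariants:
  "is_polynomial_tensor (invariants 3 (SL 3 :: 'a mat set))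
    [dickson_e [1, 2, 3], dickson_c [1, 2, 3] 2, dickson_c [1, 2, 3] 1]
    ([1] @ [milnor_Qs I (gen_dt 1 * gen_dt 2 * gen_dt 3). I \<leftarrow> proper_subsets 3])"
proof -
  let ?zs = "[1, 2, 3] :: nat list" and ?W = "SL 3 :: 'a mat set" and ?ks = "{..<3} # proper_subsets 3"
  let ?x = "dickson_gen ?zs :: nat \<Rightarrow> 'a mpoly"
  let ?fs = "map ?x [1, 3, 2]"
  have zs: "distinct ?zs" "?zs \<noteq> []" "set ?zs = {1..3}" "length ?zs = 3" by auto
  have blk: "block_mat 3 0 g" if "g \<in> ?W" for g using that by (simp add: SL_3_eq)
  have W: "g \<in> carrier_mat 3 3 \<and> det g \<noteq> 0" if "g \<in> ?W" for g using that by (simp add: SL_def)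
  have elem: "elem_mat 3 i j c \<in> ?W" if "i \<in> set ?zs" "j \<in> set ?zs" "i \<noteq> j" for i j c
    using block_mat_elem_mat[of 0 3 i j c] that unfolding block_list_eq SL_3_eq by simp
  have ring: "bij_betw (msubst (\<lambda>i. ?fs ! i)) (mpolys_in {..<length ?fs})
      {f \<in> mpolys_in {1..3}. \<forall>g\<in>?W. msubst (lin_t 3 g) f = f}"
  proof (rule invariant_polynomials_bij[OF dickson_theorem[of ?zs "{1..3}"]])
    show "msubst (lin_t 3 g) (?x v) = ?x v" if "v \<in> {1..3}" "g \<in> ?W" for v g
      using dickson_gen_block[OF blk[OF that(2)], of v] W[OF that(2)] that(1) unfolding block_list_eq zs(3) by blast
    show "f \<in> {f \<in> mpolys_in {1..3}. transv_inv ?zs f}"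
      if f: "f \<in> mpolys_in {1..3}" and inv: "\<And>g. g \<in> ?W \<Longrightarrow> msubst (lin_t 3 g) f = f" for f
      using invariant_transv[OF f, of ?zs] inv[OF elem] f zs(3) by simp
    show "{f \<in> mpolys_in {1..3}. transv_inv ?zs (f :: 'a mpoly)} \<subseteq> mpolys_in {1..3}" by (rule Collect_restrict)
    show "set [1, 3, 2] = {1..3 :: nat}" by auto
    show "set ?zs \<subseteq> {1..3}" by (rule equalityD1[OF zs(3)])
  qed simp_all
  note kset = proper_subsets(2)[of 3]
  have "is_polynomial_tensor (invariants 3 ?W) (map ext_scalar ?fs) (map (\<lambda>I. ext_scalar 1 * mui_basis ?zs I) ?ks)"
  proof (rule invariants_tensor[where n = 3 and W = ?W and fs = ?fs and ks = ?ks and b = "mui_basis ?zs" and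
        s = "\<lambda>_. 1" and \<chi> = "\<lambda>_ _. 1", OF W _ ring proper_subsets(1)])
    show "mui_basis ?zs I \<in> HBA 3" if "I \<in> set ?ks" for I
      using mui_basis_in(2)[of I ?zs 3] that zs(3) unfolding kset length_3 by blast
    show "lin_subst 3 g (mui_basis ?zs I) = ext_scalar (mconst 1) * mui_basis ?zs I" if "g \<in> ?W" "I \<in> set ?ks" for g I
      using mui_basis_block[OF blk[OF that(1)]] that(2) unfolding kset block_list_eq by simp
    show "\<forall>I\<in>set ?ks. c I = 0" if "(\<Sum>I\<in>set ?ks. ext_scalar (c I) * mui_basis ?zs I) = 0" for c
      using mui_basis_independent[OF zs(1), of c] that unfolding kset zs(4) by blast
    show "\<exists>c. x = (\<Sum>I\<in>set ?ks. ext_scalar (c I) * mui_basis ?zs I)"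
      if x: "x \<in> HBA 3" "\<And>g. g \<in> ?W \<Longrightarrow> lin_subst 3 g x = x" for x
    proof -
      have "ext_transv_inv 3 ?zs x" unfolding ext_transv_inv_def using x(2)[OF elem] by blast
      moreover have "x \<in> ext_in (set ?zs)" using x(1) unfolding zs(3) HBA_iff by blast
      ultimately show ?thesis using mui_basis_expansion[OF zs(1,2) _ x(1)] unfolding kset zs(3,4) by blast
    qed
  qed (simp_all add: SL_def)
  moreover have gens: "map ext_scalar ?fs = [dickson_e ?zs, dickson_c ?zs 2, dickson_c ?zs 1]"
    by (simp add: dickson_gen_3)
  moreover have basis: "map (\<lambda>I. ext_scalar 1 * mui_basis ?zs I) ?ks = [1] @ [milnor_Qs I (gen_dt 1 * gen_dt 2 * gen_dt 3). I \<leftarrow> proper_subsets 3]"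
    using mui_basis_list[of ?zs] unfolding length_3 by (simp add: mult.assoc)
  ultimately show ?thesis unfolding gens basis by blast
qed

subsection \<open>The groups of rank four\<close>

text \<open>
  The keys \<open>(0, I)\<close> number the elements without \<open>dt\<^sub>1\<close>, and the keys \<open>(1, J)\<close> the composites applied to the full
  product.
\<close>

definition basis_4 :: "nat \<times> nat set \<Rightarrow> 'a coh" where
  "basis_4 = (\<lambda>(i, I). if i = 0 then mui_basis [2, 3, 4] I else milnor_Qs I (top_form [1, 2, 3, 4]))"

definition keys_4 :: "(nat \<times> nat set) list" where
  "keys_4 = map (Pair 0) ({..<3} # proper_subsets 3) @ map (Pair 1) (subsets 3)"

lemma distinct_keys_4: "distinct keys_4"
  using proper_subsets(1)[of 3] subsets(2)[of 3] unfolding keys_4_def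
  by (auto simp: distinct_map inj_on_def)

lemma set_keys_4: "set keys_4 = Pair 0 ` Pow {..<3} \<union> Pair 1 ` Pow {..<3}"
  unfolding keys_4_def set_append set_map proper_subsets(2) subsets(1) ..

lemma sum_keys_4: "(\<Sum>k\<in>set keys_4. F k) = (\<Sum>I\<in>Pow {..<3}. F (0, I)) + (\<Sum>I\<in>Pow {..<3}. F (1, I))"
  unfolding set_keys_4 by (subst sum.union_disjoint) (auto simp: sum.reindex inj_on_def)

text \<open>
  The entry \<open>\<epsilon>\<^sub>1\<close> is the determinant of the matrix, because the block has determinant one.
\<close>

lemma lin_subst_volume_4:
  assumes "block_mat 4 1 g"
  shows "lin_subst 4 g (top_form [1, 2, 3, 4]) = ext_scalar (mconst (g $$ (0, 0))) * (top_form [1, 2, 3, 4] :: 'a coh)"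
proof -
  have "set [2, 3, 4] = {2..4 :: nat}" by auto
  from lin_subst_first_top_form[OF _ this, of g 1] lin_subst_block_top_form[OF assms]
  show ?thesis unfolding block_list_eq by simp
qed

lemma basis_4_character:
  assumes "block_mat 4 1 g" "k \<in> set keys_4"
  shows "lin_subst 4 g (basis_4 k) = ext_scalar (mconst (if fst k = 0 then 1 else g $$ (0, 0))) * basis_4 k"
proof (cases "fst k = 0")
  case True
  then show ?thesis
    using mui_basis_block[OF assms(1)] assms(2) unfolding block_list_eq set_keys_4 by (auto simp: basis_4_def)
next
  case False
  then obtain J where k: "k = (1, J)" "J \<in> Pow {..<3}" using assms(2) unfolding set_keys_4 by auto
  note fJ = finite_3[OF k(2)]
  show ?thesis
    using milnor_Qs_lin_subst[OF fJ, of 4 g "top_form [1, 2, 3, 4]"]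
    unfolding lin_subst_volume_4[OF assms(1)] milnor_Qs_linear(2)[OF fJ] by (simp add: basis_4_def k)
qed

lemma basis_4_in: "k \<in> set keys_4 \<Longrightarrow> basis_4 k \<in> HBA 4"
  unfolding set_keys_4
  using mui_basis_in(2)[of _ "[2, 3, 4]" 4, unfolded length_3] HBA_milnor_Qs[OF finite_3 HBA_top_form[of "[1, 2, 3, 4]" 4]]
  by (auto simp: basis_4_def)

lemma basis_4_independent:
  assumes "(\<Sum>k\<in>set keys_4. ext_scalar (c k) * basis_4 k) = 0"
  shows "\<forall>k\<in>set keys_4. c k = 0"
proof -
  let ?zs = "[2, 3, 4] :: nat list"
  let ?y = "\<Sum>I\<in>Pow {..<3}. ext_scalar (c (0, I)) * mui_basis ?zs I"
  let ?h = "\<Sum>J\<in>Pow {..<3}. ext_scalar (c (1, J)) * milnor_Qs J (top_form (1 # ?zs)) :: 'a coh"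
  have len: "length ?zs = 3" by simp
  have sum: "?y + ?h = 0" using assms unfolding sum_keys_4 by (simp add: basis_4_def)
  have "?y \<in> ext_in (set ?zs)" using mui_basis_in(1)[of _ ?zs, unfolded length_3] by (intro ext_in_sum ext_in_scalar_mult) simp
  then have "?y \<in> ext_in (- {1})" by (rule ext_in_mono) auto
  then have "?h \<in> ext_in (- {1})" using sum ext_in_uminus[of ?y "- {1}"] by (simp add: add_eq_0_iff)
  then have h: "\<forall>J\<in>Pow {..<3}. c (1, J) = 0"
    using translation_independent[of ?zs 1 "\<lambda>J. c (1, J)"] unfolding len by auto
  then have "?h = 0" by (intro sum.neutral) simp
  then have "?y = 0" using sum by simp
  then have "\<forall>I\<in>Pow {..<3}. c (0, I) = 0"
    using mui_basis_independent[of ?zs "\<lambda>I. c (0, I)"] unfolding len by auto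
  with h show ?thesis unfolding set_keys_4 by auto
qed

lemma row_mat_weyl_3E6: "row_mat 4 1 c \<in> weyl_3E6"
  using block_mat_row_mat[of 1 4 1 c] by (simp add: weyl_3E6_eq) (simp add: row_mat_def)

lemma elem_mat_weyl_3E6:
  "i \<in> set [2, 3, 4] \<Longrightarrow> j \<in> set [2, 3, 4] \<Longrightarrow> i \<noteq> j \<Longrightarrow> elem_mat 4 i j c \<in> weyl_3E6"
  using block_mat_elem_mat[of 1 4 i j c] unfolding block_list_eq weyl_3E6_eq by (auto simp: row_mat_def)

text \<open>
  The translations of \<open>t\<^sub>1\<close> determine the part with \<open>dt\<^sub>1\<close>. The rest is invariant under the transvections of the
  block and has an expansion by Mui's theorem.
\<close>

lemma basis_4_span:
  assumes x: "x \<in> HBA 4" and inv: "\<And>g. g \<in> weyl_3E6 \<Longrightarrow> lin_subst 4 g x = (x :: 'a coh)"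
  shows "\<exists>c. x = (\<Sum>k\<in>set keys_4. ext_scalar (c k) * basis_4 k)"
proof -
  let ?zs = "[2, 3, 4] :: nat list"
  have zs: "distinct ?zs" "?zs \<noteq> []" "set ?zs \<subseteq> {1..4}" "{1..4} - {1} = set ?zs" "length ?zs = 3" "1 \<in> {1..4 :: nat}" by auto
  obtain h y where y: "x = y + (\<Sum>J\<in>Pow {..<length ?zs}. ext_scalar (h J) * milnor_Qs J (top_form (1 # ?zs)))"
    "y \<in> HBA 4" "y \<in> ext_in (set ?zs)"
    "\<And>g. g \<in> weyl_3E6 \<Longrightarrow> lin_subst 4 g (top_form (1 # ?zs)) = (top_form (1 # ?zs) :: 'a coh) \<Longrightarrow>
      (\<And>i. i \<in> set ?zs \<Longrightarrow> lin_dt 4 g i \<in> ext_in (set ?zs)) \<Longrightarrow> lin_subst 4 g y = y"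
    using translation_invariant_expansion[OF zs(1,4,6) x inv row_mat_weyl_3E6] by blast
  have "ext_transv_inv 4 ?zs y"
    unfolding ext_transv_inv_def
  proof (intro ballI allI impI)
    fix i j and c :: 'a assume ij: "i \<in> set ?zs" "j \<in> set ?zs" "i \<noteq> j"
    have g: "block_mat 4 1 (elem_mat 4 i j c)" "elem_mat 4 i j c $$ (0, 0) = 1"
      using elem_mat_weyl_3E6[OF ij, of c] by (simp_all only: weyl_3E6_eq mem_Collect_eq)
    show "lin_subst 4 (elem_mat 4 i j c) y = y"
    proof (rule y(4)[OF elem_mat_weyl_3E6[OF ij]])
      show "lin_subst 4 (elem_mat 4 i j c) (top_form (1 # ?zs)) = (top_form (1 # ?zs) :: 'a coh)"
        using lin_subst_volume_4[OF g(1)] unfolding g(2) by simp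
      show "lin_dt 4 (elem_mat 4 i j c) l \<in> ext_in (set ?zs)" if "l \<in> set ?zs" for l
        using lin_dt_block[OF g(1)] that unfolding block_list_eq by blast
    qed
  qed
  then obtain f where f: "y = (\<Sum>I\<in>Pow {..<length ?zs}. ext_scalar (f I) * mui_basis ?zs I)"
    using mui_basis_expansion[OF zs(1-3) y(2,3)] by blast
  let ?c = "\<lambda>(i, I). if i = (0 :: nat) then f I else h I"
  have "x = (\<Sum>k\<in>set keys_4. ext_scalar (?c k) * basis_4 k)"
    unfolding y(1) f sum_keys_4 zs(5) by (simp add: basis_4_def)
  then show ?thesis by blast
qed

lemma norm_poly_4_bij:
  "bij_betw (msubst ((dickson_gen [2, 3, 4])(1 := norm_poly 1 [2, 3, 4]))) (mpolys_in {1..4})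
    {f \<in> mpolys_in {1..4}. transv_inv [2, 3, 4] f \<and>
      (\<forall>l\<in>lin_forms [2, 3, 4]. msubst (mvar(1 := mvar 1 + l)) f = (f :: 'a mpoly))}"
proof -
  have V: "insert 1 {2..4} = {1..4 :: nat}" by auto
  have "bij_betw (msubst (dickson_gen [2, 3, 4])) (mpolys_in {2..4}) {f \<in> mpolys_in {2..4}. transv_inv [2, 3, 4] (f :: 'a mpoly)}"
    by (rule dickson_theorem) auto
  from adjoin_norm[OF this, of "[2, 3, 4]" 1] show ?thesis unfolding V by auto
qed

lemma norm_poly_block_4:
  assumes "block_mat 4 1 (g :: 'a mat)" "det g \<noteq> 0"
  shows "msubst (lin_t 4 g) (norm_poly 1 [2, 3, 4]) = mconst (g $$ (0, 0)) * norm_poly 1 [2, 3, 4]"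
  using assms lin_t_block[OF assms(1)] unfolding block_list_eq
  by (intro norm_poly_mat) (auto simp: block_mat_def)

lemma invariant_4:
  assumes f: "f \<in> mpolys_in {1..4}" and inv: "\<And>g. g \<in> weyl_3E6 \<Longrightarrow> msubst (lin_t 4 g) f = (f :: 'a mpoly)"
  shows "transv_inv [2, 3, 4] f" "\<And>l. l \<in> lin_forms [2, 3, 4] \<Longrightarrow> msubst (mvar(1 := mvar 1 + l)) f = f"
proof -
  have V: "{1..4} - {1} = set [2, 3, 4 :: nat]" by auto
  show "transv_inv [2, 3, 4] f" by (rule invariant_transv[OF f _ inv[OF elem_mat_weyl_3E6]]) auto
  show "msubst (mvar(1 := mvar 1 + l)) f = f" if "l \<in> lin_forms [2, 3, 4]" for l
    by (rule invariant_translate[OF f _ V that inv[OF row_mat_weyl_3E6]]) simp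
qed

lemma basis_4_list:
  assumes "\<And>k. fst k = 0 \<Longrightarrow> s k = 1" "\<And>k. fst k = 1 \<Longrightarrow> s k = t"
  shows "map (\<lambda>k. ext_scalar (s k) * basis_4 k) keys_4 =
    [1] @ [milnor_Qs I (gen_dt 2 * gen_dt 3 * gen_dt 4). I \<leftarrow> proper_subsets 3] @
    [ext_scalar t * milnor_Qs J (gen_dt 1 * gen_dt 2 * gen_dt 3 * gen_dt 4). J \<leftarrow> subsets 3]"
proof -
  have "map (\<lambda>k. ext_scalar (s k) * basis_4 k) keys_4 = map (mui_basis [2, 3, 4]) ({..<3} # proper_subsets 3) @
      map (\<lambda>J. ext_scalar t * milnor_Qs J (top_form [1, 2, 3, 4])) (subsets 3)"
    unfolding keys_4_def map_append map_map by (simp add: basis_4_def assms)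
  then show ?thesis using mui_basis_list[of "[2, 3, 4]", unfolded length_3] by (simp add: mult.assoc)
qed

theorem weyl_3E6_invariants:
  "is_polynomial_tensor (invariants 4 (weyl_3E6 :: 'a mat set))
    [dickson_e [2, 3, 4], dickson_c [2, 3, 4] 2, dickson_c [2, 3, 4] 1, shifted_product 1 [2, 3, 4]]
    ([1] @ [milnor_Qs I (gen_dt 2 * gen_dt 3 * gen_dt 4). I \<leftarrow> proper_subsets 3] @
     [milnor_Qs J (gen_dt 1 * gen_dt 2 * gen_dt 3 * gen_dt 4). J \<leftarrow> subsets 3])"
proof -
  let ?W = "weyl_3E6 :: 'a mat set"
  let ?x = "(dickson_gen [2, 3, 4])(1 := norm_poly 1 [2, 3, 4]) :: nat \<Rightarrow> 'a mpoly"
  let ?fs = "map ?x [2, 4, 3, 1]"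
  have W: "block_mat 4 1 g" "g $$ (0, 0) = 1" "g \<in> carrier_mat 4 4 \<and> det g \<noteq> 0" if "g \<in> ?W" for g
    using that det_weyl(1)[of g] by (auto simp: weyl_3E6_eq weyl_2E7_eq block_mat_def)
  have ring: "bij_betw (msubst (\<lambda>i. ?fs ! i)) (mpolys_in {..<length ?fs})
      {f \<in> mpolys_in {1..4}. \<forall>g\<in>?W. msubst (lin_t 4 g) f = f}"
  proof (rule invariant_polynomials_bij[OF norm_poly_4_bij])
    fix v and g :: "'a mat" assume v: "v \<in> {1..4 :: nat}" and g: "g \<in> ?W"
    show "msubst (lin_t 4 g) (?x v) = ?x v"
    proof (cases "v = 1")
      case True
      then show ?thesis using norm_poly_block_4[of g] W[OF g] by simp
    next
      case False
      then have "v \<in> set (block_list 1)" using v by auto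
      from dickson_gen_block[OF W(1)[OF g] _ this] show ?thesis using W(3)[OF g] False unfolding block_list_eq by simp
    qed
  next
    show "f \<in> {f \<in> mpolys_in {1..4}. transv_inv [2, 3, 4] f \<and> (\<forall>l\<in>lin_forms [2, 3, 4]. msubst (mvar(1 := mvar 1 + l)) f = f)}"
      if "f \<in> mpolys_in {1..4}" "\<And>g. g \<in> ?W \<Longrightarrow> msubst (lin_t 4 g) f = f" for f
      using invariant_4[OF that] that(1) by (intro CollectI conjI ballI)
    show "set [2, 4, 3, 1] = {1..4 :: nat}" by auto
  qed (rule Collect_restrict, simp)
  have "is_polynomial_tensor (invariants 4 ?W) (map ext_scalar ?fs) (map (\<lambda>k. ext_scalar 1 * basis_4 k) keys_4)"
  proof (rule invariants_tensor[where n = 4 and W = ?W and fs = ?fs and ks = keys_4 and b = basis_4 and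
        s = "\<lambda>_. 1" and \<chi> = "\<lambda>_ _. 1", OF W(3) _ ring distinct_keys_4 basis_4_in basis_4_independent])
    show "1\<^sub>m 4 \<in> ?W" using row_mat_weyl_3E6[of "\<lambda>_. 0"] by (simp only: row_mat_0)
    show "lin_subst 4 g (basis_4 k) = ext_scalar (mconst 1) * basis_4 k" if "g \<in> ?W" "k \<in> set keys_4" for g k
      using basis_4_character[OF W(1)[OF that(1)] that(2)] W(2)[OF that(1)] by simp
  qed (simp_all add: basis_4_span)
  moreover have "map ext_scalar ?fs = [dickson_e [2, 3, 4], dickson_c [2, 3, 4] 2, dickson_c [2, 3, 4] 1, shifted_product 1 [2, 3, 4]]"
    by (simp add: dickson_gen_3 shifted_product_eq)
  ultimately show ?thesis using basis_4_list[of "\<lambda>_. 1" 1] by simp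
qed

lemma field_3:
  assumes "CARD('a) = 3"
  shows "(2 :: 'a) \<noteq> 0" "x \<noteq> 0 \<Longrightarrow> x * x = (1 :: 'a)"
proof -
  show "x * x = (1 :: 'a)" if "x \<noteq> 0"
    using power_card_minus_1[OF that] assms by (simp add: power2_eq_square)
  have "of_nat 2 \<noteq> (0 :: 'a)" unfolding of_nat_eq_0_iff_char_dvd CHAR_card assms by simp
  then show "(2 :: 'a) \<noteq> 0" by simp
qed

lemma mconst_mult_self:
  assumes "CARD('a) = 3" "e \<noteq> 0"
  shows "mconst e * (mconst e * f) = (f :: 'a mpoly)"
proof -
  have "mconst e * (mconst e * f) = mconst (e * e) * f" by (simp only: mconst_hom(4) mult.assoc)
  then show ?thesis unfolding field_3(2)[OF assms] by simp
qed

lemma weyl_3E6_subset: "weyl_3E6 \<subseteq> (weyl_2E7 :: 'a mat set)"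
  by (auto simp: weyl_3E6_eq weyl_2E7_eq)

lemma scale_row_mat_2E7: "c \<noteq> 0 \<Longrightarrow> scale_row_mat 4 1 c \<in> (weyl_2E7 :: 'a mat set)"
  using block_mat_scale_row_mat[of 1 4 1 c] by (simp add: weyl_2E7_eq) (simp add: scale_row_mat_def)

text \<open>
  The sign change of \<open>t\<^sub>1\<close> changes the sign of the norm and of the full product. So the norm is replaced by its
  square among the polynomial generators, and the coefficients of the \<open>Q\<^sub>J u\<^sub>4\<close> are odd in \<open>t\<^sub>1\<close>, which makes
  them divisible by the norm.
\<close>

theorem weyl_2E7_invariants:
  assumes three: "CARD('a) = 3"
  shows "is_polynomial_tensor (invariants 4 (weyl_2E7 :: 'a mat set))
    [dickson_e [2, 3, 4], dickson_c [2, 3, 4] 2, dickson_c [2, 3, 4] 1, shifted_product 1 [2, 3, 4] ^ 2]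
    ([1] @ [milnor_Qs I (gen_dt 2 * gen_dt 3 * gen_dt 4). I \<leftarrow> proper_subsets 3] @
     [shifted_product 1 [2, 3, 4] * milnor_Qs J (gen_dt 1 * gen_dt 2 * gen_dt 3 * gen_dt 4). J \<leftarrow> subsets 3])"
proof -
  let ?W = "weyl_2E7 :: 'a mat set" and ?N = "norm_poly 1 [2, 3, 4]"
  let ?x = "((dickson_gen [2, 3, 4])(1 := ?N))(1 := ?N ^ 2) :: nat \<Rightarrow> 'a mpoly"
  let ?fs = "map ?x [2, 4, 3, 1]" and ?neg = "mvar(1 := mconst (- 1) * mvar 1) :: nat \<Rightarrow> 'a mpoly"
  let ?s = "\<lambda>k :: nat \<times> nat set. if fst k = 0 then 1 else ?N"
  let ?\<chi> = "\<lambda>(g :: 'a mat) (k :: nat \<times> nat set). if fst k = 0 then 1 else g $$ (0, 0)"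
  have W: "block_mat 4 1 g" "g $$ (0, 0) \<noteq> 0" "g \<in> carrier_mat 4 4 \<and> det g \<noteq> 0" if "g \<in> ?W" for g
    using that det_weyl(1)[of g] by (auto simp: weyl_2E7_eq block_mat_def)
  note two = field_3(1)[OF three]
  have minus: "(- 1 :: 'a) \<noteq> 0" by simp
  have Nin: "?N \<in> mpolys_in {1..4}" by (rule mpolys_in_mono[OF norm_poly_in]) auto
  have Ng: "msubst (lin_t 4 g) ?N = mconst (g $$ (0, 0)) * ?N" if "g \<in> ?W" for g
    using norm_poly_block_4[of g] W[OF that] by blast
  have fixed: "msubst ?neg (dickson_gen [2, 3, 4] v) = dickson_gen [2, 3, 4] v" if "v \<in> {1..4}" "v \<noteq> 1" for v
    by (rule msubst_id_on[OF dickson_gen_in]) (use that in auto)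
  have sq: "bij_betw (msubst ?x) (mpolys_in {1..4}) {f \<in> {f \<in> mpolys_in {1..4}. transv_inv [2, 3, 4] f \<and>
      (\<forall>l\<in>lin_forms [2, 3, 4]. msubst (mvar(1 := mvar 1 + l)) f = f)}. msubst ?neg f = f}"
    using bij_betw_msubst_square[OF norm_poly_4_bij _ two, of 1 ?neg] norm_poly_neg[of "[2, 3, 4]" 1] fixed by simp
  have ring: "bij_betw (msubst (\<lambda>i. ?fs ! i)) (mpolys_in {..<length ?fs})
      {f \<in> mpolys_in {1..4}. \<forall>g\<in>?W. msubst (lin_t 4 g) f = f}"
  proof (rule invariant_polynomials_bij[OF sq])
    fix v and g :: "'a mat" assume v: "v \<in> {1..4 :: nat}" and g: "g \<in> ?W"
    show "msubst (lin_t 4 g) (?x v) = ?x v"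
    proof (cases "v = 1")
      case True
      have "msubst (lin_t 4 g) (?N ^ 2) = mconst (g $$ (0, 0)) * (mconst (g $$ (0, 0)) * ?N ^ 2)"
        unfolding msubst_power Ng[OF g] by (simp only: power2_eq_square mult_ac)
      then show ?thesis using mconst_mult_self[OF three W(2)[OF g]] True by simp
    next
      case False
      then have "v \<in> set (block_list 1)" using v by auto
      from dickson_gen_block[OF W(1)[OF g] _ this] show ?thesis using W(3)[OF g] False unfolding block_list_eq by simp
    qed
  next
    fix f :: "'a mpoly" assume f: "f \<in> mpolys_in {1..4}" and inv: "\<And>g. g \<in> ?W \<Longrightarrow> msubst (lin_t 4 g) f = f"
    have neg: "msubst ?neg f = f" using inv[OF scale_row_mat_2E7[OF minus]] msubst_scale_row_mat[OF f, of 1 "- 1"] by simp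
    have inv': "msubst (lin_t 4 g) f = f" if "g \<in> weyl_3E6" for g using inv that weyl_3E6_subset by blast
    show "f \<in> {f \<in> {f \<in> mpolys_in {1..4}. transv_inv [2, 3, 4] f \<and>
        (\<forall>l\<in>lin_forms [2, 3, 4]. msubst (mvar(1 := mvar 1 + l)) f = f)}. msubst ?neg f = f}"
      using invariant_4[OF f inv'] f neg by (intro CollectI conjI ballI)
  next
    show "set [2, 4, 3, 1] = {1..4 :: nat}" by auto
  qed (rule subset_trans[OF Collect_restrict Collect_restrict], simp)
  have "is_polynomial_tensor (invariants 4 ?W) (map ext_scalar ?fs) (map (\<lambda>k. ext_scalar (?s k) * basis_4 k) keys_4)"
  proof (rule invariants_tensor[where n = 4 and W = ?W and fs = ?fs and ks = keys_4 and b = basis_4 and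
        s = ?s and \<chi> = ?\<chi>, OF W(3) _ ring distinct_keys_4 basis_4_in basis_4_independent])
    show "1\<^sub>m 4 \<in> ?W" using row_mat_weyl_3E6[of "\<lambda>_. 0 :: 'a"] weyl_3E6_subset unfolding row_mat_0 by blast
    show "lin_subst 4 g (basis_4 k) = ext_scalar (mconst (?\<chi> g k)) * basis_4 k" if "g \<in> ?W" "k \<in> set keys_4" for g k
      by (rule basis_4_character[OF W(1)[OF that(1)] that(2)])
    show "\<exists>c. x = (\<Sum>k\<in>set keys_4. ext_scalar (c k) * basis_4 k)"
      if "x \<in> HBA 4" "\<And>g. g \<in> ?W \<Longrightarrow> lin_subst 4 g x = x" for x
      using that weyl_3E6_subset by (intro basis_4_span) blast+
    show "?s k \<in> mpolys_in {1..4}" for k using Nin by simp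
    show "?s k \<noteq> 0" for k using poly_dickson_poly_nonzero[of 1 "[2, 3, 4]"] by simp
    show "mconst (?\<chi> g k) * msubst (lin_t 4 g) (?s k) = ?s k" if "g \<in> ?W" for g k
      using Ng[OF that] mconst_mult_self[OF three W(2)[OF that]] by simp
    show "?s k dvd f" if f: "f \<in> mpolys_in {1..4}" and semi: "\<And>g. g \<in> ?W \<Longrightarrow> mconst (?\<chi> g k) * msubst (lin_t 4 g) f = f" for k f
    proof (cases "fst k = 0")
      case False
      have "msubst (lin_t 4 g) f = f" if "g \<in> weyl_3E6" for g
        using semi[of g] that weyl_3E6_subset False by (auto simp: weyl_3E6_eq)
      then have inv: "msubst (mvar(1 := mvar 1 + l)) f = f" if "l \<in> lin_forms [2, 3, 4]" for l
        using invariant_4(2)[OF f _ that] by blast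
      have "mconst (- 1) * msubst ?neg f = f"
        using semi[OF scale_row_mat_2E7[OF minus]] False msubst_scale_row_mat[OF f, of 1 "- 1"] by (simp add: scale_row_mat_def)
      then have "- msubst ?neg f = f" by (simp only: mconst_uminus mconst_hom(2) mult_minus_left mult_1_left)
      then have "?N dvd f" by (intro norm_dvd_odd[OF two _ _ inv]) simp_all
      then show ?thesis using False by simp
    qed simp
  qed
  moreover have "map ext_scalar ?fs = [dickson_e [2, 3, 4], dickson_c [2, 3, 4] 2, dickson_c [2, 3, 4] 1, shifted_product 1 [2, 3, 4] ^ 2]"
    by (simp add: dickson_gen_3 shifted_product_eq ext_scalar_prod)
  ultimately show ?thesis using basis_4_list[of ?s ?N] by (simp add: shifted_product_eq)
qed

end

subsection \<open>The group of rank five\<close>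

context prime_order
begin

text \<open>
  The keys \<open>(0, I)\<close> number the elements without \<open>dt\<^sub>1\<close> and \<open>dt\<^sub>5\<close>, the keys \<open>(1, I)\<close> those with \<open>dt\<^sub>5\<close> only, and
  the keys \<open>(2, J)\<close> the composites applied to the full product.
\<close>

definition basis_5 :: "nat \<times> nat set \<Rightarrow> 'a coh" where
  "basis_5 = (\<lambda>(i, I). if i = 0 then mui_basis [2, 3, 4] I else if i = 1 then mui_basis [2, 3, 4] I * gen_dt 5
     else milnor_Qs I (top_form [1, 2, 3, 4, 5]))"

definition keys_5 :: "(nat \<times> nat set) list" where
  "keys_5 = map (Pair 0) ({..<3} # proper_subsets 3) @ map (Pair 1) ({..<3} # proper_subsets 3) @ map (Pair 2) (subsets 4)"

lemma distinct_keys_5: "distinct keys_5"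
  using proper_subsets(1)[of 3] subsets(2)[of 4] unfolding keys_5_def
  by (auto simp: distinct_map inj_on_def)

lemma set_keys_5: "set keys_5 = Pair 0 ` Pow {..<3} \<union> (Pair 1 ` Pow {..<3} \<union> Pair 2 ` Pow {..<4})"
  unfolding keys_5_def set_append set_map proper_subsets(2) subsets(1) ..

lemma sum_keys_5: "(\<Sum>k\<in>set keys_5. F k) =
    (\<Sum>I\<in>Pow {..<3}. F (0, I)) + ((\<Sum>I\<in>Pow {..<3}. F (1, I)) + (\<Sum>I\<in>Pow {..<4}. F (2, I)))"
proof -
  have reindex: "(\<Sum>k\<in>Pair i ` A. F k) = (\<Sum>I\<in>A. F (i, I))" for i A
    by (subst sum.reindex) (auto simp: inj_on_def)
  have fin: "finite (Pair i ` Pow {..<m})" for i :: nat and m :: nat by simp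
  have "(\<Sum>k\<in>set keys_5. F k) = (\<Sum>k\<in>Pair 0 ` Pow {..<3}. F k) + (\<Sum>k\<in>Pair 1 ` Pow {..<3} \<union> Pair 2 ` Pow {..<4}. F k)"
    unfolding set_keys_5 by (rule sum.union_disjoint) auto
  also have "(\<Sum>k\<in>Pair 1 ` Pow {..<3} \<union> Pair 2 ` Pow {..<4}. F k) = (\<Sum>k\<in>Pair 1 ` Pow {..<3}. F k) + (\<Sum>k\<in>Pair 2 ` Pow {..<4}. F k)"
    by (rule sum.union_disjoint) auto
  finally show ?thesis unfolding reindex .
qed

lemma weyl_E8D:
  assumes "(g :: 'a mat) \<in> weyl_E8"
  shows "block_mat 5 1 g" "g $$ (0, 0) \<noteq> 0" "g $$ (4, 4) \<noteq> 0" "g \<in> carrier_mat 5 5 \<and> det g \<noteq> 0"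
    and "lin_t 5 g 5 = mconst (g $$ (4, 4)) * mvar 5"
    and "lin_dt 5 g 5 = ext_scalar (mconst (g $$ (4, 4))) * gen_dt 5"
proof -
  have g: "block_mat 5 1 g \<and> g $$ (0, 0) \<noteq> 0 \<and> g $$ (4, 4) \<noteq> 0 \<and> (\<forall>j<4. g $$ (4, j) = 0)"
    using assms unfolding weyl_E8_eq by blast
  then show "block_mat 5 1 g" "g $$ (0, 0) \<noteq> 0" "g $$ (4, 4) \<noteq> 0" by auto
  show "g \<in> carrier_mat 5 5 \<and> det g \<noteq> 0" using g det_weyl(2)[OF assms] by (simp add: block_mat_def)
  have e: "5 - 1 = (4 :: nat)" by simp
  have row: "g $$ (4, j - 1) = (if j = 5 then g $$ (4, 4) else 0)" if "j \<in> {1..5}" for j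
  proof (cases "j = 5")
    case False
    then have "j - 1 < 4" using that by auto
    then show ?thesis using g False by simp
  qed simp
  have "lin_t 5 g 5 = (\<Sum>j=1..(5::nat). if j = 5 then mconst (g $$ (4, 4)) * mvar 5 else 0)"
    unfolding lin_t_def e by (rule sum.cong[OF refl]) (simp add: row)
  then show "lin_t 5 g 5 = mconst (g $$ (4, 4)) * mvar 5" by simp
  have "lin_dt 5 g 5 = (\<Sum>j=1..(5::nat). if j = 5 then ext_scalar (mconst (g $$ (4, 4))) * gen_dt 5 else 0)"
    unfolding lin_dt_def e by (rule sum.cong[OF refl]) (simp add: row)
  then show "lin_dt 5 g 5 = ext_scalar (mconst (g $$ (4, 4))) * gen_dt 5" by simp
qed

lemma lin_forms_E8:
  assumes g: "(g :: 'a mat) \<in> weyl_E8" and i: "i \<in> set [2, 3, 4, 5]"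
  shows "lin_t 5 g i \<in> lin_forms [2, 3, 4, 5]" "lin_dt 5 g i \<in> ext_in (set [2, 3, 4, 5])"
proof -
  have "lin_t 5 g i \<in> lin_forms [2, 3, 4, 5] \<and> lin_dt 5 g i \<in> ext_in (set [2, 3, 4, 5])"
  proof (cases "i = 5")
    case True
    have "mvar 5 \<in> lin_forms [2, 3, 4, 5 :: nat]" by (rule lin_forms_var) simp
    moreover have "gen_dt 5 \<in> ext_in (set [2, 3, 4, 5 :: nat])" unfolding gen_dt_def by (rule ext_in_basis) simp
    ultimately show ?thesis unfolding True weyl_E8D(5,6)[OF g] by (intro conjI lin_forms_scale ext_in_scalar_mult)
  next
    case False
    then have i3: "i \<in> set [2, 3, 4]" using i by auto
    have sub: "set [2, 3, 4] \<subseteq> set [2, 3, 4, 5 :: nat]" by auto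
    have "lin_t 5 g i \<in> lin_forms [2, 3, 4]" "lin_dt 5 g i \<in> ext_in (set [2, 3, 4])"
      using lin_t_block[OF weyl_E8D(1)[OF g], of i] lin_dt_block[OF weyl_E8D(1)[OF g], of i] i3 unfolding block_list_eq by blast+
    then show ?thesis using lin_forms_mono[OF sub] ext_in_mono[OF _ sub] by blast
  qed
  then show "lin_t 5 g i \<in> lin_forms [2, 3, 4, 5]" "lin_dt 5 g i \<in> ext_in (set [2, 3, 4, 5])" by blast+
qed

lemma norm_poly_E8:
  assumes g: "(g :: 'a mat) \<in> weyl_E8"
  shows "msubst (lin_t 5 g) (norm_poly 1 [2, 3, 4, 5]) = mconst (g $$ (0, 0)) * norm_poly 1 [2, 3, 4, 5]"
proof (rule norm_poly_mat)
  show "set [2, 3, 4, 5] = {2..5 :: nat}" by auto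
  show "lin_t 5 g i \<in> lin_forms [2, 3, 4, 5]" if "i \<in> set [2, 3, 4, 5]" for i by (rule lin_forms_E8(1)[OF g that])
qed (use weyl_E8D(4)[OF g] in simp_all)

lemma lin_subst_volume_5:
  assumes g: "g \<in> weyl_E8"
  shows "lin_subst 5 g (top_form [1, 2, 3, 4, 5]) =
    ext_scalar (mconst (g $$ (0, 0) * g $$ (4, 4))) * (top_form [1, 2, 3, 4, 5] :: 'a coh)"
proof (rule lin_subst_first_top_form)
  show "set [2, 3, 4, 5] = {2..5 :: nat}" by auto
  have split: "top_form [2, 3, 4, 5] = top_form [2, 3, 4] * (gen_dt 5 :: 'a coh)" by (simp add: mult.assoc)
  show "lin_subst 5 g (top_form [2, 3, 4, 5]) = ext_scalar (mconst (g $$ (4, 4))) * (top_form [2, 3, 4, 5] :: 'a coh)"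
    unfolding split lin_subst_mult lin_subst_gen_dt[folded lin_dt_def] weyl_E8D(6)[OF g]
      lin_subst_block_top_form[OF weyl_E8D(1)[OF g], unfolded block_list_eq]
    by (rule mult_scalar_left_commute)
qed simp

lemma finite_4: "I \<in> Pow {..<4 :: nat} \<Longrightarrow> finite I"
  by (meson PowD finite_lessThan finite_subset)

lemma keys_5_cases:
  assumes "k \<in> set keys_5"
  obtains I where "k = (0, I)" "I \<in> Pow {..<3}" | I where "k = (1, I)" "I \<in> Pow {..<3}" | I where "k = (2, I)" "I \<in> Pow {..<4}"
  using assms unfolding set_keys_5 by blast

definition character_5 :: "'a mat \<Rightarrow> nat \<times> nat set \<Rightarrow> 'a" where
  "character_5 g k = (if fst k = 0 then 1 else if fst k = 1 then g $$ (4, 4) else g $$ (0, 0) * g $$ (4, 4))"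

lemma basis_5_character:
  assumes g: "g \<in> weyl_E8" and k: "k \<in> set keys_5"
  shows "lin_subst 5 g (basis_5 k) = ext_scalar (mconst (character_5 g k)) * basis_5 k"
  using k
proof (cases rule: keys_5_cases)
  case (1 I)
  then show ?thesis using mui_basis_block[OF weyl_E8D(1)[OF g], of I] unfolding block_list_eq by (simp add: basis_5_def character_5_def)
next
  case (2 I)
  then have "lin_subst 5 g (mui_basis [2, 3, 4] I * gen_dt 5) = mui_basis [2, 3, 4] I * (ext_scalar (mconst (g $$ (4, 4))) * gen_dt 5)"
    using mui_basis_block[OF weyl_E8D(1)[OF g], of I]
    unfolding lin_subst_mult lin_subst_gen_dt[folded lin_dt_def] weyl_E8D(6)[OF g] block_list_eq by simp
  then show ?thesis unfolding mult_scalar_left_commute[of "mui_basis [2, 3, 4] I"] by (simp add: basis_5_def character_5_def 2)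
next
  case (3 I)
  note fI = finite_4[OF 3(2)]
  show ?thesis
    using milnor_Qs_lin_subst[OF fI, of 5 g "top_form [1, 2, 3, 4, 5]"]
    unfolding lin_subst_volume_5[OF g] milnor_Qs_linear(2)[OF fI] by (simp add: basis_5_def character_5_def 3)
qed

lemma basis_5_in:
  assumes "k \<in> set keys_5"
  shows "basis_5 k \<in> HBA 5"
  using assms
proof (cases rule: keys_5_cases)
  case (1 I)
  then show ?thesis using mui_basis_in(2)[of I "[2, 3, 4]" 5, unfolded length_3] by (simp add: basis_5_def)
next
  case (2 I)
  have H: "mui_basis [2, 3, 4] I \<in> HBA 5" using mui_basis_in(2)[of I "[2, 3, 4]" 5, unfolded length_3] 2(2) by simp
  obtain e where e: "e * e = 1" "e \<in> mpolys_in {}"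
    "gen_dt 5 * mui_basis [2, 3, 4] I = ext_scalar e * (mui_basis [2, 3, 4] I * gen_dt 5)"
    using mui_basis_gen_dt[of I "[2, 3, 4]" 5, unfolded length_3, OF 2(2)] by blast
  have "ext_scalar e * (gen_dt 5 * mui_basis [2, 3, 4] I) = ext_scalar (e * e) * (mui_basis [2, 3, 4] I * gen_dt 5)"
    unfolding e(3) by (simp only: ext_scalar_hom(5) mult.assoc)
  moreover have "ext_scalar e * (gen_dt 5 * mui_basis [2, 3, 4] I) \<in> HBA 5"
    using e(2) H by (intro HBA_scalar_mult HBA_gen_dt_mult) (auto intro: mpolys_in_mono)
  ultimately show ?thesis unfolding e(1) by (simp add: basis_5_def 2)
next
  case (3 I)
  then show ?thesis
    using HBA_milnor_Qs[OF finite_4 HBA_top_form[of "[1, 2, 3, 4, 5]" 5], of I] by (simp add: basis_5_def)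
qed

lemma basis_5_independent:
  assumes "(\<Sum>k\<in>set keys_5. ext_scalar (c k) * basis_5 k) = 0"
  shows "\<forall>k\<in>set keys_5. c k = 0"
proof -
  let ?zs = "[2, 3, 4] :: nat list" and ?ys = "[2, 3, 4, 5] :: nat list"
  let ?b = "mui_basis ?zs"
  let ?y0 = "\<Sum>I\<in>Pow {..<3}. ext_scalar (c (0, I)) * ?b I"
  let ?y1 = "\<Sum>I\<in>Pow {..<3}. ext_scalar (c (1, I)) * (?b I * gen_dt 5)"
  let ?h = "\<Sum>J\<in>Pow {..<4}. ext_scalar (c (2, J)) * milnor_Qs J (top_form (1 # ?ys)) :: 'a coh"
  have len: "length ?ys = 4" by simp
  have bin: "?b I \<in> ext_in (set ?zs)" if "I \<in> Pow {..<3}" for I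
    using mui_basis_in(1)[of I ?zs, unfolded length_3] that by blast
  have sum: "?y0 + (?y1 + ?h) = 0" using assms unfolding sum_keys_5 by (simp add: basis_5_def)
  have "?y0 \<in> ext_in (set ?zs)" using bin by (intro ext_in_sum ext_in_scalar_mult)
  then have y0: "?y0 \<in> ext_in (- {1})" "?y0 \<in> ext_in (- {5})" by (rule ext_in_mono; simp)+
  have "gen_dt 5 \<in> ext_in {5 :: nat}" unfolding gen_dt_def by (rule ext_in_basis) simp
  then have d5: "(gen_dt 5 :: 'a coh) \<in> ext_in (- {1})" by (rule ext_in_mono) simp
  have "?b I \<in> ext_in (- {1})" if "I \<in> Pow {..<3}" for I by (rule ext_in_mono[OF bin[OF that]]) simp
  then have "?y1 \<in> ext_in (- {1})" by (intro ext_in_sum ext_in_scalar_mult ext_in_mult d5)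
  then have "- (?y0 + ?y1) \<in> ext_in (- {1})" by (intro ext_in_uminus ext_in_add y0(1))
  have cancel: "- (u + v) = w" if "u + (v + w) = 0" for u v w :: "'a coh"
    by (rule minus_unique) (simp only: add.assoc that)
  have "?h \<in> ext_in (- {1})" using \<open>- (?y0 + ?y1) \<in> ext_in (- {1})\<close> unfolding cancel[OF sum] .
  then have h: "\<forall>J\<in>Pow {..<4}. c (2, J) = 0"
    using translation_independent[of ?ys 1 "\<lambda>J. c (2, J)", unfolded len] by simp
  then have "?h = 0" by (intro sum.neutral) simp
  then have sum': "?y1 + ?y0 = 0" using sum by (simp add: add.commute)
  have "\<forall>I\<in>Pow {..<3}. \<exists>e. e * e = 1 \<and> gen_dt 5 * ?b I = ext_scalar e * (?b I * gen_dt 5)"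
    using mui_basis_gen_dt[of _ ?zs 5, unfolded length_3] by blast
  from bchoice[OF this] obtain e where e: "\<forall>I\<in>Pow {..<3}. e I * e I = 1 \<and> gen_dt 5 * ?b I = ext_scalar (e I) * (?b I * gen_dt 5)"
    by (rule exE)
  let ?\<alpha> = "\<Sum>I\<in>Pow {..<3}. ext_scalar (c (1, I) * e I) * ?b I"
  have "?y1 = gen_dt 5 * ?\<alpha>"
    unfolding sum_distrib_left
  proof (rule sum.cong[OF refl])
    fix I assume I: "I \<in> Pow {..<3 :: nat}"
    have eI: "e I * e I = 1" "gen_dt 5 * ?b I = ext_scalar (e I) * (?b I * gen_dt 5)" using e I by blast+
    have "gen_dt 5 * (ext_scalar (c (1, I) * e I) * ?b I) = ext_scalar (c (1, I) * (e I * e I)) * (?b I * gen_dt 5)"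
      unfolding mult_scalar_left_commute[of "gen_dt 5"] eI(2) by (simp only: ext_scalar_hom(5) mult.assoc)
    then show "ext_scalar (c (1, I)) * (?b I * gen_dt 5) = gen_dt 5 * (ext_scalar (c (1, I) * e I) * ?b I)"
      unfolding eI(1) mult_1_right by (rule sym)
  qed
  then have split: "gen_dt 5 * ?\<alpha> + ?y0 = 0" using sum' by simp
  have "?\<alpha> \<in> ext_in (set ?zs)" using bin by (intro ext_in_sum ext_in_scalar_mult)
  then have \<alpha>: "?\<alpha> \<in> ext_in (- {5})" by (rule ext_in_mono) simp
  have "?\<alpha> = 0" "?y0 = 0" using gen_dt_split_unique[OF \<alpha> y0(2) split] by blast+
  then have "\<forall>I\<in>Pow {..<3}. c (1, I) * e I = 0" "\<forall>I\<in>Pow {..<3}. c (0, I) = 0"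
    using mui_basis_independent[of ?zs "\<lambda>I. c (1, I) * e I"] mui_basis_independent[of ?zs "\<lambda>I. c (0, I)"]
    unfolding length_3 by auto
  moreover have "e I \<noteq> 0" if "I \<in> Pow {..<3}" for I
  proof -
    have "e I * e I = 1" using e that by blast
    then show ?thesis by auto
  qed
  ultimately have "c (0, I) = 0" "c (1, I) = 0" if "I \<in> Pow {..<3}" for I using that by auto
  with h show ?thesis unfolding set_keys_5 by auto
qed

lemma row_mat_weyl_E8: "row_mat 5 1 c \<in> (weyl_E8 :: 'a mat set)"
  using block_mat_row_mat[of 1 5 1 c] by (simp add: weyl_E8_eq) (simp add: row_mat_def)

lemma elem_mat_weyl_E8:
  assumes "i \<in> set [2, 3, 4]" "j \<in> set [2, 3, 4]" "i \<noteq> j"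
  shows "elem_mat 5 i j c \<in> (weyl_E8 :: 'a mat set)"
    "elem_mat 5 i j c $$ (0, 0) = 1" "elem_mat 5 i j c $$ (4, 4) = 1"
  using block_mat_elem_mat[of 1 5 i j c] assms unfolding block_list_eq weyl_E8_eq by (auto simp: row_mat_def)

lemma scale_row_mat_weyl_E8:
  "c \<noteq> 0 \<Longrightarrow> i \<in> {1, 5} \<Longrightarrow> scale_row_mat 5 i c \<in> (weyl_E8 :: 'a mat set)"
  using block_mat_scale_row_mat[of 1 5 i c] unfolding block_list_eq weyl_E8_eq by (auto simp: scale_row_mat_def)

text \<open>
  After the part with \<open>dt\<^sub>1\<close> is split off, the transvections of the block fix \<open>dt\<^sub>5\<close>. So the parts of the rest with
  and without \<open>dt\<^sub>5\<close> are invariant separately, and Mui's theorem applies to each of them.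
\<close>

lemma basis_5_span:
  assumes x: "x \<in> HBA 5" and inv: "\<And>g. g \<in> weyl_E8 \<Longrightarrow> lin_subst 5 g x = (x :: 'a coh)"
  shows "\<exists>c. x = (\<Sum>k\<in>set keys_5. ext_scalar (c k) * basis_5 k)"
proof -
  let ?zs = "[2, 3, 4] :: nat list" and ?ys = "[2, 3, 4, 5] :: nat list"
  have ys: "distinct ?ys" "{1..5} - {1} = set ?ys" "length ?ys = 4" "1 \<in> {1..5 :: nat}" by auto
  have zs: "distinct ?zs" "?zs \<noteq> []" "set ?zs \<subseteq> {1..5}" by auto
  have sub: "set ?ys - {5} = set ?zs" "set ?zs \<subseteq> {1..5} - {5}" "set ?zs \<subseteq> - {5}" by auto
  obtain h y where y: "x = y + (\<Sum>J\<in>Pow {..<length ?ys}. ext_scalar (h J) * milnor_Qs J (top_form (1 # ?ys)))"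
    "y \<in> HBA 5" "y \<in> ext_in (set ?ys)"
    "\<And>g. g \<in> weyl_E8 \<Longrightarrow> lin_subst 5 g (top_form (1 # ?ys)) = (top_form (1 # ?ys) :: 'a coh) \<Longrightarrow>
      (\<And>i. i \<in> set ?ys \<Longrightarrow> lin_dt 5 g i \<in> ext_in (set ?ys)) \<Longrightarrow> lin_subst 5 g y = y"
    using translation_invariant_expansion[OF ys(1,2,4) x inv row_mat_weyl_E8] by blast
  obtain \<alpha> \<beta> where ab: "\<alpha> \<in> ext_in (set ?ys - {5})" "\<beta> \<in> ext_in (set ?ys - {5})" "y = gen_dt 5 * \<alpha> + \<beta>"
    by (rule gen_dt_split[OF y(3)])
  note ab' = ab(1,2)[unfolded sub(1)]
  note abH = gen_dt_split_HBA(1,2)[OF y(2) ab(3) ext_in_mono[OF ab'(1) sub(2)] ext_in_mono[OF ab'(2) sub(2)]]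
  have fixed: "lin_subst 5 (elem_mat 5 i j c) \<alpha> = \<alpha> \<and> lin_subst 5 (elem_mat 5 i j c) \<beta> = \<beta>"
    if ij: "i \<in> set ?zs" "j \<in> set ?zs" "i \<noteq> j" for i j and c :: 'a
  proof -
    let ?g = "elem_mat 5 i j c"
    note g = elem_mat_weyl_E8[OF ij, of c]
    have gy: "lin_subst 5 ?g y = y"
    proof (rule y(4)[OF g(1) _ lin_forms_E8(2)[OF g(1)]])
      show "lin_subst 5 ?g (top_form (1 # ?ys)) = (top_form (1 # ?ys) :: 'a coh)"
        using lin_subst_volume_5[OF g(1)] unfolding g(2,3) by simp
    qed
    have zin: "lin_subst 5 ?g z \<in> ext_in (set ?zs)" if "z \<in> ext_in (set ?zs)" for z
      using lin_subst_ext_in[OF lin_dt_block[OF weyl_E8D(1)[OF g(1)]]] that unfolding block_list_eq by blast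
    have "lin_subst 5 ?g y = gen_dt 5 * lin_subst 5 ?g \<alpha> + lin_subst 5 ?g \<beta>"
      unfolding ab(3) lin_subst_add lin_subst_gen_dt_mult weyl_E8D(6)[OF g(1)] g(3) by simp
    then have eq: "gen_dt 5 * lin_subst 5 ?g \<alpha> + lin_subst 5 ?g \<beta> = gen_dt 5 * \<alpha> + \<beta>" using gy ab(3) by simp
    show ?thesis
      using gen_dt_split_eq[OF ext_in_mono[OF zin[OF ab'(1)] sub(3)] ext_in_mono[OF zin[OF ab'(2)] sub(3)]
        ext_in_mono[OF ab'(1) sub(3)] ext_in_mono[OF ab'(2) sub(3)] eq] by blast
  qed
  have "ext_transv_inv 5 ?zs \<alpha>" "ext_transv_inv 5 ?zs \<beta>" unfolding ext_transv_inv_def using fixed by blast+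
  then obtain f1 f0 where f: "\<alpha> = (\<Sum>I\<in>Pow {..<3}. ext_scalar (f1 I) * mui_basis ?zs I)"
    "\<beta> = (\<Sum>I\<in>Pow {..<3}. ext_scalar (f0 I) * mui_basis ?zs I)"
    using mui_basis_expansion[OF zs abH(1) ab'(1)] mui_basis_expansion[OF zs abH(2) ab'(2)] unfolding length_3 by blast
  have "\<forall>I\<in>Pow {..<3}. \<exists>e. gen_dt 5 * mui_basis ?zs I = ext_scalar e * (mui_basis ?zs I * gen_dt 5)"
    using mui_basis_gen_dt[of _ ?zs 5, unfolded length_3] by blast
  from bchoice[OF this] obtain e where e: "\<forall>I\<in>Pow {..<3}. gen_dt 5 * mui_basis ?zs I = ext_scalar (e I) * (mui_basis ?zs I * gen_dt 5)"
    by (rule exE)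
  let ?c = "\<lambda>(i, I). if i = (0 :: nat) then f0 I else if i = 1 then f1 I * e I else h I"
  have "gen_dt 5 * \<alpha> = (\<Sum>I\<in>Pow {..<3}. ext_scalar (f1 I * e I) * (mui_basis ?zs I * gen_dt 5))"
    unfolding f(1) sum_distrib_left
  proof (rule sum.cong[OF refl])
    fix I assume "I \<in> Pow {..<3 :: nat}"
    then show "gen_dt 5 * (ext_scalar (f1 I) * mui_basis ?zs I) = ext_scalar (f1 I * e I) * (mui_basis ?zs I * gen_dt 5)"
      unfolding mult_scalar_left_commute[of "gen_dt 5"] using e by (simp only: ext_scalar_hom(5) mult.assoc)
  qed
  then have "x = (\<Sum>k\<in>set keys_5. ext_scalar (?c k) * basis_5 k)"
    unfolding y(1) ab(3) f(2) sum_keys_5 ys(3) by (simp add: basis_5_def add_ac)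
  then show ?thesis by blast
qed

lemma invariant_5:
  assumes f: "f \<in> mpolys_in {1..5}"
  shows "(\<And>i j c. i \<in> set [2, 3, 4] \<Longrightarrow> j \<in> set [2, 3, 4] \<Longrightarrow> i \<noteq> j \<Longrightarrow> msubst (lin_t 5 (elem_mat 5 i j c)) f = (f :: 'a mpoly)) \<Longrightarrow>
      transv_inv [2, 3, 4] f"
    and "(\<And>c. msubst (lin_t 5 (row_mat 5 1 c)) f = f) \<Longrightarrow> l \<in> lin_forms [2, 3, 4, 5] \<Longrightarrow> msubst (mvar(1 := mvar 1 + l)) f = f"
proof -
  have V: "{1..5} - {1} = set [2, 3, 4, 5 :: nat]" by auto
  show "transv_inv [2, 3, 4] f"
    if "\<And>i j c. i \<in> set [2, 3, 4] \<Longrightarrow> j \<in> set [2, 3, 4] \<Longrightarrow> i \<noteq> j \<Longrightarrow> msubst (lin_t 5 (elem_mat 5 i j c)) f = f"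
    by (rule invariant_transv[OF f _ that]) auto
  show "msubst (mvar(1 := mvar 1 + l)) f = f"
    if "\<And>c. msubst (lin_t 5 (row_mat 5 1 c)) f = f" "l \<in> lin_forms [2, 3, 4, 5]"
    by (rule invariant_translate[OF f _ V that(2,1)]) simp
qed

abbreviation sign_change :: "nat \<Rightarrow> nat \<Rightarrow> 'a mpoly" where
  "sign_change i \<equiv> mvar(i := mconst (- 1) * mvar i)"

text \<open>
  Here \<open>t\<^sub>5\<close> is a parameter for Dickson's theorem, but one of the variables by which \<open>t\<^sub>1\<close> is translated.
\<close>

lemma polynomials_5_bij:
  assumes two: "(2 :: 'a) \<noteq> 0"
  shows "bij_betw (msubst ((dickson_gen [2, 3, 4])(1 := norm_poly 1 [2, 3, 4, 5] ^ 2, 5 := mvar 5 ^ 2))) (mpolys_in {1..5})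
    {f \<in> mpolys_in {1..5}. transv_inv [2, 3, 4] f \<and>
      (\<forall>l\<in>lin_forms [2, 3, 4, 5]. msubst (mvar(1 := mvar 1 + l)) f = (f :: 'a mpoly)) \<and>
      msubst (sign_change 1) f = f \<and> msubst (sign_change 5) f = f}"
proof -
  let ?N = "norm_poly 1 [2, 3, 4, 5]" and ?g = "dickson_gen [2, 3, 4] :: nat \<Rightarrow> 'a mpoly"
  let ?R = "{f \<in> mpolys_in {1..5}. transv_inv [2, 3, 4] f \<and>
      (\<forall>l\<in>lin_forms [2, 3, 4, 5]. msubst (mvar(1 := mvar 1 + l)) f = (f :: 'a mpoly))}"
  have V: "insert 1 {2..5} = {1..5 :: nat}" by auto
  have "bij_betw (msubst ?g) (mpolys_in {2..5}) {f \<in> mpolys_in {2..5}. transv_inv [2, 3, 4] f}"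
    by (rule dickson_theorem) auto
  from adjoin_norm[OF this, of "[2, 3, 4, 5]" 1]
  have norm: "bij_betw (msubst (?g(1 := ?N))) (mpolys_in {1..5}) ?R" unfolding V by auto
  have g5: "?g 5 = mvar 5" by (simp add: dickson_gen_def)
  have gfix: "msubst (sign_change i) (?g v) = ?g v" if "i \<in> {1, 5}" "v \<noteq> i" for i v
    by (rule msubst_id_on[OF dickson_gen_in]) (use that in auto)
  have N5: "msubst (sign_change 5) ?N = ?N"
  proof -
    have bij: "bij_betw (msubst (sign_change 5)) (lin_forms [2, 3, 4, 5]) (lin_forms [2, 3, 4, 5])"
      by (rule bij_betw_lin_forms_scale) simp
    have "msubst (sign_change 5) ?N = (\<Prod>y\<in>lin_forms [2, 3, 4, 5]. mvar 1 + msubst (sign_change 5) y)"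
      unfolding poly_dickson_poly by (simp add: msubst_hom)
    also have "\<dots> = ?N" unfolding poly_dickson_poly by (rule prod.reindex_bij_betw[OF bij])
    finally show ?thesis .
  qed
  have "bij_betw (msubst ((?g(1 := ?N))(1 := (?g(1 := ?N)) 1 ^ 2))) (mpolys_in {1..5}) {f \<in> ?R. msubst (sign_change 1) f = f}"
  proof (rule bij_betw_msubst_square[OF norm _ two])
    show "msubst (sign_change 1) ((?g(1 := ?N)) 1) = - (?g(1 := ?N)) 1" using norm_poly_neg[of "[2, 3, 4, 5]" 1] by simp
    show "msubst (sign_change 1) ((?g(1 := ?N)) v) = (?g(1 := ?N)) v" if "v \<noteq> 1" for v using gfix[of 1 v] that by simp
  qed simp
  then have sq: "bij_betw (msubst (?g(1 := ?N ^ 2))) (mpolys_in {1..5}) {f \<in> ?R. msubst (sign_change 1) f = f}" by simp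
  have "bij_betw (msubst ((?g(1 := ?N ^ 2))(5 := (?g(1 := ?N ^ 2)) 5 ^ 2))) (mpolys_in {1..5})
      {f \<in> {f \<in> ?R. msubst (sign_change 1) f = f}. msubst (sign_change 5) f = f}"
  proof (rule bij_betw_msubst_square[OF sq _ two])
    show "msubst (sign_change 5) ((?g(1 := ?N ^ 2)) 5) = - (?g(1 := ?N ^ 2)) 5"
      by (simp add: g5 mconst_uminus)
    show "msubst (sign_change 5) ((?g(1 := ?N ^ 2)) v) = (?g(1 := ?N ^ 2)) v" if "v \<noteq> 5" for v
      using gfix[of 5 v] that N5 by (simp add: msubst_power del: mconst_hom)
  qed simp
  moreover have "(?g(1 := ?N ^ 2)) 5 = mvar 5" by (simp add: g5)
  moreover have "{f \<in> {f \<in> ?R. msubst (sign_change 1) f = f}. msubst (sign_change 5) f = f} =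
    {f \<in> mpolys_in {1..5}. transv_inv [2, 3, 4] f \<and>
      (\<forall>l\<in>lin_forms [2, 3, 4, 5]. msubst (mvar(1 := mvar 1 + l)) f = f) \<and> msubst (sign_change 1) f = f \<and> msubst (sign_change 5) f = f}"
    by blast
  ultimately show ?thesis by (simp only:)
qed

lemma basis_5_list:
  assumes "\<And>k. fst k = 0 \<Longrightarrow> s k = 1" "\<And>k. fst k = 1 \<Longrightarrow> s k = mvar 5" "\<And>k. fst k = 2 \<Longrightarrow> s k = mvar 5 * t"
  shows "map (\<lambda>k. ext_scalar (s k) * basis_5 k) keys_5 =
    [1] @ [milnor_Qs I (gen_dt 2 * gen_dt 3 * gen_dt 4). I \<leftarrow> proper_subsets 3] @ [gen_t 5 * gen_dt 5] @
    [milnor_Qs I (gen_dt 2 * gen_dt 3 * gen_dt 4) * gen_t 5 * gen_dt 5. I \<leftarrow> proper_subsets 3] @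
    [gen_t 5 * ext_scalar t * milnor_Qs J (gen_dt 1 * gen_dt 2 * gen_dt 3 * gen_dt 4 * gen_dt 5). J \<leftarrow> subsets 4]"
proof -
  have "map (\<lambda>k. ext_scalar (s k) * basis_5 k) keys_5 = map (mui_basis [2, 3, 4]) ({..<3} # proper_subsets 3) @
      map ((\<lambda>b. ext_scalar (mvar 5) * (b * gen_dt 5)) \<circ> mui_basis [2, 3, 4]) ({..<3} # proper_subsets 3) @
      map (\<lambda>J. gen_t 5 * ext_scalar t * milnor_Qs J (top_form [1, 2, 3, 4, 5])) (subsets 4)"
    unfolding keys_5_def map_append map_map by (simp add: basis_5_def assms gen_t_def)
  moreover have "ext_scalar (mvar 5) * (b * gen_dt 5) = b * gen_t 5 * gen_dt 5" for b :: "'a coh"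
    unfolding gen_t_def ext_scalar_commute[of b] by (rule mult.assoc[symmetric])
  ultimately show ?thesis
    unfolding map_map[symmetric] mui_basis_list[of "[2, 3, 4]", unfolded length_3] by (simp add: mult.assoc)
qed

text \<open>
  The coefficients of the elements that contain \<open>dt\<^sub>5\<close> are odd in \<open>t\<^sub>5\<close>, and those of the \<open>Q\<^sub>J u\<^sub>5\<close> also in
  \<open>t\<^sub>1\<close>. Division of the latter by \<open>t\<^sub>5\<close> preserves invariance under the translations of \<open>t\<^sub>1\<close>, so that the norm
  divides the quotient.
\<close>

theorem weyl_E8_invariants:
  assumes three: "CARD('a) = 3"
  shows "is_polynomial_tensor (invariants 5 (weyl_E8 :: 'a mat set))
    [gen_t 5 ^ 2, dickson_e [2, 3, 4], dickson_c [2, 3, 4] 2, dickson_c [2, 3, 4] 1, shifted_product 1 [2, 3, 4, 5] ^ 2]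
    ([1] @ [milnor_Qs I (gen_dt 2 * gen_dt 3 * gen_dt 4). I \<leftarrow> proper_subsets 3] @ [gen_t 5 * gen_dt 5] @
     [milnor_Qs I (gen_dt 2 * gen_dt 3 * gen_dt 4) * gen_t 5 * gen_dt 5. I \<leftarrow> proper_subsets 3] @
     [gen_t 5 * shifted_product 1 [2, 3, 4, 5] * milnor_Qs J (gen_dt 1 * gen_dt 2 * gen_dt 3 * gen_dt 4 * gen_dt 5).
      J \<leftarrow> subsets 4])"
proof -
  let ?W = "weyl_E8 :: 'a mat set" and ?N = "norm_poly 1 [2, 3, 4, 5]"
  let ?x = "(dickson_gen [2, 3, 4])(1 := ?N ^ 2, 5 := mvar 5 ^ 2) :: nat \<Rightarrow> 'a mpoly"
  let ?fs = "map ?x [5, 2, 4, 3, 1]"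
  let ?s = "\<lambda>k :: nat \<times> nat set. if fst k = 0 then 1 else if fst k = 1 then mvar 5 else mvar 5 * ?N"
  note two = field_3(1)[OF three]
  have minus: "(- 1 :: 'a) \<noteq> 0" by simp
  have Nin: "?N \<in> mpolys_in {1..5}" by (rule mpolys_in_mono[OF norm_poly_in]) auto
  have sq: "mconst e * f * (mconst e * f) = f * f" if "e \<noteq> 0" for e :: 'a and f :: "'a mpoly"
    using mconst_mult_self[OF three that, of "f * f"] by (simp only: mult_ac)
  have ring: "bij_betw (msubst (\<lambda>i. ?fs ! i)) (mpolys_in {..<length ?fs})
      {f \<in> mpolys_in {1..5}. \<forall>g\<in>?W. msubst (lin_t 5 g) f = f}"
  proof (rule invariant_polynomials_bij[OF polynomials_5_bij[OF two]])
    fix v and g :: "'a mat" assume v: "v \<in> {1..5 :: nat}" and g: "g \<in> ?W"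
    consider "v = 1" | "v = 5" | "v \<in> set (block_list 1)" "v \<noteq> 1" "v \<noteq> 5" using v by fastforce
    then show "msubst (lin_t 5 g) (?x v) = ?x v"
    proof cases
      case 1
      then show ?thesis using sq[OF weyl_E8D(2)[OF g]] by (simp add: msubst_hom norm_poly_E8[OF g] power2_eq_square)
    next
      case 2
      have "msubst (lin_t 5 g) (mvar 5 ^ 2) = mvar 5 ^ 2"
        unfolding power2_eq_square msubst_mult msubst_mvar weyl_E8D(5)[OF g] by (rule sq[OF weyl_E8D(3)[OF g]])
      then show ?thesis using 2 by simp
    next
      case 3
      from dickson_gen_block[OF weyl_E8D(1)[OF g] _ 3(1)] show ?thesis
        using weyl_E8D(4)[OF g] 3(2,3) unfolding block_list_eq by simp
    qed
  next
    fix f :: "'a mpoly" assume f: "f \<in> mpolys_in {1..5}" and inv: "\<And>g. g \<in> ?W \<Longrightarrow> msubst (lin_t 5 g) f = f"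
    have "msubst (sign_change i) f = f" if "i \<in> {1, 5}" for i
      using inv[OF scale_row_mat_weyl_E8[OF minus that]] msubst_scale_row_mat[OF f, of i "- 1"] that by auto
    then show "f \<in> {f \<in> mpolys_in {1..5}. transv_inv [2, 3, 4] f \<and>
        (\<forall>l\<in>lin_forms [2, 3, 4, 5]. msubst (mvar(1 := mvar 1 + l)) f = f) \<and> msubst (sign_change 1) f = f \<and> msubst (sign_change 5) f = f}"
      using f invariant_5(1)[OF f inv[OF elem_mat_weyl_E8(1)]] invariant_5(2)[OF f inv[OF row_mat_weyl_E8]]
      by (intro CollectI conjI ballI) simp_all
  next
    show "set [5, 2, 4, 3, 1] = {1..5 :: nat}" by auto
  qed (rule Collect_restrict, simp)
  have "is_polynomial_tensor (invariants 5 ?W) (map ext_scalar ?fs) (map (\<lambda>k. ext_scalar (?s k) * basis_5 k) keys_5)"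
  proof (rule invariants_tensor[where n = 5 and W = ?W and fs = ?fs and ks = keys_5 and b = basis_5 and
        s = ?s and \<chi> = character_5, OF weyl_E8D(4) _ ring distinct_keys_5 basis_5_in basis_5_independent])
    show "1\<^sub>m 5 \<in> ?W" using row_mat_weyl_E8[of "\<lambda>_. 0 :: 'a"] unfolding row_mat_0 .
    show "lin_subst 5 g (basis_5 k) = ext_scalar (mconst (character_5 g k)) * basis_5 k" if "g \<in> ?W" "k \<in> set keys_5" for g k
      by (rule basis_5_character[OF that])
    show "\<exists>c. x = (\<Sum>k\<in>set keys_5. ext_scalar (c k) * basis_5 k)"
      if "x \<in> HBA 5" "\<And>g. g \<in> ?W \<Longrightarrow> lin_subst 5 g x = x" for x
      by (rule basis_5_span[OF that])
    show "?s k \<in> mpolys_in {1..5}" for k using Nin by (simp add: mpolys_in_mult)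
    show "?s k \<noteq> 0" for k using poly_dickson_poly_nonzero[of 1 "[2, 3, 4, 5]"] by simp
    show "mconst (character_5 g k) * msubst (lin_t 5 g) (?s k) = ?s k" if g: "g \<in> ?W" for g k
    proof -
      have "mconst (g $$ (0, 0) * g $$ (4, 4)) * (mconst (g $$ (4, 4)) * mvar 5 * (mconst (g $$ (0, 0)) * ?N)) =
          mconst (g $$ (0, 0)) * (mconst (g $$ (0, 0)) * (mconst (g $$ (4, 4)) * (mconst (g $$ (4, 4)) * (mvar 5 * ?N))))"
        by (simp only: mconst_hom(4) mult_ac)
      also have "\<dots> = mvar 5 * ?N"
        unfolding mconst_mult_self[OF three weyl_E8D(3)[OF g]] mconst_mult_self[OF three weyl_E8D(2)[OF g]] ..
      finally have prod: "mconst (g $$ (0, 0) * g $$ (4, 4)) * msubst (lin_t 5 g) (mvar 5 * ?N) = mvar 5 * ?N"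
        unfolding msubst_mult msubst_mvar weyl_E8D(5)[OF g] norm_poly_E8[OF g] .
      have single: "mconst (g $$ (4, 4)) * msubst (lin_t 5 g) (mvar 5) = mvar 5"
        unfolding msubst_mvar weyl_E8D(5)[OF g] by (rule mconst_mult_self[OF three weyl_E8D(3)[OF g]])
      consider "fst k = 0" | "fst k = 1" | "fst k \<noteq> 0" "fst k \<noteq> 1" by blast
      then show ?thesis
        using prod single by cases (simp_all add: character_5_def mconst_hom(2) del: mconst_hom(1,3,4))
    qed
    show "?s k dvd f"
      if f: "f \<in> mpolys_in {1..5}" and semi: "\<And>g. g \<in> ?W \<Longrightarrow> mconst (character_5 g k) * msubst (lin_t 5 g) f = f" for k f
    proof (cases "fst k = 0")
      case k0: False
      have neg: "mconst (- 1) * y = - y" for y :: "'a mpoly" by (simp only: mconst_uminus mconst_hom(2) mult_minus_left mult_1_left)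
      have entries: "scale_row_mat 5 5 c $$ (4, 4) = c" "scale_row_mat 5 5 c $$ (0, 0) = 1"
        "scale_row_mat 5 1 c $$ (4, 4) = 1" "scale_row_mat 5 1 c $$ (0, 0) = c" for c :: 'a
        by (simp_all add: scale_row_mat_def)
      have \<chi>5: "character_5 (scale_row_mat 5 5 (- 1)) k = - 1" using k0 by (simp add: character_5_def entries)
      have "mconst (- 1) * msubst (sign_change 5) f = f"
        using semi[OF scale_row_mat_weyl_E8[OF minus, of 5]] msubst_scale_row_mat[OF f, of 5 "- 1"]
        unfolding \<chi>5 by simp
      then have "- msubst (sign_change 5) f = f" unfolding neg .
      then have "mvar 5 dvd f" by (rule mvar_dvd_odd(2)[OF two])
      then obtain f' where f': "f = mvar 5 * f'" by (elim dvdE)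
      show ?thesis
      proof (cases "fst k = 1")
        case False
        have \<chi>1: "character_5 (scale_row_mat 5 1 (- 1)) k = - 1" using k0 False by (simp add: character_5_def entries)
        have "mconst (- 1) * msubst (sign_change 1) f = f"
          using semi[OF scale_row_mat_weyl_E8[OF minus, of 1]] msubst_scale_row_mat[OF f, of 1 "- 1"]
          unfolding \<chi>1 by simp
        then have "mvar 5 * (- msubst (sign_change 1) f') = mvar 5 * f'" unfolding neg f' by (simp add: msubst_mult)
        then have odd: "- msubst (sign_change 1) f' = f'"
          by (rule mult_left_cancel[THEN iffD1, rotated]) simp
        have inv: "msubst (lin_t 5 (row_mat 5 1 c)) f = f" for c
        proof -
          have "row_mat 5 1 c $$ (0, 0) = 1" "row_mat 5 1 c $$ (4, 4) = 1" by (simp_all add: row_mat_def)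
          then have "character_5 (row_mat 5 1 c) k = 1" by (simp add: character_5_def)
          then show ?thesis using semi[OF row_mat_weyl_E8, of c] by simp
        qed
        have "msubst (mvar(1 := mvar 1 + l)) f' = f'" if "l \<in> lin_forms [2, 3, 4, 5]" for l
          using invariant_5(2)[OF f inv that] unfolding f' by (simp add: msubst_mult)
        then have "?N dvd f'" by (intro norm_dvd_odd[OF two _ odd]) simp_all
        then show ?thesis using k0 False unfolding f' by (simp add: mult_dvd_mono)
      qed (use k0 f' in simp)
    qed simp
  qed
  moreover have "map ext_scalar ?fs = [gen_t 5 ^ 2, dickson_e [2, 3, 4], dickson_c [2, 3, 4] 2, dickson_c [2, 3, 4] 1,
      shifted_product 1 [2, 3, 4, 5] ^ 2]"
    by (simp add: dickson_gen_3 shifted_product_eq ext_scalar_prod gen_t_def)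
  ultimately show ?thesis using basis_5_list[of ?s ?N] by (simp add: shifted_product_eq)
qed

end

theorem proposition4p3:
  assumes "CARD('f5::{finite,field}) = 5"
    and "CARD('f3::{finite,field}) = 3"
  shows
    "(let x62 = dickson_e [1, 2, 3] :: 'f5 coh;
          x200 = dickson_c [1, 2, 3] 2;
          x240 = dickson_c [1, 2, 3] 1;
          u3 = gen_dt 1 * gen_dt 2 * gen_dt 3
      in is_polynomial_tensor (invariants 3 (SL 3)) [x62, x200, x240]
           ([1] @ [milnor_Qs I u3. I \<leftarrow> proper_subsets 3])) \<and>
     (let x26 = dickson_e [1, 2, 3] :: 'f3 coh;
          x36 = dickson_c [1, 2, 3] 2;
          x48 = dickson_c [1, 2, 3] 1;
          u3 = gen_dt 1 * gen_dt 2 * gen_dt 3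
      in is_polynomial_tensor (invariants 3 (SL 3)) [x26, x36, x48]
           ([1] @ [milnor_Qs I u3. I \<leftarrow> proper_subsets 3])) \<and>
     (let x26 = dickson_e [2, 3, 4] :: 'f3 coh;
          x36 = dickson_c [2, 3, 4] 2;
          x48 = dickson_c [2, 3, 4] 1;
          x54 = shifted_product 1 [2, 3, 4];
          u3 = gen_dt 2 * gen_dt 3 * gen_dt 4;
          u4 = gen_dt 1 * gen_dt 2 * gen_dt 3 * gen_dt 4
      in is_polynomial_tensor (invariants 4 weyl_3E6) [x26, x36, x48, x54]
           ([1] @ [milnor_Qs I u3. I \<leftarrow> proper_subsets 3] @
            [milnor_Qs J u4. J \<leftarrow> subsets 3])) \<and>
     (let x26 = dickson_e [2, 3, 4] :: 'f3 coh;
          x36 = dickson_c [2, 3, 4] 2;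
          x48 = dickson_c [2, 3, 4] 1;
          x54 = shifted_product 1 [2, 3, 4];
          x108 = x54 ^ 2;
          u3 = gen_dt 2 * gen_dt 3 * gen_dt 4;
          u4 = gen_dt 1 * gen_dt 2 * gen_dt 3 * gen_dt 4
      in is_polynomial_tensor (invariants 4 weyl_2E7) [x26, x36, x48, x108]
           ([1] @ [milnor_Qs I u3. I \<leftarrow> proper_subsets 3] @
            [x54 * milnor_Qs J u4. J \<leftarrow> subsets 3])) \<and>
     (let x2 = gen_t 5 :: 'f3 coh;
          x4 = x2 ^ 2;
          x26 = dickson_e [2, 3, 4];
          x36 = dickson_c [2, 3, 4] 2;
          x48 = dickson_c [2, 3, 4] 1;
          x162 = shifted_product 1 [2, 3, 4, 5];
          x324 = x162 ^ 2;
          u1 = gen_dt 5;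
          u3 = gen_dt 2 * gen_dt 3 * gen_dt 4;
          u5 = gen_dt 1 * gen_dt 2 * gen_dt 3 * gen_dt 4 * gen_dt 5
      in is_polynomial_tensor (invariants 5 weyl_E8) [x4, x26, x36, x48, x324]
           ([1] @ [milnor_Qs I u3. I \<leftarrow> proper_subsets 3] @
            [x2 * u1] @ [milnor_Qs I u3 * x2 * u1. I \<leftarrow> proper_subsets 3] @
            [x2 * x162 * milnor_Qs J u5. J \<leftarrow> subsets 4]))"
proof -
  have p5: "prime_order TYPE('f5)" by unfold_locales (simp add: assms(1))
  have p3: "prime_order TYPE('f3)" by unfold_locales (simp add: assms(2))
  show ?thesis
    unfolding Let_def
    using prime_order.SL_3_invariants[OF p5] prime_order.SL_3_invariants[OF p3] prime_order.weyl_3E6_invariants[OF p3]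
      prime_order.weyl_2E7_invariants[OF p3 assms(2)] prime_order.weyl_E8_invariants[OF p3 assms(2)]
    by (intro conjI)
qed

end
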